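(* Let $K$ be a field of characteristic $\neq 2$, $A$ an associative, unital, commutative $K$-algebra, and $\mathfrak{l}=\bigoplus_{\gamma\in\mathcal{B}}\mathfrak{l}_\gamma$ a Lie algebra over $K$ graded in an abelian group $\mathcal{B}$. Fix $\beta\in\mathcal{B}$ and suppose that the reduced Koszul map $\bar\eta$ of $\mathfrak{l}$ is zero in degree $\beta$. Then the kernel $\mathcal{K}(A,\mathfrak{l})_\beta$ of the surjective map $H_2(A\otimes\mathfrak{l})_\beta\to A\otimes H_2(\mathfrak{l})_\beta$ lies in an exact sequence $$0\to T_0(A^{\otimes 3})\otimes S^2(H_1(\mathfrak{l}))_\beta\to\mathcal{K}(A,\mathfrak{l})_\beta\to\big(\mathrm{HH}_1(A)\otimes\mathrm{Kill}(\mathfrak{l})_\beta\big)\oplus\big(I_A\otimes\Lambda^2(H_1(\mathfrak{l}))_\beta\big)\to 0.$$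
   Context: All tensor products, exterior/symmetric powers and homology are over $K$; $A\otimes\mathfrak{l}$ is viewed as a Lie algebra over $K$ with bracket $[a\otimes x,b\otimes y]=ab\otimes[x,y]$, graded by $(A\otimes\mathfrak{l})_\gamma=A\otimes\mathfrak{l}_\gamma$. Gradings are induced on exterior and symmetric powers (degrees add), homology and Killing modules; subscript $\beta$ denotes the degree-$\beta$ component. $H_*$ is Chevalley–Eilenberg homology with trivial coefficients. The natural map $H_2(A\otimes\mathfrak{l})\to A\otimes H_2(\mathfrak{l})$ is induced by $(a\otimes x)\wedge(b\otimes y)\mapsto ab\otimes(x\wedge y)$; it is surjective. $T_0:A^{\otimes 3}\to\Lambda^2A$ is defined by $T_0(a\otimes b\otimes c)=ab\wedge c+bc\wedge a+ca\wedge b-abc\wedge 1$; $T_0(A^{\otimes 3})$ is its image and $\mathrm{HH}_1(A)=\mathrm{coker}(T_0)$ (first Hochschild homology). $I_A$ is the kernel of the multiplication map $S^2A\to A$. $\mathrm{Kill}(\mathfrak{l})$ is the cokernel of $\mathfrak{l}^{\otimes 3}\to S^2\mathfrak{l}$, $x\otimes y\otimes z\mapsto[x,y]\odot z-x\odot[y,z]$ ($\odot$ the symmetric product). The Koszul map $\eta:\Lambda^3\mathfrak{l}\to\mathrm{Kill}(\mathfrak{l})$ sends $x\wedge y\wedge z$ to the class of $x\odot[y,z]$; it vanishes on 3-boundaries, and the reduced Koszul map $\bar\eta:H_3(\mathfrak{l})\to\mathrm{Kill}(\mathfrak{l})$ is induced by its restriction to 3-cycles; it is a graded map. *)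

theory Defs
  imports "HOL-Library.Multiset" "HOL-Algebra.Module" "HOL-Algebra.AbelCoset"
begin

section \<open>Linear algebra over a base ring, on carriers\<close>

text \<open>
  Vector spaces are \<^locale>\<open>module\<close>s over a \<^locale>\<open>field\<close> \<open>K\<close>.  The record fields \<open>mult\<close> and
  \<open>one\<close> of the vector spaces constructed below carry no meaning and are left \<open>undefined\<close>.
\<close>

definition mod_span :: "('k, 'r) ring_scheme \<Rightarrow> ('k, 'v, 'm) module_scheme \<Rightarrow> 'v set \<Rightarrow> 'v set" where
  "mod_span K V S = \<Inter>{N. submodule N K V \<and> S \<subseteq> N}"

abbreviation restrict_to :: "('k, 'v, 'm) module_scheme \<Rightarrow> 'v set \<Rightarrow> ('k, 'v, 'm) module_scheme" where
  "restrict_to V N \<equiv> V\<lparr>carrier := N\<rparr>"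

text \<open>Linear maps are extensional, so that they are determined by their values on the carrier.\<close>

definition mod_hom :: "('k, 'r) ring_scheme \<Rightarrow> ('k, 'v, 'm) module_scheme \<Rightarrow> ('k, 'w, 'n) module_scheme
    \<Rightarrow> ('v \<Rightarrow> 'w) set" where
  "mod_hom K V W = {f \<in> carrier V \<rightarrow>\<^sub>E carrier W.
     (\<forall>x\<in>carrier V. \<forall>y\<in>carrier V. f (x \<oplus>\<^bsub>V\<^esub> y) = f x \<oplus>\<^bsub>W\<^esub> f y) \<and>
     (\<forall>c\<in>carrier K. \<forall>x\<in>carrier V. f (c \<odot>\<^bsub>V\<^esub> x) = c \<odot>\<^bsub>W\<^esub> f x)}"

text \<open>
  The linear map with a prescribed property \<open>P\<close>.  Below, \<open>P\<close> always prescribes the values on a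
  generating set, and these values are compatible with the defining relations of the domain.
\<close>

definition the_hom :: "('k, 'r) ring_scheme \<Rightarrow> ('k, 'v, 'm) module_scheme \<Rightarrow> ('k, 'w, 'n) module_scheme
    \<Rightarrow> (('v \<Rightarrow> 'w) \<Rightarrow> bool) \<Rightarrow> 'v \<Rightarrow> 'w" where
  "the_hom K V W P = (THE f. f \<in> mod_hom K V W \<and> P f)"

definition quot_mod :: "('k, 'v, 'm) module_scheme \<Rightarrow> 'v set \<Rightarrow> ('k, 'v set) module" where
  "quot_mod V N = \<lparr>carrier = a_rcosets\<^bsub>V\<^esub> N, mult = undefined, one = undefined,
     zero = N, add = (<+>\<^bsub>V\<^esub>), smult = (\<lambda>c X. (\<Union>x\<in>X. N +>\<^bsub>V\<^esub> (c \<odot>\<^bsub>V\<^esub> x)))\<rparr>"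

definition direct_sum :: "('k, 'v, 'm) module_scheme \<Rightarrow> ('k, 'w, 'n) module_scheme
    \<Rightarrow> ('k, 'v \<times> 'w) module" where
  "direct_sum V W = \<lparr>carrier = carrier V \<times> carrier W, mult = undefined, one = undefined,
     zero = (\<zero>\<^bsub>V\<^esub>, \<zero>\<^bsub>W\<^esub>),
     add = (\<lambda>(v, w) (v', w'). (v \<oplus>\<^bsub>V\<^esub> v', w \<oplus>\<^bsub>W\<^esub> w')),
     smult = (\<lambda>c (v, w). (c \<odot>\<^bsub>V\<^esub> v, c \<odot>\<^bsub>W\<^esub> w))\<rparr>"

definition short_exact :: "('k, 'r) ring_scheme \<Rightarrow> ('k, 'u, 'l) module_scheme
    \<Rightarrow> ('k, 'v, 'm) module_scheme \<Rightarrow> ('k, 'w, 'n) module_scheme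
    \<Rightarrow> ('u \<Rightarrow> 'v) \<Rightarrow> ('v \<Rightarrow> 'w) \<Rightarrow> bool" where
  "short_exact K U V W f g \<longleftrightarrow> f \<in> mod_hom K U V \<and> g \<in> mod_hom K V W \<and>
     inj_on f (carrier U) \<and> f ` carrier U = a_kernel V W g \<and> g ` carrier V = carrier W"

definition free_mod :: "('k, 'r) ring_scheme \<Rightarrow> 'x set \<Rightarrow> ('k, 'x \<Rightarrow> 'k) module" where
  "free_mod K X = \<lparr>carrier = {f \<in> X \<rightarrow>\<^sub>E carrier K. finite {x \<in> X. f x \<noteq> \<zero>\<^bsub>K\<^esub>}},
     mult = undefined, one = undefined, zero = (\<lambda>x\<in>X. \<zero>\<^bsub>K\<^esub>),
     add = (\<lambda>f g. \<lambda>x\<in>X. f x \<oplus>\<^bsub>K\<^esub> g x), smult = (\<lambda>c f. \<lambda>x\<in>X. c \<otimes>\<^bsub>K\<^esub> f x)\<rparr>"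

definition free_gen :: "('k, 'r) ring_scheme \<Rightarrow> 'x set \<Rightarrow> 'x \<Rightarrow> 'x \<Rightarrow> 'k" where
  "free_gen K X x = (\<lambda>y\<in>X. if y = x then \<one>\<^bsub>K\<^esub> else \<zero>\<^bsub>K\<^esub>)"


section \<open>Tensor products\<close>

definition tensor_rels :: "('k, 'r) ring_scheme \<Rightarrow> ('k, 'v, 'm) module_scheme
    \<Rightarrow> ('k, 'w, 'n) module_scheme \<Rightarrow> ('v \<times> 'w \<Rightarrow> 'k) set" where
  "tensor_rels K V W =
    (let F = free_mod K (carrier V \<times> carrier W); e = free_gen K (carrier V \<times> carrier W) in
     mod_span K F
      ({e (v \<oplus>\<^bsub>V\<^esub> v', w) \<ominus>\<^bsub>F\<^esub> (e (v, w) \<oplus>\<^bsub>F\<^esub> e (v', w)) | v v' w.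
          v \<in> carrier V \<and> v' \<in> carrier V \<and> w \<in> carrier W} \<union>
       {e (v, w \<oplus>\<^bsub>W\<^esub> w') \<ominus>\<^bsub>F\<^esub> (e (v, w) \<oplus>\<^bsub>F\<^esub> e (v, w')) | v w w'.
          v \<in> carrier V \<and> w \<in> carrier W \<and> w' \<in> carrier W} \<union>
       {e (c \<odot>\<^bsub>V\<^esub> v, w) \<ominus>\<^bsub>F\<^esub> c \<odot>\<^bsub>F\<^esub> e (v, w) | c v w.
          c \<in> carrier K \<and> v \<in> carrier V \<and> w \<in> carrier W} \<union>
       {e (v, c \<odot>\<^bsub>W\<^esub> w) \<ominus>\<^bsub>F\<^esub> c \<odot>\<^bsub>F\<^esub> e (v, w) | c v w.
          c \<in> carrier K \<and> v \<in> carrier V \<and> w \<in> carrier W}))"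

definition tensor :: "('k, 'r) ring_scheme \<Rightarrow> ('k, 'v, 'm) module_scheme
    \<Rightarrow> ('k, 'w, 'n) module_scheme \<Rightarrow> ('k, ('v \<times> 'w \<Rightarrow> 'k) set) module" where
  "tensor K V W = quot_mod (free_mod K (carrier V \<times> carrier W)) (tensor_rels K V W)"

definition tens :: "('k, 'r) ring_scheme \<Rightarrow> ('k, 'v, 'm) module_scheme
    \<Rightarrow> ('k, 'w, 'n) module_scheme \<Rightarrow> 'v \<Rightarrow> 'w \<Rightarrow> ('v \<times> 'w \<Rightarrow> 'k) set" where
  "tens K V W v w = tensor_rels K V W +>\<^bsub>free_mod K (carrier V \<times> carrier W)\<^esub>
     free_gen K (carrier V \<times> carrier W) (v, w)"

definition tensor_map :: "('k, 'r) ring_scheme \<Rightarrow> ('k, 'v, 'm) module_scheme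
    \<Rightarrow> ('k, 'w, 'n) module_scheme \<Rightarrow> ('k, 'v2, 'm2) module_scheme \<Rightarrow> ('k, 'w2, 'n2) module_scheme
    \<Rightarrow> ('v \<Rightarrow> 'v2) \<Rightarrow> ('w \<Rightarrow> 'w2) \<Rightarrow> ('v \<times> 'w \<Rightarrow> 'k) set \<Rightarrow> ('v2 \<times> 'w2 \<Rightarrow> 'k) set" where
  "tensor_map K V W V' W' f g = the_hom K (tensor K V W) (tensor K V' W')
     (\<lambda>h. \<forall>v\<in>carrier V. \<forall>w\<in>carrier W. h (tens K V W v w) = tens K V' W' (f v) (g w))"


section \<open>Tensor, exterior and symmetric powers\<close>

definition tuples :: "('k, 'v, 'm) module_scheme \<Rightarrow> nat \<Rightarrow> 'v list set" where
  "tuples V n = {xs. length xs = n \<and> set xs \<subseteq> carrier V}"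

definition tpow_rels :: "('k, 'r) ring_scheme \<Rightarrow> ('k, 'v, 'm) module_scheme \<Rightarrow> nat
    \<Rightarrow> ('v list \<Rightarrow> 'k) set" where
  "tpow_rels K V n =
    (let F = free_mod K (tuples V n); e = free_gen K (tuples V n) in
     mod_span K F
      ({e (xs[i := x \<oplus>\<^bsub>V\<^esub> y]) \<ominus>\<^bsub>F\<^esub> (e (xs[i := x]) \<oplus>\<^bsub>F\<^esub> e (xs[i := y])) | xs i x y.
          xs \<in> tuples V n \<and> i < n \<and> x \<in> carrier V \<and> y \<in> carrier V} \<union>
       {e (xs[i := c \<odot>\<^bsub>V\<^esub> x]) \<ominus>\<^bsub>F\<^esub> c \<odot>\<^bsub>F\<^esub> e (xs[i := x]) | xs i c x.
          xs \<in> tuples V n \<and> i < n \<and> c \<in> carrier K \<and> x \<in> carrier V}))"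

definition tensor_power :: "('k, 'r) ring_scheme \<Rightarrow> ('k, 'v, 'm) module_scheme \<Rightarrow> nat
    \<Rightarrow> ('k, ('v list \<Rightarrow> 'k) set) module" where
  "tensor_power K V n = quot_mod (free_mod K (tuples V n)) (tpow_rels K V n)"

definition pure_tensor :: "('k, 'r) ring_scheme \<Rightarrow> ('k, 'v, 'm) module_scheme \<Rightarrow> 'v list
    \<Rightarrow> ('v list \<Rightarrow> 'k) set" where
  "pure_tensor K V xs = tpow_rels K V (length xs) +>\<^bsub>free_mod K (tuples V (length xs))\<^esub>
     free_gen K (tuples V (length xs)) xs"

definition ext_rels :: "('k, 'r) ring_scheme \<Rightarrow> ('k, 'v, 'm) module_scheme \<Rightarrow> nat
    \<Rightarrow> ('v list \<Rightarrow> 'k) set set" where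
  "ext_rels K V n = mod_span K (tensor_power K V n)
     {pure_tensor K V xs | xs. xs \<in> tuples V n \<and> \<not> distinct xs}"

definition ext_power :: "('k, 'r) ring_scheme \<Rightarrow> ('k, 'v, 'm) module_scheme \<Rightarrow> nat
    \<Rightarrow> ('k, ('v list \<Rightarrow> 'k) set set) module" where
  "ext_power K V n = quot_mod (tensor_power K V n) (ext_rels K V n)"

definition wedge :: "('k, 'r) ring_scheme \<Rightarrow> ('k, 'v, 'm) module_scheme \<Rightarrow> 'v list
    \<Rightarrow> ('v list \<Rightarrow> 'k) set set" where
  "wedge K V xs = ext_rels K V (length xs) +>\<^bsub>tensor_power K V (length xs)\<^esub> pure_tensor K V xs"

definition sym_rels :: "('k, 'r) ring_scheme \<Rightarrow> ('k, 'v, 'm) module_scheme \<Rightarrow> nat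
    \<Rightarrow> ('v list \<Rightarrow> 'k) set set" where
  "sym_rels K V n = mod_span K (tensor_power K V n)
     {pure_tensor K V xs \<ominus>\<^bsub>tensor_power K V n\<^esub> pure_tensor K V ys | xs ys.
        xs \<in> tuples V n \<and> ys \<in> tuples V n \<and> mset xs = mset ys}"

definition sym_power :: "('k, 'r) ring_scheme \<Rightarrow> ('k, 'v, 'm) module_scheme \<Rightarrow> nat
    \<Rightarrow> ('k, ('v list \<Rightarrow> 'k) set set) module" where
  "sym_power K V n = quot_mod (tensor_power K V n) (sym_rels K V n)"

definition symprod :: "('k, 'r) ring_scheme \<Rightarrow> ('k, 'v, 'm) module_scheme \<Rightarrow> 'v list
    \<Rightarrow> ('v list \<Rightarrow> 'k) set set" where
  "symprod K V xs = sym_rels K V (length xs) +>\<^bsub>tensor_power K V (length xs)\<^esub> pure_tensor K V xs"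

text \<open>
  If \<open>V\<close> is graded by the subspaces \<open>D \<gamma>\<close>, \<open>\<gamma> \<in> carrier B\<close>, then \<open>hom_tuples B D n \<beta>\<close> consists of
  the \<open>n\<close>-tuples of homogeneous elements of total degree \<open>\<beta>\<close>.  The grading group \<open>B\<close> is written
  multiplicatively, as in \<^locale>\<open>comm_group\<close>.
\<close>

definition hom_tuples :: "('b, 's) monoid_scheme \<Rightarrow> ('b \<Rightarrow> 'v set) \<Rightarrow> nat \<Rightarrow> 'b \<Rightarrow> 'v list set" where
  "hom_tuples B D n \<beta> = {xs. length xs = n \<and>
     (\<exists>gs. list_all2 (\<lambda>x \<gamma>. \<gamma> \<in> carrier B \<and> x \<in> D \<gamma>) xs gs \<and> foldr (\<otimes>\<^bsub>B\<^esub>) gs \<one>\<^bsub>B\<^esub> = \<beta>)}"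

definition ext_degree :: "('k, 'r) ring_scheme \<Rightarrow> ('k, 'v, 'm) module_scheme
    \<Rightarrow> ('b, 's) monoid_scheme \<Rightarrow> ('b \<Rightarrow> 'v set) \<Rightarrow> nat \<Rightarrow> 'b \<Rightarrow> ('v list \<Rightarrow> 'k) set set set" where
  "ext_degree K V B D n \<beta> = mod_span K (ext_power K V n) (wedge K V ` hom_tuples B D n \<beta>)"

definition sym_degree :: "('k, 'r) ring_scheme \<Rightarrow> ('k, 'v, 'm) module_scheme
    \<Rightarrow> ('b, 's) monoid_scheme \<Rightarrow> ('b \<Rightarrow> 'v set) \<Rightarrow> nat \<Rightarrow> 'b \<Rightarrow> ('v list \<Rightarrow> 'k) set set set" where
  "sym_degree K V B D n \<beta> = mod_span K (sym_power K V n) (symprod K V ` hom_tuples B D n \<beta>)"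


section \<open>Commutative algebras\<close>

definition T0 :: "('k, 'r) ring_scheme \<Rightarrow> ('k, 'a, 'm) module_scheme
    \<Rightarrow> ('a list \<Rightarrow> 'k) set \<Rightarrow> ('a list \<Rightarrow> 'k) set set" where
  "T0 K A = the_hom K (tensor_power K A 3) (ext_power K A 2)
     (\<lambda>f. \<forall>a\<in>carrier A. \<forall>b\<in>carrier A. \<forall>c\<in>carrier A. f (pure_tensor K A [a, b, c]) =
        (wedge K A [a \<otimes>\<^bsub>A\<^esub> b, c] \<oplus>\<^bsub>ext_power K A 2\<^esub> wedge K A [b \<otimes>\<^bsub>A\<^esub> c, a]
          \<oplus>\<^bsub>ext_power K A 2\<^esub> wedge K A [c \<otimes>\<^bsub>A\<^esub> a, b])
        \<ominus>\<^bsub>ext_power K A 2\<^esub> wedge K A [a \<otimes>\<^bsub>A\<^esub> b \<otimes>\<^bsub>A\<^esub> c, \<one>\<^bsub>A\<^esub>])"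

definition T0_image :: "('k, 'r) ring_scheme \<Rightarrow> ('k, 'a, 'm) module_scheme
    \<Rightarrow> ('k, ('a list \<Rightarrow> 'k) set set) module" where
  "T0_image K A = restrict_to (ext_power K A 2) (T0 K A ` carrier (tensor_power K A 3))"

definition HH1 :: "('k, 'r) ring_scheme \<Rightarrow> ('k, 'a, 'm) module_scheme
    \<Rightarrow> ('k, ('a list \<Rightarrow> 'k) set set set) module" where
  "HH1 K A = quot_mod (ext_power K A 2) (T0 K A ` carrier (tensor_power K A 3))"

definition sym_mult :: "('k, 'r) ring_scheme \<Rightarrow> ('k, 'a, 'm) module_scheme
    \<Rightarrow> ('a list \<Rightarrow> 'k) set set \<Rightarrow> 'a" where
  "sym_mult K A = the_hom K (sym_power K A 2) A
     (\<lambda>f. \<forall>a\<in>carrier A. \<forall>b\<in>carrier A. f (symprod K A [a, b]) = a \<otimes>\<^bsub>A\<^esub> b)"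

definition I_alg :: "('k, 'r) ring_scheme \<Rightarrow> ('k, 'a, 'm) module_scheme
    \<Rightarrow> ('k, ('a list \<Rightarrow> 'k) set set) module" where
  "I_alg K A = restrict_to (sym_power K A 2) (a_kernel (sym_power K A 2) A (sym_mult K A))"


section \<open>Lie algebras\<close>

record ('k, 'l) lie_algebra = "('k, 'l) module" +
  bracket :: "'l \<Rightarrow> 'l \<Rightarrow> 'l"

locale lie_algebra = module K L for K (structure) and L (structure) +
  assumes bracket_closed:
      "\<lbrakk>x \<in> carrier L; y \<in> carrier L\<rbrakk> \<Longrightarrow> bracket L x y \<in> carrier L"
    and bracket_add_left:
      "\<lbrakk>x \<in> carrier L; y \<in> carrier L; z \<in> carrier L\<rbrakk> \<Longrightarrow>
       bracket L (x \<oplus>\<^bsub>L\<^esub> y) z = bracket L x z \<oplus>\<^bsub>L\<^esub> bracket L y z"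
    and bracket_add_right:
      "\<lbrakk>x \<in> carrier L; y \<in> carrier L; z \<in> carrier L\<rbrakk> \<Longrightarrow>
       bracket L x (y \<oplus>\<^bsub>L\<^esub> z) = bracket L x y \<oplus>\<^bsub>L\<^esub> bracket L x z"
    and bracket_smult_left:
      "\<lbrakk>c \<in> carrier K; x \<in> carrier L; y \<in> carrier L\<rbrakk> \<Longrightarrow>
       bracket L (c \<odot>\<^bsub>L\<^esub> x) y = c \<odot>\<^bsub>L\<^esub> bracket L x y"
    and bracket_smult_right:
      "\<lbrakk>c \<in> carrier K; x \<in> carrier L; y \<in> carrier L\<rbrakk> \<Longrightarrow>
       bracket L x (c \<odot>\<^bsub>L\<^esub> y) = c \<odot>\<^bsub>L\<^esub> bracket L x y"
    and bracket_self: "x \<in> carrier L \<Longrightarrow> bracket L x x = \<zero>\<^bsub>L\<^esub>"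
    and jacobi:
      "\<lbrakk>x \<in> carrier L; y \<in> carrier L; z \<in> carrier L\<rbrakk> \<Longrightarrow>
       bracket L x (bracket L y z) \<oplus>\<^bsub>L\<^esub> bracket L y (bracket L z x) \<oplus>\<^bsub>L\<^esub>
       bracket L z (bracket L x y) = \<zero>\<^bsub>L\<^esub>"

locale graded_lie_algebra = lie_algebra K L + grading: comm_group B
  for K (structure) and L (structure) and B and D :: "'b \<Rightarrow> 'l set" +
  assumes component_submodule: "\<gamma> \<in> carrier B \<Longrightarrow> submodule (D \<gamma>) K L"
    and direct_decomposition:
      "x \<in> carrier L \<Longrightarrow> \<exists>!f. f \<in> Pi\<^sub>E (carrier B) D \<and> finite {\<gamma> \<in> carrier B. f \<gamma> \<noteq> \<zero>\<^bsub>L\<^esub>} \<and>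
         x = (\<Oplus>\<^bsub>L\<^esub>\<gamma>\<in>{\<gamma> \<in> carrier B. f \<gamma> \<noteq> \<zero>\<^bsub>L\<^esub>}. f \<gamma>)"
    and bracket_degree:
      "\<lbrakk>\<gamma> \<in> carrier B; \<delta> \<in> carrier B; x \<in> D \<gamma>; y \<in> D \<delta>\<rbrakk> \<Longrightarrow> bracket L x y \<in> D (\<gamma> \<otimes>\<^bsub>B\<^esub> \<delta>)"


subsection \<open>Chevalley--Eilenberg homology with trivial coefficients\<close>

text \<open>
  \<open>d (x\<^sub>0 \<and> \<dots> \<and> x\<^sub>n\<^sub>-\<^sub>1) = (\<Sum>i<j. (-1)^(i+j+1) [x\<^sub>i, x\<^sub>j] \<and> x\<^sub>0 \<and> \<dots> \<and> x\<^sub>n\<^sub>-\<^sub>1)\<close>, with \<open>x\<^sub>i\<close> and \<open>x\<^sub>j\<close>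
  omitted; in particular \<open>d (x \<and> y) = [x, y]\<close>.  The element \<open>x \<in> L\<close> is identified with
  \<open>wedge K L [x]\<close> in the first exterior power.
\<close>

definition ce_diff :: "('k, 'r) ring_scheme \<Rightarrow> ('k, 'l, 'm) lie_algebra_scheme \<Rightarrow> nat
    \<Rightarrow> ('l list \<Rightarrow> 'k) set set \<Rightarrow> ('l list \<Rightarrow> 'k) set set" where
  "ce_diff K L n = the_hom K (ext_power K L n) (ext_power K L (n - 1))
     (\<lambda>f. \<forall>xs\<in>tuples L n. f (wedge K L xs) =
        (\<Oplus>\<^bsub>ext_power K L (n - 1)\<^esub>j\<in>{..<n}. \<Oplus>\<^bsub>ext_power K L (n - 1)\<^esub>i\<in>{..<j}.
           ((\<ominus>\<^bsub>K\<^esub> \<one>\<^bsub>K\<^esub>) [^]\<^bsub>K\<^esub> (i + j + 1)) \<odot>\<^bsub>ext_power K L (n - 1)\<^esub>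
             wedge K L (bracket L (xs ! i) (xs ! j) # nths xs (- {i, j}))))"

definition ce_cycles :: "('k, 'r) ring_scheme \<Rightarrow> ('k, 'l, 'm) lie_algebra_scheme \<Rightarrow> nat
    \<Rightarrow> ('l list \<Rightarrow> 'k) set set set" where
  "ce_cycles K L n = a_kernel (ext_power K L n) (ext_power K L (n - 1)) (ce_diff K L n)"

definition ce_boundaries :: "('k, 'r) ring_scheme \<Rightarrow> ('k, 'l, 'm) lie_algebra_scheme \<Rightarrow> nat
    \<Rightarrow> ('l list \<Rightarrow> 'k) set set set" where
  "ce_boundaries K L n = ce_diff K L (n + 1) ` carrier (ext_power K L (n + 1))"

definition homology :: "('k, 'r) ring_scheme \<Rightarrow> ('k, 'l, 'm) lie_algebra_scheme \<Rightarrow> nat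
    \<Rightarrow> ('k, ('l list \<Rightarrow> 'k) set set set) module" where
  "homology K L n = quot_mod (restrict_to (ext_power K L n) (ce_cycles K L n)) (ce_boundaries K L n)"

text \<open>
  The cosets of the boundaries formed in the full exterior power; for cycles these are the elements
  of \<^const>\<open>homology\<close>.
\<close>

definition homology_class :: "('k, 'r) ring_scheme \<Rightarrow> ('k, 'l, 'm) lie_algebra_scheme \<Rightarrow> nat
    \<Rightarrow> ('l list \<Rightarrow> 'k) set set \<Rightarrow> ('l list \<Rightarrow> 'k) set set set" where
  "homology_class K L n z = ce_boundaries K L n +>\<^bsub>ext_power K L n\<^esub> z"

definition homology_degree :: "('k, 'r) ring_scheme \<Rightarrow> ('k, 'l, 'm) lie_algebra_scheme
    \<Rightarrow> ('b, 's) monoid_scheme \<Rightarrow> ('b \<Rightarrow> 'l set) \<Rightarrow> nat \<Rightarrow> 'b \<Rightarrow> ('l list \<Rightarrow> 'k) set set set set" where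
  "homology_degree K L B D n \<beta> =
     homology_class K L n ` (ce_cycles K L n \<inter> ext_degree K L B D n \<beta>)"


subsection \<open>The Killing module and the Koszul map\<close>

definition killing_map :: "('k, 'r) ring_scheme \<Rightarrow> ('k, 'l, 'm) lie_algebra_scheme
    \<Rightarrow> ('l list \<Rightarrow> 'k) set \<Rightarrow> ('l list \<Rightarrow> 'k) set set" where
  "killing_map K L = the_hom K (tensor_power K L 3) (sym_power K L 2)
     (\<lambda>f. \<forall>x\<in>carrier L. \<forall>y\<in>carrier L. \<forall>z\<in>carrier L. f (pure_tensor K L [x, y, z]) =
        symprod K L [bracket L x y, z] \<ominus>\<^bsub>sym_power K L 2\<^esub> symprod K L [x, bracket L y z])"

definition Kill :: "('k, 'r) ring_scheme \<Rightarrow> ('k, 'l, 'm) lie_algebra_scheme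
    \<Rightarrow> ('k, ('l list \<Rightarrow> 'k) set set set) module" where
  "Kill K L = quot_mod (sym_power K L 2) (killing_map K L ` carrier (tensor_power K L 3))"

definition kill_class :: "('k, 'r) ring_scheme \<Rightarrow> ('k, 'l, 'm) lie_algebra_scheme
    \<Rightarrow> ('l list \<Rightarrow> 'k) set set \<Rightarrow> ('l list \<Rightarrow> 'k) set set set" where
  "kill_class K L s = (killing_map K L ` carrier (tensor_power K L 3)) +>\<^bsub>sym_power K L 2\<^esub> s"

definition Kill_degree :: "('k, 'r) ring_scheme \<Rightarrow> ('k, 'l, 'm) lie_algebra_scheme
    \<Rightarrow> ('b, 's) monoid_scheme \<Rightarrow> ('b \<Rightarrow> 'l set) \<Rightarrow> 'b \<Rightarrow> ('l list \<Rightarrow> 'k) set set set set" where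
  "Kill_degree K L B D \<beta> = kill_class K L ` sym_degree K L B D 2 \<beta>"

definition koszul :: "('k, 'r) ring_scheme \<Rightarrow> ('k, 'l, 'm) lie_algebra_scheme
    \<Rightarrow> ('l list \<Rightarrow> 'k) set set \<Rightarrow> ('l list \<Rightarrow> 'k) set set set" where
  "koszul K L = the_hom K (ext_power K L 3) (Kill K L)
     (\<lambda>f. \<forall>x\<in>carrier L. \<forall>y\<in>carrier L. \<forall>z\<in>carrier L.
        f (wedge K L [x, y, z]) = kill_class K L (symprod K L [x, bracket L y z]))"

definition reduced_koszul :: "('k, 'r) ring_scheme \<Rightarrow> ('k, 'l, 'm) lie_algebra_scheme
    \<Rightarrow> ('l list \<Rightarrow> 'k) set set set \<Rightarrow> ('l list \<Rightarrow> 'k) set set set" where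
  "reduced_koszul K L = the_hom K (homology K L 3) (Kill K L)
     (\<lambda>f. \<forall>z\<in>ce_cycles K L 3. f (homology_class K L 3 z) = koszul K L z)"


subsection \<open>The Lie algebra obtained by tensoring with a commutative algebra\<close>

definition tensor_bracket :: "('k, 'r) ring_scheme \<Rightarrow> ('k, 'a, 'm) module_scheme
    \<Rightarrow> ('k, 'l, 'n) lie_algebra_scheme
    \<Rightarrow> ('a \<times> 'l \<Rightarrow> 'k) set \<Rightarrow> ('a \<times> 'l \<Rightarrow> 'k) set \<Rightarrow> ('a \<times> 'l \<Rightarrow> 'k) set" where
  "tensor_bracket K A L u v =
     the_hom K (tensor K (tensor K A L) (tensor K A L)) (tensor K A L)
       (\<lambda>f. \<forall>a\<in>carrier A. \<forall>b\<in>carrier A. \<forall>x\<in>carrier L. \<forall>y\<in>carrier L.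
          f (tens K (tensor K A L) (tensor K A L) (tens K A L a x) (tens K A L b y)) =
          tens K A L (a \<otimes>\<^bsub>A\<^esub> b) (bracket L x y))
     (tens K (tensor K A L) (tensor K A L) u v)"

definition tensor_lie :: "('k, 'r) ring_scheme \<Rightarrow> ('k, 'a, 'm) module_scheme
    \<Rightarrow> ('k, 'l, 'n) lie_algebra_scheme \<Rightarrow> ('k, ('a \<times> 'l \<Rightarrow> 'k) set) lie_algebra" where
  "tensor_lie K A L = module.extend (tensor K A L) \<lparr>bracket = tensor_bracket K A L\<rparr>"

definition tensor_component :: "('k, 'r) ring_scheme \<Rightarrow> ('k, 'a, 'm) module_scheme
    \<Rightarrow> ('k, 'l, 'n) lie_algebra_scheme \<Rightarrow> ('b \<Rightarrow> 'l set) \<Rightarrow> 'b \<Rightarrow> ('a \<times> 'l \<Rightarrow> 'k) set set" where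
  "tensor_component K A L D \<gamma> =
     mod_span K (tensor K A L) {tens K A L a x | a x. a \<in> carrier A \<and> x \<in> D \<gamma>}"

definition chain_map2 :: "('k, 'r) ring_scheme \<Rightarrow> ('k, 'a, 'm) module_scheme
    \<Rightarrow> ('k, 'l, 'n) lie_algebra_scheme
    \<Rightarrow> (('a \<times> 'l \<Rightarrow> 'k) set list \<Rightarrow> 'k) set set \<Rightarrow> ('a \<times> ('l list \<Rightarrow> 'k) set set \<Rightarrow> 'k) set" where
  "chain_map2 K A L =
     the_hom K (ext_power K (tensor_lie K A L) 2) (tensor K A (ext_power K L 2))
       (\<lambda>f. \<forall>a\<in>carrier A. \<forall>b\<in>carrier A. \<forall>x\<in>carrier L. \<forall>y\<in>carrier L.
          f (wedge K (tensor_lie K A L) [tens K A L a x, tens K A L b y]) =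
          tens K A (ext_power K L 2) (a \<otimes>\<^bsub>A\<^esub> b) (wedge K L [x, y]))"

text \<open>
  The natural map from \<open>H\<^sub>2(A \<otimes> L)\<close> to \<open>A \<otimes> H\<^sub>2(L)\<close>: the chain map sends a cycle \<open>z\<close> to the image
  in \<open>A \<otimes> \<Lambda>\<^sup>2 L\<close> of a (unique) \<open>w \<in> A \<otimes> Z\<^sub>2(L)\<close>, and the class of \<open>z\<close> is mapped to the image of \<open>w\<close>
  in \<open>A \<otimes> H\<^sub>2(L)\<close>.
\<close>

definition natural_map2 :: "('k, 'r) ring_scheme \<Rightarrow> ('k, 'a, 'm) module_scheme
    \<Rightarrow> ('k, 'l, 'n) lie_algebra_scheme
    \<Rightarrow> (('a \<times> 'l \<Rightarrow> 'k) set list \<Rightarrow> 'k) set set set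
    \<Rightarrow> ('a \<times> ('l list \<Rightarrow> 'k) set set set \<Rightarrow> 'k) set" where
  "natural_map2 K A L =
    (let Z = restrict_to (ext_power K L 2) (ce_cycles K L 2) in
     the_hom K (homology K (tensor_lie K A L) 2) (tensor K A (homology K L 2))
       (\<lambda>f. \<forall>z\<in>ce_cycles K (tensor_lie K A L) 2. \<forall>w\<in>carrier (tensor K A Z).
          chain_map2 K A L z = tensor_map K A Z A (ext_power K L 2) (\<lambda>a. a) (\<lambda>c. c) w \<longrightarrow>
          f (homology_class K (tensor_lie K A L) 2 z) =
            tensor_map K A Z A (homology K L 2) (\<lambda>a. a) (homology_class K L 2) w))"

definition natural_kernel :: "('k, 'r) ring_scheme \<Rightarrow> ('k, 'a, 'm) module_scheme
    \<Rightarrow> ('k, 'l, 'n) lie_algebra_scheme \<Rightarrow> ('b, 's) monoid_scheme \<Rightarrow> ('b \<Rightarrow> 'l set) \<Rightarrow> 'b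
    \<Rightarrow> ('k, (('a \<times> 'l \<Rightarrow> 'k) set list \<Rightarrow> 'k) set set set) module" where
  "natural_kernel K A L B D \<beta> = restrict_to (homology K (tensor_lie K A L) 2)
     {h \<in> homology_degree K (tensor_lie K A L) B (tensor_component K A L D) 2 \<beta>.
        natural_map2 K A L h = \<zero>\<^bsub>tensor K A (homology K L 2)\<^esub>}"

end

theory Submission
  imports Defs
begin

text \<open>
  In \<open>Q = \<Lambda>\<^sup>2(A \<otimes> L) / B\<^sub>2(A \<otimes> L)\<close> let \<open>q a x b y\<close> be the class of \<open>(a \<otimes> x) \<and> (b \<otimes> y)\<close>.
  Since \<open>2\<close> is invertible, \<open>Q\<close> is spanned by the skew classes
  \<open>I2 (a \<and> b) (x \<odot> y) = q a x b y - q b x a y\<close> and the symmetric classes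
  \<open>I1 (a \<odot> b) (x \<and> y) = q a x b y + q b x a y\<close>, and the kernel of the natural map is spanned by
  the \<open>I2 t s\<close> and by the \<open>I1 i w\<close> with \<open>i\<close> in \<open>I\<^sub>A\<close>.  The boundaries of \<open>A \<otimes> L\<close> force
  \<open>I2 t s = 0\<close> if \<open>s\<close> is a relation of \<open>Kill(L)\<close>, \<open>I2 t s = 0\<close> if \<open>t\<close> is in the image of \<open>T\<^sub>0\<close> and \<open>s\<close> in
  \<open>[L, L] \<odot> L\<close>, and \<open>I1 i w = 0\<close> if \<open>i\<close> is in \<open>I\<^sub>A\<close> and \<open>w\<close> in \<open>[L, L] \<and> L\<close>.  With linear sections of the
  quotient maps, \<open>I1\<close> and \<open>I2\<close> thus map the three outer terms into the kernel.

  Conversely, \<open>Q\<close> maps to each of the three terms.  The map to \<open>HH\<^sub>1(A) \<otimes> Kill(L)\<^sub>\<beta>\<close> is the delicate one: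
  \<open>I2 t s \<mapsto> [t] \<otimes> [s]\<close> kills the boundaries only after the correction
  \<open>I1 (a \<odot> b) w \<mapsto> - [ab \<and> 1] \<otimes> \<theta> w\<close>, where \<open>\<theta>\<close> on \<open>\<Lambda>\<^sup>2 L\<close> composed with the differential is the
  Koszul map in degree \<open>\<beta>\<close>.  Such a \<open>\<theta>\<close> exists because that Koszul map vanishes on 3-cycles.
\<close>

text \<open>Twice the boundary of (a \<otimes> x) \<and> (b \<otimes> y) \<and> (c \<otimes> z) has
  a skew half, the cyclic sum of \<open>I2\<close> at ab \<and> c and [x,y] \<odot> z, and a
  symmetric half, the cyclic sum of \<open>I1\<close> at ab \<odot> c and [x,y] \<and> z. In Kill(L)
  the three classes of [x,y] \<odot> z coincide with the Koszul value k of x \<and> y \<and> z, so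
  the skew half becomes (T_0(a \<otimes> b \<otimes> c) + abc \<and> 1) \<otimes> k. Modulo the
  image of T_0 the term [abc \<and> 1] \<otimes> k is left over. The correction replaces ab \<odot>
  c by the product abc, so it turns the symmetric half into -[abc \<and> 1] \<otimes> \<theta>(d(x
  \<and> y \<and> z)), which cancels that term once \<theta> composed with d is the Koszul map. The
  term with S^2(H_1) takes no correction, because brackets vanish in H_1. Over a field all maps can
  be taken linear and on the whole of Q rather than on the kernel. The proof therefore gives more
  than exactness: the three maps into the kernel and the three maps out of it are inverse to each
  other, so the sequence splits.\<close>

locale base_field = field K for K :: "('k, 'r) ring_scheme" (structure)
begin

section \<open>Vector spaces over \<open>K\<close> and normalisation of signed sums\<close>

abbreviation vs :: "('k, 'v, 'm) module_scheme \<Rightarrow> bool"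
  where "vs V \<equiv> module K V"

abbreviation sub :: "'v set \<Rightarrow> ('k, 'v, 'm) module_scheme \<Rightarrow> bool"
  where "sub N V \<equiv> submodule N K V"

abbreviation span :: "('k, 'v, 'm) module_scheme \<Rightarrow> 'v set \<Rightarrow> 'v set"
  where "span V S \<equiv> mod_span K V S"

lemma vs_group: "vs V \<Longrightarrow> abelian_group V"
  by (rule module.axioms(2))

lemma vs_monoid: "vs V \<Longrightarrow> abelian_monoid V"
  by (rule abelian_group.axioms(1)[OF vs_group])

lemma minus_one_closed [simp]: "\<ominus> \<one> \<in> carrier K"
  by simp

text \<open>Goals mix many spaces over \<open>K\<close>, so the axioms are restated with
  \<open>vs V\<close> as a premise for the simplifier to discharge, in place of one interpretation
  per space.\<close>

lemmas vs_zero [simp] = abelian_monoid.zero_closed[OF vs_monoid]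
lemmas vs_add [simp] = abelian_monoid.a_closed[OF vs_monoid]
lemmas vs_neg [simp] = abelian_group.a_inv_closed[OF vs_group]
lemmas vs_smult [simp] = module.smult_closed[of K]
lemmas vs_l_zero [simp] = abelian_monoid.l_zero[OF vs_monoid]
lemmas vs_r_zero [simp] = abelian_monoid.r_zero[OF vs_monoid]
lemmas vs_r_neg [simp] = abelian_group.r_neg[OF vs_group]
lemmas vs_l_neg [simp] = abelian_group.l_neg[OF vs_group]
lemmas vs_neg_neg [simp] = abelian_group.minus_minus[OF vs_group]
lemmas vs_neg_add = abelian_group.minus_add[OF vs_group]
lemmas vs_assoc = abelian_monoid.a_assoc[OF vs_monoid]
lemmas vs_comm = abelian_monoid.a_comm[OF vs_monoid]
lemmas vs_lcomm = abelian_monoid.a_lcomm[OF vs_monoid]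
lemmas vs_smult_one [simp] = module.smult_one[of K]
lemmas vs_smult_zero_left [simp] = module.smult_l_null[of K]
lemmas vs_smult_zero_right [simp] = module.smult_r_null[of K]
lemmas vs_smult_add = module.smult_r_distr[of K]
lemmas vs_add_smult = module.smult_l_distr[of K]
lemmas vs_smult_smult = module.smult_assoc1[of K]
lemmas vs_smult_neg = module.smult_r_minus[of K]
lemmas vs_neg_smult = module.smult_l_minus[of K]

lemma vs_minus [simp]:
  "vs V \<Longrightarrow> x \<in> carrier V \<Longrightarrow> y \<in> carrier V \<Longrightarrow> x \<ominus>\<^bsub>V\<^esub> y \<in> carrier V"
  by (simp add: a_minus_def)

lemma vs_neg_zero [simp]: "vs V \<Longrightarrow> \<ominus>\<^bsub>V\<^esub> \<zero>\<^bsub>V\<^esub> = \<zero>\<^bsub>V\<^esub>"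
  using vs_l_neg[of V "\<zero>\<^bsub>V\<^esub>"] by simp

lemma vs_neg_eq: "vs V \<Longrightarrow> x \<in> carrier V \<Longrightarrow> \<ominus>\<^bsub>V\<^esub> x = (\<ominus> \<one>) \<odot>\<^bsub>V\<^esub> x"
  by (simp add: vs_neg_smult)

lemma vs_minus_eq_zero_iff:
  assumes "vs V" "x \<in> carrier V" "y \<in> carrier V"
  shows "x \<ominus>\<^bsub>V\<^esub> y = \<zero>\<^bsub>V\<^esub> \<longleftrightarrow> x = y"
proof
  assume "x \<ominus>\<^bsub>V\<^esub> y = \<zero>\<^bsub>V\<^esub>"
  then have "x \<ominus>\<^bsub>V\<^esub> y \<oplus>\<^bsub>V\<^esub> y = y" using assms by simp
  then show "x = y" using assms by (simp add: a_minus_def vs_assoc)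
qed (use assms in \<open>simp add: a_minus_def\<close>)

lemma vs_minus_self [simp]: "vs V \<Longrightarrow> x \<in> carrier V \<Longrightarrow> x \<ominus>\<^bsub>V\<^esub> x = \<zero>\<^bsub>V\<^esub>"
  by (simp add: a_minus_def)

lemma vs_minus_zero [simp]: "vs V \<Longrightarrow> x \<in> carrier V \<Longrightarrow> x \<ominus>\<^bsub>V\<^esub> \<zero>\<^bsub>V\<^esub> = x"
  by (simp add: a_minus_def)

text \<open>
  Identities between \<open>\<int>\<close>-linear combinations are decided by rewriting: \<open>sg V x b\<close> is \<open>x\<close> or
  \<open>- x\<close>, with the sign as last argument, so that ordered rewriting of a sum places equal
  atoms of opposite sign next to each other.
\<close>

definition sg :: "('k, 'v, 'm) module_scheme \<Rightarrow> 'v \<Rightarrow> bool \<Rightarrow> 'v"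
  where "sg V x b = (if b then x else \<ominus>\<^bsub>V\<^esub> x)"

lemma sg_eqI:
  assumes "sg V (x \<ominus>\<^bsub>V\<^esub> y) True = \<zero>\<^bsub>V\<^esub>" "vs V" "x \<in> carrier V" "y \<in> carrier V"
  shows "x = y"
  using assms by (simp add: sg_def vs_minus_eq_zero_iff)

lemma sg_closed: "vs V \<Longrightarrow> x \<in> carrier V \<Longrightarrow> sg V x b \<in> carrier V"
  by (simp add: sg_def)

lemma sg_add: "vs V \<Longrightarrow> x \<in> carrier V \<Longrightarrow> y \<in> carrier V \<Longrightarrow>
    sg V (x \<oplus>\<^bsub>V\<^esub> y) b = sg V x b \<oplus>\<^bsub>V\<^esub> sg V y b"
  by (simp add: sg_def vs_neg_add vs_comm)

lemma sg_neg: "vs V \<Longrightarrow> x \<in> carrier V \<Longrightarrow> sg V (\<ominus>\<^bsub>V\<^esub> x) b = sg V x (\<not> b)"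
  by (simp add: sg_def)

lemma sg_minus: "vs V \<Longrightarrow> x \<in> carrier V \<Longrightarrow> y \<in> carrier V \<Longrightarrow>
    sg V (x \<ominus>\<^bsub>V\<^esub> y) b = sg V x b \<oplus>\<^bsub>V\<^esub> sg V y (\<not> b)"
  by (simp add: a_minus_def sg_add sg_neg)

lemma sg_zero: "vs V \<Longrightarrow> sg V \<zero>\<^bsub>V\<^esub> b = \<zero>\<^bsub>V\<^esub>"
  by (simp add: sg_def)

text \<open>Scalars are pushed inward only past sums, differences and negatives. A multiple of an
  atom counts as an atom itself, so that a coefficient such as one half needs no arithmetic.\<close>

lemma sg_smult: "vs V \<Longrightarrow> c \<in> carrier K \<Longrightarrow> x \<in> carrier V \<Longrightarrow> y \<in> carrier V \<Longrightarrow>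
    sg V (c \<odot>\<^bsub>V\<^esub> (x \<oplus>\<^bsub>V\<^esub> y)) b = sg V (c \<odot>\<^bsub>V\<^esub> x) b \<oplus>\<^bsub>V\<^esub> sg V (c \<odot>\<^bsub>V\<^esub> y) b"
  "vs V \<Longrightarrow> c \<in> carrier K \<Longrightarrow> x \<in> carrier V \<Longrightarrow> y \<in> carrier V \<Longrightarrow>
    sg V (c \<odot>\<^bsub>V\<^esub> (x \<ominus>\<^bsub>V\<^esub> y)) b = sg V (c \<odot>\<^bsub>V\<^esub> x) b \<oplus>\<^bsub>V\<^esub> sg V (c \<odot>\<^bsub>V\<^esub> y) (\<not> b)"
  "vs V \<Longrightarrow> c \<in> carrier K \<Longrightarrow> x \<in> carrier V \<Longrightarrow>
    sg V (c \<odot>\<^bsub>V\<^esub> (\<ominus>\<^bsub>V\<^esub> x)) b = sg V (c \<odot>\<^bsub>V\<^esub> x) (\<not> b)"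
  by (simp_all add: vs_smult_add sg_add a_minus_def vs_smult_neg sg_neg)

lemma sg_cancel:
  "vs V \<Longrightarrow> x \<in> carrier V \<Longrightarrow> sg V x True \<oplus>\<^bsub>V\<^esub> sg V x False = \<zero>\<^bsub>V\<^esub>"
  "vs V \<Longrightarrow> x \<in> carrier V \<Longrightarrow> sg V x False \<oplus>\<^bsub>V\<^esub> sg V x True = \<zero>\<^bsub>V\<^esub>"
  "vs V \<Longrightarrow> x \<in> carrier V \<Longrightarrow> y \<in> carrier V \<Longrightarrow>
    sg V x True \<oplus>\<^bsub>V\<^esub> (sg V x False \<oplus>\<^bsub>V\<^esub> y) = y"
  "vs V \<Longrightarrow> x \<in> carrier V \<Longrightarrow> y \<in> carrier V \<Longrightarrow>
    sg V x False \<oplus>\<^bsub>V\<^esub> (sg V x True \<oplus>\<^bsub>V\<^esub> y) = y"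
  by (simp_all add: sg_def flip: vs_assoc)

lemmas sg_simps = sg_closed sg_add sg_neg sg_minus sg_zero sg_smult sg_cancel
  vs_assoc vs_comm vs_lcomm

subsection \<open>Subspaces and spans\<close>

text \<open>Closure under negation comes from the scalar -1.\<close>

lemma subI:
  assumes "vs V" "N \<subseteq> carrier V" "\<zero>\<^bsub>V\<^esub> \<in> N"
    and "\<And>x y. x \<in> N \<Longrightarrow> y \<in> N \<Longrightarrow> x \<oplus>\<^bsub>V\<^esub> y \<in> N"
    and "\<And>c x. c \<in> carrier K \<Longrightarrow> x \<in> N \<Longrightarrow> c \<odot>\<^bsub>V\<^esub> x \<in> N"
  shows "sub N V"
proof (rule module.submoduleI[OF assms(1-3)])
  fix a assume "a \<in> N"
  then show "\<ominus>\<^bsub>V\<^esub> a \<in> N" using assms(2) assms(5)[of "\<ominus> \<one>" a] vs_neg_eq[OF assms(1)] by auto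
qed (use assms in auto)

lemma sub_closed:
  assumes "sub N V" "vs V"
  shows "x \<in> N \<Longrightarrow> x \<in> carrier V" "\<zero>\<^bsub>V\<^esub> \<in> N" "x \<in> N \<Longrightarrow> \<ominus>\<^bsub>V\<^esub> x \<in> N"
    "x \<in> N \<Longrightarrow> y \<in> N \<Longrightarrow> x \<oplus>\<^bsub>V\<^esub> y \<in> N"
    "x \<in> N \<Longrightarrow> y \<in> N \<Longrightarrow> x \<ominus>\<^bsub>V\<^esub> y \<in> N"
    "c \<in> carrier K \<Longrightarrow> x \<in> N \<Longrightarrow> c \<odot>\<^bsub>V\<^esub> x \<in> N"
proof -
  note s = module.submoduleE[OF assms(2,1)]
  have z: "x \<in> N \<Longrightarrow> \<zero>\<^bsub>V\<^esub> \<in> N" for x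
    using s(3)[of x] s(5)[of x "\<ominus>\<^bsub>V\<^esub> x"] s(1) assms(2) by auto
  show "x \<in> N \<Longrightarrow> x \<in> carrier V" "\<zero>\<^bsub>V\<^esub> \<in> N" "x \<in> N \<Longrightarrow> \<ominus>\<^bsub>V\<^esub> x \<in> N"
    "x \<in> N \<Longrightarrow> y \<in> N \<Longrightarrow> x \<oplus>\<^bsub>V\<^esub> y \<in> N"
    "x \<in> N \<Longrightarrow> y \<in> N \<Longrightarrow> x \<ominus>\<^bsub>V\<^esub> y \<in> N"
    "c \<in> carrier K \<Longrightarrow> x \<in> N \<Longrightarrow> c \<odot>\<^bsub>V\<^esub> x \<in> N"
    using s z unfolding a_minus_def by auto
qed

lemma sub_subset: "sub N V \<Longrightarrow> vs V \<Longrightarrow> N \<subseteq> carrier V"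
  by (auto dest: sub_closed)

lemma sub_carrier [simp]: "vs V \<Longrightarrow> sub (carrier V) V"
  by (rule module.carrier_is_submodule)

lemma vs_restrict [simp]: "vs V \<Longrightarrow> sub N V \<Longrightarrow> vs (restrict_to V N)"
  by (rule submodule.submodule_is_module)

lemma neg_restrict [simp]:
  "vs V \<Longrightarrow> sub N V \<Longrightarrow> x \<in> N \<Longrightarrow> \<ominus>\<^bsub>restrict_to V N\<^esub> x = \<ominus>\<^bsub>V\<^esub> x"
  using vs_neg_eq[OF vs_restrict, of V N x] vs_neg_eq[of V x] by (simp add: sub_closed)

lemma minus_restrict [simp]:
  "vs V \<Longrightarrow> sub N V \<Longrightarrow> x \<in> N \<Longrightarrow> y \<in> N \<Longrightarrow> x \<ominus>\<^bsub>restrict_to V N\<^esub> y = x \<ominus>\<^bsub>V\<^esub> y"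
  by (simp add: a_minus_def)

lemma sub_span [simp]:
  assumes "vs V" "S \<subseteq> carrier V"
  shows "sub (span V S) V"
proof (rule subI[OF assms(1)])
  show "span V S \<subseteq> carrier V" unfolding mod_span_def using sub_carrier[OF assms(1)] assms(2) by blast
qed (use assms(1) in \<open>auto simp: mod_span_def intro: sub_closed\<close>)

lemma span_superset: "S \<subseteq> span V S"
  by (auto simp: mod_span_def)

lemma span_least: "sub N V \<Longrightarrow> S \<subseteq> N \<Longrightarrow> span V S \<subseteq> N"
  by (auto simp: mod_span_def)

lemma span_closed: "vs V \<Longrightarrow> S \<subseteq> carrier V \<Longrightarrow> x \<in> span V S \<Longrightarrow> x \<in> carrier V"
  by (rule sub_closed(1)[OF sub_span])


lemma span_base: "x \<in> S \<Longrightarrow> x \<in> span V S"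
  by (auto simp: mod_span_def)

lemma span_induct [consumes 3, case_names base zero add smult]:
  assumes "x \<in> span V S" "vs V" "S \<subseteq> carrier V"
    and "\<And>s. s \<in> S \<Longrightarrow> P s" "P \<zero>\<^bsub>V\<^esub>"
    and "\<And>x y. x \<in> span V S \<Longrightarrow> y \<in> span V S \<Longrightarrow> x \<in> carrier V \<Longrightarrow> y \<in> carrier V \<Longrightarrow> P x \<Longrightarrow> P y \<Longrightarrow> P (x \<oplus>\<^bsub>V\<^esub> y)"
    and "\<And>c x. c \<in> carrier K \<Longrightarrow> x \<in> span V S \<Longrightarrow> x \<in> carrier V \<Longrightarrow> P x \<Longrightarrow> P (c \<odot>\<^bsub>V\<^esub> x)"
  shows "P x"
proof -
  let ?N = "{x \<in> span V S. P x}"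
  have "sub ?N V"
    using assms sub_closed[OF sub_span[OF assms(2,3)] assms(2)]
    by (intro subI) auto
  moreover have "S \<subseteq> ?N" using assms(4) by (auto intro: span_base)
  ultimately show ?thesis using span_least[of ?N V S] assms(1) by blast
qed

definition spans :: "('k, 'v, 'm) module_scheme \<Rightarrow> 'v set \<Rightarrow> bool"
  where "spans V S \<longleftrightarrow> S \<subseteq> carrier V \<and> carrier V \<subseteq> span V S"

lemma spans_subset: "spans V S \<Longrightarrow> S \<subseteq> carrier V"
  by (simp add: spans_def)

lemma spansD: "spans V S \<Longrightarrow> x \<in> carrier V \<Longrightarrow> x \<in> span V S"
  by (auto simp: spans_def)

lemma spans_carrier: "spans V (carrier V)"
  by (simp add: spans_def span_superset)

lemma span_restrict:
  assumes "vs V" "sub N V" "S \<subseteq> N"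
  shows "span (restrict_to V N) S = span V S"
proof
  have 1: "S \<subseteq> carrier V" using assms(3) sub_subset[OF assms(2,1)] by (rule subset_trans)
  have "span V S \<subseteq> N" using assms by (intro span_least)
  then have "sub (span V S) (restrict_to V N)"
    using sub_closed[OF sub_span[OF assms(1) 1] assms(1)] assms by (intro subI) auto
  then show "span (restrict_to V N) S \<subseteq> span V S" using span_superset by (intro span_least)
  have 2: "sub (span (restrict_to V N) S) (restrict_to V N)"
    using assms by (intro sub_span) auto
  have "sub (span (restrict_to V N) S) V"
    using sub_closed[OF 2 vs_restrict[OF assms(1,2)]] sub_closed[OF assms(2,1)] assms
    by (intro subI) auto
  then show "span V S \<subseteq> span (restrict_to V N) S" using span_superset by (intro span_least)
qed

lemma spans_restrict_span:
  assumes "vs V" "S \<subseteq> carrier V"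
  shows "spans (restrict_to V (span V S)) S"
  using assms by (simp add: spans_def span_restrict span_superset)

subsection \<open>Linear maps\<close>

text \<open>Unlike \<open>mod_hom\<close>, linearity here makes no claim about values outside the
  carrier, so that compositions and lambda terms are linear as they stand.
  \<open>mod_hom_iff\<close> relates the two notions.\<close>

definition lin :: "('k, 'v, 'm) module_scheme \<Rightarrow> ('k, 'w, 'n) module_scheme \<Rightarrow> ('v \<Rightarrow> 'w) \<Rightarrow> bool"
  where "lin V W f \<longleftrightarrow> (\<forall>x\<in>carrier V. f x \<in> carrier W) \<and>
    (\<forall>x\<in>carrier V. \<forall>y\<in>carrier V. f (x \<oplus>\<^bsub>V\<^esub> y) = f x \<oplus>\<^bsub>W\<^esub> f y) \<and>
    (\<forall>c\<in>carrier K. \<forall>x\<in>carrier V. f (c \<odot>\<^bsub>V\<^esub> x) = c \<odot>\<^bsub>W\<^esub> f x)"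

lemma linI:
  assumes "\<And>x. x \<in> carrier V \<Longrightarrow> f x \<in> carrier W"
    and "\<And>x y. x \<in> carrier V \<Longrightarrow> y \<in> carrier V \<Longrightarrow> f (x \<oplus>\<^bsub>V\<^esub> y) = f x \<oplus>\<^bsub>W\<^esub> f y"
    and "\<And>c x. c \<in> carrier K \<Longrightarrow> x \<in> carrier V \<Longrightarrow> f (c \<odot>\<^bsub>V\<^esub> x) = c \<odot>\<^bsub>W\<^esub> f x"
  shows "lin V W f"
  using assms by (simp add: lin_def)

lemma lin_closed: "lin V W f \<Longrightarrow> x \<in> carrier V \<Longrightarrow> f x \<in> carrier W"
  by (simp add: lin_def)

lemma lin_add: "lin V W f \<Longrightarrow> x \<in> carrier V \<Longrightarrow> y \<in> carrier V \<Longrightarrow>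
    f (x \<oplus>\<^bsub>V\<^esub> y) = f x \<oplus>\<^bsub>W\<^esub> f y"
  by (simp add: lin_def)

lemma lin_smult: "lin V W f \<Longrightarrow> c \<in> carrier K \<Longrightarrow> x \<in> carrier V \<Longrightarrow>
    f (c \<odot>\<^bsub>V\<^esub> x) = c \<odot>\<^bsub>W\<^esub> f x"
  by (simp add: lin_def)

lemma lin_zero:
  assumes "lin V W f" "vs V" "vs W"
  shows "f \<zero>\<^bsub>V\<^esub> = \<zero>\<^bsub>W\<^esub>"
  using lin_smult[OF assms(1), of \<zero> "\<zero>\<^bsub>V\<^esub>"] lin_closed[OF assms(1), of "\<zero>\<^bsub>V\<^esub>"] assms by simp

lemma lin_neg:
  assumes "lin V W f" "vs V" "vs W" "x \<in> carrier V"
  shows "f (\<ominus>\<^bsub>V\<^esub> x) = \<ominus>\<^bsub>W\<^esub> f x"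
  using assms lin_smult[OF assms(1), of "\<ominus> \<one>" x] lin_closed[OF assms(1)] by (simp add: vs_neg_eq)

lemma lin_minus:
  assumes "lin V W f" "vs V" "vs W" "x \<in> carrier V" "y \<in> carrier V"
  shows "f (x \<ominus>\<^bsub>V\<^esub> y) = f x \<ominus>\<^bsub>W\<^esub> f y"
  using assms by (simp add: a_minus_def lin_add lin_neg)

lemma lin_cong:
  assumes "vs V" "lin V W f" "\<And>x. x \<in> carrier V \<Longrightarrow> f x = g x"
  shows "lin V W g"
  using assms(2) assms(3) assms(1) by (simp add: lin_def)

text \<open>With these rules the linearity of a lambda term in one variable is proved by following
  its syntax.\<close>

named_theorems lin_intros

lemma lin_id [lin_intros]: "lin V V (\<lambda>x. x)"
  by (simp add: lin_def)

lemma lin_comp: "lin V' W g \<Longrightarrow> lin V V' f \<Longrightarrow> lin V W (\<lambda>x. g (f x))"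
  by (simp add: lin_def)

lemma lin_const_zero [lin_intros]: "vs W \<Longrightarrow> lin V W (\<lambda>x. \<zero>\<^bsub>W\<^esub>)"
  by (simp add: lin_def)

lemma lin_plus [lin_intros]: "vs W \<Longrightarrow> lin V W f \<Longrightarrow> lin V W g \<Longrightarrow> lin V W (\<lambda>x. f x \<oplus>\<^bsub>W\<^esub> g x)"
  by (simp add: lin_def vs_smult_add vs_assoc vs_lcomm)

lemma lin_scale [lin_intros]: "vs W \<Longrightarrow> c \<in> carrier K \<Longrightarrow> lin V W f \<Longrightarrow> lin V W (\<lambda>x. c \<odot>\<^bsub>W\<^esub> f x)"
  by (simp add: lin_def vs_smult_add m_comm flip: vs_smult_smult)

lemma lin_uminus [lin_intros]:
  assumes "vs W" "lin V W f"
  shows "lin V W (\<lambda>x. \<ominus>\<^bsub>W\<^esub> f x)"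
  using assms by (simp add: lin_def vs_smult_neg vs_neg_add vs_comm)

lemma lin_diff [lin_intros]:
  "vs W \<Longrightarrow> lin V W f \<Longrightarrow> lin V W g \<Longrightarrow> lin V W (\<lambda>x. f x \<ominus>\<^bsub>W\<^esub> g x)"
  unfolding a_minus_def by (intro lin_plus lin_uminus)

lemma lin_restrict_dom: "lin V W f \<Longrightarrow> vs V \<Longrightarrow> sub N V \<Longrightarrow> lin (restrict_to V N) W f"
  by (simp add: lin_def sub_closed(1))

lemma lin_restrict_cod: "lin V (restrict_to W N) f \<Longrightarrow> vs W \<Longrightarrow> sub N W \<Longrightarrow> lin V W f"
  by (simp add: lin_def sub_closed(1))

lemma lin_into_restrict: "lin V W f \<Longrightarrow> (\<And>x. x \<in> carrier V \<Longrightarrow> f x \<in> N) \<Longrightarrow> lin V (restrict_to W N) f"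
  by (auto simp: lin_def)

lemma sub_kernel:
  assumes "vs V" "vs W" "lin V W f"
  shows "sub {x \<in> carrier V. f x = \<zero>\<^bsub>W\<^esub>} V"
  using assms by (intro subI) (auto simp: lin_add lin_smult lin_zero)

lemma sub_vimage:
  assumes "vs V" "vs W" "lin V W f" "sub N W"
  shows "sub {x \<in> carrier V. f x \<in> N} V"
  using assms sub_closed[OF assms(4,2)] by (intro subI) (auto simp: lin_add lin_smult lin_zero)

lemma sub_image:
  assumes "vs V" "vs W" "lin V W f" "sub N V"
  shows "sub (f ` N) W"
proof (rule subI[OF assms(2)])
  note n = sub_closed[OF assms(4,1)]
  show "f ` N \<subseteq> carrier W" using n(1) lin_closed[OF assms(3)] by auto
  show "\<zero>\<^bsub>W\<^esub> \<in> f ` N" using n(2) lin_zero[OF assms(3,1,2)] by force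
  fix x y assume "x \<in> f ` N" "y \<in> f ` N"
  then obtain a b where "a \<in> N" "b \<in> N" "x = f a" "y = f b" by auto
  then show "x \<oplus>\<^bsub>W\<^esub> y \<in> f ` N" using n(1,4) lin_add[OF assms(3), of a b] by force
next
  note n = sub_closed[OF assms(4,1)]
  fix c x assume "c \<in> carrier K" "x \<in> f ` N"
  then show "c \<odot>\<^bsub>W\<^esub> x \<in> f ` N" using n(1,6) lin_smult[OF assms(3), of c] by force
qed

lemma lin_span:
  assumes "lin V W f" "vs V" "vs W" "S \<subseteq> carrier V" "sub N W" "\<And>s. s \<in> S \<Longrightarrow> f s \<in> N"
    and "x \<in> span V S"
  shows "f x \<in> N"
proof -
  have "span V S \<subseteq> {x \<in> carrier V. f x \<in> N}"
    using assms by (intro span_least sub_vimage[OF assms(2,3,1,5)]) auto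
  then show ?thesis using assms(7) by auto
qed

lemma image_span:
  assumes "lin V W f" "vs V" "vs W" "S \<subseteq> carrier V"
  shows "f ` span V S = span W (f ` S)"
proof
  have 1: "f ` S \<subseteq> carrier W" using assms lin_closed[OF assms(1)] by auto
  show "f ` span V S \<subseteq> span W (f ` S)"
    using lin_span[OF assms sub_span[OF assms(3) 1]] span_base[of _ "f ` S"] by blast
  show "span W (f ` S) \<subseteq> f ` span V S"
    by (intro span_least sub_image[OF assms(2,3,1)] sub_span image_mono span_superset assms)
qed

lemma spans_image:
  assumes "lin V W f" "vs V" "vs W" "spans V S" "carrier W \<subseteq> f ` carrier V"
  shows "spans W (f ` S)"
proof -
  have "span V S = carrier V"
    using sub_subset[OF sub_span[OF assms(2) spans_subset[OF assms(4)]] assms(2)] assms(4)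
    by (simp add: spans_def)
  then show ?thesis
    using image_span[OF assms(1-3) spans_subset[OF assms(4)]] spans_subset[OF assms(4)]
      lin_closed[OF assms(1)] assms(5)
    by (auto simp: spans_def)
qed

lemma lin_eq_on_span:
  assumes "lin V W f" "lin V W g" "vs V" "vs W" "S \<subseteq> carrier V"
    "\<And>s. s \<in> S \<Longrightarrow> f s = g s" "x \<in> span V S"
  shows "f x = g x"
  using assms(7,3,5)
  by (induction rule: span_induct)
    (use assms in \<open>simp_all add: lin_zero lin_add lin_smult\<close>)

lemma lin_eq:
  assumes "spans V S" "lin V W f" "lin V W g" "vs V" "vs W"
    "\<And>s. s \<in> S \<Longrightarrow> f s = g s" "x \<in> carrier V"
  shows "f x = g x"
  using lin_eq_on_span[OF assms(2-5) spans_subset[OF assms(1)] assms(6) spansD[OF assms(1,7)]] .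

lemma lin_vanish:
  assumes "spans V S" "lin V W f" "vs V" "vs W"
    "\<And>s. s \<in> S \<Longrightarrow> f s = \<zero>\<^bsub>W\<^esub>" "x \<in> carrier V"
  shows "f x = \<zero>\<^bsub>W\<^esub>"
  using lin_eq[OF assms(1,2) lin_const_zero[OF assms(4)] assms(3-6)] .

lemma mod_hom_iff: "f \<in> mod_hom K V W \<longleftrightarrow> lin V W f \<and> f \<in> extensional (carrier V)"
  by (auto simp: mod_hom_def lin_def PiE_def)

lemma lin_restrict_ext: "vs V \<Longrightarrow> lin V W f \<Longrightarrow> lin V W (restrict f (carrier V))"
  by (rule lin_cong) auto

text \<open>Gives access to every map introduced by \<open>the_hom\<close>. A linear
  \<open>f\<close> with property \<open>P\<close> witnesses existence; the last premise, agreement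
  of any two candidates on a spanning set, gives uniqueness. The restriction of \<open>f\<close> to
  the carrier supplies the extensionality that \<open>mod_hom\<close> demands.\<close>

lemma the_hom_props:
  assumes "spans V S" "vs V" "vs W" "lin V W f" "P (restrict f (carrier V))"
    and "\<forall>g h. lin V W g \<longrightarrow> lin V W h \<longrightarrow> P g \<longrightarrow> P h \<longrightarrow> (\<forall>s\<in>S. g s = h s)"
  shows "lin V W (the_hom K V W P)" "P (the_hom K V W P)" "the_hom K V W P \<in> mod_hom K V W"
    "x \<in> carrier V \<Longrightarrow> the_hom K V W P x = f x"
proof -
  let ?f = "restrict f (carrier V)"
  have f: "?f \<in> mod_hom K V W" using assms by (simp add: mod_hom_iff lin_restrict_ext)
  have "the_hom K V W P = ?f"
    unfolding the_hom_def
  proof (rule the_equality)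
    show "?f \<in> mod_hom K V W \<and> P ?f" using f assms by simp
    fix g assume g: "g \<in> mod_hom K V W \<and> P g"
    show "g = ?f"
    proof (rule extensionalityI)
      show "g \<in> extensional (carrier V)" "?f \<in> extensional (carrier V)"
        using g f by (auto simp: mod_hom_iff)
      fix x assume x: "x \<in> carrier V"
      have l: "lin V W g" "lin V W ?f" using f g by (auto simp: mod_hom_iff)
      show "g x = ?f x"
        by (rule lin_eq[OF assms(1) l assms(2,3) _ x])
          (use assms(5,6) l g in blast)
    qed
  qed
  then show "lin V W (the_hom K V W P)" "P (the_hom K V W P)" "the_hom K V W P \<in> mod_hom K V W"
    "x \<in> carrier V \<Longrightarrow> the_hom K V W P x = f x"
    using f assms(5) by (auto simp: mod_hom_iff)
qed

subsection \<open>Quotients\<close>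

lemma sub_abelian_subgroup: "vs V \<Longrightarrow> sub N V \<Longrightarrow> abelian_subgroup N V"
  by (intro abelian_subgroupI3 additive_subgroupI vs_group submodule.axioms(1))

lemma coset_def: "N +>\<^bsub>V\<^esub> x = {n \<oplus>\<^bsub>V\<^esub> x | n. n \<in> N}"
  by (auto simp: a_r_coset_def')

lemma coset_subset:
  assumes "vs V" "sub N V" "x \<in> carrier V" "y \<in> carrier V" "x \<ominus>\<^bsub>V\<^esub> y \<in> N"
  shows "N +>\<^bsub>V\<^esub> x \<subseteq> N +>\<^bsub>V\<^esub> y"
proof
  note n = sub_closed[OF assms(2,1)]
  fix z assume "z \<in> N +>\<^bsub>V\<^esub> x"
  then obtain m where m: "m \<in> N" "z = m \<oplus>\<^bsub>V\<^esub> x" by (auto simp: coset_def)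
  have "z = (m \<oplus>\<^bsub>V\<^esub> (x \<ominus>\<^bsub>V\<^esub> y)) \<oplus>\<^bsub>V\<^esub> y"
    by (rule sg_eqI[of V]) (use assms n(1)[OF m(1)] m(2) in \<open>simp_all add: sg_simps\<close>)
  then show "z \<in> N +>\<^bsub>V\<^esub> y" using n(4)[OF m(1) assms(5)] by (auto simp: coset_def)
qed

lemma coset_eq_iff:
  assumes "vs V" "sub N V" "x \<in> carrier V" "y \<in> carrier V"
  shows "N +>\<^bsub>V\<^esub> x = N +>\<^bsub>V\<^esub> y \<longleftrightarrow> x \<ominus>\<^bsub>V\<^esub> y \<in> N"
proof
  note n = sub_closed[OF assms(2,1)]
  assume "N +>\<^bsub>V\<^esub> x = N +>\<^bsub>V\<^esub> y"
  moreover have "x \<in> N +>\<^bsub>V\<^esub> x" using assms n(2) by (force simp: coset_def)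
  ultimately obtain m where m: "m \<in> N" "x = m \<oplus>\<^bsub>V\<^esub> y" by (auto simp: coset_def)
  then have "x \<ominus>\<^bsub>V\<^esub> y = m" using assms n(1)[OF m(1)] by (simp add: a_minus_def vs_assoc)
  then show "x \<ominus>\<^bsub>V\<^esub> y \<in> N" using m by simp
next
  assume a: "x \<ominus>\<^bsub>V\<^esub> y \<in> N"
  have "y \<ominus>\<^bsub>V\<^esub> x = \<ominus>\<^bsub>V\<^esub> (x \<ominus>\<^bsub>V\<^esub> y)"
    by (rule sg_eqI[of V]) (use assms in \<open>simp_all add: sg_simps\<close>)
  then have "y \<ominus>\<^bsub>V\<^esub> x \<in> N" using sub_closed(3)[OF assms(2,1) a] by simp
  then show "N +>\<^bsub>V\<^esub> x = N +>\<^bsub>V\<^esub> y"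
    using a assms by (intro subset_antisym coset_subset)
qed

lemma quot_carrier: "carrier (quot_mod V N) = (\<lambda>x. N +>\<^bsub>V\<^esub> x) ` carrier V"
  by (auto simp: quot_mod_def A_RCOSETS_def')

lemma quot_zero: "\<zero>\<^bsub>quot_mod V N\<^esub> = N"
  by (simp add: quot_mod_def)

lemma coset_zero:
  assumes "vs V" "sub N V"
  shows "N +>\<^bsub>V\<^esub> \<zero>\<^bsub>V\<^esub> = N"
  using sub_closed(1)[OF assms(2,1)] assms by (force simp: coset_def)

lemma coset_eq_zero_iff:
  assumes "vs V" "sub N V" "x \<in> carrier V"
  shows "N +>\<^bsub>V\<^esub> x = \<zero>\<^bsub>quot_mod V N\<^esub> \<longleftrightarrow> x \<in> N"
  using coset_eq_iff[OF assms, of "\<zero>\<^bsub>V\<^esub>"] assms by (simp add: coset_zero quot_zero)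

lemma quot_add:
  assumes "vs V" "sub N V" "x \<in> carrier V" "y \<in> carrier V"
  shows "(N +>\<^bsub>V\<^esub> x) \<oplus>\<^bsub>quot_mod V N\<^esub> (N +>\<^bsub>V\<^esub> y) = N +>\<^bsub>V\<^esub> (x \<oplus>\<^bsub>V\<^esub> y)"
  using abelian_subgroup.a_rcos_sum[OF sub_abelian_subgroup[OF assms(1,2)] assms(3,4)]
  by (simp add: quot_mod_def)

text \<open>The scalar multiple in \<open>quot_mod\<close> is a union over all representatives of
  the coset. Two representatives differ by an element of \<open>N\<close>, and so do their
  multiples, hence the union is over one and the same coset.\<close>

lemma quot_smult:
  assumes "vs V" "sub N V" "c \<in> carrier K" "x \<in> carrier V"
  shows "c \<odot>\<^bsub>quot_mod V N\<^esub> (N +>\<^bsub>V\<^esub> x) = N +>\<^bsub>V\<^esub> (c \<odot>\<^bsub>V\<^esub> x)"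
proof -
  note n = sub_closed[OF assms(2,1)]
  have "N +>\<^bsub>V\<^esub> (c \<odot>\<^bsub>V\<^esub> z) = N +>\<^bsub>V\<^esub> (c \<odot>\<^bsub>V\<^esub> x)" if z: "z \<in> N +>\<^bsub>V\<^esub> x" for z
  proof -
    obtain m where m: "m \<in> N" "z = m \<oplus>\<^bsub>V\<^esub> x" using z by (auto simp: coset_def)
    have "c \<odot>\<^bsub>V\<^esub> z \<ominus>\<^bsub>V\<^esub> c \<odot>\<^bsub>V\<^esub> x = c \<odot>\<^bsub>V\<^esub> m"
      by (rule sg_eqI[of V]) (use assms n(1)[OF m(1)] m(2) in \<open>simp_all add: sg_simps\<close>)
    then have "c \<odot>\<^bsub>V\<^esub> z \<ominus>\<^bsub>V\<^esub> c \<odot>\<^bsub>V\<^esub> x \<in> N" using n(6)[OF assms(3) m(1)] by metis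
    moreover have "z \<in> carrier V" using n(1)[OF m(1)] m(2) assms by simp
    ultimately show ?thesis using coset_eq_iff[OF assms(1,2)] assms by auto
  qed
  then have "(\<Union>z\<in>N +>\<^bsub>V\<^esub> x. N +>\<^bsub>V\<^esub> (c \<odot>\<^bsub>V\<^esub> z)) = (\<Union>z\<in>N +>\<^bsub>V\<^esub> x. N +>\<^bsub>V\<^esub> (c \<odot>\<^bsub>V\<^esub> x))"
    by (rule SUP_cong[OF refl])
  moreover have "x \<in> N +>\<^bsub>V\<^esub> x" using assms n(2) by (force simp: coset_def)
  ultimately show ?thesis unfolding quot_mod_def by (simp add: UN_constant) blast
qed

lemma vs_quot [simp]:
  assumes "vs V" "sub N V"
  shows "vs (quot_mod V N)"
proof (rule moduleI)
  note [simp] = assms quot_carrier quot_add[OF assms] quot_smult[OF assms]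
  show "cring K" by (rule is_cring)
  show "abelian_group (quot_mod V N)"
  proof (rule abelian_groupI)
    fix X assume "X \<in> carrier (quot_mod V N)"
    then obtain x where x: "x \<in> carrier V" "X = N +>\<^bsub>V\<^esub> x" by auto
    have "(N +>\<^bsub>V\<^esub> \<ominus>\<^bsub>V\<^esub> x) \<oplus>\<^bsub>quot_mod V N\<^esub> X = \<zero>\<^bsub>quot_mod V N\<^esub>"
      using x by (simp add: coset_zero quot_zero)
    then show "\<exists>Y\<in>carrier (quot_mod V N). Y \<oplus>\<^bsub>quot_mod V N\<^esub> X = \<zero>\<^bsub>quot_mod V N\<^esub>"
      using x by (intro bexI[of _ "N +>\<^bsub>V\<^esub> \<ominus>\<^bsub>V\<^esub> x"]) auto
    show "\<zero>\<^bsub>quot_mod V N\<^esub> \<oplus>\<^bsub>quot_mod V N\<^esub> X = X"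
      using x quot_add[OF assms, of "\<zero>\<^bsub>V\<^esub>" x] by (simp add: coset_zero[OF assms] quot_zero)
  next
    show "\<zero>\<^bsub>quot_mod V N\<^esub> \<in> carrier (quot_mod V N)"
      using coset_zero[OF assms] by (auto simp: quot_zero quot_carrier)
  qed (auto simp: vs_assoc vs_comm vs_lcomm)
qed (auto simp: assms quot_carrier quot_add quot_smult vs_add_smult vs_smult_add vs_smult_smult)

lemma lin_coset:
  "vs V \<Longrightarrow> sub N V \<Longrightarrow> lin V (quot_mod V N) (\<lambda>x. N +>\<^bsub>V\<^esub> x)"
  by (rule linI) (auto simp: quot_carrier quot_add quot_smult)

lemma quot_lift:
  assumes "vs V" "vs W" "sub N V" "lin V W f" "\<And>n. n \<in> N \<Longrightarrow> f n = \<zero>\<^bsub>W\<^esub>"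
  obtains h where "lin (quot_mod V N) W h" "\<And>x. x \<in> carrier V \<Longrightarrow> h (N +>\<^bsub>V\<^esub> x) = f x"
proof
  define h where "h X = f (SOME x. x \<in> carrier V \<and> X = N +>\<^bsub>V\<^esub> x)" for X
  show h: "h (N +>\<^bsub>V\<^esub> x) = f x" if x: "x \<in> carrier V" for x
  proof -
    let ?y = "SOME y. y \<in> carrier V \<and> N +>\<^bsub>V\<^esub> x = N +>\<^bsub>V\<^esub> y"
    have y: "?y \<in> carrier V \<and> N +>\<^bsub>V\<^esub> x = N +>\<^bsub>V\<^esub> ?y" by (rule someI[of _ x]) (simp add: x)
    then have "x \<ominus>\<^bsub>V\<^esub> ?y \<in> N" using coset_eq_iff[OF assms(1,3) x] by blast
    then have "f x \<ominus>\<^bsub>W\<^esub> f ?y = \<zero>\<^bsub>W\<^esub>"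
      using assms(5) lin_minus[OF assms(4,1,2) x] y by metis
    then have "f x = f ?y"
      using vs_minus_eq_zero_iff[OF assms(2)] lin_closed[OF assms(4)] x y by blast
    then show ?thesis by (simp add: h_def)
  qed
  show "lin (quot_mod V N) W h"
    using assms by (intro linI)
      (auto simp: quot_carrier quot_add quot_smult h lin_closed[OF assms(4)] lin_add[OF assms(4)]
        lin_smult[OF assms(4)])
qed

lemma spans_quot:
  assumes "vs V" "sub N V" "spans V S"
  shows "spans (quot_mod V N) ((\<lambda>x. N +>\<^bsub>V\<^esub> x) ` S)"
  by (rule spans_image[OF lin_coset]) (use assms in \<open>simp_all add: quot_carrier\<close>)

subsection \<open>Free modules\<close>

lemma free_carrier: "f \<in> carrier (free_mod K X) \<longleftrightarrow>
    f \<in> X \<rightarrow>\<^sub>E carrier K \<and> finite {x \<in> X. f x \<noteq> \<zero>}"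
  by (simp add: free_mod_def)

lemma free_add_supp:
  assumes "f \<in> carrier (free_mod K X)" "g \<in> carrier (free_mod K X)"
  shows "finite {x \<in> X. f x \<oplus> g x \<noteq> \<zero>}"
  by (rule finite_subset[of _ "{x \<in> X. f x \<noteq> \<zero>} \<union> {x \<in> X. g x \<noteq> \<zero>}"])
    (use assms in \<open>auto simp: free_carrier\<close>)

lemma free_smult_supp:
  assumes "c \<in> carrier K" "f \<in> carrier (free_mod K X)"
  shows "finite {x \<in> X. c \<otimes> f x \<noteq> \<zero>}"
  by (rule finite_subset[of _ "{x \<in> X. f x \<noteq> \<zero>}"])
    (use assms in \<open>auto simp: free_carrier\<close>)

lemma vs_free [simp]: "vs (free_mod K X)"
proof (rule moduleI)
  let ?F = "free_mod K X"
  have cl: "f x \<in> carrier K" if "f \<in> carrier ?F" "x \<in> X" for f x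
    using that by (auto simp: free_carrier)
  have eqI: "f = g" if "f \<in> extensional X" "g \<in> extensional X" "\<And>x. x \<in> X \<Longrightarrow> f x = g x"
    for f g :: "_ \<Rightarrow> 'k"
    using that by (rule extensionalityI)
  have ext: "f \<in> extensional X" if "f \<in> carrier ?F" for f
    using that by (auto simp: free_carrier PiE_def)
  have ad: "f \<oplus>\<^bsub>?F\<^esub> g = (\<lambda>x\<in>X. f x \<oplus> g x)" for f g by (simp add: free_mod_def)
  have sm: "c \<odot>\<^bsub>?F\<^esub> f = (\<lambda>x\<in>X. c \<otimes> f x)" for c f by (simp add: free_mod_def)
  have ze: "\<zero>\<^bsub>?F\<^esub> = (\<lambda>x\<in>X. \<zero>)" by (simp add: free_mod_def)
  have adc: "f \<oplus>\<^bsub>?F\<^esub> g \<in> carrier ?F" if "f \<in> carrier ?F" "g \<in> carrier ?F" for f g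
    unfolding free_carrier[of "f \<oplus>\<^bsub>?F\<^esub> g"] using that free_add_supp[OF that]
    by (auto simp: ad cl cong: conj_cong)
  have smc: "c \<odot>\<^bsub>?F\<^esub> f \<in> carrier ?F" if "c \<in> carrier K" "f \<in> carrier ?F" for c f
    unfolding free_carrier[of "c \<odot>\<^bsub>?F\<^esub> f"] using that free_smult_supp[OF that]
    by (auto simp: sm cl cong: conj_cong)
  have zec: "\<zero>\<^bsub>?F\<^esub> \<in> carrier ?F" by (auto simp: free_carrier ze cong: conj_cong)
  show "cring K" by (rule is_cring)
  show "abelian_group ?F"
  proof (rule abelian_groupI)
    fix f assume f: "f \<in> carrier ?F"
    show "\<exists>g\<in>carrier ?F. g \<oplus>\<^bsub>?F\<^esub> f = \<zero>\<^bsub>?F\<^esub>"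
      using f by (intro bexI[OF _ smc[OF minus_one_closed f]] eqI)
        (auto simp: ad sm ze cl l_minus l_neg)
    show "\<zero>\<^bsub>?F\<^esub> \<oplus>\<^bsub>?F\<^esub> f = f" using f by (intro eqI) (auto simp: ad ze cl ext)
    fix g assume g: "g \<in> carrier ?F"
    show "f \<oplus>\<^bsub>?F\<^esub> g = g \<oplus>\<^bsub>?F\<^esub> f" using f g by (intro eqI) (auto simp: ad cl a_comm)
    fix h assume h: "h \<in> carrier ?F"
    show "(f \<oplus>\<^bsub>?F\<^esub> g) \<oplus>\<^bsub>?F\<^esub> h = f \<oplus>\<^bsub>?F\<^esub> (g \<oplus>\<^bsub>?F\<^esub> h)"
      using f g h by (intro eqI) (auto simp: ad cl a_assoc)
  qed (use adc zec in auto)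
  show "\<one> \<odot>\<^bsub>?F\<^esub> f = f" if f: "f \<in> carrier ?F" for f
    using f by (intro eqI) (auto simp: sm cl ext)
  fix a f assume a: "a \<in> carrier K" and f: "f \<in> carrier ?F"
  show "a \<odot>\<^bsub>?F\<^esub> f \<in> carrier ?F" by (rule smc[OF a f])
  fix b assume b: "b \<in> carrier K"
  show "(a \<oplus> b) \<odot>\<^bsub>?F\<^esub> f = a \<odot>\<^bsub>?F\<^esub> f \<oplus>\<^bsub>?F\<^esub> b \<odot>\<^bsub>?F\<^esub> f"
    using a b f by (intro eqI) (auto simp: ad sm cl l_distr)
  show "(a \<otimes> b) \<odot>\<^bsub>?F\<^esub> f = a \<odot>\<^bsub>?F\<^esub> (b \<odot>\<^bsub>?F\<^esub> f)"
    using a b f by (intro eqI) (auto simp: sm cl m_assoc)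
next
  let ?F = "free_mod K X"
  fix a f g assume a: "a \<in> carrier K" and f: "f \<in> carrier ?F" and g: "g \<in> carrier ?F"
  show "a \<odot>\<^bsub>?F\<^esub> (f \<oplus>\<^bsub>?F\<^esub> g) = a \<odot>\<^bsub>?F\<^esub> f \<oplus>\<^bsub>?F\<^esub> a \<odot>\<^bsub>?F\<^esub> g"
    using a f g unfolding free_mod_def
    by (intro extensionalityI[of _ X]) (auto simp: r_distr PiE_def Pi_def)
qed

lemma free_gen_closed [simp]: "free_gen K X x \<in> carrier (free_mod K X)"
proof -
  have "finite {y \<in> X. (if y = x then \<one> else \<zero>) \<noteq> \<zero>}"
    by (rule finite_subset[of _ "{x}"]) auto
  then show ?thesis by (auto simp: free_gen_def free_carrier cong: conj_cong)
qed

text \<open>Induction on the number of nonzero coefficients: resetting one of them to zero removes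
  one multiple of a generator.\<close>

lemma spans_free: "spans (free_mod K X) (free_gen K X ` X)"
proof -
  let ?F = "free_mod K X" let ?e = "free_gen K X"
  have e: "?e ` X \<subseteq> carrier ?F" by auto
  have "f \<in> span ?F (?e ` X)" if "f \<in> carrier ?F" "card {x \<in> X. f x \<noteq> \<zero>} = n" for n f
    using that
  proof (induction n arbitrary: f)
    case 0
    have "f = \<zero>\<^bsub>?F\<^esub>"
      unfolding free_mod_def using 0
      by (intro extensionalityI[of _ X]) (auto simp: free_carrier PiE_def)
    then show ?case using sub_closed(2)[OF sub_span[OF vs_free e] vs_free] by simp
  next
    case (Suc n)
    then have fin: "finite {x \<in> X. f x \<noteq> \<zero>}" by (simp add: free_carrier)
    obtain x where x: "x \<in> X" "f x \<noteq> \<zero>" using Suc by (metis (mono_tags, lifting) Collect_empty_eq card.empty nat.distinct(1))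
    define g where "g = f(x := \<zero>)"
    have s: "{y \<in> X. g y \<noteq> \<zero>} = {y \<in> X. f y \<noteq> \<zero>} - {x}" by (auto simp: g_def)
    have g: "g \<in> carrier ?F" using Suc(2) x s fin
      by (auto simp: free_carrier g_def PiE_def extensional_def)
    have "g \<in> span ?F (?e ` X)"
      using Suc(3) x fin s by (intro Suc.IH g) simp
    moreover have fx: "f x \<in> carrier K" using Suc(2) x by (auto simp: free_carrier)
    moreover have "f = g \<oplus>\<^bsub>?F\<^esub> f x \<odot>\<^bsub>?F\<^esub> ?e x"
    proof (rule extensionalityI[of _ X])
      fix y assume "y \<in> X"
      then show "f y = (g \<oplus>\<^bsub>?F\<^esub> f x \<odot>\<^bsub>?F\<^esub> ?e x) y"
        using fx Suc(2) by (auto simp: free_mod_def g_def free_gen_def PiE_def Pi_def)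
    qed (use Suc(2) in \<open>auto simp: free_mod_def PiE_def\<close>)
    ultimately show ?case
      using sub_closed(4,6)[OF sub_span[OF vs_free e] vs_free] span_base[of "?e x" "?e ` X" ?F] x
      by (metis imageI)
  qed
  then show ?thesis using e by (auto simp: spans_def)
qed

text \<open>Sums over the supports of two vectors can thus be compared over the union of the
  supports.\<close>

lemma finsum_superset:
  assumes "abelian_monoid W" "S \<subseteq> T" "finite T" "f \<in> T \<rightarrow> carrier W"
    "\<And>x. x \<in> T - S \<Longrightarrow> f x = \<zero>\<^bsub>W\<^esub>"
  shows "finsum W f T = finsum W f S"
proof -
  interpret W: abelian_monoid W by (rule assms(1))
  have "finsum W f (S \<union> (T - S)) = finsum W f S \<oplus>\<^bsub>W\<^esub> finsum W f (T - S)"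
    using assms finite_subset[OF assms(2,3)] by (intro W.finsum_Un_disjoint) auto
  moreover have "finsum W f (T - S) = \<zero>\<^bsub>W\<^esub>"
    using W.finsum_cong'[of "T - S" "T - S" "\<lambda>_. \<zero>\<^bsub>W\<^esub>" f] assms(5) by (simp add: W.finsum_zero)
  moreover have "S \<union> (T - S) = T" using assms(2) by auto
  moreover have "finsum W f S \<in> carrier W" using assms by (intro W.finsum_closed) auto
  ultimately show ?thesis by simp
qed

lemma free_lift:
  assumes W: "vs W" and \<phi>: "\<And>x. x \<in> X \<Longrightarrow> \<phi> x \<in> carrier W"
  obtains h where "lin (free_mod K X) W h" "\<And>x. x \<in> X \<Longrightarrow> h (free_gen K X x) = \<phi> x"
proof
  let ?F = "free_mod K X"
  let ?s = "\<lambda>f. {x \<in> X. f x \<noteq> \<zero>}"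
  define h where "h f = finsum W (\<lambda>x. f x \<odot>\<^bsub>W\<^esub> \<phi> x) (?s f)" for f
  interpret W: abelian_monoid W by (rule vs_monoid[OF W])
  have cl: "f x \<in> carrier K" if "f \<in> carrier ?F" "x \<in> X" for f x
    using that by (auto simp: free_carrier)
  have sup: "h f = finsum W (\<lambda>x. f x \<odot>\<^bsub>W\<^esub> \<phi> x) T"
    if "f \<in> carrier ?F" "?s f \<subseteq> T" "finite T" "T \<subseteq> X" for f T
    unfolding h_def using that W \<phi> cl[OF that(1)]
    by (intro finsum_superset[symmetric]) (auto simp: W.abelian_monoid_axioms)
  have fin: "finite (?s f)" if "f \<in> carrier ?F" for f using that by (simp add: free_carrier)
  show "lin ?F W h"
  proof (rule linI)
    fix f assume f: "f \<in> carrier ?F"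
    show "h f \<in> carrier W" unfolding h_def using f W \<phi> cl by (intro W.finsum_closed) auto
    fix g assume g: "g \<in> carrier ?F"
    let ?T = "?s f \<union> ?s g"
    have T: "finite ?T" "?T \<subseteq> X" using fin f g by auto
    have fg: "(f \<oplus>\<^bsub>?F\<^esub> g) x = f x \<oplus> g x" if "x \<in> X" for x
      using that by (simp add: free_mod_def)
    have "h (f \<oplus>\<^bsub>?F\<^esub> g) = finsum W (\<lambda>x. (f \<oplus>\<^bsub>?F\<^esub> g) x \<odot>\<^bsub>W\<^esub> \<phi> x) ?T"
      using f g T by (intro sup) (auto simp: fg)
    also have "\<dots> = finsum W (\<lambda>x. f x \<odot>\<^bsub>W\<^esub> \<phi> x \<oplus>\<^bsub>W\<^esub> g x \<odot>\<^bsub>W\<^esub> \<phi> x) ?T"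
      using f g W \<phi> cl by (intro W.finsum_cong') (auto simp: fg vs_add_smult)
    also have "\<dots> = finsum W (\<lambda>x. f x \<odot>\<^bsub>W\<^esub> \<phi> x) ?T \<oplus>\<^bsub>W\<^esub> finsum W (\<lambda>x. g x \<odot>\<^bsub>W\<^esub> \<phi> x) ?T"
      using f g W \<phi> cl by (intro W.finsum_addf) auto
    also have "\<dots> = h f \<oplus>\<^bsub>W\<^esub> h g" using f g T by (simp add: sup[of f ?T] sup[of g ?T])
    finally show "h (f \<oplus>\<^bsub>?F\<^esub> g) = h f \<oplus>\<^bsub>W\<^esub> h g" .
  next
    fix c f assume c: "c \<in> carrier K" and f: "f \<in> carrier ?F"
    have cf: "(c \<odot>\<^bsub>?F\<^esub> f) x = c \<otimes> f x" if "x \<in> X" for x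
      using that by (simp add: free_mod_def)
    have "h (c \<odot>\<^bsub>?F\<^esub> f) = finsum W (\<lambda>x. (c \<odot>\<^bsub>?F\<^esub> f) x \<odot>\<^bsub>W\<^esub> \<phi> x) (?s f)"
      using f c fin by (intro sup) (auto simp: cf)
    also have "\<dots> = finsum W (\<lambda>x. c \<odot>\<^bsub>W\<^esub> (f x \<odot>\<^bsub>W\<^esub> \<phi> x)) (?s f)"
      using f c W \<phi> cl by (intro W.finsum_cong') (auto simp: cf vs_smult_smult)
    also have "\<dots> = c \<odot>\<^bsub>W\<^esub> h f"
      unfolding h_def using f c W \<phi> cl fin
      by (intro module.finsum_smult_ldistr[OF W, symmetric]) auto
    finally show "h (c \<odot>\<^bsub>?F\<^esub> f) = c \<odot>\<^bsub>W\<^esub> h f" .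
  qed
  fix x assume x: "x \<in> X"
  have "h (free_gen K X x) = finsum W (\<lambda>y. free_gen K X x y \<odot>\<^bsub>W\<^esub> \<phi> y) {x}"
    using x by (intro sup free_gen_closed) (auto simp: free_gen_def)
  also have "\<dots> = \<phi> x" using x W \<phi> by (simp add: free_gen_def)
  finally show "h (free_gen K X x) = \<phi> x" .
qed

text \<open>The premise on relations quantifies over all linear \<open>h\<close> with the prescribed
  values. Each relation is then verified by expanding \<open>h\<close> along it, without looking
  inside the free module.\<close>

lemma presented_lift:
  fixes X R
  defines "F \<equiv> free_mod K X"
  assumes R: "R \<subseteq> carrier F" and W: "vs W" and \<phi>: "\<And>x. x \<in> X \<Longrightarrow> \<phi> x \<in> carrier W"
    and rel: "\<And>h r. lin F W h \<Longrightarrow> (\<And>x. x \<in> X \<Longrightarrow> h (free_gen K X x) = \<phi> x) \<Longrightarrow> r \<in> R \<Longrightarrow> h r = \<zero>\<^bsub>W\<^esub>"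
  obtains h where "lin (quot_mod F (span F R)) W h"
    "\<And>x. x \<in> X \<Longrightarrow> h (span F R +>\<^bsub>F\<^esub> free_gen K X x) = \<phi> x"
proof -
  have F: "vs F" by (simp add: F_def)
  obtain h where h: "lin F W h" "\<And>x. x \<in> X \<Longrightarrow> h (free_gen K X x) = \<phi> x"
    using free_lift[OF W, where X = X and \<phi> = \<phi>, OF \<phi>] unfolding F_def by blast
  have "h r = \<zero>\<^bsub>W\<^esub>" if "r \<in> span F R" for r
    using lin_eq_on_span[OF h(1) lin_const_zero[OF W] F W R _ that] rel[OF h] by blast
  then obtain g where "lin (quot_mod F (span F R)) W g"
      "\<And>x. x \<in> carrier F \<Longrightarrow> g (span F R +>\<^bsub>F\<^esub> x) = h x"
    using quot_lift[OF F W sub_span[OF F R] h(1)] by blast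
  then show thesis using h(2) by (intro that) (auto simp: F_def)
qed

lemma spans_presented:
  fixes X R
  defines "F \<equiv> free_mod K X"
  assumes R: "R \<subseteq> carrier F"
  shows "spans (quot_mod F (span F R)) ((\<lambda>x. span F R +>\<^bsub>F\<^esub> free_gen K X x) ` X)"
  using spans_quot[OF _ sub_span[OF _ R] spans_free[of X, folded F_def]] by (simp add: F_def image_image)

subsection \<open>Complements\<close>

lemma sub_Int_zero:
  assumes "vs V" "sub N V" "sub M V" "N \<inter> M = {\<zero>\<^bsub>V\<^esub>}" "a \<in> N" "b \<in> M" "a' \<in> N" "b' \<in> M"
    "a \<oplus>\<^bsub>V\<^esub> b = a' \<oplus>\<^bsub>V\<^esub> b'"
  shows "a = a'" "b = b'"
proof -
  note cl = sub_closed(1)[OF assms(2,1)] sub_closed(1)[OF assms(3,1)]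
  have c: "a \<in> carrier V" "b \<in> carrier V" "a' \<in> carrier V" "b' \<in> carrier V"
    using assms(5-8) cl by blast+
  have "a \<ominus>\<^bsub>V\<^esub> a' = (a \<oplus>\<^bsub>V\<^esub> b) \<ominus>\<^bsub>V\<^esub> (a' \<oplus>\<^bsub>V\<^esub> b)"
    by (rule sg_eqI[of V]) (use assms(1) c in \<open>simp_all add: sg_simps\<close>)
  also have "\<dots> = b' \<ominus>\<^bsub>V\<^esub> b"
    unfolding assms(9) by (rule sg_eqI[of V]) (use assms(1) c in \<open>simp_all add: sg_simps\<close>)
  finally have "a \<ominus>\<^bsub>V\<^esub> a' \<in> N \<inter> M" "b' \<ominus>\<^bsub>V\<^esub> b \<in> N \<inter> M"
    using sub_closed(5)[OF assms(2,1,5,7)] sub_closed(5)[OF assms(3,1,8,6)] by auto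
  then show "a = a'" "b = b'"
    using assms(1,4) c by (auto simp: vs_minus_eq_zero_iff)
qed

text \<open>Zorn's lemma for the subspaces that meet \<open>N\<close> only in zero. If some x lay
  outside N + C for a maximal C, then C + Kx would still meet N only in zero.\<close>

lemma complement_exists:
  assumes V: "vs V" and N: "sub N V"
  obtains C where "sub C V" "N \<inter> C = {\<zero>\<^bsub>V\<^esub>}"
    "\<And>x. x \<in> carrier V \<Longrightarrow> \<exists>n\<in>N. \<exists>c\<in>C. x = n \<oplus>\<^bsub>V\<^esub> c"
proof -
  define \<A> where "\<A> = {C. sub C V \<and> N \<inter> C = {\<zero>\<^bsub>V\<^esub>}}"
  note n = sub_closed[OF N V]
  have "{\<zero>\<^bsub>V\<^esub>} \<in> \<A>" unfolding \<A>_def using V n(2) by (auto intro!: subI)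
  then have ne: "\<A> \<noteq> {}" by auto
  have "\<Union>\<C> \<in> \<A>" if "\<C> \<noteq> {}" "subset.chain \<A> \<C>" for \<C>
  proof -
    have c: "sub C V" "N \<inter> C = {\<zero>\<^bsub>V\<^esub>}" if "C \<in> \<C>" for C
      using that \<open>subset.chain \<A> \<C>\<close> by (auto simp: subset.chain_def \<A>_def)
    have tot: "C \<subseteq> C' \<or> C' \<subseteq> C" if "C \<in> \<C>" "C' \<in> \<C>" for C C'
      using that \<open>subset.chain \<A> \<C>\<close> by (auto simp: subset.chain_def)
    have "sub (\<Union>\<C>) V"
    proof (rule subI[OF V])
      show "\<Union>\<C> \<subseteq> carrier V" using c(1) sub_subset[OF _ V] by blast
      show "\<zero>\<^bsub>V\<^esub> \<in> \<Union>\<C>" using c(1) sub_closed(2)[OF _ V] that(1) by blast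
      fix x y assume "x \<in> \<Union>\<C>" "y \<in> \<Union>\<C>"
      then obtain C where "C \<in> \<C>" "x \<in> C" "y \<in> C" using tot by blast
      then show "x \<oplus>\<^bsub>V\<^esub> y \<in> \<Union>\<C>" using sub_closed(4)[OF c(1) V] by blast
    next
      fix k x assume "k \<in> carrier K" "x \<in> \<Union>\<C>"
      then show "k \<odot>\<^bsub>V\<^esub> x \<in> \<Union>\<C>" using sub_closed(6)[OF c(1) V] by blast
    qed
    then show ?thesis using c(2) that(1) by (auto simp: \<A>_def)
  qed
  from subset_Zorn_nonempty[OF ne this] obtain C where
    C: "C \<in> \<A>" and max: "\<And>X. X \<in> \<A> \<Longrightarrow> C \<subseteq> X \<Longrightarrow> X = C" by blast
  have CV: "sub C V" and CN: "N \<inter> C = {\<zero>\<^bsub>V\<^esub>}" using C by (auto simp: \<A>_def)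
  note c = sub_closed[OF CV V]
  have "\<exists>n\<in>N. \<exists>c\<in>C. x = n \<oplus>\<^bsub>V\<^esub> c" if x: "x \<in> carrier V" for x
  proof (rule ccontr)
    assume contra: "\<not> ?thesis"
    \<comment> \<open>The candidate that contradicts maximality is the sum of \<open>C\<close> and
      the line through \<open>x\<close>.\<close>
    define C' where "C' = {b \<oplus>\<^bsub>V\<^esub> k \<odot>\<^bsub>V\<^esub> x | b k. b \<in> C \<and> k \<in> carrier K}"
    have sC': "sub C' V"
    proof (rule subI[OF V])
      show "C' \<subseteq> carrier V" using c(1) V x by (auto simp: C'_def)
      have "\<zero>\<^bsub>V\<^esub> = \<zero>\<^bsub>V\<^esub> \<oplus>\<^bsub>V\<^esub> \<zero> \<odot>\<^bsub>V\<^esub> x" using V x by simp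
      then show "\<zero>\<^bsub>V\<^esub> \<in> C'" unfolding C'_def using c(2) by blast
      fix y z assume "y \<in> C'" "z \<in> C'"
      then obtain b k b' k' where bk: "b \<in> C" "k \<in> carrier K" "b' \<in> C" "k' \<in> carrier K"
        "y = b \<oplus>\<^bsub>V\<^esub> k \<odot>\<^bsub>V\<^esub> x" "z = b' \<oplus>\<^bsub>V\<^esub> k' \<odot>\<^bsub>V\<^esub> x" by (auto simp: C'_def)
      have "y \<oplus>\<^bsub>V\<^esub> z = (b \<oplus>\<^bsub>V\<^esub> b') \<oplus>\<^bsub>V\<^esub> (k \<oplus> k') \<odot>\<^bsub>V\<^esub> x"
        using bk V x c(1) by (simp add: vs_add_smult vs_assoc vs_lcomm)
      then show "y \<oplus>\<^bsub>V\<^esub> z \<in> C'" unfolding C'_def using bk c(4) by blast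
    next
      fix l y assume l: "l \<in> carrier K" and "y \<in> C'"
      then obtain b k where bk: "b \<in> C" "k \<in> carrier K" "y = b \<oplus>\<^bsub>V\<^esub> k \<odot>\<^bsub>V\<^esub> x"
        by (auto simp: C'_def)
      have "l \<odot>\<^bsub>V\<^esub> y = l \<odot>\<^bsub>V\<^esub> b \<oplus>\<^bsub>V\<^esub> (l \<otimes> k) \<odot>\<^bsub>V\<^esub> x"
        using bk l V x c(1) by (simp add: vs_smult_add vs_smult_smult)
      then show "l \<odot>\<^bsub>V\<^esub> y \<in> C'" unfolding C'_def using bk l c(6) by blast
    qed
    have "y = \<zero>\<^bsub>V\<^esub>" if y: "y \<in> N" "y \<in> C'" for y
    proof -
      obtain b k where bk: "b \<in> C" "k \<in> carrier K" "y = b \<oplus>\<^bsub>V\<^esub> k \<odot>\<^bsub>V\<^esub> x"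
        using y(2) by (auto simp: C'_def)
      show ?thesis
      proof (cases "k = \<zero>")
        case True
        then have "y = b" using bk V x c(1) by simp
        then show ?thesis using CN y bk by blast
      next
        case False
        \<comment> \<open>Here scalars must be invertible: a nonzero multiple of \<open>x\<close> in
          N + C brings \<open>x\<close> itself into N + C.\<close>
        then have k: "inv k \<in> carrier K" "inv k \<otimes> k = \<one>"
          using bk(2) field_Units by auto
        have kx: "k \<odot>\<^bsub>V\<^esub> x = y \<ominus>\<^bsub>V\<^esub> b"
          by (rule sg_eqI[of V]) (use V x bk c(1)[of b] in \<open>simp_all add: sg_simps\<close>)
        have "x = inv k \<odot>\<^bsub>V\<^esub> (k \<odot>\<^bsub>V\<^esub> x)"
          using k bk(2) V x by (simp flip: vs_smult_smult)
        also have "\<dots> = inv k \<odot>\<^bsub>V\<^esub> y \<oplus>\<^bsub>V\<^esub> inv k \<odot>\<^bsub>V\<^esub> (\<ominus>\<^bsub>V\<^esub> b)"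
          unfolding kx a_minus_def using k V n(1)[OF y(1)] c(1)[OF bk(1)] by (simp add: vs_smult_add)
        finally have "x = inv k \<odot>\<^bsub>V\<^esub> y \<oplus>\<^bsub>V\<^esub> inv k \<odot>\<^bsub>V\<^esub> (\<ominus>\<^bsub>V\<^esub> b)" .
        then show ?thesis using contra n(6)[OF k(1) y(1)] c(6)[OF k(1) c(3)[OF bk(1)]] by blast
      qed
    qed
    then have "N \<inter> C' = {\<zero>\<^bsub>V\<^esub>}" using n(2) sub_closed(2)[OF sC' V] by blast
    then have "C' \<in> \<A>" using sC' by (simp add: \<A>_def)
    moreover have sub: "C \<subseteq> C'"
    proof
      fix b assume b: "b \<in> C"
      then have "b = b \<oplus>\<^bsub>V\<^esub> \<zero> \<odot>\<^bsub>V\<^esub> x" using V x c(1) by simp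
      then show "b \<in> C'" unfolding C'_def using b by blast
    qed
    ultimately have "C' = C" by (rule max)
    moreover have "x = \<zero>\<^bsub>V\<^esub> \<oplus>\<^bsub>V\<^esub> \<one> \<odot>\<^bsub>V\<^esub> x" using V x by simp
    then have "x \<in> C'" unfolding C'_def using c(2) by blast
    ultimately have "x \<in> C" by simp
    moreover have "x = \<zero>\<^bsub>V\<^esub> \<oplus>\<^bsub>V\<^esub> x" using V x by simp
    ultimately show False using contra n(2) by blast
  qed
  with that CV CN show thesis by blast
qed

text \<open>A generalised inverse: \<open>e\<close> inverts \<open>d\<close> on a complement
  \<open>C\<close> of the kernel and is zero on a complement \<open>E\<close> of the image.
  Sections, retractions and factorisations are all read off from it.\<close>

lemma pseudo_inverse_exists:
  assumes V: "vs V" and W: "vs W" and d: "lin V W d"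
  obtains e where "lin W V e" "\<And>x. x \<in> carrier V \<Longrightarrow> d (e (d x)) = d x"
proof -
  let ?M = "{x \<in> carrier V. d x = \<zero>\<^bsub>W\<^esub>}" and ?I = "d ` carrier V"
  have M: "sub ?M V" by (rule sub_kernel[OF V W d])
  have I: "sub ?I W" by (rule sub_image[OF V W d sub_carrier[OF V]])
  obtain C where C: "sub C V" "?M \<inter> C = {\<zero>\<^bsub>V\<^esub>}"
    and Cx: "\<And>x. x \<in> carrier V \<Longrightarrow> \<exists>n\<in>?M. \<exists>c\<in>C. x = n \<oplus>\<^bsub>V\<^esub> c"
    by (rule complement_exists[OF V M]) blast
  obtain E where E: "sub E W" "?I \<inter> E = {\<zero>\<^bsub>W\<^esub>}"
    and Ex: "\<And>x. x \<in> carrier W \<Longrightarrow> \<exists>n\<in>?I. \<exists>c\<in>E. x = n \<oplus>\<^bsub>W\<^esub> c"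
    by (rule complement_exists[OF W I]) blast
  note c = sub_closed[OF C(1) V] and b = sub_closed[OF E(1) W]
  have dI: "d v \<in> ?I" if "v \<in> C" for v using c(1)[OF that] by auto
  \<comment> \<open>The graph of \<open>e\<close>: \<open>v\<close> is the preimage in
    \<open>C\<close> of the image component of \<open>w\<close>. The component of \<open>w\<close>
    in \<open>E\<close> is discarded.\<close>
  define P where "P w v \<longleftrightarrow> v \<in> C \<and> (\<exists>e\<in>E. w = d v \<oplus>\<^bsub>W\<^esub> e)" for w v
  have ex: "\<exists>v. P w v" if w: "w \<in> carrier W" for w
  proof -
    obtain x e where x: "x \<in> carrier V" "e \<in> E" "w = d x \<oplus>\<^bsub>W\<^esub> e" using Ex[OF w] by blast
    obtain m v where m: "m \<in> ?M" "v \<in> C" "x = m \<oplus>\<^bsub>V\<^esub> v" using Cx[OF x(1)] by blast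
    have "d x = d v" using m c(1) lin_add[OF d] lin_closed[OF d] W by simp
    then show ?thesis using m x by (auto simp: P_def)
  qed
  have un: "v = v'" if "P w v" "P w v'" for w v v'
  proof -
    obtain e e' where e: "v \<in> C" "v' \<in> C" "e \<in> E" "e' \<in> E" "w = d v \<oplus>\<^bsub>W\<^esub> e" "w = d v' \<oplus>\<^bsub>W\<^esub> e'"
      using \<open>P w v\<close> \<open>P w v'\<close> by (auto simp: P_def)
    then have "d v = d v'"
      using sub_Int_zero(1)[OF W I E dI[OF e(1)] e(3) dI[OF e(2)] e(4)] e(5,6) by simp
    then have "v \<ominus>\<^bsub>V\<^esub> v' \<in> ?M"
      using e(1,2) c(1) lin_minus[OF d V W] lin_closed[OF d] V W by simp
    then have "v \<ominus>\<^bsub>V\<^esub> v' = \<zero>\<^bsub>V\<^esub>" using C(2) c(5)[OF e(1,2)] by blast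
    then show ?thesis using vs_minus_eq_zero_iff[OF V] c(1) e(1,2) by blast
  qed
  define e where "e w = (SOME v. P w v)" for w
  have P: "P w (e w)" if "w \<in> carrier W" for w
    unfolding e_def using ex[OF that] by (rule someI_ex)
  have eC: "e w \<in> C" if "w \<in> carrier W" for w using P[OF that] by (simp add: P_def)
  show thesis
  proof (rule that)
    show "lin W V e"
    proof (rule linI)
      fix x assume x: "x \<in> carrier W"
      show "e x \<in> carrier V" using eC[OF x] c(1) by blast
      obtain p where p: "p \<in> E" "x = d (e x) \<oplus>\<^bsub>W\<^esub> p" using P[OF x] by (auto simp: P_def)
      fix y assume y: "y \<in> carrier W"
      obtain q where q: "q \<in> E" "y = d (e y) \<oplus>\<^bsub>W\<^esub> q" using P[OF y] by (auto simp: P_def)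
      have cl: "d (e x) \<in> carrier W" "d (e y) \<in> carrier W" "p \<in> carrier W" "q \<in> carrier W"
        using eC x y c(1) lin_closed[OF d] b(1) p q by blast+
      have "d (e x \<oplus>\<^bsub>V\<^esub> e y) = d (e x) \<oplus>\<^bsub>W\<^esub> d (e y)"
        using lin_add[OF d] eC x y c(1) by blast
      moreover have "x \<oplus>\<^bsub>W\<^esub> y = (d (e x) \<oplus>\<^bsub>W\<^esub> p) \<oplus>\<^bsub>W\<^esub> (d (e y) \<oplus>\<^bsub>W\<^esub> q)" using p q by simp
      moreover have "\<dots> = (d (e x) \<oplus>\<^bsub>W\<^esub> d (e y)) \<oplus>\<^bsub>W\<^esub> (p \<oplus>\<^bsub>W\<^esub> q)"
        using cl W by (simp add: vs_assoc vs_lcomm)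
      ultimately have "P (x \<oplus>\<^bsub>W\<^esub> y) (e x \<oplus>\<^bsub>V\<^esub> e y)"
        unfolding P_def using c(4) eC x y b(4)[OF p(1) q(1)] by metis
      then show "e (x \<oplus>\<^bsub>W\<^esub> y) = e x \<oplus>\<^bsub>V\<^esub> e y" using un P[of "x \<oplus>\<^bsub>W\<^esub> y"] W x y by auto
    next
      fix k x assume k: "k \<in> carrier K" and x: "x \<in> carrier W"
      obtain p where p: "p \<in> E" "x = d (e x) \<oplus>\<^bsub>W\<^esub> p" using P[OF x] by (auto simp: P_def)
      have cl: "e x \<in> carrier V" "d (e x) \<in> carrier W" "p \<in> carrier W"
        using eC x c(1) lin_closed[OF d] b(1) p by blast+
      have "k \<odot>\<^bsub>W\<^esub> x = k \<odot>\<^bsub>W\<^esub> (d (e x) \<oplus>\<^bsub>W\<^esub> p)" using p by simp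
      also have "\<dots> = d (k \<odot>\<^bsub>V\<^esub> e x) \<oplus>\<^bsub>W\<^esub> k \<odot>\<^bsub>W\<^esub> p"
        using cl W k lin_smult[OF d k] by (simp add: vs_smult_add)
      finally have "P (k \<odot>\<^bsub>W\<^esub> x) (k \<odot>\<^bsub>V\<^esub> e x)"
        unfolding P_def using c(6)[OF k eC[OF x]] b(6)[OF k p(1)] by blast
      then show "e (k \<odot>\<^bsub>W\<^esub> x) = k \<odot>\<^bsub>V\<^esub> e x" using un P[of "k \<odot>\<^bsub>W\<^esub> x"] W x k by auto
    qed
    fix x assume x: "x \<in> carrier V"
    have dx: "d x \<in> carrier W" by (rule lin_closed[OF d x])
    obtain p where p: "p \<in> E" "d x = d (e (d x)) \<oplus>\<^bsub>W\<^esub> p" using P[OF dx] by (auto simp: P_def)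
    have "d x \<oplus>\<^bsub>W\<^esub> \<zero>\<^bsub>W\<^esub> = d (e (d x)) \<oplus>\<^bsub>W\<^esub> p" using p dx W by simp
    then show "d (e (d x)) = d x"
      using sub_Int_zero(1)[OF W I E _ b(2) dI[OF eC[OF dx]] p(1), of "d x"] x by simp
  qed
qed

lemma section_exists:
  assumes "vs V" "vs W" "lin V W d" "carrier W \<subseteq> d ` carrier V"
  obtains s where "lin W V s" "\<And>w. w \<in> carrier W \<Longrightarrow> d (s w) = w"
proof -
  obtain s where s: "lin W V s" "\<And>x. x \<in> carrier V \<Longrightarrow> d (s (d x)) = d x"
    using pseudo_inverse_exists[OF assms(1-3)] by metis
  then show thesis using assms(4) by (intro that[of s]) auto
qed

text \<open>A generalised inverse of the inclusion of \<open>N\<close> restricts to the identity on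
  \<open>N\<close>.\<close>

lemma retraction_exists:
  assumes "vs V" "sub N V"
  obtains r where "lin V (restrict_to V N) r" "\<And>x. x \<in> N \<Longrightarrow> r x = x"
proof -
  have R: "vs (restrict_to V N)" using assms by simp
  have i: "lin (restrict_to V N) V (\<lambda>x. x)" by (rule lin_restrict_dom[OF lin_id assms])
  obtain r where "lin V (restrict_to V N) r" "\<And>x. x \<in> carrier (restrict_to V N) \<Longrightarrow> r x = x"
    using pseudo_inverse_exists[OF R assms(1) i] by metis
  then show thesis by (intro that[of r]) auto
qed

text \<open>For a generalised inverse \<open>s\<close> of \<open>d\<close>, the vectors s(d x) and x
  differ by an element of the kernel of \<open>d\<close>, so \<open>f\<close> composed with
  \<open>s\<close> does what is asked. In this way the Koszul map becomes a linear function of the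
  differential.\<close>

lemma factor_exists:
  assumes V: "vs V" and W: "vs W" and U: "vs U" and d: "lin V W d" and f: "lin V U f"
    and ker: "\<And>x. x \<in> carrier V \<Longrightarrow> d x = \<zero>\<^bsub>W\<^esub> \<Longrightarrow> f x = \<zero>\<^bsub>U\<^esub>"
  obtains g where "lin W U g" "\<And>x. x \<in> carrier V \<Longrightarrow> g (d x) = f x"
proof -
  obtain s where s: "lin W V s" "\<And>x. x \<in> carrier V \<Longrightarrow> d (s (d x)) = d x"
    using pseudo_inverse_exists[OF V W d] by metis
  show thesis
  proof (rule that)
    show "lin W U (\<lambda>w. f (s w))" by (rule lin_comp[OF f s(1)])
    fix x assume x: "x \<in> carrier V"
    have sd: "s (d x) \<in> carrier V" using lin_closed[OF s(1)] lin_closed[OF d x] by blast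
    have "d (s (d x) \<ominus>\<^bsub>V\<^esub> x) = \<zero>\<^bsub>W\<^esub>"
      using lin_minus[OF d V W sd x] s(2)[OF x] lin_closed[OF d x] W by simp
    then have "f (s (d x) \<ominus>\<^bsub>V\<^esub> x) = \<zero>\<^bsub>U\<^esub>" using ker V sd x by simp
    then show "f (s (d x)) = f x"
      using lin_minus[OF f V U sd x] vs_minus_eq_zero_iff[OF U] lin_closed[OF f] sd x by metis
  qed
qed

subsection \<open>Bilinear maps and tensor products\<close>

definition bilin :: "('k, 'v, 'm) module_scheme \<Rightarrow> ('k, 'w, 'n) module_scheme
    \<Rightarrow> ('k, 'x, 'l) module_scheme \<Rightarrow> ('v \<Rightarrow> 'w \<Rightarrow> 'x) \<Rightarrow> bool"
  where "bilin V W X \<phi> \<longleftrightarrow> (\<forall>w\<in>carrier W. lin V X (\<lambda>v. \<phi> v w)) \<and> (\<forall>v\<in>carrier V. lin W X (\<phi> v))"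

lemma bilinI:
  assumes "\<And>w. w \<in> carrier W \<Longrightarrow> lin V X (\<lambda>v. \<phi> v w)" "\<And>v. v \<in> carrier V \<Longrightarrow> lin W X (\<lambda>w. \<phi> v w)"
  shows "bilin V W X \<phi>"
  using assms by (simp add: bilin_def)

lemma bilin_left: "bilin V W X \<phi> \<Longrightarrow> w \<in> carrier W \<Longrightarrow> lin V X (\<lambda>v. \<phi> v w)"
  and bilin_right: "bilin V W X \<phi> \<Longrightarrow> v \<in> carrier V \<Longrightarrow> lin W X (\<lambda>w. \<phi> v w)"
  by (auto simp: bilin_def)

lemma bilin_closed: "bilin V W X \<phi> \<Longrightarrow> v \<in> carrier V \<Longrightarrow> w \<in> carrier W \<Longrightarrow> \<phi> v w \<in> carrier X"
  by (rule lin_closed[OF bilin_right])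

lemma bilin_in_sub:
  assumes "bilin V W X \<phi>" "vs V" "vs W" "vs X" "S \<subseteq> carrier V" "T \<subseteq> carrier W" "sub N X"
    "\<And>s t. s \<in> S \<Longrightarrow> t \<in> T \<Longrightarrow> \<phi> s t \<in> N" "v \<in> span V S" "w \<in> span W T"
  shows "\<phi> v w \<in> N"
proof -
  have w: "w \<in> carrier W" by (rule span_closed[OF assms(3,6,10)])
  have "\<phi> s w \<in> N" if "s \<in> S" for s
    using lin_span[OF bilin_right[OF assms(1)] assms(3,4,6,7) _ assms(10)] that assms(5,8) by blast
  then show ?thesis
    using lin_span[OF bilin_left[OF assms(1) w] assms(2,4,5,7) _ assms(9)] by blast
qed

lemma bilin_eq:
  assumes "spans V S" "spans W T" "bilin V W X \<phi>" "bilin V W X \<psi>" "vs V" "vs W" "vs X"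
    "\<And>s t. s \<in> S \<Longrightarrow> t \<in> T \<Longrightarrow> \<phi> s t = \<psi> s t" "v \<in> carrier V" "w \<in> carrier W"
  shows "\<phi> v w = \<psi> v w"
proof (rule lin_eq[OF assms(1) bilin_left[OF assms(3,10)] bilin_left[OF assms(4,10)] assms(5,7) _ assms(9)])
  fix s assume s: "s \<in> S"
  then have "s \<in> carrier V" using assms(1) by (auto simp: spans_def)
  then show "\<phi> s w = \<psi> s w"
    using lin_eq[OF assms(2) bilin_right[OF assms(3)] bilin_right[OF assms(4)] assms(6,7) _ assms(10)]
      assms(8) s by blast
qed

text \<open>Skewness is a bilinear identity and can be tested on a spanning set, whereas alternation
  is quadratic and cannot. Invertibility of 2 turns the former into the latter. The other place
  where 2 is inverted is \<open>half\<close>.\<close>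

lemma bilin_skew_alternating:
  assumes "bilin V V W \<phi>" "vs V" "vs W" "\<one> \<oplus> \<one> \<noteq> \<zero>" "x \<in> carrier V" "\<phi> x x = \<ominus>\<^bsub>W\<^esub> \<phi> x x"
  shows "\<phi> x x = \<zero>\<^bsub>W\<^esub>"
proof -
  let ?y = "\<phi> x x"
  have y: "?y \<in> carrier W" by (rule bilin_closed[OF assms(1,5,5)])
  have "(\<one> \<oplus> \<one>) \<odot>\<^bsub>W\<^esub> ?y = ?y \<oplus>\<^bsub>W\<^esub> ?y" using y assms(3) by (simp add: vs_add_smult)
  also have "\<dots> = \<zero>\<^bsub>W\<^esub>" by (subst (1) assms(6)) (use y assms(3) in simp)
  finally have z: "(\<one> \<oplus> \<one>) \<odot>\<^bsub>W\<^esub> ?y = \<zero>\<^bsub>W\<^esub>" .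
  have u: "\<one> \<oplus> \<one> \<in> Units K" using assms(4) field_Units by auto
  have "?y = (inv (\<one> \<oplus> \<one>) \<otimes> (\<one> \<oplus> \<one>)) \<odot>\<^bsub>W\<^esub> ?y" using y assms(3) u by simp
  also have "\<dots> = inv (\<one> \<oplus> \<one>) \<odot>\<^bsub>W\<^esub> ((\<one> \<oplus> \<one>) \<odot>\<^bsub>W\<^esub> ?y)"
    using y assms(3) u by (intro vs_smult_smult) auto
  finally show ?thesis using z assms(3) u by simp
qed

lemma bilin_alternating_skew:
  assumes "bilin V V W \<phi>" "vs V" "vs W" "\<And>x. x \<in> carrier V \<Longrightarrow> \<phi> x x = \<zero>\<^bsub>W\<^esub>"
    "x \<in> carrier V" "y \<in> carrier V"
  shows "\<phi> x y = \<ominus>\<^bsub>W\<^esub> \<phi> y x"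
proof -
  note cl = bilin_closed[OF assms(1)]
  have "\<zero>\<^bsub>W\<^esub> = \<phi> (x \<oplus>\<^bsub>V\<^esub> y) (x \<oplus>\<^bsub>V\<^esub> y)" using assms by simp
  also have "\<dots> = \<phi> x (x \<oplus>\<^bsub>V\<^esub> y) \<oplus>\<^bsub>W\<^esub> \<phi> y (x \<oplus>\<^bsub>V\<^esub> y)"
    using assms by (intro lin_add[OF bilin_left[OF assms(1)]]) auto
  also have "\<dots> = (\<phi> x x \<oplus>\<^bsub>W\<^esub> \<phi> x y) \<oplus>\<^bsub>W\<^esub> (\<phi> y x \<oplus>\<^bsub>W\<^esub> \<phi> y y)"
    using assms by (simp add: lin_add[OF bilin_right[OF assms(1)]])
  also have "\<dots> = \<phi> x y \<oplus>\<^bsub>W\<^esub> \<phi> y x" using assms cl by simp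
  finally have "\<phi> x y \<oplus>\<^bsub>W\<^esub> \<phi> y x = \<zero>\<^bsub>W\<^esub>" by simp
  then have "\<ominus>\<^bsub>W\<^esub> \<phi> y x = \<phi> x y \<oplus>\<^bsub>W\<^esub> \<phi> y x \<oplus>\<^bsub>W\<^esub> \<ominus>\<^bsub>W\<^esub> \<phi> y x" using assms cl by simp
  also have "\<dots> = \<phi> x y" using assms cl by (simp add: vs_assoc)
  finally show ?thesis by simp
qed

text \<open>The generating set inside \<open>tensor_rels\<close>, named so that the tensor product
  takes the form required by \<open>presented_lift\<close>.\<close>

definition tensor_rel_gens :: "('k, 'v, 'm) module_scheme \<Rightarrow> ('k, 'w, 'n) module_scheme \<Rightarrow> ('v \<times> 'w \<Rightarrow> 'k) set"
  where "tensor_rel_gens V W =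
    (let F = free_mod K (carrier V \<times> carrier W); e = free_gen K (carrier V \<times> carrier W) in
      ({e (v \<oplus>\<^bsub>V\<^esub> v', w) \<ominus>\<^bsub>F\<^esub> (e (v, w) \<oplus>\<^bsub>F\<^esub> e (v', w)) | v v' w.
          v \<in> carrier V \<and> v' \<in> carrier V \<and> w \<in> carrier W} \<union>
       {e (v, w \<oplus>\<^bsub>W\<^esub> w') \<ominus>\<^bsub>F\<^esub> (e (v, w) \<oplus>\<^bsub>F\<^esub> e (v, w')) | v w w'.
          v \<in> carrier V \<and> w \<in> carrier W \<and> w' \<in> carrier W} \<union>
       {e (c \<odot>\<^bsub>V\<^esub> v, w) \<ominus>\<^bsub>F\<^esub> c \<odot>\<^bsub>F\<^esub> e (v, w) | c v w.
          c \<in> carrier K \<and> v \<in> carrier V \<and> w \<in> carrier W} \<union>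
       {e (v, c \<odot>\<^bsub>W\<^esub> w) \<ominus>\<^bsub>F\<^esub> c \<odot>\<^bsub>F\<^esub> e (v, w) | c v w.
          c \<in> carrier K \<and> v \<in> carrier V \<and> w \<in> carrier W}))"

lemma tensor_rels_eq:
  "tensor_rels K V W = span (free_mod K (carrier V \<times> carrier W)) (tensor_rel_gens V W)"
  by (simp add: tensor_rels_def tensor_rel_gens_def Let_def)

lemma tensor_rel_gens_subset:
  "tensor_rel_gens V W \<subseteq> carrier (free_mod K (carrier V \<times> carrier W))"
  by (auto simp: tensor_rel_gens_def Let_def)

lemma tensor_eq: "tensor K V W =
    quot_mod (free_mod K (carrier V \<times> carrier W)) (span (free_mod K (carrier V \<times> carrier W)) (tensor_rel_gens V W))"
  by (simp add: tensor_def tensor_rels_eq)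

lemma sub_tensor_rels: "sub (tensor_rels K V W) (free_mod K (carrier V \<times> carrier W))"
  unfolding tensor_rels_eq by (rule sub_span[OF vs_free tensor_rel_gens_subset])

lemma vs_tensor [simp]: "vs (tensor K V W)"
  unfolding tensor_def by (rule vs_quot[OF vs_free sub_tensor_rels])

lemma tensor_lift:
  assumes V: "vs V" and W: "vs W" and X: "vs X" and \<phi>: "bilin V W X \<phi>"
  obtains h where "lin (tensor K V W) X h"
    "\<And>v w. v \<in> carrier V \<Longrightarrow> w \<in> carrier W \<Longrightarrow> h (tens K V W v w) = \<phi> v w"
proof -
  let ?X = "carrier V \<times> carrier W" and ?e = "free_gen K (carrier V \<times> carrier W)"
  let ?F = "free_mod K ?X"
  note cl = bilin_closed[OF \<phi>]
  have cl': "case_prod \<phi> x \<in> carrier X" if "x \<in> ?X" for x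
    using that cl by auto
  have rel: "h r = \<zero>\<^bsub>X\<^esub>" if h: "lin ?F X h" "\<And>x. x \<in> ?X \<Longrightarrow> h (?e x) = case_prod \<phi> x"
    and r: "r \<in> tensor_rel_gens V W" for h r
    using r V W X cl unfolding tensor_rel_gens_def Let_def
    by (auto simp: lin_minus[OF h(1) vs_free X] lin_add[OF h(1)] lin_smult[OF h(1)] h(2)
      vs_minus_eq_zero_iff lin_add[OF bilin_left[OF \<phi>]] lin_add[OF bilin_right[OF \<phi>]]
      lin_smult[OF bilin_left[OF \<phi>]] lin_smult[OF bilin_right[OF \<phi>]])
  obtain h where "lin (tensor K V W) X h"
    "\<And>x. x \<in> ?X \<Longrightarrow> h (tensor_rels K V W +>\<^bsub>?F\<^esub> ?e x) = case_prod \<phi> x"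
    unfolding tensor_eq tensor_rels_eq
    by (rule presented_lift[OF tensor_rel_gens_subset[of V W] X, where \<phi> = "case_prod \<phi>"],
      erule cl', rule rel, assumption, assumption, assumption) blast
  then show thesis by (intro that) (auto simp: tens_def)
qed

lemma bilin_tens:
  assumes "vs V" "vs W"
  shows "bilin V W (tensor K V W) (tens K V W)"
proof -
  let ?X = "carrier V \<times> carrier W" and ?e = "free_gen K (carrier V \<times> carrier W)"
  let ?F = "free_mod K ?X" and ?N = "tensor_rels K V W"
  have eq: "?N +>\<^bsub>?F\<^esub> x = ?N +>\<^bsub>?F\<^esub> y" if "x \<ominus>\<^bsub>?F\<^esub> y \<in> tensor_rel_gens V W" "x \<in> carrier ?F" "y \<in> carrier ?F"
    for x y
    using that coset_eq_iff[OF vs_free sub_tensor_rels that(2,3)] span_base[OF that(1)]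
    by (simp add: tensor_rels_eq)
  note q = quot_add[OF vs_free sub_tensor_rels] quot_smult[OF vs_free sub_tensor_rels]
  have c: "tens K V W v w \<in> carrier (tensor K V W)" for v w
    by (auto simp: tens_def tensor_def quot_carrier)
  show ?thesis
  proof (intro bilinI linI c)
    fix v v' w assume a: "v \<in> carrier V" "v' \<in> carrier V" "w \<in> carrier W"
    then have "?e (v \<oplus>\<^bsub>V\<^esub> v', w) \<ominus>\<^bsub>?F\<^esub> (?e (v, w) \<oplus>\<^bsub>?F\<^esub> ?e (v', w)) \<in> tensor_rel_gens V W"
      unfolding tensor_rel_gens_def Let_def by blast
    from eq[OF this] show "tens K V W (v \<oplus>\<^bsub>V\<^esub> v') w = tens K V W v w \<oplus>\<^bsub>tensor K V W\<^esub> tens K V W v' w"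
      using a assms by (simp add: tens_def tensor_def q)
  next
    fix v w w' assume a: "v \<in> carrier V" "w \<in> carrier W" "w' \<in> carrier W"
    then have "?e (v, w \<oplus>\<^bsub>W\<^esub> w') \<ominus>\<^bsub>?F\<^esub> (?e (v, w) \<oplus>\<^bsub>?F\<^esub> ?e (v, w')) \<in> tensor_rel_gens V W"
      unfolding tensor_rel_gens_def Let_def by blast
    from eq[OF this] show "tens K V W v (w \<oplus>\<^bsub>W\<^esub> w') = tens K V W v w \<oplus>\<^bsub>tensor K V W\<^esub> tens K V W v w'"
      using a assms by (simp add: tens_def tensor_def q)
  next
    fix k v w assume a: "k \<in> carrier K" "v \<in> carrier V" "w \<in> carrier W"
    then have "?e (k \<odot>\<^bsub>V\<^esub> v, w) \<ominus>\<^bsub>?F\<^esub> k \<odot>\<^bsub>?F\<^esub> ?e (v, w) \<in> tensor_rel_gens V W"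
      unfolding tensor_rel_gens_def Let_def by blast
    from eq[OF this] show "tens K V W (k \<odot>\<^bsub>V\<^esub> v) w = k \<odot>\<^bsub>tensor K V W\<^esub> tens K V W v w"
      using a assms by (simp add: tens_def tensor_def q)
  next
    fix k v w assume a: "k \<in> carrier K" "v \<in> carrier V" "w \<in> carrier W"
    then have "?e (v, k \<odot>\<^bsub>W\<^esub> w) \<ominus>\<^bsub>?F\<^esub> k \<odot>\<^bsub>?F\<^esub> ?e (v, w) \<in> tensor_rel_gens V W"
      unfolding tensor_rel_gens_def Let_def by blast
    from eq[OF this] show "tens K V W v (k \<odot>\<^bsub>W\<^esub> w) = k \<odot>\<^bsub>tensor K V W\<^esub> tens K V W v w"
      using a assms by (simp add: tens_def tensor_def q)
  qed
qed

lemma tens_closed [simp]: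
  "vs V \<Longrightarrow> vs W \<Longrightarrow> v \<in> carrier V \<Longrightarrow> w \<in> carrier W \<Longrightarrow> tens K V W v w \<in> carrier (tensor K V W)"
  by (rule bilin_closed[OF bilin_tens])

lemma lin_tens [lin_intros]:
  "vs V \<Longrightarrow> vs W \<Longrightarrow> lin U V f \<Longrightarrow> w \<in> carrier W \<Longrightarrow> lin U (tensor K V W) (\<lambda>x. tens K V W (f x) w)"
  "vs V \<Longrightarrow> vs W \<Longrightarrow> lin U W g \<Longrightarrow> v \<in> carrier V \<Longrightarrow> lin U (tensor K V W) (\<lambda>x. tens K V W v (g x))"
  by (rule lin_comp[OF bilin_left[OF bilin_tens]] lin_comp[OF bilin_right[OF bilin_tens]]; assumption)+

lemma spans_tensor_all:
  "spans (tensor K V W) {tens K V W v w | v w. v \<in> carrier V \<and> w \<in> carrier W}"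
proof -
  have "{tens K V W v w | v w. v \<in> carrier V \<and> w \<in> carrier W} =
    (\<lambda>x. tensor_rels K V W +>\<^bsub>free_mod K (carrier V \<times> carrier W)\<^esub>
      free_gen K (carrier V \<times> carrier W) x) ` (carrier V \<times> carrier W)"
    by (auto simp: tens_def)
  then show ?thesis
    using spans_presented[OF tensor_rel_gens_subset, of V W] by (simp add: tensor_eq tensor_rels_eq)
qed

lemma spans_tensor:
  assumes "vs V" "vs W" "spans V S" "spans W T"
  shows "spans (tensor K V W) {tens K V W s t | s t. s \<in> S \<and> t \<in> T}" (is "spans _ ?G")
proof -
  have ST: "S \<subseteq> carrier V" "T \<subseteq> carrier W" using assms by (auto simp: spans_def)
  then have G: "?G \<subseteq> carrier (tensor K V W)"
    using assms(1,2) by (auto intro!: tens_closed)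
  have "tens K V W v w \<in> span (tensor K V W) ?G" if "v \<in> carrier V" "w \<in> carrier W" for v w
    by (rule bilin_in_sub[OF bilin_tens assms(1,2) vs_tensor ST sub_span[OF vs_tensor G]])
      (use assms that in \<open>auto intro: span_base spansD\<close>)
  then have "span (tensor K V W) {tens K V W v w | v w. v \<in> carrier V \<and> w \<in> carrier W}
      \<subseteq> span (tensor K V W) ?G"
    by (intro span_least sub_span[OF vs_tensor G]) auto
  then show ?thesis using spans_tensor_all[of V W] G by (auto simp: spans_def)
qed

lemma lin_tensor_eq:
  assumes "vs V" "vs W" "vs X" "spans V S" "spans W T" "lin (tensor K V W) X f" "lin (tensor K V W) X g"
    "\<And>v w. v \<in> S \<Longrightarrow> w \<in> T \<Longrightarrow> f (tens K V W v w) = g (tens K V W v w)"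
    "x \<in> carrier (tensor K V W)"
  shows "f x = g x"
  by (rule lin_eq[OF spans_tensor[OF assms(1,2,4,5)] assms(6,7) vs_tensor assms(3) _ assms(9)])
    (use assms(8) in auto)

lemma tensor_map:
  assumes "vs V" "vs W" "vs V'" "vs W'" "lin V V' f" "lin W W' g"
  shows "lin (tensor K V W) (tensor K V' W') (tensor_map K V W V' W' f g)"
    "\<And>v w. v \<in> carrier V \<Longrightarrow> w \<in> carrier W \<Longrightarrow>
      tensor_map K V W V' W' f g (tens K V W v w) = tens K V' W' (f v) (g w)"
proof -
  have "bilin V W (tensor K V' W') (\<lambda>v w. tens K V' W' (f v) (g w))"
    using assms by (intro bilinI lin_intros) (auto intro: lin_closed)
  from tensor_lift[OF assms(1,2) vs_tensor this] obtain h where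
    h: "lin (tensor K V W) (tensor K V' W') h"
      "\<And>v w. v \<in> carrier V \<Longrightarrow> w \<in> carrier W \<Longrightarrow> h (tens K V W v w) = tens K V' W' (f v) (g w)"
    by metis
  let ?P = "\<lambda>h. \<forall>v\<in>carrier V. \<forall>w\<in>carrier W. h (tens K V W v w) = tens K V' W' (f v) (g w)"
  have P: "?P (restrict h (carrier (tensor K V W)))"
    using h assms by simp
  have un: "\<forall>p q. lin (tensor K V W) (tensor K V' W') p \<longrightarrow> lin (tensor K V W) (tensor K V' W') q \<longrightarrow>
      ?P p \<longrightarrow> ?P q \<longrightarrow> (\<forall>s\<in>{tens K V W v w | v w. v \<in> carrier V \<and> w \<in> carrier W}. p s = q s)"
    by auto
  note t = the_hom_props[where P = ?P, OF spans_tensor_all vs_tensor vs_tensor h(1) P un, folded tensor_map_def]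
  show "lin (tensor K V W) (tensor K V' W') (tensor_map K V W V' W' f g)" by (rule t(1))
  show "\<And>v w. v \<in> carrier V \<Longrightarrow> w \<in> carrier W \<Longrightarrow>
      tensor_map K V W V' W' f g (tens K V W v w) = tens K V' W' (f v) (g w)"
    using t(2) by blast
qed

subsection \<open>Multilinear maps and tensor powers\<close>

definition mlin :: "('k, 'v, 'm) module_scheme \<Rightarrow> nat \<Rightarrow> ('k, 'w, 'n) module_scheme \<Rightarrow> ('v list \<Rightarrow> 'w) \<Rightarrow> bool"
  where "mlin V n W \<phi> \<longleftrightarrow> (\<forall>xs\<in>tuples V n. \<phi> xs \<in> carrier W) \<and>
    (\<forall>xs\<in>tuples V n. \<forall>i<n. lin V W (\<lambda>x. \<phi> (xs[i := x])))"

lemma mlinD: "mlin V n W \<phi> \<Longrightarrow> xs \<in> tuples V n \<Longrightarrow> i < n \<Longrightarrow> lin V W (\<lambda>x. \<phi> (xs[i := x]))"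
  and mlin_closed: "mlin V n W \<phi> \<Longrightarrow> xs \<in> tuples V n \<Longrightarrow> \<phi> xs \<in> carrier W"
  by (auto simp: mlin_def)

lemma mlin_comp: "lin W X h \<Longrightarrow> mlin V n W \<phi> \<Longrightarrow> mlin V n X (\<lambda>xs. h (\<phi> xs))"
  unfolding mlin_def by (auto intro: lin_comp lin_closed)

lemma tuples_update: "xs \<in> tuples V n \<Longrightarrow> x \<in> carrier V \<Longrightarrow> xs[i := x] \<in> tuples V n"
  using set_update_subset_insert[of xs i x] by (auto simp: tuples_def)

lemma tuples_length: "xs \<in> tuples V n \<Longrightarrow> length xs = n"
  by (simp add: tuples_def)

definition tpow_rel_gens :: "('k, 'v, 'm) module_scheme \<Rightarrow> nat \<Rightarrow> ('v list \<Rightarrow> 'k) set"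
  where "tpow_rel_gens V n = (let F = free_mod K (tuples V n); e = free_gen K (tuples V n) in
      ({e (xs[i := x \<oplus>\<^bsub>V\<^esub> y]) \<ominus>\<^bsub>F\<^esub> (e (xs[i := x]) \<oplus>\<^bsub>F\<^esub> e (xs[i := y])) | xs i x y.
          xs \<in> tuples V n \<and> i < n \<and> x \<in> carrier V \<and> y \<in> carrier V} \<union>
       {e (xs[i := c \<odot>\<^bsub>V\<^esub> x]) \<ominus>\<^bsub>F\<^esub> c \<odot>\<^bsub>F\<^esub> e (xs[i := x]) | xs i c x.
          xs \<in> tuples V n \<and> i < n \<and> c \<in> carrier K \<and> x \<in> carrier V}))"

lemma tpow_rels_eq: "tpow_rels K V n = span (free_mod K (tuples V n)) (tpow_rel_gens V n)"
  by (simp add: tpow_rels_def tpow_rel_gens_def Let_def)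

lemma tpow_rel_gens_subset: "tpow_rel_gens V n \<subseteq> carrier (free_mod K (tuples V n))"
  by (auto simp: tpow_rel_gens_def Let_def)

lemma tpow_eq: "tensor_power K V n =
    quot_mod (free_mod K (tuples V n)) (span (free_mod K (tuples V n)) (tpow_rel_gens V n))"
  by (simp add: tensor_power_def tpow_rels_eq)

lemma sub_tpow_rels: "sub (tpow_rels K V n) (free_mod K (tuples V n))"
  unfolding tpow_rels_eq by (rule sub_span[OF vs_free tpow_rel_gens_subset])

lemma vs_tpow [simp]: "vs (tensor_power K V n)"
  unfolding tensor_power_def by (rule vs_quot[OF vs_free sub_tpow_rels])

lemma tpow_lift:
  assumes V: "vs V" and W: "vs W" and \<phi>: "mlin V n W \<phi>"
  obtains h where "lin (tensor_power K V n) W h"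
    "\<And>xs. xs \<in> tuples V n \<Longrightarrow> h (pure_tensor K V xs) = \<phi> xs"
proof -
  let ?e = "free_gen K (tuples V n)"
  let ?F = "free_mod K (tuples V n)"
  note cl = mlin_closed[OF \<phi>]
  have rel: "h r = \<zero>\<^bsub>W\<^esub>" if h: "lin ?F W h" "\<And>xs. xs \<in> tuples V n \<Longrightarrow> h (?e xs) = \<phi> xs"
    and r: "r \<in> tpow_rel_gens V n" for h r
    using r V W cl unfolding tpow_rel_gens_def Let_def
    by (auto simp: lin_minus[OF h(1) vs_free W] lin_add[OF h(1)] lin_smult[OF h(1)] h(2) tuples_update
      vs_minus_eq_zero_iff lin_add[OF mlinD[OF \<phi>]] lin_smult[OF mlinD[OF \<phi>]])
  obtain h where "lin (tensor_power K V n) W h"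
    "\<And>xs. xs \<in> tuples V n \<Longrightarrow> h (tpow_rels K V n +>\<^bsub>?F\<^esub> ?e xs) = \<phi> xs"
    unfolding tpow_eq tpow_rels_eq
    by (rule presented_lift[OF tpow_rel_gens_subset[of V n] W, where \<phi> = \<phi>],
      erule cl, rule rel, assumption, assumption, assumption) blast
  then show thesis by (intro that) (auto simp: pure_tensor_def tuples_length)
qed

lemma pure_tensor_eq: "xs \<in> tuples V n \<Longrightarrow>
    pure_tensor K V xs = tpow_rels K V n +>\<^bsub>free_mod K (tuples V n)\<^esub> free_gen K (tuples V n) xs"
  by (simp add: pure_tensor_def tuples_length)

lemma pure_tensor_closed [simp]: "xs \<in> tuples V n \<Longrightarrow> pure_tensor K V xs \<in> carrier (tensor_power K V n)"
  by (auto simp: pure_tensor_eq tensor_power_def quot_carrier)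

lemma mlin_pure_tensor:
  assumes "vs V"
  shows "mlin V n (tensor_power K V n) (pure_tensor K V)"
proof -
  let ?e = "free_gen K (tuples V n)"
  let ?F = "free_mod K (tuples V n)" and ?N = "tpow_rels K V n"
  have eq: "?N +>\<^bsub>?F\<^esub> x = ?N +>\<^bsub>?F\<^esub> y" if "x \<ominus>\<^bsub>?F\<^esub> y \<in> tpow_rel_gens V n" "x \<in> carrier ?F" "y \<in> carrier ?F"
    for x y
    using that coset_eq_iff[OF vs_free sub_tpow_rels that(2,3)] span_base[OF that(1)]
    by (simp add: tpow_rels_eq)
  note q = quot_add[OF vs_free sub_tpow_rels] quot_smult[OF vs_free sub_tpow_rels]
  show ?thesis unfolding mlin_def
  proof (intro conjI ballI allI impI linI)
    fix xs i x y assume xs: "xs \<in> tuples V n" "i < n" "x \<in> carrier V" "y \<in> carrier V"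
    have "?e (xs[i := x \<oplus>\<^bsub>V\<^esub> y]) \<ominus>\<^bsub>?F\<^esub> (?e (xs[i := x]) \<oplus>\<^bsub>?F\<^esub> ?e (xs[i := y])) \<in> tpow_rel_gens V n"
      unfolding tpow_rel_gens_def Let_def using xs by blast
    from eq[OF this] show "pure_tensor K V (xs[i := x \<oplus>\<^bsub>V\<^esub> y]) =
      pure_tensor K V (xs[i := x]) \<oplus>\<^bsub>tensor_power K V n\<^esub> pure_tensor K V (xs[i := y])"
      using assms xs by (simp add: pure_tensor_eq[of _ V n] tuples_update tensor_power_def q)
  next
    fix xs i c x assume xs: "xs \<in> tuples V n" "i < n" "c \<in> carrier K" "x \<in> carrier V"
    have "?e (xs[i := c \<odot>\<^bsub>V\<^esub> x]) \<ominus>\<^bsub>?F\<^esub> c \<odot>\<^bsub>?F\<^esub> ?e (xs[i := x]) \<in> tpow_rel_gens V n"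
      unfolding tpow_rel_gens_def Let_def using xs by blast
    from eq[OF this] show "pure_tensor K V (xs[i := c \<odot>\<^bsub>V\<^esub> x]) =
      c \<odot>\<^bsub>tensor_power K V n\<^esub> pure_tensor K V (xs[i := x])"
      using assms xs by (simp add: pure_tensor_eq[of _ V n] tuples_update tensor_power_def q)
  qed (auto intro: pure_tensor_closed tuples_update)
qed

lemma spans_tpow: "spans (tensor_power K V n) (pure_tensor K V ` tuples V n)"
proof -
  have "pure_tensor K V ` tuples V n =
    (\<lambda>xs. tpow_rels K V n +>\<^bsub>free_mod K (tuples V n)\<^esub> free_gen K (tuples V n) xs) ` tuples V n"
    by (auto simp: pure_tensor_eq)
  then show ?thesis
    using spans_presented[OF tpow_rel_gens_subset, of V n] by (simp add: tpow_eq tpow_rels_eq)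
qed

subsection \<open>Exterior and symmetric powers\<close>

lemma sub_ext_rels: "sub (ext_rels K V n) (tensor_power K V n)"
  unfolding ext_rels_def by (rule sub_span) auto

lemma sub_sym_rels: "sub (sym_rels K V n) (tensor_power K V n)"
  unfolding sym_rels_def by (rule sub_span) auto

lemma vs_ext [simp]: "vs (ext_power K V n)"
  unfolding ext_power_def by (rule vs_quot[OF vs_tpow sub_ext_rels])

lemma vs_sym [simp]: "vs (sym_power K V n)"
  unfolding sym_power_def by (rule vs_quot[OF vs_tpow sub_sym_rels])

lemma wedge_eq: "xs \<in> tuples V n \<Longrightarrow> wedge K V xs = ext_rels K V n +>\<^bsub>tensor_power K V n\<^esub> pure_tensor K V xs"
  by (simp add: wedge_def tuples_length)

lemma symprod_eq: "xs \<in> tuples V n \<Longrightarrow> symprod K V xs = sym_rels K V n +>\<^bsub>tensor_power K V n\<^esub> pure_tensor K V xs"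
  by (simp add: symprod_def tuples_length)

lemma mlin_cong: "mlin V n W \<phi> \<Longrightarrow> vs V \<Longrightarrow> (\<And>xs. xs \<in> tuples V n \<Longrightarrow> \<phi> xs = \<psi> xs) \<Longrightarrow> mlin V n W \<psi>"
  unfolding mlin_def
proof (intro conjI ballI allI impI)
  fix xs i assume a: "(\<forall>xs\<in>tuples V n. \<phi> xs \<in> carrier W) \<and> (\<forall>xs\<in>tuples V n. \<forall>i<n. lin V W (\<lambda>x. \<phi> (xs[i := x])))"
    "vs V" "\<And>xs. xs \<in> tuples V n \<Longrightarrow> \<phi> xs = \<psi> xs" "xs \<in> tuples V n" "i < n"
  show "lin V W (\<lambda>x. \<psi> (xs[i := x]))"
    by (rule lin_cong[OF a(2), of W "\<lambda>x. \<phi> (xs[i := x])"]) (use a in \<open>simp_all add: tuples_update\<close>)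
qed auto

lemma mlin_wedge: "vs V \<Longrightarrow> mlin V n (ext_power K V n) (wedge K V)"
  by (rule mlin_cong[OF mlin_comp[OF lin_coset[OF vs_tpow sub_ext_rels] mlin_pure_tensor, folded ext_power_def]])
    (simp_all add: wedge_eq[of _ V n])

lemma mlin_symprod: "vs V \<Longrightarrow> mlin V n (sym_power K V n) (symprod K V)"
  by (rule mlin_cong[OF mlin_comp[OF lin_coset[OF vs_tpow sub_sym_rels] mlin_pure_tensor, folded sym_power_def]])
    (simp_all add: symprod_eq[of _ V n])

lemma wedge_zero:
  assumes "xs \<in> tuples V n" "\<not> distinct xs"
  shows "wedge K V xs = \<zero>\<^bsub>ext_power K V n\<^esub>"
proof -
  have "pure_tensor K V xs \<in> ext_rels K V n"
    unfolding ext_rels_def using assms by (auto intro: span_base)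
  then show ?thesis
    using coset_eq_zero_iff[OF vs_tpow sub_ext_rels pure_tensor_closed[OF assms(1)]] wedge_eq[OF assms(1)]
    by (simp add: ext_power_def)
qed

lemma symprod_mset:
  assumes "xs \<in> tuples V n" "ys \<in> tuples V n" "mset xs = mset ys"
  shows "symprod K V xs = symprod K V ys"
proof -
  have "pure_tensor K V xs \<ominus>\<^bsub>tensor_power K V n\<^esub> pure_tensor K V ys \<in> sym_rels K V n"
    unfolding sym_rels_def using assms by (auto intro!: span_base)
  then show ?thesis
    using coset_eq_iff[OF vs_tpow sub_sym_rels pure_tensor_closed[OF assms(1)] pure_tensor_closed[OF assms(2)]]
    by (simp add: symprod_eq[OF assms(1)] symprod_eq[OF assms(2)])
qed

lemma spans_ext: "spans (ext_power K V n) (wedge K V ` tuples V n)"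
  using spans_quot[OF vs_tpow sub_ext_rels spans_tpow, of V n]
  by (simp add: ext_power_def image_image wedge_eq cong: image_cong)

lemma spans_sym: "spans (sym_power K V n) (symprod K V ` tuples V n)"
  using spans_quot[OF vs_tpow sub_sym_rels spans_tpow, of V n]
  by (simp add: sym_power_def image_image symprod_eq cong: image_cong)

lemma ext_lift:
  assumes V: "vs V" and W: "vs W" and \<phi>: "mlin V n W \<phi>"
    and alt: "\<And>xs. xs \<in> tuples V n \<Longrightarrow> \<not> distinct xs \<Longrightarrow> \<phi> xs = \<zero>\<^bsub>W\<^esub>"
  obtains h where "lin (ext_power K V n) W h" "\<And>xs. xs \<in> tuples V n \<Longrightarrow> h (wedge K V xs) = \<phi> xs"
proof -
  obtain g where g: "lin (tensor_power K V n) W g"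
    "\<And>xs. xs \<in> tuples V n \<Longrightarrow> g (pure_tensor K V xs) = \<phi> xs"
    using tpow_lift[OF V W \<phi>] by metis
  have "g r = \<zero>\<^bsub>W\<^esub>" if "r \<in> ext_rels K V n" for r
    by (rule lin_eq_on_span[OF g(1) lin_const_zero[OF W] vs_tpow W _ _ that[unfolded ext_rels_def]])
      (use g(2) alt in auto)
  then obtain h where "lin (ext_power K V n) W h"
    "\<And>x. x \<in> carrier (tensor_power K V n) \<Longrightarrow> h (ext_rels K V n +>\<^bsub>tensor_power K V n\<^esub> x) = g x"
    using quot_lift[OF vs_tpow W sub_ext_rels g(1)] unfolding ext_power_def by metis
  then show thesis using g(2) by (intro that) (auto simp: wedge_eq)
qed

lemma sym_lift:
  assumes V: "vs V" and W: "vs W" and \<phi>: "mlin V n W \<phi>"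
    and sym: "\<And>xs ys. xs \<in> tuples V n \<Longrightarrow> ys \<in> tuples V n \<Longrightarrow> mset xs = mset ys \<Longrightarrow> \<phi> xs = \<phi> ys"
  obtains h where "lin (sym_power K V n) W h" "\<And>xs. xs \<in> tuples V n \<Longrightarrow> h (symprod K V xs) = \<phi> xs"
proof -
  obtain g where g: "lin (tensor_power K V n) W g"
    "\<And>xs. xs \<in> tuples V n \<Longrightarrow> g (pure_tensor K V xs) = \<phi> xs"
    using tpow_lift[OF V W \<phi>] by metis
  have "g r = \<zero>\<^bsub>W\<^esub>" if "r \<in> sym_rels K V n" for r
  proof (rule lin_eq_on_span[OF g(1) lin_const_zero[OF W] vs_tpow W _ _ that[unfolded sym_rels_def]])
    fix s assume "s \<in> {pure_tensor K V xs \<ominus>\<^bsub>tensor_power K V n\<^esub> pure_tensor K V ys | xs ys.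
        xs \<in> tuples V n \<and> ys \<in> tuples V n \<and> mset xs = mset ys}"
    then obtain xs ys where s: "s = pure_tensor K V xs \<ominus>\<^bsub>tensor_power K V n\<^esub> pure_tensor K V ys"
      "xs \<in> tuples V n" "ys \<in> tuples V n" "mset xs = mset ys" by auto
    have "g s = \<phi> xs \<ominus>\<^bsub>W\<^esub> \<phi> ys"
      using s g(2) lin_minus[OF g(1) vs_tpow W, of "pure_tensor K V xs" "pure_tensor K V ys"] by simp
    then show "g s = \<zero>\<^bsub>W\<^esub>" using sym[OF s(2-4)] W mlin_closed[OF \<phi> s(3)] by simp
  qed auto
  then obtain h where "lin (sym_power K V n) W h"
    "\<And>x. x \<in> carrier (tensor_power K V n) \<Longrightarrow> h (sym_rels K V n +>\<^bsub>tensor_power K V n\<^esub> x) = g x"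
    using quot_lift[OF vs_tpow W sub_sym_rels g(1)] unfolding sym_power_def by metis
  then show thesis using g(2) by (intro that) (auto simp: symprod_eq)
qed

end

text \<open>The degree 1 stays the literal \<open>1\<close>, the form in which
  \<open>ext_power K L 1\<close> and \<open>homology K L 1\<close> are stated, and is not turned
  into \<open>Suc 0\<close>.\<close>

declare One_nat_def [simp del]

context base_field
begin

subsection \<open>Exterior and symmetric powers in low degrees\<close>

lemma tuple_iff [simp]:
  "[a] \<in> tuples V 1 \<longleftrightarrow> a \<in> carrier V"
  "[a, b] \<in> tuples V 2 \<longleftrightarrow> a \<in> carrier V \<and> b \<in> carrier V"
  "[a, b, c] \<in> tuples V 3 \<longleftrightarrow> a \<in> carrier V \<and> b \<in> carrier V \<and> c \<in> carrier V"
  "[a, b, c, d] \<in> tuples V 4 \<longleftrightarrow> a \<in> carrier V \<and> b \<in> carrier V \<and> c \<in> carrier V \<and> d \<in> carrier V"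
  by (auto simp: tuples_def)

lemma tuples_1: "xs \<in> tuples V 1 \<Longrightarrow> \<exists>a. xs = [a] \<and> a \<in> carrier V"
  and tuples_2: "xs \<in> tuples V 2 \<Longrightarrow> \<exists>a b. xs = [a, b] \<and> a \<in> carrier V \<and> b \<in> carrier V"
  and tuples_3: "xs \<in> tuples V 3 \<Longrightarrow>
    \<exists>a b c. xs = [a, b, c] \<and> a \<in> carrier V \<and> b \<in> carrier V \<and> c \<in> carrier V"
  and tuples_4: "xs \<in> tuples V 4 \<Longrightarrow>
    \<exists>a b c d. xs = [a, b, c, d] \<and> a \<in> carrier V \<and> b \<in> carrier V \<and> c \<in> carrier V \<and> d \<in> carrier V"
  by (auto simp: tuples_def length_Suc_conv eval_nat_numeral One_nat_def)

lemma mlin1I: "lin V W (\<lambda>a. \<phi> [a]) \<Longrightarrow> mlin V 1 W \<phi>"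
  unfolding mlin_def using lin_closed[of V W "\<lambda>a. \<phi> [a]"] by (auto dest!: tuples_1)

lemma mlin2I:
  assumes "\<And>b. b \<in> carrier V \<Longrightarrow> lin V W (\<lambda>a. \<phi> [a, b])" "\<And>a. a \<in> carrier V \<Longrightarrow> lin V W (\<lambda>b. \<phi> [a, b])"
  shows "mlin V 2 W \<phi>"
  unfolding mlin_def
proof (intro conjI ballI allI impI)
  fix xs assume "xs \<in> tuples V 2"
  then obtain a b where x: "xs = [a, b]" "a \<in> carrier V" "b \<in> carrier V" using tuples_2 by blast
  then show "\<phi> xs \<in> carrier W" using lin_closed[OF assms(1)] by blast
  fix i :: nat assume "i < 2"
  then have "i = 0 \<or> i = 1" by auto
  then show "lin V W (\<lambda>x. \<phi> (xs[i := x]))" using assms x by (auto simp: One_nat_def)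
qed

lemma mlin3I:
  assumes "\<And>b c. b \<in> carrier V \<Longrightarrow> c \<in> carrier V \<Longrightarrow> lin V W (\<lambda>a. \<phi> [a, b, c])"
    "\<And>a c. a \<in> carrier V \<Longrightarrow> c \<in> carrier V \<Longrightarrow> lin V W (\<lambda>b. \<phi> [a, b, c])"
    "\<And>a b. a \<in> carrier V \<Longrightarrow> b \<in> carrier V \<Longrightarrow> lin V W (\<lambda>c. \<phi> [a, b, c])"
  shows "mlin V 3 W \<phi>"
  unfolding mlin_def
proof (intro conjI ballI allI impI)
  fix xs assume "xs \<in> tuples V 3"
  then obtain a b c where x: "xs = [a, b, c]" "a \<in> carrier V" "b \<in> carrier V" "c \<in> carrier V"
    using tuples_3 by blast
  then show "\<phi> xs \<in> carrier W" using lin_closed[OF assms(1)] by blast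
  fix i :: nat assume "i < 3"
  then have "i = 0 \<or> i = 1 \<or> i = 2" by auto
  then show "lin V W (\<lambda>x. \<phi> (xs[i := x]))" using assms x by (auto simp: One_nat_def)
qed

lemma mlin4I:
  assumes "\<And>b c d. b \<in> carrier V \<Longrightarrow> c \<in> carrier V \<Longrightarrow> d \<in> carrier V \<Longrightarrow> lin V W (\<lambda>a. \<phi> [a, b, c, d])"
    "\<And>a c d. a \<in> carrier V \<Longrightarrow> c \<in> carrier V \<Longrightarrow> d \<in> carrier V \<Longrightarrow> lin V W (\<lambda>b. \<phi> [a, b, c, d])"
    "\<And>a b d. a \<in> carrier V \<Longrightarrow> b \<in> carrier V \<Longrightarrow> d \<in> carrier V \<Longrightarrow> lin V W (\<lambda>c. \<phi> [a, b, c, d])"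
    "\<And>a b c. a \<in> carrier V \<Longrightarrow> b \<in> carrier V \<Longrightarrow> c \<in> carrier V \<Longrightarrow> lin V W (\<lambda>d. \<phi> [a, b, c, d])"
  shows "mlin V 4 W \<phi>"
  unfolding mlin_def
proof (intro conjI ballI allI impI)
  fix xs assume "xs \<in> tuples V 4"
  then obtain a b c d where x: "xs = [a, b, c, d]" "a \<in> carrier V" "b \<in> carrier V" "c \<in> carrier V" "d \<in> carrier V"
    using tuples_4 by blast
  then show "\<phi> xs \<in> carrier W" using lin_closed[OF assms(1)] by blast
  fix i :: nat assume "i < 4"
  then have "i = 0 \<or> i = 1 \<or> i = 2 \<or> i = 3" by auto
  then show "lin V W (\<lambda>x. \<phi> (xs[i := x]))" using assms x by (elim disjE) (simp_all add: eval_nat_numeral One_nat_def)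
qed

lemma mlin1: "mlin V 1 W \<phi> \<Longrightarrow> vs V \<Longrightarrow> lin V W (\<lambda>x. \<phi> [x])"
  using mlinD[of V 1 W \<phi> "[\<zero>\<^bsub>V\<^esub>]" 0] by simp

lemma mlin2:
  assumes "mlin V 2 W \<phi>" "a \<in> carrier V"
  shows "lin V W (\<lambda>x. \<phi> [x, a])" "lin V W (\<lambda>x. \<phi> [a, x])"
  using mlinD[OF assms(1), of "[a, a]" 0] mlinD[OF assms(1), of "[a, a]" 1] assms(2) by (simp_all add: One_nat_def)

lemma mlin3:
  assumes "mlin V 3 W \<phi>" "a \<in> carrier V" "b \<in> carrier V"
  shows "lin V W (\<lambda>x. \<phi> [x, a, b])" "lin V W (\<lambda>x. \<phi> [a, x, b])" "lin V W (\<lambda>x. \<phi> [a, b, x])"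
  using mlinD[OF assms(1), of "[a, a, b]" 0] mlinD[OF assms(1), of "[a, a, b]" 1]
    mlinD[OF assms(1), of "[a, b, a]" 2] assms(2,3) by (simp_all add: One_nat_def)

lemma wedge_closed [simp]:
  "vs V \<Longrightarrow> xs \<in> tuples V n \<Longrightarrow> wedge K V xs \<in> carrier (ext_power K V n)"
  by (rule mlin_closed[OF mlin_wedge])

lemma symprod_closed [simp]:
  "vs V \<Longrightarrow> xs \<in> tuples V n \<Longrightarrow> symprod K V xs \<in> carrier (sym_power K V n)"
  by (rule mlin_closed[OF mlin_symprod])

lemma lin_wedge1 [lin_intros]:
  "vs V \<Longrightarrow> lin U V f \<Longrightarrow> lin U (ext_power K V 1) (\<lambda>x. wedge K V [f x])"
  by (rule lin_comp[OF mlin1[OF mlin_wedge]])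

lemma lin_wedge2 [lin_intros]:
  assumes "vs V" "lin U V f" "a \<in> carrier V"
  shows "lin U (ext_power K V 2) (\<lambda>x. wedge K V [f x, a])"
    "lin U (ext_power K V 2) (\<lambda>x. wedge K V [a, f x])"
  using lin_comp[OF mlin2(1)[OF mlin_wedge[OF assms(1)] assms(3)] assms(2)]
    lin_comp[OF mlin2(2)[OF mlin_wedge[OF assms(1)] assms(3)] assms(2)] by auto

lemma lin_symprod2 [lin_intros]:
  assumes "vs V" "lin U V f" "a \<in> carrier V"
  shows "lin U (sym_power K V 2) (\<lambda>x. symprod K V [f x, a])"
    "lin U (sym_power K V 2) (\<lambda>x. symprod K V [a, f x])"
  using lin_comp[OF mlin2(1)[OF mlin_symprod[OF assms(1)] assms(3)] assms(2)]
    lin_comp[OF mlin2(2)[OF mlin_symprod[OF assms(1)] assms(3)] assms(2)] by auto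

lemma lin_wedge3 [lin_intros]:
  assumes "vs V" "lin U V f" "a \<in> carrier V" "b \<in> carrier V"
  shows "lin U (ext_power K V 3) (\<lambda>x. wedge K V [f x, a, b])"
    "lin U (ext_power K V 3) (\<lambda>x. wedge K V [a, f x, b])"
    "lin U (ext_power K V 3) (\<lambda>x. wedge K V [a, b, f x])"
  using lin_comp[OF mlin3(1)[OF mlin_wedge[OF assms(1)] assms(3,4)] assms(2)]
    lin_comp[OF mlin3(2)[OF mlin_wedge[OF assms(1)] assms(3,4)] assms(2)]
    lin_comp[OF mlin3(3)[OF mlin_wedge[OF assms(1)] assms(3,4)] assms(2)] by auto

lemma wedge2_self [simp]: "a \<in> carrier V \<Longrightarrow> wedge K V [a, a] = \<zero>\<^bsub>ext_power K V 2\<^esub>"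
  by (rule wedge_zero) auto

lemma bilin_wedge: "vs V \<Longrightarrow> bilin V V (ext_power K V 2) (\<lambda>a b. wedge K V [a, b])"
  by (intro bilinI lin_intros)


lemma wedge2_swap:
  "vs V \<Longrightarrow> a \<in> carrier V \<Longrightarrow> b \<in> carrier V \<Longrightarrow> wedge K V [a, b] = \<ominus>\<^bsub>ext_power K V 2\<^esub> wedge K V [b, a]"
  by (rule bilin_alternating_skew[OF bilin_wedge]) auto

lemma symprod2_comm:
  "a \<in> carrier V \<Longrightarrow> b \<in> carrier V \<Longrightarrow> symprod K V [a, b] = symprod K V [b, a]"
  by (rule symprod_mset[of _ V 2]) auto

lemma wedge3_zero [simp]:
  assumes "a \<in> carrier V" "b \<in> carrier V"
  shows "wedge K V [a, a, b] = \<zero>\<^bsub>ext_power K V 3\<^esub>" "wedge K V [a, b, a] = \<zero>\<^bsub>ext_power K V 3\<^esub>"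
    "wedge K V [b, a, a] = \<zero>\<^bsub>ext_power K V 3\<^esub>"
  using assms by (auto intro!: wedge_zero)

lemma wedge3_swap:
  assumes "vs V" "a \<in> carrier V" "b \<in> carrier V" "c \<in> carrier V"
  shows "wedge K V [a, b, c] = \<ominus>\<^bsub>ext_power K V 3\<^esub> wedge K V [b, a, c]"
    "wedge K V [a, b, c] = \<ominus>\<^bsub>ext_power K V 3\<^esub> wedge K V [a, c, b]"
proof -
  have "bilin V V (ext_power K V 3) (\<lambda>a b. wedge K V [a, b, c])"
    using assms by (intro bilinI lin_intros)
  then show "wedge K V [a, b, c] = \<ominus>\<^bsub>ext_power K V 3\<^esub> wedge K V [b, a, c]"
    by (rule bilin_alternating_skew) (use assms in auto)
  have "bilin V V (ext_power K V 3) (\<lambda>b c. wedge K V [a, b, c])"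
    using assms by (intro bilinI lin_intros)
  then show "wedge K V [a, b, c] = \<ominus>\<^bsub>ext_power K V 3\<^esub> wedge K V [a, c, b]"
    by (rule bilin_alternating_skew) (use assms in auto)
qed

lemma ext1_lift:
  assumes "vs V" "vs W" "lin V W f"
  obtains h where "lin (ext_power K V 1) W h" "\<And>a. a \<in> carrier V \<Longrightarrow> h (wedge K V [a]) = f a"
proof -
  have m: "mlin V 1 W (\<lambda>xs. f (hd xs))" using assms by (intro mlin1I) simp
  obtain h where h: "lin (ext_power K V 1) W h" "\<And>xs. xs \<in> tuples V 1 \<Longrightarrow> h (wedge K V xs) = f (hd xs)"
    by (rule ext_lift[OF assms(1,2) m]) (auto dest!: tuples_1)
  show thesis by (rule that[OF h(1)]) (use h(2)[of "[_]"] in simp)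
qed

lemma ext2_lift:
  assumes "vs V" "vs W" "bilin V V W \<phi>" "\<And>x. x \<in> carrier V \<Longrightarrow> \<phi> x x = \<zero>\<^bsub>W\<^esub>"
  obtains h where "lin (ext_power K V 2) W h"
    "\<And>a b. a \<in> carrier V \<Longrightarrow> b \<in> carrier V \<Longrightarrow> h (wedge K V [a, b]) = \<phi> a b"
proof -
  have m: "mlin V 2 W (\<lambda>xs. \<phi> (xs ! 0) (xs ! 1))"
    using bilin_left[OF assms(3)] bilin_right[OF assms(3)] by (intro mlin2I) (simp_all add: One_nat_def)
  have z: "\<phi> (xs ! 0) (xs ! 1) = \<zero>\<^bsub>W\<^esub>" if "xs \<in> tuples V 2" "\<not> distinct xs" for xs
    using tuples_2[OF that(1)] that(2) assms(4) by (auto simp: One_nat_def)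
  obtain h where h: "lin (ext_power K V 2) W h"
      "\<And>xs. xs \<in> tuples V 2 \<Longrightarrow> h (wedge K V xs) = \<phi> (xs ! 0) (xs ! 1)"
    by (rule ext_lift[OF assms(1,2) m z]) blast+
  show thesis by (rule that[OF h(1)]) (use h(2)[of "[_, _]"] in \<open>simp add: One_nat_def\<close>)
qed

lemma sym2_lift:
  assumes "vs V" "vs W" "bilin V V W \<phi>"
    "\<And>x y. x \<in> carrier V \<Longrightarrow> y \<in> carrier V \<Longrightarrow> \<phi> x y = \<phi> y x"
  obtains h where "lin (sym_power K V 2) W h"
    "\<And>a b. a \<in> carrier V \<Longrightarrow> b \<in> carrier V \<Longrightarrow> h (symprod K V [a, b]) = \<phi> a b"
proof -
  have m: "mlin V 2 W (\<lambda>xs. \<phi> (xs ! 0) (xs ! 1))"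
    using bilin_left[OF assms(3)] bilin_right[OF assms(3)] by (intro mlin2I) (simp_all add: One_nat_def)
  have s: "\<phi> (xs ! 0) (xs ! 1) = \<phi> (ys ! 0) (ys ! 1)"
    if "xs \<in> tuples V 2" "ys \<in> tuples V 2" "mset xs = mset ys" for xs ys
    using tuples_2[OF that(1)] tuples_2[OF that(2)] that(3) assms(4)
    by (auto simp: add_eq_conv_ex One_nat_def)
  obtain h where h: "lin (sym_power K V 2) W h"
      "\<And>xs. xs \<in> tuples V 2 \<Longrightarrow> h (symprod K V xs) = \<phi> (xs ! 0) (xs ! 1)"
    by (rule sym_lift[OF assms(1,2) m s]) blast+
  show thesis by (rule that[OF h(1)]) (use h(2)[of "[_, _]"] in \<open>simp add: One_nat_def\<close>)
qed

lemma ext3_lift: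
  assumes "vs V" "vs W"
    "\<And>b c. b \<in> carrier V \<Longrightarrow> c \<in> carrier V \<Longrightarrow> lin V W (\<lambda>a. \<phi> a b c)"
    "\<And>a c. a \<in> carrier V \<Longrightarrow> c \<in> carrier V \<Longrightarrow> lin V W (\<lambda>b. \<phi> a b c)"
    "\<And>a b. a \<in> carrier V \<Longrightarrow> b \<in> carrier V \<Longrightarrow> lin V W (\<lambda>c. \<phi> a b c)"
    "\<And>a b. a \<in> carrier V \<Longrightarrow> b \<in> carrier V \<Longrightarrow> \<phi> a a b = \<zero>\<^bsub>W\<^esub> \<and> \<phi> a b a = \<zero>\<^bsub>W\<^esub> \<and> \<phi> b a a = \<zero>\<^bsub>W\<^esub>"
  obtains h where "lin (ext_power K V 3) W h"
    "\<And>a b c. a \<in> carrier V \<Longrightarrow> b \<in> carrier V \<Longrightarrow> c \<in> carrier V \<Longrightarrow> h (wedge K V [a, b, c]) = \<phi> a b c"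
proof -
  have m: "mlin V 3 W (\<lambda>xs. \<phi> (xs ! 0) (xs ! 1) (xs ! 2))"
    using assms(3-5) by (intro mlin3I) (simp_all add: eval_nat_numeral One_nat_def)
  have z: "\<phi> (xs ! 0) (xs ! 1) (xs ! 2) = \<zero>\<^bsub>W\<^esub>" if "xs \<in> tuples V 3" "\<not> distinct xs" for xs
    using tuples_3[OF that(1)] that(2) assms(6) by (auto simp: One_nat_def)
  obtain h where h: "lin (ext_power K V 3) W h"
      "\<And>xs. xs \<in> tuples V 3 \<Longrightarrow> h (wedge K V xs) = \<phi> (xs ! 0) (xs ! 1) (xs ! 2)"
    by (rule ext_lift[OF assms(1,2) m z]) blast+
  show thesis by (rule that[OF h(1)]) (use h(2)[of "[_, _, _]"] in \<open>simp add: One_nat_def\<close>)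
qed

lemma ext4_lift:
  assumes "vs V" "vs W"
    "\<And>b c d. b \<in> carrier V \<Longrightarrow> c \<in> carrier V \<Longrightarrow> d \<in> carrier V \<Longrightarrow> lin V W (\<lambda>a. \<phi> a b c d)"
    "\<And>a c d. a \<in> carrier V \<Longrightarrow> c \<in> carrier V \<Longrightarrow> d \<in> carrier V \<Longrightarrow> lin V W (\<lambda>b. \<phi> a b c d)"
    "\<And>a b d. a \<in> carrier V \<Longrightarrow> b \<in> carrier V \<Longrightarrow> d \<in> carrier V \<Longrightarrow> lin V W (\<lambda>c. \<phi> a b c d)"
    "\<And>a b c. a \<in> carrier V \<Longrightarrow> b \<in> carrier V \<Longrightarrow> c \<in> carrier V \<Longrightarrow> lin V W (\<lambda>d. \<phi> a b c d)"
    "\<And>a b c. a \<in> carrier V \<Longrightarrow> b \<in> carrier V \<Longrightarrow> c \<in> carrier V \<Longrightarrow>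
      \<phi> a a b c = \<zero>\<^bsub>W\<^esub> \<and> \<phi> a b a c = \<zero>\<^bsub>W\<^esub> \<and> \<phi> a b c a = \<zero>\<^bsub>W\<^esub> \<and>
      \<phi> b a a c = \<zero>\<^bsub>W\<^esub> \<and> \<phi> b a c a = \<zero>\<^bsub>W\<^esub> \<and> \<phi> b c a a = \<zero>\<^bsub>W\<^esub>"
  obtains h where "lin (ext_power K V 4) W h"
    "\<And>a b c d. a \<in> carrier V \<Longrightarrow> b \<in> carrier V \<Longrightarrow> c \<in> carrier V \<Longrightarrow> d \<in> carrier V \<Longrightarrow>
      h (wedge K V [a, b, c, d]) = \<phi> a b c d"
proof -
  have m: "mlin V 4 W (\<lambda>xs. \<phi> (xs ! 0) (xs ! 1) (xs ! 2) (xs ! 3))"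
    using assms(3-6) by (intro mlin4I) (simp_all add: eval_nat_numeral One_nat_def)
  have z: "\<phi> (xs ! 0) (xs ! 1) (xs ! 2) (xs ! 3) = \<zero>\<^bsub>W\<^esub>" if "xs \<in> tuples V 4" "\<not> distinct xs" for xs
    using tuples_4[OF that(1)] that(2) assms(7) by (auto simp: One_nat_def)
  obtain h where h: "lin (ext_power K V 4) W h"
      "\<And>xs. xs \<in> tuples V 4 \<Longrightarrow> h (wedge K V xs) = \<phi> (xs ! 0) (xs ! 1) (xs ! 2) (xs ! 3)"
    by (rule ext_lift[OF assms(1,2) m z]) blast+
  show thesis by (rule that[OF h(1)]) (use h(2)[of "[_, _, _, _]"] in \<open>simp add: One_nat_def\<close>)
qed

lemma tpow3_lift:
  assumes "vs V" "vs W"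
    "\<And>b c. b \<in> carrier V \<Longrightarrow> c \<in> carrier V \<Longrightarrow> lin V W (\<lambda>a. \<phi> a b c)"
    "\<And>a c. a \<in> carrier V \<Longrightarrow> c \<in> carrier V \<Longrightarrow> lin V W (\<lambda>b. \<phi> a b c)"
    "\<And>a b. a \<in> carrier V \<Longrightarrow> b \<in> carrier V \<Longrightarrow> lin V W (\<lambda>c. \<phi> a b c)"
  obtains h where "lin (tensor_power K V 3) W h"
    "\<And>a b c. a \<in> carrier V \<Longrightarrow> b \<in> carrier V \<Longrightarrow> c \<in> carrier V \<Longrightarrow> h (pure_tensor K V [a, b, c]) = \<phi> a b c"
proof -
  have m: "mlin V 3 W (\<lambda>xs. \<phi> (xs ! 0) (xs ! 1) (xs ! 2))"
    using assms(3-5) by (intro mlin3I) (simp_all add: eval_nat_numeral One_nat_def)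
  obtain h where h: "lin (tensor_power K V 3) W h"
      "\<And>xs. xs \<in> tuples V 3 \<Longrightarrow> h (pure_tensor K V xs) = \<phi> (xs ! 0) (xs ! 1) (xs ! 2)"
    using tpow_lift[OF assms(1,2) m] by metis
  show thesis by (rule that[OF h(1)]) (use h(2)[of "[_, _, _]"] in \<open>simp add: One_nat_def\<close>)
qed

text \<open>The entries are released from \<open>S\<close> one position at a time. In the induction
  on \<open>k\<close> only the positions from \<open>k\<close> on have to lie in \<open>S\<close>,
  and the step is linearity in the slot \<open>k\<close>.\<close>

lemma mlin_in_sub:
  assumes \<phi>: "mlin V n W \<phi>" and V: "vs V" and W: "vs W" and N: "sub N W" and S: "spans V S"
    and N\<phi>: "\<And>xs. length xs = n \<Longrightarrow> set xs \<subseteq> S \<Longrightarrow> \<phi> xs \<in> N" and xs: "xs \<in> tuples V n"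
  shows "\<phi> xs \<in> N"
proof -
  have SV: "S \<subseteq> carrier V" using S by (rule spans_subset)
  have "\<phi> xs \<in> N" if "k \<le> n" "xs \<in> tuples V n" "\<forall>i. k \<le> i \<longrightarrow> i < n \<longrightarrow> xs ! i \<in> S" for k xs
    using that
  proof (induction k arbitrary: xs)
    case 0
    then show ?case by (intro N\<phi>) (auto simp: tuples_def in_set_conv_nth)
  next
    case (Suc k)
    have l: "length xs = n" using Suc.prems(2) by (rule tuples_length)
    have x: "xs ! k \<in> carrier V" using Suc.prems(1,2) l by (auto simp: tuples_def)
    have "\<phi> (xs[k := s]) \<in> N" if "s \<in> S" for s
      using Suc.prems that SV l by (intro Suc.IH) (auto simp: nth_list_update intro!: tuples_update)
    then have "\<phi> (xs[k := xs ! k]) \<in> N"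
      using lin_span[OF mlinD[OF \<phi> Suc.prems(2)] V W SV N _ spansD[OF S x], of k] Suc.prems(1) by auto
    then show ?case by simp
  qed
  from this[of n xs] xs show ?thesis by auto
qed

lemma spans_ext_gen:
  assumes "vs V" "spans V S"
  shows "spans (ext_power K V n) {wedge K V xs | xs. length xs = n \<and> set xs \<subseteq> S}" (is "spans _ ?G")
proof -
  have G: "?G \<subseteq> carrier (ext_power K V n)"
    using assms spans_subset[OF assms(2)] by (auto intro!: wedge_closed simp: tuples_def)
  have "wedge K V ` tuples V n \<subseteq> span (ext_power K V n) ?G"
    using mlin_in_sub[OF mlin_wedge[OF assms(1)] assms(1) vs_ext sub_span[OF vs_ext G] assms(2)]
    by (auto intro: span_base)
  then have "span (ext_power K V n) (wedge K V ` tuples V n) \<subseteq> span (ext_power K V n) ?G"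
    by (intro span_least sub_span[OF vs_ext G])
  then show ?thesis using spans_ext[of V n] G by (auto simp: spans_def)
qed

lemma spans_sym_gen:
  assumes "vs V" "spans V S"
  shows "spans (sym_power K V n) {symprod K V xs | xs. length xs = n \<and> set xs \<subseteq> S}" (is "spans _ ?G")
proof -
  have G: "?G \<subseteq> carrier (sym_power K V n)"
    using assms spans_subset[OF assms(2)] by (auto intro!: symprod_closed simp: tuples_def)
  have "symprod K V ` tuples V n \<subseteq> span (sym_power K V n) ?G"
    using mlin_in_sub[OF mlin_symprod[OF assms(1)] assms(1) vs_sym sub_span[OF vs_sym G] assms(2)]
    by (auto intro: span_base)
  then have "span (sym_power K V n) (symprod K V ` tuples V n) \<subseteq> span (sym_power K V n) ?G"
    by (intro span_least sub_span[OF vs_sym G])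
  then show ?thesis using spans_sym[of V n] G by (auto simp: spans_def)
qed

lemma spans_ext2:
  assumes "vs V" "spans V S"
  shows "spans (ext_power K V 2) {wedge K V [s, t] | s t. s \<in> S \<and> t \<in> S}"
proof -
  have "{wedge K V xs | xs. length xs = 2 \<and> set xs \<subseteq> S} = {wedge K V [s, t] | s t. s \<in> S \<and> t \<in> S}"
    by (auto simp: length_Suc_conv numeral_2_eq_2) force
  then show ?thesis using spans_ext_gen[OF assms, of 2] by simp
qed

lemma spans_sym2:
  assumes "vs V" "spans V S"
  shows "spans (sym_power K V 2) {symprod K V [s, t] | s t. s \<in> S \<and> t \<in> S}"
proof -
  have "{symprod K V xs | xs. length xs = 2 \<and> set xs \<subseteq> S} = {symprod K V [s, t] | s t. s \<in> S \<and> t \<in> S}"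
    by (auto simp: length_Suc_conv numeral_2_eq_2) force
  then show ?thesis using spans_sym_gen[OF assms, of 2] by simp
qed

lemma spans_ext3:
  assumes "vs V" "spans V S"
  shows "spans (ext_power K V 3) {wedge K V [s, t, u] | s t u. s \<in> S \<and> t \<in> S \<and> u \<in> S}"
proof -
  have "{wedge K V xs | xs. length xs = 3 \<and> set xs \<subseteq> S} = {wedge K V [s, t, u] | s t u. s \<in> S \<and> t \<in> S \<and> u \<in> S}"
    by (auto simp: length_Suc_conv numeral_3_eq_3) force
  then show ?thesis using spans_ext_gen[OF assms, of 3] by simp
qed

subsection \<open>Bilinear maps on presented spaces\<close>

text \<open>Relations are not listed. Instead \<open>C\<close> is the condition under which a family
  of values on the generators extends to a linear map, such as bilinear and alternating for an
  exterior square. Tensor products, exterior and symmetric squares and graded sums then all fall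
  under \<open>bilin_lift\<close>. The target \<open>W\<close> is a parameter, because HOL cannot
  quantify over its type inside the definition.\<close>

definition presents :: "('k, 'v, 'm) module_scheme \<Rightarrow> ('k, 'w, 'n) module_scheme \<Rightarrow> 'i set
    \<Rightarrow> ('i \<Rightarrow> 'v) \<Rightarrow> (('i \<Rightarrow> 'w) \<Rightarrow> bool) \<Rightarrow> bool"
  where "presents V W I g C \<longleftrightarrow> vs V \<and> vs W \<and> spans V (g ` I) \<and>
    (\<forall>\<phi>. \<phi> ` I \<subseteq> carrier W \<longrightarrow> C \<phi> \<longrightarrow> (\<exists>h. lin V W h \<and> (\<forall>i\<in>I. h (g i) = \<phi> i)))"

text \<open>The families that satisfy \<open>C\<close> form a subspace, and only their values on
  \<open>I\<close> count. Therefore the condition passes from generators of the other factor to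
  arbitrary vectors of it.\<close>

definition linear_condition :: "('k, 'w, 'n) module_scheme \<Rightarrow> 'i set \<Rightarrow> (('i \<Rightarrow> 'w) \<Rightarrow> bool) \<Rightarrow> bool"
  where "linear_condition W I C \<longleftrightarrow>
    (\<forall>\<phi> \<psi>. (\<forall>i\<in>I. \<phi> i = \<psi> i) \<longrightarrow> C \<phi> \<longrightarrow> C \<psi>) \<and> C (\<lambda>_. \<zero>\<^bsub>W\<^esub>) \<and>
    (\<forall>\<phi> \<psi>. \<phi> ` I \<subseteq> carrier W \<longrightarrow> \<psi> ` I \<subseteq> carrier W \<longrightarrow> C \<phi> \<longrightarrow> C \<psi> \<longrightarrow> C (\<lambda>i. \<phi> i \<oplus>\<^bsub>W\<^esub> \<psi> i)) \<and>
    (\<forall>c\<in>carrier K. \<forall>\<phi>. \<phi> ` I \<subseteq> carrier W \<longrightarrow> C \<phi> \<longrightarrow> C (\<lambda>i. c \<odot>\<^bsub>W\<^esub> \<phi> i))"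

lemma linear_condition_cong:
  assumes "linear_condition W I C" "C \<phi>" "\<forall>i\<in>I. \<phi> i = \<psi> i"
  shows "C \<psi>"
proof -
  have "\<forall>\<phi> \<psi>. (\<forall>i\<in>I. \<phi> i = \<psi> i) \<longrightarrow> C \<phi> \<longrightarrow> C \<psi>"
    using assms(1) unfolding linear_condition_def by (elim conjE)
  from this[rule_format, of \<phi> \<psi>] show ?thesis using assms(2,3) by simp
qed

lemma linear_conditionD:
  assumes "linear_condition W I C"
  shows "C (\<lambda>_. \<zero>\<^bsub>W\<^esub>)"
    "\<phi> ` I \<subseteq> carrier W \<Longrightarrow> \<psi> ` I \<subseteq> carrier W \<Longrightarrow> C \<phi> \<Longrightarrow> C \<psi> \<Longrightarrow> C (\<lambda>i. \<phi> i \<oplus>\<^bsub>W\<^esub> \<psi> i)"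
    "c \<in> carrier K \<Longrightarrow> \<phi> ` I \<subseteq> carrier W \<Longrightarrow> C \<phi> \<Longrightarrow> C (\<lambda>i. c \<odot>\<^bsub>W\<^esub> \<phi> i)"
  using assms by (simp_all add: linear_condition_def)

text \<open>For each fixed \<open>i'\<close> the values extend linearly over \<open>V\<close>,
  giving \<open>h i'\<close>. For v = g i the family of the \<open>h i' v\<close> satisfies
  \<open>C'\<close> by assumption; as \<open>C'\<close> is a linear condition, it holds for every v,
  and the family extends linearly over \<open>V'\<close>.\<close>

lemma bilin_lift:
  assumes p: "presents V W I g C" and p': "presents V' W I' g' C'" and lc: "linear_condition W I' C'"
    and q: "\<And>i i'. i \<in> I \<Longrightarrow> i' \<in> I' \<Longrightarrow> q i i' \<in> carrier W"
    and C: "\<And>i'. i' \<in> I' \<Longrightarrow> C (\<lambda>i. q i i')" and C': "\<And>i. i \<in> I \<Longrightarrow> C' (\<lambda>i'. q i i')"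
  obtains \<phi> where "bilin V V' W \<phi>" "\<And>i i'. i \<in> I \<Longrightarrow> i' \<in> I' \<Longrightarrow> \<phi> (g i) (g' i') = q i i'"
proof -
  have V: "vs V" "vs V'" and W: "vs W" and sV: "spans V (g ` I)" and sV': "spans V' (g' ` I')"
    using p p' by (auto simp: presents_def)
  have "\<exists>h. lin V W h \<and> (\<forall>i\<in>I. h (g i) = q i i')" if "i' \<in> I'" for i'
  proof -
    have "(\<lambda>i. q i i') ` I \<subseteq> carrier W" using q that by auto
    then show ?thesis using p C[OF that] unfolding presents_def by blast
  qed
  then obtain h where h: "\<And>i'. i' \<in> I' \<Longrightarrow> lin V W (h i')"
    "\<And>i i'. i' \<in> I' \<Longrightarrow> i \<in> I \<Longrightarrow> h i' (g i) = q i i'" by metis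
  have Ch: "C' (\<lambda>i'. h i' v)" if "v \<in> carrier V" for v
    using spansD[OF sV that] V(1) spans_subset[OF sV]
  proof (induction rule: span_induct)
    case (base s)
    then obtain i where i: "i \<in> I" "s = g i" by auto
    show ?case by (rule linear_condition_cong[OF lc C'[OF i(1)]]) (simp add: i h(2))
  next
    case zero
    show ?case
      by (rule linear_condition_cong[OF lc linear_conditionD(1)[OF lc]])
        (simp add: lin_zero[OF h(1) V(1) W])
  next
    case (add x y)
    have "(\<lambda>i'. h i' x) ` I' \<subseteq> carrier W" "(\<lambda>i'. h i' y) ` I' \<subseteq> carrier W"
      using lin_closed[OF h(1)] add(3,4) by auto
    then have "C' (\<lambda>i'. h i' x \<oplus>\<^bsub>W\<^esub> h i' y)"
      using linear_conditionD(2)[OF lc, where \<phi> = "\<lambda>i'. h i' x" and \<psi> = "\<lambda>i'. h i' y"] add(5,6) by simp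
    then show ?case
      by (rule linear_condition_cong[OF lc]) (simp add: lin_add[OF h(1)] add(3,4))
  next
    case (smult c x)
    have "(\<lambda>i'. h i' x) ` I' \<subseteq> carrier W" using lin_closed[OF h(1)] smult(3) by auto
    then have "C' (\<lambda>i'. c \<odot>\<^bsub>W\<^esub> h i' x)"
      using linear_conditionD(3)[OF lc, where c = c and \<phi> = "\<lambda>i'. h i' x"] smult(1,4) by simp
    then show ?case
      by (rule linear_condition_cong[OF lc]) (simp add: lin_smult[OF h(1)] smult(1,3))
  qed
  have "\<exists>k. lin V' W k \<and> (\<forall>i'\<in>I'. k (g' i') = h i' v)" if "v \<in> carrier V" for v
  proof -
    have "(\<lambda>i'. h i' v) ` I' \<subseteq> carrier W" using lin_closed[OF h(1)] that by auto
    then show ?thesis using p' Ch[OF that] unfolding presents_def by blast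
  qed
  then obtain \<phi> where \<phi>: "\<And>v. v \<in> carrier V \<Longrightarrow> lin V' W (\<phi> v)"
    "\<And>v i'. v \<in> carrier V \<Longrightarrow> i' \<in> I' \<Longrightarrow> \<phi> v (g' i') = h i' v" by metis
  have "bilin V V' W \<phi>"
  proof (rule bilinI)
    fix v assume "v \<in> carrier V"
    then show "lin V' W (\<lambda>w. \<phi> v w)" by (rule \<phi>(1))
  next
    fix w assume w: "w \<in> carrier V'"
    show "lin V W (\<lambda>v. \<phi> v w)"
    proof (rule linI)
      fix x assume x: "x \<in> carrier V"
      show "\<phi> x w \<in> carrier W" by (rule lin_closed[OF \<phi>(1)[OF x] w])
      fix y assume y: "y \<in> carrier V"
      show "\<phi> (x \<oplus>\<^bsub>V\<^esub> y) w = \<phi> x w \<oplus>\<^bsub>W\<^esub> \<phi> y w"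
        by (rule lin_eq[OF sV' \<phi>(1) lin_plus[OF W \<phi>(1)[OF x] \<phi>(1)[OF y]] V(2) W _ w])
          (use \<phi>(2) x y V h(1) in \<open>auto simp: lin_add\<close>)
    next
      fix c x assume c: "c \<in> carrier K" and x: "x \<in> carrier V"
      show "\<phi> (c \<odot>\<^bsub>V\<^esub> x) w = c \<odot>\<^bsub>W\<^esub> \<phi> x w"
        by (rule lin_eq[OF sV' \<phi>(1) lin_scale[OF W c \<phi>(1)[OF x]] V(2) W _ w])
          (use \<phi>(2) x c V h(1) in \<open>auto simp: lin_smult\<close>)
    qed
  qed
  moreover have "g i \<in> carrier V" if "i \<in> I" for i using spans_subset[OF sV] that by auto
  ultimately show thesis using \<phi>(2) h(2) by (intro that) auto
qed

lemma bilin_cong: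
  assumes "bilin V W X \<phi>" "vs V" "vs W" "\<And>v w. v \<in> carrier V \<Longrightarrow> w \<in> carrier W \<Longrightarrow> \<phi> v w = \<psi> v w"
  shows "bilin V W X \<psi>"
proof (rule bilinI)
  fix w assume "w \<in> carrier W"
  then show "lin V X (\<lambda>v. \<psi> v w)"
    using lin_cong[OF assms(2) bilin_left[OF assms(1)]] assms(4) by metis
next
  fix v assume "v \<in> carrier V"
  then show "lin W X (\<lambda>w. \<psi> v w)"
    using lin_cong[OF assms(3) bilin_right[OF assms(1)]] assms(4) by metis
qed

lemma linear_condition_bilin:
  assumes "vs V" "vs W" "vs X"
  shows "linear_condition X (carrier V \<times> carrier W) (\<lambda>\<phi>. bilin V W X (\<lambda>v w. \<phi> (v, w)))"
  unfolding linear_condition_def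
proof (intro conjI allI impI ballI)
  fix \<phi> \<psi> :: "_ \<Rightarrow> _" assume "\<forall>i\<in>carrier V \<times> carrier W. \<phi> i = \<psi> i" "bilin V W X (\<lambda>v w. \<phi> (v, w))"
  then show "bilin V W X (\<lambda>v w. \<psi> (v, w))"
    using bilin_cong[OF _ assms(1,2), of X "\<lambda>v w. \<phi> (v, w)" "\<lambda>v w. \<psi> (v, w)"] by auto
qed (use assms in \<open>auto simp: bilin_def intro!: lin_intros\<close>)

lemma presents_tensor:
  assumes "vs V" "vs W" "vs X"
  shows "presents (tensor K V W) X (carrier V \<times> carrier W) (\<lambda>(v, w). tens K V W v w)
    (\<lambda>\<phi>. bilin V W X (\<lambda>v w. \<phi> (v, w)))"
proof -
  have "spans (tensor K V W) ((\<lambda>(v, w). tens K V W v w) ` (carrier V \<times> carrier W))"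
    using spans_tensor_all[of V W] by (rule back_subst[of "spans _"]) auto
  moreover have "\<exists>h. lin (tensor K V W) X h \<and> (\<forall>i\<in>carrier V \<times> carrier W. h (case i of (v, w) \<Rightarrow> tens K V W v w) = \<phi> i)"
    if "bilin V W X (\<lambda>v w. \<phi> (v, w))" for \<phi>
  proof -
    note b = that
    obtain h where "lin (tensor K V W) X h" "\<And>v w. v \<in> carrier V \<Longrightarrow> w \<in> carrier W \<Longrightarrow> h (tens K V W v w) = \<phi> (v, w)"
      by (rule tensor_lift[OF assms b]) blast
    then show ?thesis by (intro exI[of _ h]) auto
  qed
  ultimately show ?thesis using assms by (simp add: presents_def)
qed

lemma presents_ext2:
  assumes "vs V" "vs X"
  shows "presents (ext_power K V 2) X (carrier V \<times> carrier V) (\<lambda>(v, w). wedge K V [v, w])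
    (\<lambda>\<phi>. bilin V V X (\<lambda>v w. \<phi> (v, w)) \<and> (\<forall>v\<in>carrier V. \<phi> (v, v) = \<zero>\<^bsub>X\<^esub>))"
proof -
  have "spans (ext_power K V 2) ((\<lambda>(v, w). wedge K V [v, w]) ` (carrier V \<times> carrier V))"
    using spans_ext2[OF assms(1) spans_carrier] by (rule back_subst[of "spans _"]) auto
  moreover have "\<exists>h. lin (ext_power K V 2) X h \<and> (\<forall>i\<in>carrier V \<times> carrier V. h (case i of (v, w) \<Rightarrow> wedge K V [v, w]) = \<phi> i)"
    if "bilin V V X (\<lambda>v w. \<phi> (v, w))" "\<forall>v\<in>carrier V. \<phi> (v, v) = \<zero>\<^bsub>X\<^esub>" for \<phi>
  proof -
    note b = that
    obtain h where "lin (ext_power K V 2) X h" "\<And>v w. v \<in> carrier V \<Longrightarrow> w \<in> carrier V \<Longrightarrow> h (wedge K V [v, w]) = \<phi> (v, w)"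
      by (rule ext2_lift[OF assms b(1)]) (use b(2) in blast)+
    then show ?thesis by (intro exI[of _ h]) auto
  qed
  ultimately show ?thesis using assms by (simp add: presents_def)
qed

lemma presents_sym2:
  assumes "vs V" "vs X"
  shows "presents (sym_power K V 2) X (carrier V \<times> carrier V) (\<lambda>(v, w). symprod K V [v, w])
    (\<lambda>\<phi>. bilin V V X (\<lambda>v w. \<phi> (v, w)) \<and> (\<forall>v\<in>carrier V. \<forall>w\<in>carrier V. \<phi> (v, w) = \<phi> (w, v)))"
proof -
  have "spans (sym_power K V 2) ((\<lambda>(v, w). symprod K V [v, w]) ` (carrier V \<times> carrier V))"
    using spans_sym2[OF assms(1) spans_carrier] by (rule back_subst[of "spans _"]) auto
  moreover have "\<exists>h. lin (sym_power K V 2) X h \<and> (\<forall>i\<in>carrier V \<times> carrier V. h (case i of (v, w) \<Rightarrow> symprod K V [v, w]) = \<phi> i)"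
    if "bilin V V X (\<lambda>v w. \<phi> (v, w))" "\<forall>v\<in>carrier V. \<forall>w\<in>carrier V. \<phi> (v, w) = \<phi> (w, v)" for \<phi>
  proof -
    note b = that
    obtain h where "lin (sym_power K V 2) X h" "\<And>v w. v \<in> carrier V \<Longrightarrow> w \<in> carrier V \<Longrightarrow> h (symprod K V [v, w]) = \<phi> (v, w)"
      by (rule sym2_lift[OF assms b(1)]) (use b(2) in blast)+
    then show ?thesis by (intro exI[of _ h]) auto
  qed
  ultimately show ?thesis using assms by (simp add: presents_def)
qed

lemma linear_condition_alternating:
  assumes "vs V" "vs X"
  shows "linear_condition X (carrier V \<times> carrier V)
    (\<lambda>\<phi>. bilin V V X (\<lambda>v w. \<phi> (v, w)) \<and> (\<forall>v\<in>carrier V. \<phi> (v, v) = \<zero>\<^bsub>X\<^esub>))"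
  using linear_condition_bilin[OF assms(1,1,2)] assms unfolding linear_condition_def by simp

lemma linear_condition_symmetric:
  assumes "vs V" "vs X"
  shows "linear_condition X (carrier V \<times> carrier V)
    (\<lambda>\<phi>. bilin V V X (\<lambda>v w. \<phi> (v, w)) \<and> (\<forall>v\<in>carrier V. \<forall>w\<in>carrier V. \<phi> (v, w) = \<phi> (w, v)))"
  using linear_condition_bilin[OF assms(1,1,2)] assms unfolding linear_condition_def by simp

lemma tensor_tensor_lift:
  assumes "vs A" "vs L" "vs W"
    "\<And>b y. b \<in> carrier A \<Longrightarrow> y \<in> carrier L \<Longrightarrow> bilin A L W (\<lambda>a x. q a x b y)"
    "\<And>a x. a \<in> carrier A \<Longrightarrow> x \<in> carrier L \<Longrightarrow> bilin A L W (\<lambda>b y. q a x b y)"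
  obtains \<phi> where "bilin (tensor K A L) (tensor K A L) W \<phi>"
    "\<And>a x b y. a \<in> carrier A \<Longrightarrow> x \<in> carrier L \<Longrightarrow> b \<in> carrier A \<Longrightarrow> y \<in> carrier L \<Longrightarrow>
      \<phi> (tens K A L a x) (tens K A L b y) = q a x b y"
proof -
  note p = presents_tensor[OF assms(1-3)]
  obtain \<phi> where "bilin (tensor K A L) (tensor K A L) W \<phi>"
    "\<And>i i'. i \<in> carrier A \<times> carrier L \<Longrightarrow> i' \<in> carrier A \<times> carrier L \<Longrightarrow>
      \<phi> (case i of (v, w) \<Rightarrow> tens K A L v w) (case i' of (v, w) \<Rightarrow> tens K A L v w) = (case i of (a, x) \<Rightarrow> case i' of (b, y) \<Rightarrow> q a x b y)"
    by (rule bilin_lift[OF p p linear_condition_bilin[OF assms(1-3)],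
          where q = "\<lambda>i i'. case i of (a, x) \<Rightarrow> case i' of (b, y) \<Rightarrow> q a x b y"])
      (use assms(4,5) bilin_closed[OF assms(4)] in auto)
  then show thesis by (intro that) force+
qed

lemma ext_sym_lift:
  assumes "vs A" "vs L" "vs W"
    "\<And>x y. x \<in> carrier L \<Longrightarrow> y \<in> carrier L \<Longrightarrow> bilin A A W (\<lambda>a b. q a b x y)"
    "\<And>a b. a \<in> carrier A \<Longrightarrow> b \<in> carrier A \<Longrightarrow> bilin L L W (\<lambda>x y. q a b x y)"
    "\<And>a x y. a \<in> carrier A \<Longrightarrow> x \<in> carrier L \<Longrightarrow> y \<in> carrier L \<Longrightarrow> q a a x y = \<zero>\<^bsub>W\<^esub>"
    "\<And>a b x y. a \<in> carrier A \<Longrightarrow> b \<in> carrier A \<Longrightarrow> x \<in> carrier L \<Longrightarrow> y \<in> carrier L \<Longrightarrow> q a b x y = q a b y x"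
  obtains \<phi> where "bilin (ext_power K A 2) (sym_power K L 2) W \<phi>"
    "\<And>a b x y. a \<in> carrier A \<Longrightarrow> b \<in> carrier A \<Longrightarrow> x \<in> carrier L \<Longrightarrow> y \<in> carrier L \<Longrightarrow>
      \<phi> (wedge K A [a, b]) (symprod K L [x, y]) = q a b x y"
proof -
  obtain \<phi> where "bilin (ext_power K A 2) (sym_power K L 2) W \<phi>"
    "\<And>i i'. i \<in> carrier A \<times> carrier A \<Longrightarrow> i' \<in> carrier L \<times> carrier L \<Longrightarrow>
      \<phi> (case i of (v, w) \<Rightarrow> wedge K A [v, w]) (case i' of (v, w) \<Rightarrow> symprod K L [v, w]) = (case i of (a, b) \<Rightarrow> case i' of (x, y) \<Rightarrow> q a b x y)"
    by (rule bilin_lift[OF presents_ext2[OF assms(1,3)] presents_sym2[OF assms(2,3)] linear_condition_symmetric[OF assms(2,3)],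
          where q = "\<lambda>i i'. case i of (a, b) \<Rightarrow> case i' of (x, y) \<Rightarrow> q a b x y"])
      (use assms(4-7) bilin_closed[OF assms(4)] in auto)
  then show thesis by (intro that) force+
qed

lemma sym_ext_lift:
  assumes "vs A" "vs L" "vs W"
    "\<And>x y. x \<in> carrier L \<Longrightarrow> y \<in> carrier L \<Longrightarrow> bilin A A W (\<lambda>a b. q a b x y)"
    "\<And>a b. a \<in> carrier A \<Longrightarrow> b \<in> carrier A \<Longrightarrow> bilin L L W (\<lambda>x y. q a b x y)"
    "\<And>a b x y. a \<in> carrier A \<Longrightarrow> b \<in> carrier A \<Longrightarrow> x \<in> carrier L \<Longrightarrow> y \<in> carrier L \<Longrightarrow> q a b x y = q b a x y"
    "\<And>a b x. a \<in> carrier A \<Longrightarrow> b \<in> carrier A \<Longrightarrow> x \<in> carrier L \<Longrightarrow> q a b x x = \<zero>\<^bsub>W\<^esub>"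
  obtains \<phi> where "bilin (sym_power K A 2) (ext_power K L 2) W \<phi>"
    "\<And>a b x y. a \<in> carrier A \<Longrightarrow> b \<in> carrier A \<Longrightarrow> x \<in> carrier L \<Longrightarrow> y \<in> carrier L \<Longrightarrow>
      \<phi> (symprod K A [a, b]) (wedge K L [x, y]) = q a b x y"
proof -
  obtain \<phi> where "bilin (sym_power K A 2) (ext_power K L 2) W \<phi>"
    "\<And>i i'. i \<in> carrier A \<times> carrier A \<Longrightarrow> i' \<in> carrier L \<times> carrier L \<Longrightarrow>
      \<phi> (case i of (v, w) \<Rightarrow> symprod K A [v, w]) (case i' of (v, w) \<Rightarrow> wedge K L [v, w]) = (case i of (a, b) \<Rightarrow> case i' of (x, y) \<Rightarrow> q a b x y)"
    by (rule bilin_lift[OF presents_sym2[OF assms(1,3)] presents_ext2[OF assms(2,3)] linear_condition_alternating[OF assms(2,3)],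
          where q = "\<lambda>i i'. case i of (a, b) \<Rightarrow> case i' of (x, y) \<Rightarrow> q a b x y"])
      (use assms(4-7) bilin_closed[OF assms(4)] in auto)
  then show thesis by (intro that) force+
qed

subsection \<open>The Chevalley--Eilenberg differential in low degrees\<close>

text \<open>Bilinear and alternating is what makes the differentials in degrees up to 4 well
  defined, and this much is established both for L and for A \<otimes> L. The Jacobi identity comes
  in later, for L alone, in \<open>koszul_boundary\<close> and
  \<open>boundaries_2_subset_cycles\<close>.\<close>

definition alt_bracket :: "('k, 'l, 'm) lie_algebra_scheme \<Rightarrow> bool"
  where "alt_bracket L \<longleftrightarrow> vs L \<and> bilin L L L (bracket L) \<and> (\<forall>x\<in>carrier L. bracket L x x = \<zero>\<^bsub>L\<^esub>)"

lemma alt_bracketD: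
  assumes "alt_bracket L"
  shows "vs L" "bilin L L L (bracket L)" "x \<in> carrier L \<Longrightarrow> bracket L x x = \<zero>\<^bsub>L\<^esub>"
    "x \<in> carrier L \<Longrightarrow> y \<in> carrier L \<Longrightarrow> bracket L x y \<in> carrier L"
    "x \<in> carrier L \<Longrightarrow> y \<in> carrier L \<Longrightarrow> bracket L x y = \<ominus>\<^bsub>L\<^esub> bracket L y x"
proof -
  show *: "vs L" "bilin L L L (bracket L)" "x \<in> carrier L \<Longrightarrow> bracket L x x = \<zero>\<^bsub>L\<^esub>" for x
    using assms by (auto simp: alt_bracket_def)
  show "x \<in> carrier L \<Longrightarrow> y \<in> carrier L \<Longrightarrow> bracket L x y \<in> carrier L"
    using bilin_closed[OF *(2)] .
  show "x \<in> carrier L \<Longrightarrow> y \<in> carrier L \<Longrightarrow> bracket L x y = \<ominus>\<^bsub>L\<^esub> bracket L y x"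
    using bilin_alternating_skew[OF *(2,1,1)] *(3) by blast
qed

lemma lin_bracket [lin_intros]:
  "alt_bracket L \<Longrightarrow> lin U L f \<Longrightarrow> y \<in> carrier L \<Longrightarrow> lin U L (\<lambda>x. bracket L (f x) y)"
  "alt_bracket L \<Longrightarrow> lin U L f \<Longrightarrow> y \<in> carrier L \<Longrightarrow> lin U L (\<lambda>x. bracket L y (f x))"
  by (rule lin_comp[OF bilin_left[OF alt_bracketD(2)]] lin_comp[OF bilin_right[OF alt_bracketD(2)]]; assumption)+

lemma finsum_lessThan:
  assumes "vs W"
  shows "finsum W f ({} :: nat set) = \<zero>\<^bsub>W\<^esub>"
    "f 0 \<in> carrier W \<Longrightarrow> finsum W f {..<1::nat} = f 0"
    "f 0 \<in> carrier W \<Longrightarrow> f 1 \<in> carrier W \<Longrightarrow> finsum W f {..<2::nat} = f 0 \<oplus>\<^bsub>W\<^esub> f 1"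
    "f 0 \<in> carrier W \<Longrightarrow> f 1 \<in> carrier W \<Longrightarrow> f 2 \<in> carrier W \<Longrightarrow>
      finsum W f {..<3::nat} = f 0 \<oplus>\<^bsub>W\<^esub> f 1 \<oplus>\<^bsub>W\<^esub> f 2"
    "f 0 \<in> carrier W \<Longrightarrow> f 1 \<in> carrier W \<Longrightarrow> f 2 \<in> carrier W \<Longrightarrow> f 3 \<in> carrier W \<Longrightarrow>
      finsum W f {..<4::nat} = f 0 \<oplus>\<^bsub>W\<^esub> f 1 \<oplus>\<^bsub>W\<^esub> f 2 \<oplus>\<^bsub>W\<^esub> f 3"
proof -
  interpret W: abelian_monoid W by (rule vs_monoid[OF assms])
  have s: "finsum W f {..<Suc n} = finsum W f {..<n} \<oplus>\<^bsub>W\<^esub> f n"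
    if "f \<in> {..<n} \<rightarrow> carrier W" "f n \<in> carrier W" for n
    using that by (simp add: lessThan_Suc W.a_comm)
  show 0: "finsum W f ({} :: nat set) = \<zero>\<^bsub>W\<^esub>" by simp
  show 1: "f 0 \<in> carrier W \<Longrightarrow> finsum W f {..<1::nat} = f 0"
    using s[of 0] 0 by (simp add: One_nat_def)
  show 2: "f 0 \<in> carrier W \<Longrightarrow> f 1 \<in> carrier W \<Longrightarrow> finsum W f {..<2::nat} = f 0 \<oplus>\<^bsub>W\<^esub> f 1"
    using s[of 1] 1 by (simp add: numeral_2_eq_2 One_nat_def lessThan_Suc)
  show 3: "f 0 \<in> carrier W \<Longrightarrow> f 1 \<in> carrier W \<Longrightarrow> f 2 \<in> carrier W \<Longrightarrow>
      finsum W f {..<3::nat} = f 0 \<oplus>\<^bsub>W\<^esub> f 1 \<oplus>\<^bsub>W\<^esub> f 2"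
    using s[of 2] 2 by (simp add: eval_nat_numeral One_nat_def lessThan_Suc)
  show "f 0 \<in> carrier W \<Longrightarrow> f 1 \<in> carrier W \<Longrightarrow> f 2 \<in> carrier W \<Longrightarrow> f 3 \<in> carrier W \<Longrightarrow>
      finsum W f {..<4::nat} = f 0 \<oplus>\<^bsub>W\<^esub> f 1 \<oplus>\<^bsub>W\<^esub> f 2 \<oplus>\<^bsub>W\<^esub> f 3"
    using s[of 3] 3 by (simp add: eval_nat_numeral One_nat_def lessThan_Suc)
qed

lemma nths_omit_pair:
  "nths [a, b] (- {0, 1}) = []"
  "nths [a, b, c] (- {0, 1}) = [c]" "nths [a, b, c] (- {0, 2}) = [b]" "nths [a, b, c] (- {1, 2}) = [a]"
  "nths [a, b, c, d] (- {0, 1}) = [c, d]" "nths [a, b, c, d] (- {0, 2}) = [b, d]"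
  "nths [a, b, c, d] (- {0, 3}) = [b, c]" "nths [a, b, c, d] (- {1, 2}) = [a, d]"
  "nths [a, b, c, d] (- {1, 3}) = [a, c]" "nths [a, b, c, d] (- {2, 3}) = [a, b]"
  by (simp_all add: nths_Cons eval_nat_numeral One_nat_def)

lemma minus_one_pow:
  "(\<ominus> \<one>) [^] (1::nat) = \<ominus> \<one>"
  "(\<ominus> \<one>) [^] (2::nat) = \<one>" "(\<ominus> \<one>) [^] (3::nat) = \<ominus> \<one>" "(\<ominus> \<one>) [^] (4::nat) = \<one>"
  "(\<ominus> \<one>) [^] (5::nat) = \<ominus> \<one>" "(\<ominus> \<one>) [^] (6::nat) = \<one>"
proof -
  have e: "(\<ominus> \<one>) [^] (n + 2) = (\<ominus> \<one>) [^] n" for n :: nat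
    by (simp add: numeral_2_eq_2 l_minus r_minus)
  show e1: "(\<ominus> \<one>) [^] (1::nat) = \<ominus> \<one>" by (simp add: One_nat_def)
  show e2: "(\<ominus> \<one>) [^] (2::nat) = \<one>" using e[of 0] by (simp only: add_0 nat_pow_0)
  show e3: "(\<ominus> \<one>) [^] (3::nat) = \<ominus> \<one>" and e4: "(\<ominus> \<one>) [^] (4::nat) = \<one>"
    using e[of 1] e[of 2] e1 e2 by simp_all
  show "(\<ominus> \<one>) [^] (5::nat) = \<ominus> \<one>" "(\<ominus> \<one>) [^] (6::nat) = \<one>"
    using e[of 3] e[of 4] e3 e4 by simp_all
qed

lemma ce_diff_props:
  assumes "vs L" "lin (ext_power K L n) (ext_power K L (n - 1)) h"
    and "\<And>xs. xs \<in> tuples L n \<Longrightarrow> h (wedge K L xs) =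
        (\<Oplus>\<^bsub>ext_power K L (n - 1)\<^esub>j\<in>{..<n}. \<Oplus>\<^bsub>ext_power K L (n - 1)\<^esub>i\<in>{..<j}.
           ((\<ominus> \<one>) [^] (i + j + 1)) \<odot>\<^bsub>ext_power K L (n - 1)\<^esub>
             wedge K L (bracket L (xs ! i) (xs ! j) # nths xs (- {i, j})))"
  shows "lin (ext_power K L n) (ext_power K L (n - 1)) (ce_diff K L n)"
    "\<And>x. x \<in> carrier (ext_power K L n) \<Longrightarrow> ce_diff K L n x = h x"
proof -
  let ?P = "\<lambda>f. \<forall>xs\<in>tuples L n. f (wedge K L xs) =
        (\<Oplus>\<^bsub>ext_power K L (n - 1)\<^esub>j\<in>{..<n}. \<Oplus>\<^bsub>ext_power K L (n - 1)\<^esub>i\<in>{..<j}.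
           ((\<ominus> \<one>) [^] (i + j + 1)) \<odot>\<^bsub>ext_power K L (n - 1)\<^esub>
             wedge K L (bracket L (xs ! i) (xs ! j) # nths xs (- {i, j})))"
  have P: "?P (restrict h (carrier (ext_power K L n)))"
    using assms(3) wedge_closed[OF assms(1)] by (simp del: wedge_closed)
  have un: "\<forall>p q. lin (ext_power K L n) (ext_power K L (n - 1)) p \<longrightarrow> lin (ext_power K L n) (ext_power K L (n - 1)) q \<longrightarrow>
      ?P p \<longrightarrow> ?P q \<longrightarrow> (\<forall>s\<in>wedge K L ` tuples L n. p s = q s)"
    by simp
  note t = the_hom_props[where P = ?P, OF spans_ext vs_ext vs_ext assms(2) P un, folded ce_diff_def]
  show "lin (ext_power K L n) (ext_power K L (n - 1)) (ce_diff K L n)" by (rule t(1))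
  show "\<And>x. x \<in> carrier (ext_power K L n) \<Longrightarrow> ce_diff K L n x = h x" by (rule t(4))
qed

text \<open>With a single factor the double sum over i < j is empty; hence every 1-chain is a
  cycle.\<close>

lemma ce_diff_1:
  assumes "vs L" "x \<in> carrier (ext_power K L 1)"
  shows "ce_diff K L 1 x = \<zero>\<^bsub>ext_power K L 0\<^esub>"
proof -
  have "\<zero>\<^bsub>ext_power K L 0\<^esub> = (\<Oplus>\<^bsub>ext_power K L 0\<^esub>j\<in>{..<1}. \<Oplus>\<^bsub>ext_power K L 0\<^esub>i\<in>{..<j}.
           ((\<ominus> \<one>) [^] (i + j + 1)) \<odot>\<^bsub>ext_power K L 0\<^esub>
             wedge K L (bracket L (xs ! i) (xs ! j) # nths xs (- {i, j})))" for xs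
    by (simp add: finsum_lessThan)
  then show ?thesis
    using ce_diff_props(2)[OF assms(1), of 1 "\<lambda>_. \<zero>\<^bsub>ext_power K L 0\<^esub>"] assms(2)
    by (simp add: lin_const_zero)
qed

lemma ce_diff_2:
  assumes L: "alt_bracket L"
  shows "lin (ext_power K L 2) (ext_power K L 1) (ce_diff K L 2)"
    "\<And>a b. a \<in> carrier L \<Longrightarrow> b \<in> carrier L \<Longrightarrow> ce_diff K L 2 (wedge K L [a, b]) = wedge K L [bracket L a b]"
proof -
  note v [simp] = alt_bracketD(1,4)[OF L]
  have "bilin L L (ext_power K L 1) (\<lambda>a b. wedge K L [bracket L a b])"
    using L v(1) by (intro bilinI lin_intros)
  moreover have "wedge K L [bracket L a a] = \<zero>\<^bsub>ext_power K L 1\<^esub>" if "a \<in> carrier L" for a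
    using alt_bracketD(3)[OF L that] lin_zero[OF mlin1[OF mlin_wedge[OF v(1)] v(1)] v(1) vs_ext] by simp
  ultimately obtain h where h: "lin (ext_power K L 2) (ext_power K L 1) h"
    "\<And>a b. a \<in> carrier L \<Longrightarrow> b \<in> carrier L \<Longrightarrow> h (wedge K L [a, b]) = wedge K L [bracket L a b]"
    by (rule ext2_lift[OF v(1) vs_ext]) blast+
  have "h (wedge K L xs) = (\<Oplus>\<^bsub>ext_power K L (2 - 1)\<^esub>j\<in>{..<2}. \<Oplus>\<^bsub>ext_power K L (2 - 1)\<^esub>i\<in>{..<j}.
           ((\<ominus> \<one>) [^] (i + j + 1)) \<odot>\<^bsub>ext_power K L (2 - 1)\<^esub>
             wedge K L (bracket L (xs ! i) (xs ! j) # nths xs (- {i, j})))" if xs: "xs \<in> tuples L 2" for xs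
  proof -
    obtain a b where "xs = [a, b]" "a \<in> carrier L" "b \<in> carrier L" using tuples_2[OF xs] by blast
    moreover have d: "(2::nat) - 1 = 1" by (simp add: One_nat_def)
    ultimately show ?thesis unfolding d
      using h(2) by (simp add: finsum_lessThan nths_omit_pair minus_one_pow nth_Cons')
  qed
  from ce_diff_props[OF v(1) _ this] h
  show "lin (ext_power K L 2) (ext_power K L 1) (ce_diff K L 2)"
    "\<And>a b. a \<in> carrier L \<Longrightarrow> b \<in> carrier L \<Longrightarrow> ce_diff K L 2 (wedge K L [a, b]) = wedge K L [bracket L a b]"
    by (simp_all add: One_nat_def)
qed

lemma ce_diff_3:
  assumes L: "alt_bracket L"
  shows "lin (ext_power K L 3) (ext_power K L 2) (ce_diff K L 3)"
    "\<And>a b c. a \<in> carrier L \<Longrightarrow> b \<in> carrier L \<Longrightarrow> c \<in> carrier L \<Longrightarrow> ce_diff K L 3 (wedge K L [a, b, c]) =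
      wedge K L [bracket L a b, c] \<ominus>\<^bsub>ext_power K L 2\<^esub> wedge K L [bracket L a c, b] \<oplus>\<^bsub>ext_power K L 2\<^esub>
      wedge K L [bracket L b c, a]"
proof -
  let ?E = "ext_power K L 2"
  note v [simp] = alt_bracketD(1,4)[OF L]
  let ?\<phi> = "\<lambda>a b c. wedge K L [bracket L a b, c] \<ominus>\<^bsub>?E\<^esub> wedge K L [bracket L a c, b] \<oplus>\<^bsub>?E\<^esub>
      wedge K L [bracket L b c, a]"
  have alt: "?\<phi> a a b = \<zero>\<^bsub>?E\<^esub> \<and> ?\<phi> a b a = \<zero>\<^bsub>?E\<^esub> \<and> ?\<phi> b a a = \<zero>\<^bsub>?E\<^esub>"
    if a: "a \<in> carrier L" and b: "b \<in> carrier L" for a b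
  proof -
    have z: "wedge K L [\<zero>\<^bsub>L\<^esub>, y] = \<zero>\<^bsub>?E\<^esub>" if "y \<in> carrier L" for y
      using lin_zero[OF lin_wedge2(1)[OF v(1) lin_id that] v(1) vs_ext] .
    have n: "wedge K L [bracket L b a, a] = \<ominus>\<^bsub>?E\<^esub> wedge K L [bracket L a b, a]"
      unfolding alt_bracketD(5)[OF L b a]
      using lin_neg[OF lin_wedge2(1)[OF v(1) lin_id a] v(1) vs_ext] a b by simp
    show ?thesis using a b n by (simp add: z alt_bracketD(3)[OF L] a_minus_def)
  qed
  have l: "lin L ?E (\<lambda>a. ?\<phi> a b c)" "lin L ?E (\<lambda>a. ?\<phi> b a c)" "lin L ?E (\<lambda>a. ?\<phi> b c a)"
    if "b \<in> carrier L" "c \<in> carrier L" for b c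
    using that L by (intro lin_intros; simp)+
  obtain h where h: "lin (ext_power K L 3) ?E h"
    "\<And>a b c. a \<in> carrier L \<Longrightarrow> b \<in> carrier L \<Longrightarrow> c \<in> carrier L \<Longrightarrow> h (wedge K L [a, b, c]) = ?\<phi> a b c"
    by (rule ext3_lift[of L ?E ?\<phi>, OF v(1) vs_ext l alt]) blast+
  have "h (wedge K L xs) = (\<Oplus>\<^bsub>ext_power K L (3 - 1)\<^esub>j\<in>{..<3}. \<Oplus>\<^bsub>ext_power K L (3 - 1)\<^esub>i\<in>{..<j}.
           ((\<ominus> \<one>) [^] (i + j + 1)) \<odot>\<^bsub>ext_power K L (3 - 1)\<^esub>
             wedge K L (bracket L (xs ! i) (xs ! j) # nths xs (- {i, j})))" if xs: "xs \<in> tuples L 3" for xs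
  proof -
    obtain a b c where "xs = [a, b, c]" "a \<in> carrier L" "b \<in> carrier L" "c \<in> carrier L"
      using tuples_3[OF xs] by blast
    then show ?thesis
      using h(2) by (simp add: finsum_lessThan nths_omit_pair minus_one_pow nth_Cons' vs_neg_smult
        l_minus r_minus a_minus_def vs_assoc)
  qed
  from ce_diff_props[OF v(1) _ this] h
  show "lin (ext_power K L 3) ?E (ce_diff K L 3)"
    "\<And>a b c. a \<in> carrier L \<Longrightarrow> b \<in> carrier L \<Longrightarrow> c \<in> carrier L \<Longrightarrow> ce_diff K L 3 (wedge K L [a, b, c]) = ?\<phi> a b c"
    by simp_all
qed

text \<open>The terms stand in the order of the double sum, with j outside and i inside: the pairs
  01, 02, 12, 03, 13, 23. This explains the sign pattern + - + + - +.\<close>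

lemma ce_diff_4:
  assumes L: "alt_bracket L"
  shows "lin (ext_power K L 4) (ext_power K L 3) (ce_diff K L 4)"
    "\<And>a b c d. a \<in> carrier L \<Longrightarrow> b \<in> carrier L \<Longrightarrow> c \<in> carrier L \<Longrightarrow> d \<in> carrier L \<Longrightarrow>
      ce_diff K L 4 (wedge K L [a, b, c, d]) =
      wedge K L [bracket L a b, c, d] \<ominus>\<^bsub>ext_power K L 3\<^esub> wedge K L [bracket L a c, b, d] \<oplus>\<^bsub>ext_power K L 3\<^esub>
      wedge K L [bracket L b c, a, d] \<oplus>\<^bsub>ext_power K L 3\<^esub> wedge K L [bracket L a d, b, c] \<ominus>\<^bsub>ext_power K L 3\<^esub>
      wedge K L [bracket L b d, a, c] \<oplus>\<^bsub>ext_power K L 3\<^esub> wedge K L [bracket L c d, a, b]"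
proof -
  let ?E = "ext_power K L 3"
  note v [simp] = alt_bracketD(1,4)[OF L]
  let ?\<phi> = "\<lambda>a b c d. wedge K L [bracket L a b, c, d] \<ominus>\<^bsub>?E\<^esub> wedge K L [bracket L a c, b, d] \<oplus>\<^bsub>?E\<^esub>
      wedge K L [bracket L b c, a, d] \<oplus>\<^bsub>?E\<^esub> wedge K L [bracket L a d, b, c] \<ominus>\<^bsub>?E\<^esub>
      wedge K L [bracket L b d, a, c] \<oplus>\<^bsub>?E\<^esub> wedge K L [bracket L c d, a, b]"
  have alt: "?\<phi> a a b c = \<zero>\<^bsub>?E\<^esub> \<and> ?\<phi> a b a c = \<zero>\<^bsub>?E\<^esub> \<and> ?\<phi> a b c a = \<zero>\<^bsub>?E\<^esub> \<and>
      ?\<phi> b a a c = \<zero>\<^bsub>?E\<^esub> \<and> ?\<phi> b a c a = \<zero>\<^bsub>?E\<^esub> \<and> ?\<phi> b c a a = \<zero>\<^bsub>?E\<^esub>"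
    if a: "a \<in> carrier L" and b: "b \<in> carrier L" and c: "c \<in> carrier L" for a b c
  proof -
    have z: "wedge K L [\<zero>\<^bsub>L\<^esub>, y, u] = \<zero>\<^bsub>?E\<^esub>" if "y \<in> carrier L" "u \<in> carrier L" for y u
      using lin_zero[OF lin_wedge3(1)[OF v(1) lin_id that] v(1) vs_ext] .
    have n: "wedge K L [\<ominus>\<^bsub>L\<^esub> x, y, u] = \<ominus>\<^bsub>?E\<^esub> wedge K L [x, y, u]"
      if "x \<in> carrier L" "y \<in> carrier L" "u \<in> carrier L" for x y u
      using lin_neg[OF lin_wedge3(1)[OF v(1) lin_id that(2,3)] v(1) vs_ext that(1)] .
    have w: "wedge K L [x, b, a] = \<ominus>\<^bsub>?E\<^esub> wedge K L [x, a, b]" "wedge K L [x, c, a] = \<ominus>\<^bsub>?E\<^esub> wedge K L [x, a, c]"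
      if "x \<in> carrier L" for x
      using wedge3_swap(2)[OF v(1) that] a b c by blast+
    note s = alt_bracketD(5)[OF L b a] alt_bracketD(5)[OF L c a]
    note [simp] = a b c z n alt_bracketD(3)[OF L]
    have "?\<phi> a a b c = \<zero>\<^bsub>?E\<^esub>" by (rule sg_eqI[of ?E]) (simp_all add: sg_simps)
    moreover have "?\<phi> a b a c = \<zero>\<^bsub>?E\<^esub>" unfolding s
      by (rule sg_eqI[of ?E]) (simp_all add: w sg_simps)
    moreover have "?\<phi> a b c a = \<zero>\<^bsub>?E\<^esub>" unfolding s
      by (rule sg_eqI[of ?E]) (simp_all add: w sg_simps)
    moreover have "?\<phi> b a a c = \<zero>\<^bsub>?E\<^esub>" unfolding s
      by (rule sg_eqI[of ?E]) (simp_all add: w sg_simps)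
    moreover have "?\<phi> b a c a = \<zero>\<^bsub>?E\<^esub>" unfolding s
      by (rule sg_eqI[of ?E]) (simp_all add: w sg_simps)
    moreover have "?\<phi> b c a a = \<zero>\<^bsub>?E\<^esub>" unfolding s
      by (rule sg_eqI[of ?E]) (simp_all add: w sg_simps)
    ultimately show ?thesis by blast
  qed
  have l: "lin L ?E (\<lambda>a. ?\<phi> a b c d)" "lin L ?E (\<lambda>a. ?\<phi> b a c d)"
    "lin L ?E (\<lambda>a. ?\<phi> b c a d)" "lin L ?E (\<lambda>a. ?\<phi> b c d a)"
    if "b \<in> carrier L" "c \<in> carrier L" "d \<in> carrier L" for b c d
    using that L by (intro lin_intros; simp)+
  obtain h where h: "lin (ext_power K L 4) ?E h"
    "\<And>a b c d. a \<in> carrier L \<Longrightarrow> b \<in> carrier L \<Longrightarrow> c \<in> carrier L \<Longrightarrow> d \<in> carrier L \<Longrightarrow>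
      h (wedge K L [a, b, c, d]) = ?\<phi> a b c d"
    by (rule ext4_lift[of L ?E ?\<phi>, OF v(1) vs_ext l alt]) blast+
  have "h (wedge K L xs) = (\<Oplus>\<^bsub>ext_power K L (4 - 1)\<^esub>j\<in>{..<4}. \<Oplus>\<^bsub>ext_power K L (4 - 1)\<^esub>i\<in>{..<j}.
           ((\<ominus> \<one>) [^] (i + j + 1)) \<odot>\<^bsub>ext_power K L (4 - 1)\<^esub>
             wedge K L (bracket L (xs ! i) (xs ! j) # nths xs (- {i, j})))" if xs: "xs \<in> tuples L 4" for xs
  proof -
    obtain a b c d where "xs = [a, b, c, d]" "a \<in> carrier L" "b \<in> carrier L" "c \<in> carrier L" "d \<in> carrier L"
      using tuples_4[OF xs] by blast
    then show ?thesis
      using h(2) by (simp add: finsum_lessThan nths_omit_pair minus_one_pow nth_Cons' vs_neg_smult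
        l_minus r_minus a_minus_def vs_assoc)
  qed
  from ce_diff_props[OF v(1) _ this] h
  show "lin (ext_power K L 4) ?E (ce_diff K L 4)"
    "\<And>a b c d. a \<in> carrier L \<Longrightarrow> b \<in> carrier L \<Longrightarrow> c \<in> carrier L \<Longrightarrow> d \<in> carrier L \<Longrightarrow>
      ce_diff K L 4 (wedge K L [a, b, c, d]) = ?\<phi> a b c d"
    by simp_all
qed

subsection \<open>Homology\<close>

text \<open>A coset of the boundaries is the same set, whether formed among the cycles or in the
  whole exterior power. So homology lies inside the quotient of all chains by boundaries; for A
  \<otimes> L this larger quotient is \<open>Q\<close>, on which maps are defined without a cycle
  condition.\<close>

lemma homology_eq: "homology K L n =
    restrict_to (quot_mod (ext_power K L n) (ce_boundaries K L n)) (homology_class K L n ` ce_cycles K L n)"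
  unfolding homology_def quot_mod_def homology_class_def
  by (auto simp: A_RCOSETS_def' a_r_coset_def' set_add_def' fun_eq_iff image_def)

lemma lin_homology_class:
  "sub (ce_boundaries K L n) (ext_power K L n) \<Longrightarrow>
    lin (ext_power K L n) (quot_mod (ext_power K L n) (ce_boundaries K L n)) (homology_class K L n)"
  using lin_coset[OF vs_ext] unfolding homology_class_def .

lemma sub_boundaries:
  "alt_bracket L \<Longrightarrow> sub (ce_boundaries K L 1) (ext_power K L 1)"
  "alt_bracket L \<Longrightarrow> sub (ce_boundaries K L 2) (ext_power K L 2)"
  "alt_bracket L \<Longrightarrow> sub (ce_boundaries K L 3) (ext_power K L 3)"
  using sub_image[OF vs_ext vs_ext ce_diff_2(1) sub_carrier[OF vs_ext], of L]
    sub_image[OF vs_ext vs_ext ce_diff_3(1) sub_carrier[OF vs_ext], of L]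
    sub_image[OF vs_ext vs_ext ce_diff_4(1) sub_carrier[OF vs_ext], of L]
  by (simp_all add: ce_boundaries_def)

lemma cycles_iff: "z \<in> ce_cycles K L n \<longleftrightarrow>
    z \<in> carrier (ext_power K L n) \<and> ce_diff K L n z = \<zero>\<^bsub>ext_power K L (n - 1)\<^esub>"
  by (simp add: ce_cycles_def a_kernel_def')

lemma cycles_1:
  assumes "vs L"
  shows "ce_cycles K L 1 = carrier (ext_power K L 1)"
proof -
  have "x \<in> ce_cycles K L 1 \<longleftrightarrow> x \<in> carrier (ext_power K L 1)" for x
    using ce_diff_1[OF assms, of x] by (simp only: cycles_iff diff_self_eq_0) blast
  then show ?thesis by blast
qed

lemma sub_cycles:
  "vs L \<Longrightarrow> sub (ce_cycles K L 1) (ext_power K L 1)"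
  "alt_bracket L \<Longrightarrow> sub (ce_cycles K L 2) (ext_power K L 2)"
  "alt_bracket L \<Longrightarrow> sub (ce_cycles K L 3) (ext_power K L 3)"
  using sub_kernel[OF vs_ext vs_ext ce_diff_2(1), of L] sub_kernel[OF vs_ext vs_ext ce_diff_3(1), of L]
  by (simp_all add: cycles_1) (simp_all add: ce_cycles_def a_kernel_def' One_nat_def)

lemma sub_homology:
  assumes "sub (ce_boundaries K L n) (ext_power K L n)" "sub (ce_cycles K L n) (ext_power K L n)"
  shows "sub (homology_class K L n ` ce_cycles K L n) (quot_mod (ext_power K L n) (ce_boundaries K L n))"
  by (rule sub_image[OF vs_ext vs_quot[OF vs_ext assms(1)] lin_homology_class[OF assms(1)] assms(2)])

lemma vs_homology:
  assumes "sub (ce_boundaries K L n) (ext_power K L n)" "sub (ce_cycles K L n) (ext_power K L n)"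
  shows "vs (homology K L n)"
  unfolding homology_eq by (intro vs_restrict vs_quot vs_ext assms sub_homology)

lemma lin_homology_class_cycles:
  assumes "sub (ce_boundaries K L n) (ext_power K L n)" "sub (ce_cycles K L n) (ext_power K L n)"
  shows "lin (restrict_to (ext_power K L n) (ce_cycles K L n)) (homology K L n) (homology_class K L n)"
  unfolding homology_eq
  by (intro lin_into_restrict lin_restrict_dom lin_homology_class assms vs_ext) auto

lemma homology_class_zero_iff:
  assumes "sub (ce_boundaries K L n) (ext_power K L n)" "z \<in> carrier (ext_power K L n)"
  shows "homology_class K L n z = \<zero>\<^bsub>homology K L n\<^esub> \<longleftrightarrow> z \<in> ce_boundaries K L n"
  using coset_eq_zero_iff[OF vs_ext assms] by (simp add: homology_eq homology_class_def)

lemma carrier_homology: "carrier (homology K L n) = homology_class K L n ` ce_cycles K L n"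
  by (simp add: homology_eq)

end

subsection \<open>The Killing module and the Koszul map\<close>

locale lie_over_field = base_field K for K :: "('k, 'r) ring_scheme" (structure) +
  fixes L :: "('k, 'l, 'n) lie_algebra_scheme"
  assumes lie: "lie_algebra K L"
begin

lemma alt_L: "alt_bracket L"
proof -
  interpret L: lie_algebra K L by (rule lie)
  have "vs L" by (rule L.module_axioms)
  then show ?thesis
    unfolding alt_bracket_def
    by (auto intro!: bilinI linI simp: L.bracket_closed L.bracket_add_left L.bracket_add_right
      L.bracket_smult_left L.bracket_smult_right L.bracket_self)
qed

lemmas vs_L [simp] = alt_bracketD(1)[OF alt_L]
lemmas bracket_self_L [simp] = alt_bracketD(3)[OF alt_L]
lemmas bracket_closed_L [simp] = alt_bracketD(4)[OF alt_L]
lemmas bracket_skew_L = alt_bracketD(5)[OF alt_L]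
lemmas lin_bracket_L [lin_intros] = lin_bracket[OF alt_L]

lemma jacobi_L:
  "x \<in> carrier L \<Longrightarrow> y \<in> carrier L \<Longrightarrow> z \<in> carrier L \<Longrightarrow>
    bracket L x (bracket L y z) \<oplus>\<^bsub>L\<^esub> bracket L y (bracket L z x) \<oplus>\<^bsub>L\<^esub> bracket L z (bracket L x y) = \<zero>\<^bsub>L\<^esub>"
  by (rule lie_algebra.jacobi[OF lie])

lemma killing_map:
  shows "lin (tensor_power K L 3) (sym_power K L 2) (killing_map K L)"
    "\<And>x y z. x \<in> carrier L \<Longrightarrow> y \<in> carrier L \<Longrightarrow> z \<in> carrier L \<Longrightarrow>
      killing_map K L (pure_tensor K L [x, y, z]) =
      symprod K L [bracket L x y, z] \<ominus>\<^bsub>sym_power K L 2\<^esub> symprod K L [x, bracket L y z]"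
proof -
  let ?S = "sym_power K L 2"
  let ?\<phi> = "\<lambda>x y z. symprod K L [bracket L x y, z] \<ominus>\<^bsub>?S\<^esub> symprod K L [x, bracket L y z]"
  have l: "lin L ?S (\<lambda>a. ?\<phi> a b c)" "lin L ?S (\<lambda>a. ?\<phi> b a c)" "lin L ?S (\<lambda>a. ?\<phi> b c a)"
    if "b \<in> carrier L" "c \<in> carrier L" for b c
    using that by (intro lin_intros; simp)+
  obtain h where h: "lin (tensor_power K L 3) ?S h"
    "\<And>a b c. a \<in> carrier L \<Longrightarrow> b \<in> carrier L \<Longrightarrow> c \<in> carrier L \<Longrightarrow> h (pure_tensor K L [a, b, c]) = ?\<phi> a b c"
    by (rule tpow3_lift[of L ?S ?\<phi>, OF vs_L vs_sym l]) blast+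
  let ?P = "\<lambda>f. \<forall>x\<in>carrier L. \<forall>y\<in>carrier L. \<forall>z\<in>carrier L. f (pure_tensor K L [x, y, z]) = ?\<phi> x y z"
  have P: "?P (restrict h (carrier (tensor_power K L 3)))" using h(2) by simp
  have un: "\<forall>p q. lin (tensor_power K L 3) ?S p \<longrightarrow> lin (tensor_power K L 3) ?S q \<longrightarrow>
      ?P p \<longrightarrow> ?P q \<longrightarrow> (\<forall>s\<in>pure_tensor K L ` tuples L 3. p s = q s)"
    by (auto dest!: tuples_3)
  note t = the_hom_props[where P = ?P, OF spans_tpow vs_tpow vs_sym h(1) P un, folded killing_map_def]
  show "lin (tensor_power K L 3) ?S (killing_map K L)" by (rule t(1))
  show "\<And>x y z. x \<in> carrier L \<Longrightarrow> y \<in> carrier L \<Longrightarrow> z \<in> carrier L \<Longrightarrow>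
      killing_map K L (pure_tensor K L [x, y, z]) = ?\<phi> x y z" using t(2) by blast
qed

abbreviation "kill_rels \<equiv> killing_map K L ` carrier (tensor_power K L 3)"

lemma sub_kill_rels: "sub kill_rels (sym_power K L 2)"
  by (rule sub_image[OF vs_tpow vs_sym killing_map(1) sub_carrier[OF vs_tpow]])

lemma vs_Kill [simp]: "vs (Kill K L)"
  unfolding Kill_def by (rule vs_quot[OF vs_sym sub_kill_rels])

lemma lin_kill_class: "lin (sym_power K L 2) (Kill K L) (kill_class K L)"
  using lin_coset[OF vs_sym sub_kill_rels] unfolding Kill_def kill_class_def .

lemma kill_class_surj: "carrier (Kill K L) \<subseteq> kill_class K L ` carrier (sym_power K L 2)"
  unfolding Kill_def kill_class_def by (simp add: quot_carrier)

lemma kill_class_eq_zero_iff: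
  "s \<in> carrier (sym_power K L 2) \<Longrightarrow> kill_class K L s = \<zero>\<^bsub>Kill K L\<^esub> \<longleftrightarrow> s \<in> kill_rels"
  using coset_eq_zero_iff[OF vs_sym sub_kill_rels] unfolding Kill_def kill_class_def .

lemma kill_lift:
  assumes "vs W" "lin (sym_power K L 2) W f"
    "\<And>t. t \<in> carrier (tensor_power K L 3) \<Longrightarrow> f (killing_map K L t) = \<zero>\<^bsub>W\<^esub>"
  obtains h where "lin (Kill K L) W h"
    "\<And>s. s \<in> carrier (sym_power K L 2) \<Longrightarrow> h (kill_class K L s) = f s"
proof -
  obtain h where "lin (quot_mod (sym_power K L 2) kill_rels) W h"
    "\<And>s. s \<in> carrier (sym_power K L 2) \<Longrightarrow> h (kill_rels +>\<^bsub>sym_power K L 2\<^esub> s) = f s"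
    by (rule quot_lift[OF vs_sym assms(1) sub_kill_rels assms(2)]) (use assms(3) in blast)+
  then show thesis by (intro that) (simp_all add: Kill_def kill_class_def)
qed

lemmas lin_kill_class' [lin_intros] = lin_comp[OF lin_kill_class]

lemma kill_class_closed [simp]: "s \<in> carrier (sym_power K L 2) \<Longrightarrow> kill_class K L s \<in> carrier (Kill K L)"
  by (rule lin_closed[OF lin_kill_class])

text \<open>The class of x \<odot> y is the universal invariant symmetric bilinear form on L.
  Invariance and symmetry together make the class of [x,y] \<odot> z invariant under cyclic rotation
  of x, y, z.\<close>

lemma kill_class_invariant:
  assumes "x \<in> carrier L" "y \<in> carrier L" "z \<in> carrier L"
  shows "kill_class K L (symprod K L [bracket L x y, z]) = kill_class K L (symprod K L [x, bracket L y z])"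
proof -
  have "symprod K L [bracket L x y, z] \<ominus>\<^bsub>sym_power K L 2\<^esub> symprod K L [x, bracket L y z] \<in> kill_rels"
    using killing_map(2)[OF assms] assms by (metis image_eqI pure_tensor_closed tuple_iff(3))
  then have "kill_class K L (symprod K L [bracket L x y, z] \<ominus>\<^bsub>sym_power K L 2\<^esub> symprod K L [x, bracket L y z]) = \<zero>\<^bsub>Kill K L\<^esub>"
    using assms by (subst kill_class_eq_zero_iff) auto
  then show ?thesis
    using lin_minus[OF lin_kill_class vs_sym vs_Kill, of "symprod K L [bracket L x y, z]" "symprod K L [x, bracket L y z]"] assms
    by (simp add: vs_minus_eq_zero_iff)
qed

lemma lin_kill_symprod:
  "y \<in> carrier L \<Longrightarrow> lin L (Kill K L) (\<lambda>x. kill_class K L (symprod K L [x, y]))"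
  "y \<in> carrier L \<Longrightarrow> lin L (Kill K L) (\<lambda>x. kill_class K L (symprod K L [y, x]))"
  by (intro lin_intros; simp)+

lemma koszul:
  shows "lin (ext_power K L 3) (Kill K L) (koszul K L)"
    "\<And>x y z. x \<in> carrier L \<Longrightarrow> y \<in> carrier L \<Longrightarrow> z \<in> carrier L \<Longrightarrow>
      koszul K L (wedge K L [x, y, z]) = kill_class K L (symprod K L [x, bracket L y z])"
proof -
  let ?W = "Kill K L"
  let ?\<phi> = "\<lambda>x y z. kill_class K L (symprod K L [x, bracket L y z])"
  have l: "lin L ?W (\<lambda>a. ?\<phi> a b c)" "lin L ?W (\<lambda>a. ?\<phi> b a c)" "lin L ?W (\<lambda>a. ?\<phi> b c a)"
    if "b \<in> carrier L" "c \<in> carrier L" for b c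
    using that by (intro lin_intros; simp)+
  \<comment> \<open>For two equal leading arguments, invariance moves the bracket: a \<odot> [a,b]
    has the same class as [a,a] \<odot> b, which is zero.\<close>
  have z: "?\<phi> b a a = \<zero>\<^bsub>?W\<^esub>" "?\<phi> a a b = \<zero>\<^bsub>?W\<^esub>" if "a \<in> carrier L" "b \<in> carrier L" for a b
    using that lin_zero[OF lin_kill_symprod(1) vs_L vs_Kill, of b] lin_zero[OF lin_kill_symprod(2) vs_L vs_Kill, of b]
      kill_class_invariant[of a a b] by simp_all
  have alt: "?\<phi> a a b = \<zero>\<^bsub>?W\<^esub> \<and> ?\<phi> a b a = \<zero>\<^bsub>?W\<^esub> \<and> ?\<phi> b a a = \<zero>\<^bsub>?W\<^esub>"
    if "a \<in> carrier L" "b \<in> carrier L" for a b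
  proof -
    have "?\<phi> a b a = kill_class K L (symprod K L [a, \<ominus>\<^bsub>L\<^esub> bracket L a b])"
      using bracket_skew_L[OF that(2,1)] by simp
    also have "\<dots> = \<ominus>\<^bsub>?W\<^esub> ?\<phi> a a b"
      using that by (intro lin_neg[OF lin_kill_symprod(2) vs_L vs_Kill]) auto
    finally show ?thesis using z that by simp
  qed
  obtain h where h: "lin (ext_power K L 3) ?W h"
    "\<And>a b c. a \<in> carrier L \<Longrightarrow> b \<in> carrier L \<Longrightarrow> c \<in> carrier L \<Longrightarrow> h (wedge K L [a, b, c]) = ?\<phi> a b c"
    by (rule ext3_lift[of L ?W ?\<phi>, OF vs_L vs_Kill l alt]) blast+
  let ?P = "\<lambda>f. \<forall>x\<in>carrier L. \<forall>y\<in>carrier L. \<forall>z\<in>carrier L. f (wedge K L [x, y, z]) = ?\<phi> x y z"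
  have P: "?P (restrict h (carrier (ext_power K L 3)))" using h(2) by simp
  have un: "\<forall>p q. lin (ext_power K L 3) ?W p \<longrightarrow> lin (ext_power K L 3) ?W q \<longrightarrow>
      ?P p \<longrightarrow> ?P q \<longrightarrow> (\<forall>s\<in>wedge K L ` tuples L 3. p s = q s)"
    by (auto dest!: tuples_3)
  note t = the_hom_props[where P = ?P, OF spans_ext vs_ext vs_Kill h(1) P un, folded koszul_def]
  show "lin (ext_power K L 3) ?W (koszul K L)" by (rule t(1))
  show "\<And>x y z. x \<in> carrier L \<Longrightarrow> y \<in> carrier L \<Longrightarrow> z \<in> carrier L \<Longrightarrow>
      koszul K L (wedge K L [x, y, z]) = ?\<phi> x y z" using t(2) by blast
qed

text \<open>The differential of a \<and> b \<and> c \<and> d has six terms. Symmetry of the form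
  makes them equal in pairs, and invariance moves all other brackets into the second argument
  against a; what appears is twice the Jacobi sum of b, c, d paired with a.\<close>

lemma koszul_boundary:
  assumes "z \<in> ce_boundaries K L 3"
  shows "koszul K L z = \<zero>\<^bsub>Kill K L\<^esub>"
proof -
  let ?W = "Kill K L" and ?E = "ext_power K L 3"
  let ?k = "\<lambda>x y. kill_class K L (symprod K L [x, y])"
  have "koszul K L (ce_diff K L 4 w) = \<zero>\<^bsub>?W\<^esub>" if "w \<in> carrier (ext_power K L 4)" for w
  proof (rule lin_vanish[OF spans_ext lin_comp[OF koszul(1) ce_diff_4(1)[OF alt_L]] vs_ext vs_Kill _ that])
    fix s assume "s \<in> wedge K L ` tuples L 4"
    then obtain a b c d where s: "s = wedge K L [a, b, c, d]"
      and [simp]: "a \<in> carrier L" "b \<in> carrier L" "c \<in> carrier L" "d \<in> carrier L"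
      using tuples_4 by blast
    have comm: "?k (bracket L x y) (bracket L u v) = ?k (bracket L u v) (bracket L x y)"
      if "x \<in> carrier L" "y \<in> carrier L" "u \<in> carrier L" "v \<in> carrier L" for x y u v
      using that symprod2_comm[of "bracket L x y" L "bracket L u v"] by simp
    have inv: "?k (bracket L a y) (bracket L u v) = ?k a (bracket L y (bracket L u v))"
      if "y \<in> carrier L" "u \<in> carrier L" "v \<in> carrier L" for y u v
      using that by (simp add: kill_class_invariant)
    have neg: "?k a (bracket L c (bracket L b d)) = \<ominus>\<^bsub>?W\<^esub> ?k a (bracket L c (bracket L d b))"
      using bracket_skew_L[of b d] lin_neg[OF lin_bracket_L(2)[OF lin_id, of c], of "bracket L d b"]
        lin_neg[OF lin_kill_symprod(2), of a "bracket L c (bracket L d b)"] by simp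
    have jac: "?k a (bracket L b (bracket L c d)) \<oplus>\<^bsub>?W\<^esub> ?k a (bracket L c (bracket L d b)) \<oplus>\<^bsub>?W\<^esub>
        ?k a (bracket L d (bracket L b c)) = \<zero>\<^bsub>?W\<^esub>"
      using jacobi_L[of b c d] lin_zero[OF lin_kill_symprod(2), of a]
        lin_add[OF lin_kill_symprod(2), of a "bracket L b (bracket L c d) \<oplus>\<^bsub>L\<^esub> bracket L c (bracket L d b)" "bracket L d (bracket L b c)"]
        lin_add[OF lin_kill_symprod(2), of a "bracket L b (bracket L c d)" "bracket L c (bracket L d b)"]
      by simp
    let ?p = "?k a (bracket L b (bracket L c d))" and ?q = "?k a (bracket L c (bracket L d b))"
      and ?r = "?k a (bracket L d (bracket L b c))"
    have "koszul K L (ce_diff K L 4 s) =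
      ?k (bracket L a b) (bracket L c d) \<ominus>\<^bsub>?W\<^esub> ?k (bracket L a c) (bracket L b d) \<oplus>\<^bsub>?W\<^esub>
      ?k (bracket L b c) (bracket L a d) \<oplus>\<^bsub>?W\<^esub> ?k (bracket L a d) (bracket L b c) \<ominus>\<^bsub>?W\<^esub>
      ?k (bracket L b d) (bracket L a c) \<oplus>\<^bsub>?W\<^esub> ?k (bracket L c d) (bracket L a b)"
      unfolding s by (simp add: ce_diff_4(2)[OF alt_L] lin_add[OF koszul(1)] lin_minus[OF koszul(1)] koszul(2))
    also have "\<dots> = (?p \<oplus>\<^bsub>?W\<^esub> ?q \<oplus>\<^bsub>?W\<^esub> ?r) \<oplus>\<^bsub>?W\<^esub> (?p \<oplus>\<^bsub>?W\<^esub> ?q \<oplus>\<^bsub>?W\<^esub> ?r)"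
      by (rule sg_eqI[of ?W]) (simp_all add: comm[of b c a d] comm[of b d a c] comm[of c d a b] inv neg sg_simps)
    also have "\<dots> = \<zero>\<^bsub>?W\<^esub>" unfolding jac by simp
    finally show "koszul K L (ce_diff K L 4 s) = \<zero>\<^bsub>?W\<^esub>" .
  qed
  then show ?thesis using assms by (auto simp: ce_boundaries_def)
qed

lemma reduced_koszul:
  assumes "z \<in> ce_cycles K L 3"
  shows "reduced_koszul K L (homology_class K L 3 z) = koszul K L z"
proof -
  let ?E = "ext_power K L 3" and ?B = "ce_boundaries K L 3" and ?H = "homology K L 3"
  note B = sub_boundaries(3)[OF alt_L] and Z = sub_cycles(3)[OF alt_L]
  obtain h where h: "lin (quot_mod ?E ?B) (Kill K L) h"
    "\<And>x. x \<in> carrier ?E \<Longrightarrow> h (?B +>\<^bsub>?E\<^esub> x) = koszul K L x"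
    using quot_lift[OF vs_ext vs_Kill B koszul(1) koszul_boundary] by metis
  have H: "lin ?H (Kill K L) h"
    unfolding homology_eq by (rule lin_restrict_dom[OF h(1) vs_quot[OF vs_ext B] sub_homology[OF B Z]])
  let ?P = "\<lambda>f. \<forall>z\<in>ce_cycles K L 3. f (homology_class K L 3 z) = koszul K L z"
  have P: "?P (restrict h (carrier ?H))"
    using h(2) sub_closed(1)[OF Z vs_ext] by (simp add: carrier_homology homology_class_def)
  have un: "\<forall>p q. lin ?H (Kill K L) p \<longrightarrow> lin ?H (Kill K L) q \<longrightarrow> ?P p \<longrightarrow> ?P q \<longrightarrow> (\<forall>s\<in>carrier ?H. p s = q s)"
    by (simp add: carrier_homology)
  note t = the_hom_props[where P = ?P, OF spans_carrier vs_homology[OF B Z] vs_Kill H P un, folded reduced_koszul_def]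
  show ?thesis using t(2) assms by blast
qed

text \<open>On a \<and> b \<and> c the composite of the two differentials is minus the Jacobi
  sum.\<close>

lemma boundaries_2_subset_cycles: "ce_boundaries K L 2 \<subseteq> ce_cycles K L 2"
proof -
  let ?E = "ext_power K L 1" and ?w = "\<lambda>x. wedge K L [x]"
  note w = mlin1[OF mlin_wedge[OF vs_L] vs_L]
  have "ce_diff K L 2 (ce_diff K L 3 w) = \<zero>\<^bsub>?E\<^esub>" if "w \<in> carrier (ext_power K L 3)" for w
  proof (rule lin_vanish[OF spans_ext lin_comp[OF ce_diff_2(1)[OF alt_L] ce_diff_3(1)[OF alt_L]] vs_ext vs_ext _ that])
    fix s assume "s \<in> wedge K L ` tuples L 3"
    then obtain a b c where s: "s = wedge K L [a, b, c]"
      and [simp]: "a \<in> carrier L" "b \<in> carrier L" "c \<in> carrier L"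
      using tuples_3 by blast
    have "bracket L (bracket L a c) b = \<ominus>\<^bsub>L\<^esub> bracket L b (bracket L a c)"
      by (rule bracket_skew_L) simp_all
    also have "bracket L b (bracket L a c) = \<ominus>\<^bsub>L\<^esub> bracket L b (bracket L c a)"
      unfolding bracket_skew_L[OF \<open>a \<in> carrier L\<close> \<open>c \<in> carrier L\<close>]
      by (rule lin_neg[OF lin_bracket_L(2)[OF lin_id]]) simp_all
    finally have e: "bracket L (bracket L a c) b = bracket L b (bracket L c a)"
      "bracket L (bracket L a b) c = \<ominus>\<^bsub>L\<^esub> bracket L c (bracket L a b)"
      "bracket L (bracket L b c) a = \<ominus>\<^bsub>L\<^esub> bracket L a (bracket L b c)"
      by (simp_all add: bracket_skew_L[of "bracket L a b" c] bracket_skew_L[of "bracket L b c" a])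
    have "bracket L (bracket L a b) c \<ominus>\<^bsub>L\<^esub> bracket L (bracket L a c) b \<oplus>\<^bsub>L\<^esub> bracket L (bracket L b c) a =
      \<ominus>\<^bsub>L\<^esub> (bracket L a (bracket L b c) \<oplus>\<^bsub>L\<^esub> bracket L b (bracket L c a) \<oplus>\<^bsub>L\<^esub> bracket L c (bracket L a b))"
      by (rule sg_eqI[of L]) (simp_all add: e sg_simps)
    then have j: "bracket L (bracket L a b) c \<ominus>\<^bsub>L\<^esub> bracket L (bracket L a c) b \<oplus>\<^bsub>L\<^esub> bracket L (bracket L b c) a = \<zero>\<^bsub>L\<^esub>"
      by (simp add: jacobi_L)
    have "ce_diff K L 2 (ce_diff K L 3 s) =
      ?w (bracket L (bracket L a b) c) \<ominus>\<^bsub>?E\<^esub> ?w (bracket L (bracket L a c) b) \<oplus>\<^bsub>?E\<^esub> ?w (bracket L (bracket L b c) a)"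
      unfolding s by (simp add: ce_diff_3(2)[OF alt_L] lin_add[OF ce_diff_2(1)[OF alt_L]]
        lin_minus[OF ce_diff_2(1)[OF alt_L]] ce_diff_2(2)[OF alt_L])
    also have "\<dots> = ?w (bracket L (bracket L a b) c \<ominus>\<^bsub>L\<^esub> bracket L (bracket L a c) b \<oplus>\<^bsub>L\<^esub> bracket L (bracket L b c) a)"
      by (simp add: lin_add[OF w] lin_minus[OF w])
    also have "\<dots> = \<zero>\<^bsub>?E\<^esub>" unfolding j by (rule lin_zero[OF w vs_L vs_ext])
    finally show "ce_diff K L 2 (ce_diff K L 3 s) = \<zero>\<^bsub>?E\<^esub>" .
  qed
  then show ?thesis
    using lin_closed[OF ce_diff_3(1)[OF alt_L]] by (auto simp: ce_boundaries_def cycles_iff One_nat_def)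
qed

end

subsection \<open>Commutative algebras\<close>

locale algebra_over_field = base_field K for K :: "('k, 'r) ring_scheme" (structure) +
  fixes A :: "('k, 'a, 'm) module_scheme"
  assumes alg: "algebra K A"
begin

lemma vs_A [simp]: "vs A"
  by (rule algebra.axioms(1)[OF alg])

lemma cring_A: "cring A"
  by (rule algebra.axioms(2)[OF alg])

lemma one_A [simp]: "\<one>\<^bsub>A\<^esub> \<in> carrier A"
  using cring_A by (simp add: cring_def ring.ring_simprules)

lemma mult_A [simp]: "a \<in> carrier A \<Longrightarrow> b \<in> carrier A \<Longrightarrow> a \<otimes>\<^bsub>A\<^esub> b \<in> carrier A"
  using cring_A by (simp add: cring_def ring.ring_simprules)

lemma mult_A_simps:
  "a \<in> carrier A \<Longrightarrow> \<one>\<^bsub>A\<^esub> \<otimes>\<^bsub>A\<^esub> a = a"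
  "a \<in> carrier A \<Longrightarrow> a \<otimes>\<^bsub>A\<^esub> \<one>\<^bsub>A\<^esub> = a"
  "a \<in> carrier A \<Longrightarrow> b \<in> carrier A \<Longrightarrow> a \<otimes>\<^bsub>A\<^esub> b = b \<otimes>\<^bsub>A\<^esub> a"
  "a \<in> carrier A \<Longrightarrow> b \<in> carrier A \<Longrightarrow> c \<in> carrier A \<Longrightarrow> a \<otimes>\<^bsub>A\<^esub> b \<otimes>\<^bsub>A\<^esub> c = a \<otimes>\<^bsub>A\<^esub> (b \<otimes>\<^bsub>A\<^esub> c)"
  "a \<in> carrier A \<Longrightarrow> b \<in> carrier A \<Longrightarrow> c \<in> carrier A \<Longrightarrow> a \<otimes>\<^bsub>A\<^esub> (b \<otimes>\<^bsub>A\<^esub> c) = b \<otimes>\<^bsub>A\<^esub> (a \<otimes>\<^bsub>A\<^esub> c)"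
  using cring.cring_simprules[OF cring_A] by simp_all

lemma lin_mult_A [lin_intros]:
  assumes "lin U A f" "b \<in> carrier A"
  shows "lin U A (\<lambda>x. f x \<otimes>\<^bsub>A\<^esub> b)" "lin U A (\<lambda>x. b \<otimes>\<^bsub>A\<^esub> f x)"
proof -
  have "lin A A (\<lambda>a. a \<otimes>\<^bsub>A\<^esub> b)"
    using assms(2) algebra.smult_assoc2[OF alg] cring.cring_simprules(23)[OF cring_A]
    by (intro linI) (simp_all add: cring.cring_simprules[OF cring_A])
  from lin_comp[OF this assms(1)] show 1: "lin U A (\<lambda>x. f x \<otimes>\<^bsub>A\<^esub> b)" .
  have eq: "f x \<otimes>\<^bsub>A\<^esub> b = b \<otimes>\<^bsub>A\<^esub> f x" if "x \<in> carrier U" for x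
    by (rule mult_A_simps(3)[OF lin_closed[OF assms(1) that] assms(2)])
  show "lin U A (\<lambda>x. b \<otimes>\<^bsub>A\<^esub> f x)"
  proof (rule linI)
    fix x assume x: "x \<in> carrier U"
    show "b \<otimes>\<^bsub>A\<^esub> f x \<in> carrier A" using lin_closed[OF assms(1) x] assms(2) by simp
  next
    fix x y assume "x \<in> carrier U" "y \<in> carrier U"
    then show "b \<otimes>\<^bsub>A\<^esub> f (x \<oplus>\<^bsub>U\<^esub> y) = b \<otimes>\<^bsub>A\<^esub> f x \<oplus>\<^bsub>A\<^esub> b \<otimes>\<^bsub>A\<^esub> f y"
      using assms lin_closed[OF assms(1)] by (simp add: lin_add cring.cring_simprules[OF cring_A])
  next
    fix c x assume c: "c \<in> carrier K" and x: "x \<in> carrier U"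
    have fx: "f x \<in> carrier A" by (rule lin_closed[OF assms(1) x])
    have "b \<otimes>\<^bsub>A\<^esub> f (c \<odot>\<^bsub>U\<^esub> x) = (c \<odot>\<^bsub>A\<^esub> f x) \<otimes>\<^bsub>A\<^esub> b"
      using lin_smult[OF assms(1) c x] mult_A_simps(3)[of b "c \<odot>\<^bsub>A\<^esub> f x"] fx c assms(2) by simp
    also have "\<dots> = c \<odot>\<^bsub>A\<^esub> (f x \<otimes>\<^bsub>A\<^esub> b)" by (rule algebra.smult_assoc2[OF alg c fx assms(2)])
    finally show "b \<otimes>\<^bsub>A\<^esub> f (c \<odot>\<^bsub>U\<^esub> x) = c \<odot>\<^bsub>A\<^esub> (b \<otimes>\<^bsub>A\<^esub> f x)" using eq[OF x] by simp
  qed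
qed

lemma T0:
  shows "lin (tensor_power K A 3) (ext_power K A 2) (T0 K A)"
    "\<And>a b c. a \<in> carrier A \<Longrightarrow> b \<in> carrier A \<Longrightarrow> c \<in> carrier A \<Longrightarrow>
      T0 K A (pure_tensor K A [a, b, c]) =
        (wedge K A [a \<otimes>\<^bsub>A\<^esub> b, c] \<oplus>\<^bsub>ext_power K A 2\<^esub> wedge K A [b \<otimes>\<^bsub>A\<^esub> c, a]
          \<oplus>\<^bsub>ext_power K A 2\<^esub> wedge K A [c \<otimes>\<^bsub>A\<^esub> a, b])
        \<ominus>\<^bsub>ext_power K A 2\<^esub> wedge K A [a \<otimes>\<^bsub>A\<^esub> b \<otimes>\<^bsub>A\<^esub> c, \<one>\<^bsub>A\<^esub>]"
proof -
  let ?S = "ext_power K A 2"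
  let ?\<phi> = "\<lambda>a b c. (wedge K A [a \<otimes>\<^bsub>A\<^esub> b, c] \<oplus>\<^bsub>?S\<^esub> wedge K A [b \<otimes>\<^bsub>A\<^esub> c, a]
          \<oplus>\<^bsub>?S\<^esub> wedge K A [c \<otimes>\<^bsub>A\<^esub> a, b]) \<ominus>\<^bsub>?S\<^esub> wedge K A [a \<otimes>\<^bsub>A\<^esub> b \<otimes>\<^bsub>A\<^esub> c, \<one>\<^bsub>A\<^esub>]"
  have l: "lin A ?S (\<lambda>a. ?\<phi> a b c)" "lin A ?S (\<lambda>a. ?\<phi> b a c)" "lin A ?S (\<lambda>a. ?\<phi> b c a)"
    if "b \<in> carrier A" "c \<in> carrier A" for b c
    using that by (intro lin_intros; simp)+
  obtain h where h: "lin (tensor_power K A 3) ?S h"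
    "\<And>a b c. a \<in> carrier A \<Longrightarrow> b \<in> carrier A \<Longrightarrow> c \<in> carrier A \<Longrightarrow> h (pure_tensor K A [a, b, c]) = ?\<phi> a b c"
    by (rule tpow3_lift[of A ?S ?\<phi>, OF vs_A vs_ext l]) blast+
  let ?P = "\<lambda>f. \<forall>x\<in>carrier A. \<forall>y\<in>carrier A. \<forall>z\<in>carrier A. f (pure_tensor K A [x, y, z]) = ?\<phi> x y z"
  have P: "?P (restrict h (carrier (tensor_power K A 3)))" using h(2) by simp
  have un: "\<forall>p q. lin (tensor_power K A 3) ?S p \<longrightarrow> lin (tensor_power K A 3) ?S q \<longrightarrow>
      ?P p \<longrightarrow> ?P q \<longrightarrow> (\<forall>s\<in>pure_tensor K A ` tuples A 3. p s = q s)"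
    by (auto dest!: tuples_3)
  note t = the_hom_props[where P = ?P, OF spans_tpow vs_tpow vs_ext h(1) P un, folded T0_def]
  show "lin (tensor_power K A 3) ?S (T0 K A)" by (rule t(1))
  show "\<And>x y z. x \<in> carrier A \<Longrightarrow> y \<in> carrier A \<Longrightarrow> z \<in> carrier A \<Longrightarrow>
      T0 K A (pure_tensor K A [x, y, z]) = ?\<phi> x y z" using t(2) by blast
qed

abbreviation "T0_range \<equiv> T0 K A ` carrier (tensor_power K A 3)"

lemma sub_T0_range: "sub T0_range (ext_power K A 2)"
  by (rule sub_image[OF vs_tpow vs_ext T0(1) sub_carrier[OF vs_tpow]])

lemma vs_T0_image [simp]: "vs (T0_image K A)"
  unfolding T0_image_def by (rule vs_restrict[OF vs_ext sub_T0_range])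

lemma vs_HH1 [simp]: "vs (HH1 K A)"
  unfolding HH1_def by (rule vs_quot[OF vs_ext sub_T0_range])

lemma sym_mult:
  shows "lin (sym_power K A 2) A (sym_mult K A)"
    "\<And>a b. a \<in> carrier A \<Longrightarrow> b \<in> carrier A \<Longrightarrow> sym_mult K A (symprod K A [a, b]) = a \<otimes>\<^bsub>A\<^esub> b"
proof -
  have b: "bilin A A A (\<otimes>\<^bsub>A\<^esub>)"
    by (rule bilinI) (intro lin_intros; simp)+
  obtain h where h: "lin (sym_power K A 2) A h"
    "\<And>a b. a \<in> carrier A \<Longrightarrow> b \<in> carrier A \<Longrightarrow> h (symprod K A [a, b]) = a \<otimes>\<^bsub>A\<^esub> b"
    by (rule sym2_lift[OF vs_A vs_A b mult_A_simps(3)]) blast+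
  let ?P = "\<lambda>f. \<forall>x\<in>carrier A. \<forall>y\<in>carrier A. f (symprod K A [x, y]) = x \<otimes>\<^bsub>A\<^esub> y"
  have P: "?P (restrict h (carrier (sym_power K A 2)))" using h(2) by simp
  have un: "\<forall>p q. lin (sym_power K A 2) A p \<longrightarrow> lin (sym_power K A 2) A q \<longrightarrow>
      ?P p \<longrightarrow> ?P q \<longrightarrow> (\<forall>s\<in>symprod K A ` tuples A 2. p s = q s)"
    by (auto dest!: tuples_2)
  note t = the_hom_props[where P = ?P, OF spans_sym vs_sym vs_A h(1) P un, folded sym_mult_def]
  show "lin (sym_power K A 2) A (sym_mult K A)" by (rule t(1))
  show "\<And>a b. a \<in> carrier A \<Longrightarrow> b \<in> carrier A \<Longrightarrow> sym_mult K A (symprod K A [a, b]) = a \<otimes>\<^bsub>A\<^esub> b"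
    using t(2) by blast
qed

abbreviation "mult_kernel \<equiv> {s \<in> carrier (sym_power K A 2). sym_mult K A s = \<zero>\<^bsub>A\<^esub>}"

lemma I_alg_eq: "I_alg K A = restrict_to (sym_power K A 2) mult_kernel"
  by (simp add: I_alg_def a_kernel_def')

lemma sub_mult_kernel: "sub mult_kernel (sym_power K A 2)"
  by (rule sub_kernel[OF vs_sym vs_A sym_mult(1)])

lemma vs_I_alg [simp]: "vs (I_alg K A)"
  unfolding I_alg_eq by (rule vs_restrict[OF vs_sym sub_mult_kernel])

end

subsection \<open>Gradings\<close>

context base_field
begin

lemma spans_tpow_gen:
  assumes "vs V" "spans V S"
  shows "spans (tensor_power K V n) {pure_tensor K V xs | xs. length xs = n \<and> set xs \<subseteq> S}" (is "spans _ ?G")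
proof -
  have G: "?G \<subseteq> carrier (tensor_power K V n)"
    using assms spans_subset[OF assms(2)] by (auto intro!: pure_tensor_closed simp: tuples_def)
  have "pure_tensor K V ` tuples V n \<subseteq> span (tensor_power K V n) ?G"
    using mlin_in_sub[OF mlin_pure_tensor[OF assms(1)] assms(1) vs_tpow sub_span[OF vs_tpow G] assms(2)]
    by (auto intro: span_base)
  then have "span (tensor_power K V n) (pure_tensor K V ` tuples V n) \<subseteq> span (tensor_power K V n) ?G"
    by (intro span_least sub_span[OF vs_tpow G])
  then show ?thesis using spans_tpow[of V n] G by (auto simp: spans_def)
qed

lemma spans_tpow3:
  assumes "vs V" "spans V S"
  shows "spans (tensor_power K V 3) {pure_tensor K V [s, t, u] | s t u. s \<in> S \<and> t \<in> S \<and> u \<in> S}"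
proof -
  have "{pure_tensor K V xs | xs. length xs = 3 \<and> set xs \<subseteq> S} =
      {pure_tensor K V [s, t, u] | s t u. s \<in> S \<and> t \<in> S \<and> u \<in> S}"
    by (auto simp: length_Suc_conv numeral_3_eq_3) force
  then show ?thesis using spans_tpow_gen[OF assms, of 3] by simp
qed

lemma hom_tuples_1:
  assumes "comm_group B"
  shows "xs \<in> hom_tuples B D 1 \<beta> \<longleftrightarrow> \<beta> \<in> carrier B \<and> (\<exists>x\<in>D \<beta>. xs = [x])"
proof -
  interpret B: comm_group B by (rule assms)
  show ?thesis
    by (auto simp: hom_tuples_def length_Suc_conv One_nat_def list_all2_Cons1)
qed

lemma hom_tuples_2:
  assumes "comm_group B"
  shows "xs \<in> hom_tuples B D 2 \<beta> \<longleftrightarrow>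
    (\<exists>\<gamma>\<in>carrier B. \<exists>\<delta>\<in>carrier B. \<exists>x\<in>D \<gamma>. \<exists>y\<in>D \<delta>. \<gamma> \<otimes>\<^bsub>B\<^esub> \<delta> = \<beta> \<and> xs = [x, y])"
proof -
  interpret B: comm_group B by (rule assms)
  show ?thesis
  proof
    assume "xs \<in> hom_tuples B D 2 \<beta>"
    then show "\<exists>\<gamma>\<in>carrier B. \<exists>\<delta>\<in>carrier B. \<exists>x\<in>D \<gamma>. \<exists>y\<in>D \<delta>. \<gamma> \<otimes>\<^bsub>B\<^esub> \<delta> = \<beta> \<and> xs = [x, y]"
      by (auto simp: hom_tuples_def length_Suc_conv numeral_2_eq_2 list_all2_Cons1) blast
  next
    assume "\<exists>\<gamma>\<in>carrier B. \<exists>\<delta>\<in>carrier B. \<exists>x\<in>D \<gamma>. \<exists>y\<in>D \<delta>. \<gamma> \<otimes>\<^bsub>B\<^esub> \<delta> = \<beta> \<and> xs = [x, y]"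
    then obtain \<gamma> \<delta> x y where "\<gamma> \<in> carrier B" "\<delta> \<in> carrier B" "x \<in> D \<gamma>" "y \<in> D \<delta>"
      "\<gamma> \<otimes>\<^bsub>B\<^esub> \<delta> = \<beta>" "xs = [x, y]" by blast
    then show "xs \<in> hom_tuples B D 2 \<beta>"
      by (auto simp: hom_tuples_def intro!: exI[of _ "[\<gamma>, \<delta>]"])
  qed
qed

lemma hom_tuples_3:
  assumes "comm_group B" "\<gamma> \<in> carrier B" "\<delta> \<in> carrier B" "\<epsilon> \<in> carrier B" "x \<in> D \<gamma>" "y \<in> D \<delta>" "z \<in> D \<epsilon>"
    "\<gamma> \<otimes>\<^bsub>B\<^esub> (\<delta> \<otimes>\<^bsub>B\<^esub> \<epsilon>) = \<beta>"
  shows "[x, y, z] \<in> hom_tuples B D 3 \<beta>"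
proof -
  interpret B: comm_group B by (rule assms)
  show ?thesis using assms
    by (auto simp: hom_tuples_def intro!: exI[of _ "[\<gamma>, \<delta>, \<epsilon>]"])
qed

lemma tuples_hom_tuples:
  assumes "\<And>\<gamma>. \<gamma> \<in> carrier B \<Longrightarrow> D \<gamma> \<subseteq> carrier V" "xs \<in> hom_tuples B D n \<beta>"
  shows "xs \<in> tuples V n"
  using assms unfolding hom_tuples_def tuples_def
  by (auto simp: list_all2_conv_all_nth in_set_conv_nth) blast

end

locale graded_over_field = lie_over_field K L for K :: "('k, 'r) ring_scheme" (structure)
    and L :: "('k, 'l, 'n) lie_algebra_scheme" +
  fixes B :: "('b, 's) monoid_scheme" and D :: "'b \<Rightarrow> 'l set" and \<beta> :: 'b
  assumes graded: "graded_lie_algebra K L B D"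
    and char: "\<one> \<oplus> \<one> \<noteq> \<zero>"
begin

lemma B_group: "comm_group B"
  using graded by (rule graded_lie_algebra.axioms(2))

lemma B_mult [simp]: "\<gamma> \<in> carrier B \<Longrightarrow> \<delta> \<in> carrier B \<Longrightarrow> \<gamma> \<otimes>\<^bsub>B\<^esub> \<delta> \<in> carrier B"
  using B_group by (simp add: comm_group_def comm_monoid.axioms(1) monoid.m_closed)

lemma B_assoc: "\<gamma> \<in> carrier B \<Longrightarrow> \<delta> \<in> carrier B \<Longrightarrow> \<epsilon> \<in> carrier B \<Longrightarrow>
    \<gamma> \<otimes>\<^bsub>B\<^esub> \<delta> \<otimes>\<^bsub>B\<^esub> \<epsilon> = \<gamma> \<otimes>\<^bsub>B\<^esub> (\<delta> \<otimes>\<^bsub>B\<^esub> \<epsilon>)"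
  using B_group by (simp add: comm_group_def comm_monoid.axioms(1) monoid.m_assoc)

lemma B_comm: "\<gamma> \<in> carrier B \<Longrightarrow> \<delta> \<in> carrier B \<Longrightarrow> \<gamma> \<otimes>\<^bsub>B\<^esub> \<delta> = \<delta> \<otimes>\<^bsub>B\<^esub> \<gamma>"
  using B_group by (simp add: comm_group_def comm_monoid.m_comm)

lemma B_lcomm: "\<gamma> \<in> carrier B \<Longrightarrow> \<delta> \<in> carrier B \<Longrightarrow> \<epsilon> \<in> carrier B \<Longrightarrow>
    \<gamma> \<otimes>\<^bsub>B\<^esub> (\<delta> \<otimes>\<^bsub>B\<^esub> \<epsilon>) = \<delta> \<otimes>\<^bsub>B\<^esub> (\<gamma> \<otimes>\<^bsub>B\<^esub> \<epsilon>)"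
  using B_group by (simp add: comm_group_def comm_monoid.m_lcomm)

lemma sub_D: "\<gamma> \<in> carrier B \<Longrightarrow> sub (D \<gamma>) L"
  using graded by (rule graded_lie_algebra.component_submodule)

lemma D_closed: "\<gamma> \<in> carrier B \<Longrightarrow> x \<in> D \<gamma> \<Longrightarrow> x \<in> carrier L"
  by (rule sub_closed(1)[OF sub_D vs_L])

lemma bracket_D: "\<gamma> \<in> carrier B \<Longrightarrow> \<delta> \<in> carrier B \<Longrightarrow> x \<in> D \<gamma> \<Longrightarrow> y \<in> D \<delta> \<Longrightarrow>
    bracket L x y \<in> D (\<gamma> \<otimes>\<^bsub>B\<^esub> \<delta>)"
  using graded by (rule graded_lie_algebra.bracket_degree)

definition decomposes :: "'l \<Rightarrow> ('b \<Rightarrow> 'l) \<Rightarrow> bool"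
  where "decomposes x f \<longleftrightarrow> f \<in> Pi\<^sub>E (carrier B) D \<and> finite {\<gamma> \<in> carrier B. f \<gamma> \<noteq> \<zero>\<^bsub>L\<^esub>} \<and>
         x = (\<Oplus>\<^bsub>L\<^esub>\<gamma>\<in>{\<gamma> \<in> carrier B. f \<gamma> \<noteq> \<zero>\<^bsub>L\<^esub>}. f \<gamma>)"

lemma decomposes_unique: "x \<in> carrier L \<Longrightarrow> \<exists>!f. decomposes x f"
  unfolding decomposes_def using graded by (rule graded_lie_algebra.direct_decomposition)

lemma decomposes_closed: "decomposes x f \<Longrightarrow> \<gamma> \<in> carrier B \<Longrightarrow> f \<gamma> \<in> D \<gamma>"
  by (auto simp: decomposes_def)

text \<open>The support of a sum or of a multiple may shrink. A finite set that contains the support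
  is therefore enough to recognise a decomposition.\<close>

lemma decomposes_superset:
  assumes "f \<in> Pi\<^sub>E (carrier B) D" "finite T" "T \<subseteq> carrier B"
    "\<And>\<gamma>. \<gamma> \<in> carrier B \<Longrightarrow> \<gamma> \<notin> T \<Longrightarrow> f \<gamma> = \<zero>\<^bsub>L\<^esub>" "x = finsum L f T"
  shows "decomposes x f"
proof -
  let ?S = "{\<gamma> \<in> carrier B. f \<gamma> \<noteq> \<zero>\<^bsub>L\<^esub>}"
  have S: "?S \<subseteq> T" using assms(4) by auto
  have "f \<gamma> \<in> carrier L" if "\<gamma> \<in> carrier B" for \<gamma>
    using D_closed[OF that PiE_mem[OF assms(1) that]] .
  then have "finsum L f T = finsum L f ?S"
    using S assms by (intro finsum_superset vs_monoid vs_L) auto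
  then show ?thesis using assms finite_subset[OF S] by (simp add: decomposes_def)
qed

lemma spans_homogeneous: "spans L (\<Union>\<gamma>\<in>carrier B. D \<gamma>)"
proof -
  let ?U = "\<Union>\<gamma>\<in>carrier B. D \<gamma>"
  interpret L: abelian_monoid L by (rule vs_monoid[OF vs_L])
  have U: "?U \<subseteq> carrier L" using D_closed by auto
  have "x \<in> span L ?U" if x: "x \<in> carrier L" for x
  proof -
    obtain f where f: "decomposes x f" using decomposes_unique[OF x] by blast
    have "finsum L f S \<in> span L ?U" if "finite S" "S \<subseteq> carrier B" for S
      using that
    proof (induction S rule: finite_induct)
      case empty
      then show ?case using sub_closed(2)[OF sub_span[OF vs_L U] vs_L] by simp
    next
      case (insert \<gamma> S)
      have "f \<delta> \<in> D \<delta>" if "\<delta> \<in> carrier B" for \<delta> using f that by (rule decomposes_closed)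
      then have "finsum L f (insert \<gamma> S) = f \<gamma> \<oplus>\<^bsub>L\<^esub> finsum L f S" "f \<gamma> \<in> ?U"
        using insert D_closed by (auto intro!: L.finsum_insert)
      then show ?case
        using insert span_base[of "f \<gamma>" ?U L] sub_closed(4)[OF sub_span[OF vs_L U] vs_L] by simp
    qed
    then show ?thesis using f unfolding decomposes_def by fastforce
  qed
  then show ?thesis using U by (auto simp: spans_def)
qed

text \<open>The universal property of a direct sum. Because decompositions are unique, the family of
  components \<open>c x\<close> is linear in \<open>x\<close>, and \<open>f\<close> adds up the
  images of the finitely many nonzero components.\<close>

lemma grading_lift:
  assumes W: "vs W" and h: "\<And>\<gamma>. \<gamma> \<in> carrier B \<Longrightarrow> lin (restrict_to L (D \<gamma>)) W (h \<gamma>)"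
  obtains f where "lin L W f" "\<And>\<gamma> x. \<gamma> \<in> carrier B \<Longrightarrow> x \<in> D \<gamma> \<Longrightarrow> f x = h \<gamma> x"
proof -
  interpret L: abelian_monoid L by (rule vs_monoid[OF vs_L])
  interpret W: abelian_monoid W by (rule vs_monoid[OF W])
  have hc: "h \<gamma> x \<in> carrier W" if "\<gamma> \<in> carrier B" "x \<in> D \<gamma>" for \<gamma> x
    using lin_closed[OF h[OF that(1)]] that by simp
  have h0: "h \<gamma> \<zero>\<^bsub>L\<^esub> = \<zero>\<^bsub>W\<^esub>" if "\<gamma> \<in> carrier B" for \<gamma>
    using lin_zero[OF h[OF that] vs_restrict[OF vs_L sub_D[OF that]] W] by simp
  have ha: "h \<gamma> (x \<oplus>\<^bsub>L\<^esub> y) = h \<gamma> x \<oplus>\<^bsub>W\<^esub> h \<gamma> y" if "\<gamma> \<in> carrier B" "x \<in> D \<gamma>" "y \<in> D \<gamma>" for \<gamma> x y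
    using lin_add[OF h[OF that(1)]] that by simp
  have hs: "h \<gamma> (c \<odot>\<^bsub>L\<^esub> x) = c \<odot>\<^bsub>W\<^esub> h \<gamma> x" if "\<gamma> \<in> carrier B" "c \<in> carrier K" "x \<in> D \<gamma>" for \<gamma> c x
    using lin_smult[OF h[OF that(1)]] that by simp
  define c where "c x = (THE f. decomposes x f)" for x
  have c: "decomposes x (c x)" if "x \<in> carrier L" for x
    unfolding c_def by (rule theI'[OF decomposes_unique[OF that]])
  have cu: "c x = f" if "x \<in> carrier L" "decomposes x f" for x f
    using decomposes_unique[OF that(1)] c[OF that(1)] that(2) by blast
  let ?S = "\<lambda>x. {\<gamma> \<in> carrier B. c x \<gamma> \<noteq> \<zero>\<^bsub>L\<^esub>}"
  have S: "finite (?S x)" if "x \<in> carrier L" for x using c[OF that] by (simp add: decomposes_def)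
  have cD: "c x \<gamma> \<in> D \<gamma>" if "x \<in> carrier L" "\<gamma> \<in> carrier B" for x \<gamma>
    using c[OF that(1)] that(2) by (rule decomposes_closed)
  have cL: "c x \<gamma> \<in> carrier L" if "x \<in> carrier L" "\<gamma> \<in> carrier B" for x \<gamma>
    using cD[OF that] D_closed that(2) by blast
  have cs: "x = finsum L (c x) T" if "x \<in> carrier L" "?S x \<subseteq> T" "finite T" "T \<subseteq> carrier B" for x T
  proof -
    have "finsum L (c x) T = finsum L (c x) (?S x)"
      using that cL by (intro finsum_superset vs_monoid vs_L) auto
    then show ?thesis using c[OF that(1)] by (simp add: decomposes_def)
  qed
  define f where "f x = finsum W (\<lambda>\<gamma>. h \<gamma> (c x \<gamma>)) (?S x)" for x
  have fs: "f x = finsum W (\<lambda>\<gamma>. h \<gamma> (c x \<gamma>)) T" if "x \<in> carrier L" "?S x \<subseteq> T" "finite T" "T \<subseteq> carrier B" for x T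
    unfolding f_def using that cD hc h0
    by (intro finsum_superset[symmetric] vs_monoid W) auto
  show thesis
  proof (rule that)
    show "lin L W f"
    proof (rule linI)
      fix x assume x: "x \<in> carrier L"
      show "f x \<in> carrier W" unfolding f_def using x cD hc by (intro W.finsum_closed) auto
      fix y assume y: "y \<in> carrier L"
      let ?T = "?S x \<union> ?S y"
      have T: "finite ?T" "?T \<subseteq> carrier B" using S x y by auto
      let ?g = "\<lambda>\<gamma>\<in>carrier B. c x \<gamma> \<oplus>\<^bsub>L\<^esub> c y \<gamma>"
      have "decomposes (x \<oplus>\<^bsub>L\<^esub> y) ?g"
      proof (rule decomposes_superset[OF _ T])
        show "?g \<in> Pi\<^sub>E (carrier B) D"
          using cD x y by (auto intro: sub_closed(4)[OF sub_D vs_L])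
        have "x \<oplus>\<^bsub>L\<^esub> y = finsum L (c x) ?T \<oplus>\<^bsub>L\<^esub> finsum L (c y) ?T"
          using cs[OF x _ T] cs[OF y _ T] by simp
        also have "\<dots> = finsum L (\<lambda>\<gamma>. c x \<gamma> \<oplus>\<^bsub>L\<^esub> c y \<gamma>) ?T"
          using cL x y by (intro L.finsum_addf[symmetric]) auto
        also have "\<dots> = finsum L ?g ?T" using cL x y by (intro L.finsum_cong') auto
        finally show "x \<oplus>\<^bsub>L\<^esub> y = finsum L ?g ?T" .
      qed auto
      then have cxy: "c (x \<oplus>\<^bsub>L\<^esub> y) = ?g" using x y by (intro cu) auto
      have "f (x \<oplus>\<^bsub>L\<^esub> y) = finsum W (\<lambda>\<gamma>. h \<gamma> (c (x \<oplus>\<^bsub>L\<^esub> y) \<gamma>)) ?T"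
        using x y T by (intro fs) (auto simp: cxy)
      also have "\<dots> = finsum W (\<lambda>\<gamma>. h \<gamma> (c x \<gamma>) \<oplus>\<^bsub>W\<^esub> h \<gamma> (c y \<gamma>)) ?T"
        using x y cD hc ha by (intro W.finsum_cong') (auto simp: cxy)
      also have "\<dots> = f x \<oplus>\<^bsub>W\<^esub> f y"
        using x y cD hc fs[OF x _ T] fs[OF y _ T] by (simp add: W.finsum_addf Pi_def)
      finally show "f (x \<oplus>\<^bsub>L\<^esub> y) = f x \<oplus>\<^bsub>W\<^esub> f y" .
    next
      fix k x assume k: "k \<in> carrier K" and x: "x \<in> carrier L"
      let ?T = "?S x"
      have T: "finite ?T" "?T \<subseteq> carrier B" using S x by auto
      let ?g = "\<lambda>\<gamma>\<in>carrier B. k \<odot>\<^bsub>L\<^esub> c x \<gamma>"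
      have "decomposes (k \<odot>\<^bsub>L\<^esub> x) ?g"
      proof (rule decomposes_superset[OF _ T])
        show "?g \<in> Pi\<^sub>E (carrier B) D"
          using cD x k by (auto intro: sub_closed(6)[OF sub_D vs_L])
        have "k \<odot>\<^bsub>L\<^esub> x = k \<odot>\<^bsub>L\<^esub> finsum L (c x) ?T" using cs[OF x _ T] by simp
        also have "\<dots> = finsum L (\<lambda>\<gamma>. k \<odot>\<^bsub>L\<^esub> c x \<gamma>) ?T"
          using cL x k T by (intro module.finsum_smult_ldistr vs_L) auto
        also have "\<dots> = finsum L ?g ?T" using cL x k by (intro L.finsum_cong') auto
        finally show "k \<odot>\<^bsub>L\<^esub> x = finsum L ?g ?T" .
      qed (use k in auto)
      then have cxy: "c (k \<odot>\<^bsub>L\<^esub> x) = ?g" using x k by (intro cu) auto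
      have "f (k \<odot>\<^bsub>L\<^esub> x) = finsum W (\<lambda>\<gamma>. h \<gamma> (c (k \<odot>\<^bsub>L\<^esub> x) \<gamma>)) ?T"
        using x k T by (intro fs) (auto simp: cxy)
      also have "\<dots> = finsum W (\<lambda>\<gamma>. k \<odot>\<^bsub>W\<^esub> h \<gamma> (c x \<gamma>)) ?T"
        using x k cD hc hs W by (intro W.finsum_cong') (auto simp: cxy)
      also have "\<dots> = k \<odot>\<^bsub>W\<^esub> f x"
        unfolding f_def using x k cD hc T by (intro module.finsum_smult_ldistr[OF W, symmetric]) auto
      finally show "f (k \<odot>\<^bsub>L\<^esub> x) = k \<odot>\<^bsub>W\<^esub> f x" .
    qed
    fix \<gamma> x assume \<gamma>: "\<gamma> \<in> carrier B" and x: "x \<in> D \<gamma>"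
    have xL: "x \<in> carrier L" by (rule D_closed[OF \<gamma> x])
    let ?g = "\<lambda>\<delta>\<in>carrier B. if \<delta> = \<gamma> then x else \<zero>\<^bsub>L\<^esub>"
    have "decomposes x ?g"
      by (rule decomposes_superset[where T = "{\<gamma>}"])
        (use \<gamma> x xL in \<open>auto intro: sub_closed(2)[OF sub_D vs_L]\<close>)
    then have cx: "c x = ?g" using xL by (intro cu)
    have "f x = finsum W (\<lambda>\<delta>. h \<delta> (c x \<delta>)) {\<gamma>}"
      using xL \<gamma> by (intro fs) (auto simp: cx)
    also have "\<dots> = h \<gamma> x" using \<gamma> x hc by (simp add: cx)
    finally show "f x = h \<gamma> x" .
  qed
qed

text \<open>Truncates \<open>F\<close> to total degree \<open>\<beta>\<close>. In the language of
  \<open>presents\<close>, \<open>L\<close> is generated by its homogeneous vectors subject to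
  linearity in each degree, so that a rule depending on the two degrees extends to a bilinear
  map.\<close>

lemma homogeneous_bilin:
  assumes W: "vs W" and F: "bilin L L W F"
  obtains \<phi> where "bilin L L W \<phi>"
    "\<And>\<gamma> \<delta> x y. \<gamma> \<in> carrier B \<Longrightarrow> \<delta> \<in> carrier B \<Longrightarrow> x \<in> D \<gamma> \<Longrightarrow> y \<in> D \<delta> \<Longrightarrow>
      \<phi> x y = (if \<gamma> \<otimes>\<^bsub>B\<^esub> \<delta> = \<beta> then F x y else \<zero>\<^bsub>W\<^esub>)"
proof -
  \<comment> \<open>The index records the degree beside the vector, since a vector alone need not
    determine it: zero lies in every component.\<close>
  let ?I = "SIGMA \<gamma>:carrier B. D \<gamma>"
  let ?C = "\<lambda>\<phi>. \<forall>\<gamma>\<in>carrier B. lin (restrict_to L (D \<gamma>)) W (\<lambda>x. \<phi> (\<gamma>, x))"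
  have "\<exists>h. lin L W h \<and> (\<forall>i\<in>?I. h (snd i) = \<phi> i)" if C: "?C \<phi>" for \<phi>
  proof -
    obtain f where "lin L W f" "\<And>\<gamma> x. \<gamma> \<in> carrier B \<Longrightarrow> x \<in> D \<gamma> \<Longrightarrow> f x = \<phi> (\<gamma>, x)"
      using grading_lift[OF W, of "\<lambda>\<gamma> x. \<phi> (\<gamma>, x)"] C by blast
    then show ?thesis by (intro exI[of _ f]) auto
  qed
  moreover have "snd ` ?I = (\<Union>\<gamma>\<in>carrier B. D \<gamma>)" by force
  ultimately have p: "presents L W ?I snd ?C"
    using spans_homogeneous W by (simp add: presents_def)
  have lc: "linear_condition W ?I ?C"
    unfolding linear_condition_def
  proof (intro conjI allI impI ballI)
    fix \<phi> \<psi> \<gamma> assume "\<forall>i\<in>?I. \<phi> i = \<psi> i" "?C \<phi>" "\<gamma> \<in> carrier B"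
    then show "lin (restrict_to L (D \<gamma>)) W (\<lambda>x. \<psi> (\<gamma>, x))"
      using lin_cong[OF vs_restrict[OF vs_L sub_D], of \<gamma> W "\<lambda>x. \<phi> (\<gamma>, x)" "\<lambda>x. \<psi> (\<gamma>, x)"] by auto
  qed (use W in \<open>auto intro!: lin_intros\<close>)
  let ?q = "\<lambda>i i'. if fst i \<otimes>\<^bsub>B\<^esub> fst i' = \<beta> then F (snd i) (snd i') else \<zero>\<^bsub>W\<^esub>"
  have l: "lin (restrict_to L (D \<gamma>)) W (\<lambda>x. F x y)" "lin (restrict_to L (D \<gamma>)) W (\<lambda>x. F y x)"
    if "\<gamma> \<in> carrier B" "y \<in> carrier L" for \<gamma> y
    using lin_restrict_dom[OF bilin_left[OF F that(2)] vs_L sub_D[OF that(1)]]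
      lin_restrict_dom[OF bilin_right[OF F that(2)] vs_L sub_D[OF that(1)]] by auto
  obtain \<phi> where "bilin L L W \<phi>" "\<And>i i'. i \<in> ?I \<Longrightarrow> i' \<in> ?I \<Longrightarrow> \<phi> (snd i) (snd i') = ?q i i'"
  proof (rule bilin_lift[OF p p lc, where q = ?q])
    fix i i' assume "i \<in> ?I" "i' \<in> ?I"
    then show "?q i i' \<in> carrier W" using bilin_closed[OF F] D_closed W by auto
  next
    fix i' assume "i' \<in> ?I"
    then obtain \<delta> y where i': "i' = (\<delta>, y)" "\<delta> \<in> carrier B" "y \<in> D \<delta>" by auto
    show "\<forall>\<gamma>\<in>carrier B. lin (restrict_to L (D \<gamma>)) W (\<lambda>x. ?q (\<gamma>, x) i')"
    proof
      fix \<gamma> assume "\<gamma> \<in> carrier B"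
      then show "lin (restrict_to L (D \<gamma>)) W (\<lambda>x. ?q (\<gamma>, x) i')"
        using l(1) lin_const_zero[OF W] D_closed[OF i'(2,3)] i' by (cases "\<gamma> \<otimes>\<^bsub>B\<^esub> \<delta> = \<beta>") simp_all
    qed
  next
    fix i assume "i \<in> ?I"
    then obtain \<delta> y where i: "i = (\<delta>, y)" "\<delta> \<in> carrier B" "y \<in> D \<delta>" by auto
    show "\<forall>\<gamma>\<in>carrier B. lin (restrict_to L (D \<gamma>)) W (\<lambda>x. ?q i (\<gamma>, x))"
    proof
      fix \<gamma> assume "\<gamma> \<in> carrier B"
      then show "lin (restrict_to L (D \<gamma>)) W (\<lambda>x. ?q i (\<gamma>, x))"
        using l(2) lin_const_zero[OF W] D_closed[OF i(2,3)] i by (cases "\<delta> \<otimes>\<^bsub>B\<^esub> \<gamma> = \<beta>") simp_all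
    qed
  qed blast
  then show thesis by (intro that) force+
qed

lemma bilin_homogeneous_eq:
  assumes "vs W" "bilin L L W \<phi>" "bilin L L W \<psi>"
    "\<And>\<gamma> \<delta> x y. \<gamma> \<in> carrier B \<Longrightarrow> \<delta> \<in> carrier B \<Longrightarrow> x \<in> D \<gamma> \<Longrightarrow> y \<in> D \<delta> \<Longrightarrow> \<phi> x y = \<psi> x y"
    "x \<in> carrier L" "y \<in> carrier L"
  shows "\<phi> x y = \<psi> x y"
  by (rule bilin_eq[OF spans_homogeneous spans_homogeneous assms(2,3) vs_L vs_L assms(1) _ assms(5,6)])
    (use assms(4) in blast)

text \<open>The truncated wedge is skew because this can be tested on homogeneous vectors;
  alternation then follows since 2 is invertible. The last property holds because all three terms of
  the differential of a homogeneous x \<and> y \<and> u have the same degree.\<close>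

lemma ext2_projection:
  obtains p where "lin (ext_power K L 2) (ext_power K L 2) p"
    "\<And>\<gamma> \<delta> x y. \<gamma> \<in> carrier B \<Longrightarrow> \<delta> \<in> carrier B \<Longrightarrow> x \<in> D \<gamma> \<Longrightarrow> y \<in> D \<delta> \<Longrightarrow>
      p (wedge K L [x, y]) = (if \<gamma> \<otimes>\<^bsub>B\<^esub> \<delta> = \<beta> then wedge K L [x, y] else \<zero>\<^bsub>ext_power K L 2\<^esub>)"
    "\<And>\<gamma> \<delta> \<epsilon> x y u. \<gamma> \<in> carrier B \<Longrightarrow> \<delta> \<in> carrier B \<Longrightarrow> \<epsilon> \<in> carrier B \<Longrightarrow> x \<in> D \<gamma> \<Longrightarrow> y \<in> D \<delta> \<Longrightarrow> u \<in> D \<epsilon> \<Longrightarrow>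
      p (ce_diff K L 3 (wedge K L [x, y, u])) =
      (if \<gamma> \<otimes>\<^bsub>B\<^esub> (\<delta> \<otimes>\<^bsub>B\<^esub> \<epsilon>) = \<beta> then ce_diff K L 3 (wedge K L [x, y, u]) else \<zero>\<^bsub>ext_power K L 2\<^esub>)"
proof -
  let ?E = "ext_power K L 2"
  obtain \<phi> where \<phi>: "bilin L L ?E \<phi>"
    "\<And>\<gamma> \<delta> x y. \<gamma> \<in> carrier B \<Longrightarrow> \<delta> \<in> carrier B \<Longrightarrow> x \<in> D \<gamma> \<Longrightarrow> y \<in> D \<delta> \<Longrightarrow>
      \<phi> x y = (if \<gamma> \<otimes>\<^bsub>B\<^esub> \<delta> = \<beta> then wedge K L [x, y] else \<zero>\<^bsub>?E\<^esub>)"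
    by (rule homogeneous_bilin[OF vs_ext bilin_wedge[OF vs_L]]) blast
  have sw: "bilin L L ?E (\<lambda>x y. \<ominus>\<^bsub>?E\<^esub> \<phi> y x)"
    by (intro bilinI lin_uminus vs_ext bilin_left[OF \<phi>(1)] bilin_right[OF \<phi>(1)])
  have skew: "\<phi> x y = \<ominus>\<^bsub>?E\<^esub> \<phi> y x" if "x \<in> carrier L" "y \<in> carrier L" for x y
  proof (rule bilin_homogeneous_eq[OF vs_ext \<phi>(1) sw _ that])
    fix \<gamma> \<delta> x y assume "\<gamma> \<in> carrier B" "\<delta> \<in> carrier B" "x \<in> D \<gamma>" "y \<in> D \<delta>"
    then show "\<phi> x y = \<ominus>\<^bsub>?E\<^esub> \<phi> y x"
      using \<phi>(2)[of \<gamma> \<delta> x y] \<phi>(2)[of \<delta> \<gamma> y x] B_comm[of \<gamma> \<delta>] wedge2_swap[OF vs_L, of x y] D_closed by auto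
  qed
  have alt: "\<phi> x x = \<zero>\<^bsub>?E\<^esub>" if "x \<in> carrier L" for x
    by (rule bilin_skew_alternating[OF \<phi>(1) vs_L vs_ext char that skew[OF that that]])
  obtain p where p: "lin ?E ?E p" "\<And>a b. a \<in> carrier L \<Longrightarrow> b \<in> carrier L \<Longrightarrow> p (wedge K L [a, b]) = \<phi> a b"
    by (rule ext2_lift[OF vs_L vs_ext \<phi>(1) alt]) blast+
  have ph: "p (wedge K L [x, y]) = (if \<gamma> \<otimes>\<^bsub>B\<^esub> \<delta> = \<beta> then wedge K L [x, y] else \<zero>\<^bsub>?E\<^esub>)"
    if "\<gamma> \<in> carrier B" "\<delta> \<in> carrier B" "x \<in> D \<gamma>" "y \<in> D \<delta>" for \<gamma> \<delta> x y
    using \<phi>(2)[OF that] p(2)[of x y] D_closed[OF that(1,3)] D_closed[OF that(2,4)] by simp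
  have pd: "p (ce_diff K L 3 (wedge K L [x, y, u])) =
      (if \<gamma> \<otimes>\<^bsub>B\<^esub> (\<delta> \<otimes>\<^bsub>B\<^esub> \<epsilon>) = \<beta> then ce_diff K L 3 (wedge K L [x, y, u]) else \<zero>\<^bsub>?E\<^esub>)"
    if g [simp]: "\<gamma> \<in> carrier B" "\<delta> \<in> carrier B" "\<epsilon> \<in> carrier B" "x \<in> D \<gamma>" "y \<in> D \<delta>" "u \<in> D \<epsilon>" for \<gamma> \<delta> \<epsilon> x y u
  proof -
    have [simp]: "x \<in> carrier L" "y \<in> carrier L" "u \<in> carrier L" using g D_closed by blast+
    have e: "\<gamma> \<otimes>\<^bsub>B\<^esub> \<delta> \<otimes>\<^bsub>B\<^esub> \<epsilon> = \<gamma> \<otimes>\<^bsub>B\<^esub> (\<delta> \<otimes>\<^bsub>B\<^esub> \<epsilon>)" "\<gamma> \<otimes>\<^bsub>B\<^esub> \<epsilon> \<otimes>\<^bsub>B\<^esub> \<delta> = \<gamma> \<otimes>\<^bsub>B\<^esub> (\<delta> \<otimes>\<^bsub>B\<^esub> \<epsilon>)"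
      "\<delta> \<otimes>\<^bsub>B\<^esub> \<epsilon> \<otimes>\<^bsub>B\<^esub> \<gamma> = \<gamma> \<otimes>\<^bsub>B\<^esub> (\<delta> \<otimes>\<^bsub>B\<^esub> \<epsilon>)"
      by (simp_all add: B_assoc B_comm B_lcomm)
    show ?thesis
      using ph[of "\<gamma> \<otimes>\<^bsub>B\<^esub> \<delta>" \<epsilon> "bracket L x y" u] ph[of "\<gamma> \<otimes>\<^bsub>B\<^esub> \<epsilon>" \<delta> "bracket L x u" y]
        ph[of "\<delta> \<otimes>\<^bsub>B\<^esub> \<epsilon>" \<gamma> "bracket L y u" x]
      by (simp add: ce_diff_3(2)[OF alt_L] lin_add[OF p(1)] lin_minus[OF p(1)] bracket_D e)
  qed
  show thesis by (rule that[OF p(1) ph pd])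
qed

lemma sub_sym_degree: "sub (sym_degree K L B D 2 \<beta>) (sym_power K L 2)"
  unfolding sym_degree_def
  by (intro sub_span vs_sym) (auto simp: hom_tuples_2[OF B_group] intro!: symprod_closed, (erule (1) D_closed)+)

lemma sub_Kill_degree: "sub (Kill_degree K L B D \<beta>) (Kill K L)"
  unfolding Kill_degree_def by (rule sub_image[OF vs_sym vs_Kill lin_kill_class sub_sym_degree])

lemma symprod_in_degree:
  "\<gamma> \<in> carrier B \<Longrightarrow> \<delta> \<in> carrier B \<Longrightarrow> x \<in> D \<gamma> \<Longrightarrow> y \<in> D \<delta> \<Longrightarrow> \<gamma> \<otimes>\<^bsub>B\<^esub> \<delta> = \<beta> \<Longrightarrow>
    symprod K L [x, y] \<in> sym_degree K L B D 2 \<beta>"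
  unfolding sym_degree_def by (intro span_base imageI iffD2[OF hom_tuples_2[OF B_group]]) blast

text \<open>The truncated symmetric product respects the Killing relations, because [x,y] \<odot> z
  and x \<odot> [y,z] have equal degree for homogeneous x, y, z.\<close>

lemma Kill_projection:
  obtains r where "lin (Kill K L) (restrict_to (Kill K L) (Kill_degree K L B D \<beta>)) r"
    "\<And>\<gamma> \<delta> x y. \<gamma> \<in> carrier B \<Longrightarrow> \<delta> \<in> carrier B \<Longrightarrow> x \<in> D \<gamma> \<Longrightarrow> y \<in> D \<delta> \<Longrightarrow>
      r (kill_class K L (symprod K L [x, y])) =
        (if \<gamma> \<otimes>\<^bsub>B\<^esub> \<delta> = \<beta> then kill_class K L (symprod K L [x, y]) else \<zero>\<^bsub>Kill K L\<^esub>)"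
proof -
  let ?W = "Kill K L" and ?k = "\<lambda>x y. kill_class K L (symprod K L [x, y])"
  have k: "bilin L L ?W ?k" by (intro bilinI lin_kill_symprod)
  obtain \<phi> where \<phi>: "bilin L L ?W \<phi>"
    "\<And>\<gamma> \<delta> x y. \<gamma> \<in> carrier B \<Longrightarrow> \<delta> \<in> carrier B \<Longrightarrow> x \<in> D \<gamma> \<Longrightarrow> y \<in> D \<delta> \<Longrightarrow>
      \<phi> x y = (if \<gamma> \<otimes>\<^bsub>B\<^esub> \<delta> = \<beta> then ?k x y else \<zero>\<^bsub>?W\<^esub>)"
    by (rule homogeneous_bilin[OF vs_Kill k]) blast
  have sw: "bilin L L ?W (\<lambda>x y. \<phi> y x)"
    by (intro bilinI bilin_left[OF \<phi>(1)] bilin_right[OF \<phi>(1)])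
  have sym: "\<phi> x y = \<phi> y x" if "x \<in> carrier L" "y \<in> carrier L" for x y
  proof (rule bilin_homogeneous_eq[OF vs_Kill \<phi>(1) sw _ that])
    fix \<gamma> \<delta> x y assume "\<gamma> \<in> carrier B" "\<delta> \<in> carrier B" "x \<in> D \<gamma>" "y \<in> D \<delta>"
    then show "\<phi> x y = \<phi> y x"
      using \<phi>(2)[of \<gamma> \<delta> x y] \<phi>(2)[of \<delta> \<gamma> y x] B_comm[of \<gamma> \<delta>] symprod2_comm[of x L y] D_closed by auto
  qed
  obtain p where p: "lin (sym_power K L 2) ?W p"
    "\<And>a b. a \<in> carrier L \<Longrightarrow> b \<in> carrier L \<Longrightarrow> p (symprod K L [a, b]) = \<phi> a b"
    by (rule sym2_lift[OF vs_L vs_Kill \<phi>(1) sym]) blast+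
  have pk: "p (killing_map K L t) = \<zero>\<^bsub>?W\<^esub>" if "t \<in> carrier (tensor_power K L 3)" for t
  proof (rule lin_vanish[OF spans_tpow3[OF vs_L spans_homogeneous] lin_comp[OF p(1) killing_map(1)] vs_tpow vs_Kill _ that])
    fix s assume "s \<in> {pure_tensor K L [s, t, u] | s t u. s \<in> (\<Union>\<gamma>\<in>carrier B. D \<gamma>) \<and>
        t \<in> (\<Union>\<gamma>\<in>carrier B. D \<gamma>) \<and> u \<in> (\<Union>\<gamma>\<in>carrier B. D \<gamma>)}"
    then obtain x y z \<gamma> \<delta> \<epsilon> where s: "s = pure_tensor K L [x, y, z]"
      and g [simp]: "\<gamma> \<in> carrier B" "\<delta> \<in> carrier B" "\<epsilon> \<in> carrier B" "x \<in> D \<gamma>" "y \<in> D \<delta>" "z \<in> D \<epsilon>" by auto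
    have [simp]: "x \<in> carrier L" "y \<in> carrier L" "z \<in> carrier L" using g D_closed by blast+
    have "p (killing_map K L s) = \<phi> (bracket L x y) z \<ominus>\<^bsub>?W\<^esub> \<phi> x (bracket L y z)"
      unfolding s by (simp add: killing_map(2) lin_minus[OF p(1)] p(2))
    also have "\<phi> (bracket L x y) z = \<phi> x (bracket L y z)"
      using \<phi>(2)[of "\<gamma> \<otimes>\<^bsub>B\<^esub> \<delta>" \<epsilon> "bracket L x y" z] \<phi>(2)[of \<gamma> "\<delta> \<otimes>\<^bsub>B\<^esub> \<epsilon>" x "bracket L y z"]
        bracket_D[of \<gamma> \<delta> x y] bracket_D[of \<delta> \<epsilon> y z] B_assoc[of \<gamma> \<delta> \<epsilon>] kill_class_invariant[of x y z] by simp
    finally show "p (killing_map K L s) = \<zero>\<^bsub>?W\<^esub>" by (simp add: bilin_closed[OF \<phi>(1)])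
  qed
  obtain r where r: "lin ?W ?W r" "\<And>s. s \<in> carrier (sym_power K L 2) \<Longrightarrow> r (kill_class K L s) = p s"
    by (rule kill_lift[OF vs_Kill p(1) pk]) blast+
  have rk: "r (?k x y) = \<phi> x y" if "x \<in> carrier L" "y \<in> carrier L" for x y
    using that r(2) p(2) by simp
  have hom: "\<phi> x y \<in> Kill_degree K L B D \<beta>" if "x \<in> carrier L" "y \<in> carrier L" for x y
  proof (rule bilin_in_sub[OF \<phi>(1) vs_L vs_L vs_Kill _ _ sub_Kill_degree])
    fix s t assume "s \<in> (\<Union>\<gamma>\<in>carrier B. D \<gamma>)" "t \<in> (\<Union>\<gamma>\<in>carrier B. D \<gamma>)"
    then show "\<phi> s t \<in> Kill_degree K L B D \<beta>"
      using \<phi>(2) symprod_in_degree sub_closed(2)[OF sub_Kill_degree vs_Kill]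
      by (auto simp: Kill_degree_def)
  qed (use spansD[OF spans_homogeneous] spans_subset[OF spans_homogeneous] that in auto)
  have "r w \<in> Kill_degree K L B D \<beta>" if "w \<in> carrier ?W" for w
  proof -
    obtain s where s: "s \<in> carrier (sym_power K L 2)" "w = kill_class K L s" using kill_class_surj \<open>w \<in> carrier ?W\<close> by auto
    have "p s \<in> Kill_degree K L B D \<beta>"
      by (rule lin_span[OF p(1) vs_sym vs_Kill spans_subset[OF spans_sym2[OF vs_L spans_carrier]]
            sub_Kill_degree _ spansD[OF spans_sym2[OF vs_L spans_carrier] s(1)]])
        (use p(2) hom in auto)
    then show ?thesis using r(2) s by simp
  qed
  then have "lin ?W (restrict_to ?W (Kill_degree K L B D \<beta>)) r" by (rule lin_into_restrict[OF r(1)])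
  then show thesis by (rule that) (use rk \<phi>(2) D_closed in auto)
qed

text \<open>The hypothesis covers only cycles of degree \<open>\<beta>\<close>, whereas the
  factorisation through the differential needs arbitrary cycles. Write z as z1 + z2, with z1 of
  degree \<open>\<beta>\<close> and z2 made of other degrees. The projection of d z = 0 to degree
  \<open>\<beta>\<close> is d z1, so z1 is a cycle and the hypothesis applies to it; on z2 the map
  \<open>r\<close> kills the Koszul value.\<close>

lemma koszul_projection_cycle:
  assumes hyp: "\<And>h. h \<in> homology_degree K L B D 3 \<beta> \<Longrightarrow> reduced_koszul K L h = \<zero>\<^bsub>Kill K L\<^esub>"
    and r: "lin (Kill K L) W r" and W: "vs W"
    and r_hom: "\<And>\<gamma> \<delta> x y. \<gamma> \<in> carrier B \<Longrightarrow> \<delta> \<in> carrier B \<Longrightarrow> x \<in> D \<gamma> \<Longrightarrow> y \<in> D \<delta> \<Longrightarrow>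
      \<gamma> \<otimes>\<^bsub>B\<^esub> \<delta> \<noteq> \<beta> \<Longrightarrow> r (kill_class K L (symprod K L [x, y])) = \<zero>\<^bsub>W\<^esub>"
    and z: "z \<in> ce_cycles K L 3"
  shows "r (koszul K L z) = \<zero>\<^bsub>W\<^esub>"
proof -
  let ?E = "ext_power K L 2" and ?T = "ext_power K L 3" and ?d = "ce_diff K L 3"
  let ?U = "\<Union>\<gamma>\<in>carrier B. D \<gamma>"
  note d = ce_diff_3[OF alt_L]
  obtain p where p: "lin ?E ?E p"
    "\<And>\<gamma> \<delta> \<epsilon> x y u. \<gamma> \<in> carrier B \<Longrightarrow> \<delta> \<in> carrier B \<Longrightarrow> \<epsilon> \<in> carrier B \<Longrightarrow> x \<in> D \<gamma> \<Longrightarrow> y \<in> D \<delta> \<Longrightarrow> u \<in> D \<epsilon> \<Longrightarrow>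
      p (?d (wedge K L [x, y, u])) =
      (if \<gamma> \<otimes>\<^bsub>B\<^esub> (\<delta> \<otimes>\<^bsub>B\<^esub> \<epsilon>) = \<beta> then ?d (wedge K L [x, y, u]) else \<zero>\<^bsub>?E\<^esub>)"
    by (rule ext2_projection) blast
  have hD: "D \<gamma> \<subseteq> carrier L" if "\<gamma> \<in> carrier B" for \<gamma> using D_closed[OF that] by blast
  have wc: "wedge K L ` hom_tuples B D 3 \<beta> \<subseteq> carrier ?T"
    using tuples_hom_tuples[OF hD] by (auto intro!: wedge_closed)
  have deg: "sub (ext_degree K L B D 3 \<beta>) ?T" unfolding ext_degree_def by (rule sub_span[OF vs_ext wc])
  note degc = sub_closed[OF deg vs_ext]
  \<comment> \<open>In place of a projection of the third exterior power, the splitting is carried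
    through a span induction, with exactly the properties of z1 and z2 that the conclusion
    uses.\<close>
  let ?P = "\<lambda>z. \<exists>z1\<in>ext_degree K L B D 3 \<beta>. \<exists>z2\<in>carrier ?T. z = z1 \<oplus>\<^bsub>?T\<^esub> z2 \<and>
    p (?d z1) = ?d z1 \<and> p (?d z2) = \<zero>\<^bsub>?E\<^esub> \<and> r (koszul K L z2) = \<zero>\<^bsub>W\<^esub>"
  note pd = lin_comp[OF p(1) d(1)] and rk = lin_comp[OF r koszul(1)]
  have zT: "z \<in> carrier ?T" and dz: "?d z = \<zero>\<^bsub>?E\<^esub>" using z by (simp_all add: cycles_iff)
  note sp = spans_ext3[OF vs_L spans_homogeneous]
  have "?P z" using spansD[OF sp zT] vs_ext spans_subset[OF sp]
  proof (induction rule: span_induct)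
    case (base s)
    then obtain x y u \<gamma> \<delta> \<epsilon> where s: "s = wedge K L [x, y, u]"
      and g [simp]: "\<gamma> \<in> carrier B" "\<delta> \<in> carrier B" "\<epsilon> \<in> carrier B" "x \<in> D \<gamma>" "y \<in> D \<delta>" "u \<in> D \<epsilon>" by auto
    have [simp]: "x \<in> carrier L" "y \<in> carrier L" "u \<in> carrier L" using g D_closed by blast+
    have sT: "s \<in> carrier ?T" by (simp add: s)
    have pds: "p (?d s) = (if \<gamma> \<otimes>\<^bsub>B\<^esub> (\<delta> \<otimes>\<^bsub>B\<^esub> \<epsilon>) = \<beta> then ?d s else \<zero>\<^bsub>?E\<^esub>)"
      unfolding s by (rule p(2)[OF g])
    show ?case
    proof (cases "\<gamma> \<otimes>\<^bsub>B\<^esub> (\<delta> \<otimes>\<^bsub>B\<^esub> \<epsilon>) = \<beta>")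
      case True
      have "s \<in> ext_degree K L B D 3 \<beta>"
        unfolding ext_degree_def s
        by (rule span_base, rule imageI) (rule hom_tuples_3[OF B_group g True])
      then show ?thesis
        using True pds sT lin_zero[OF pd vs_ext vs_ext] lin_zero[OF rk vs_ext W]
        by (intro bexI[of _ s] bexI[of _ "\<zero>\<^bsub>?T\<^esub>"]) auto
    next
      case False
      have "r (koszul K L s) = \<zero>\<^bsub>W\<^esub>"
        unfolding s using r_hom[of \<gamma> "\<delta> \<otimes>\<^bsub>B\<^esub> \<epsilon>" x "bracket L y u"] False
        by (simp add: koszul(2) bracket_D)
      then show ?thesis
        using False pds sT degc(2) lin_zero[OF pd vs_ext vs_ext] lin_zero[OF d(1) vs_ext vs_ext]
        by (intro bexI[of _ "\<zero>\<^bsub>?T\<^esub>"] bexI[of _ s]) auto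
    qed
  next
    case zero
    show ?case
      using degc(2) lin_zero[OF pd vs_ext vs_ext] lin_zero[OF d(1) vs_ext vs_ext] lin_zero[OF rk vs_ext W]
      by (intro bexI[of _ "\<zero>\<^bsub>?T\<^esub>"]) auto
  next
    case (add x y)
    then obtain x1 x2 y1 y2 where h: "x1 \<in> ext_degree K L B D 3 \<beta>" "y1 \<in> ext_degree K L B D 3 \<beta>"
      "x2 \<in> carrier ?T" "y2 \<in> carrier ?T" "x = x1 \<oplus>\<^bsub>?T\<^esub> x2" "y = y1 \<oplus>\<^bsub>?T\<^esub> y2"
      "p (?d x1) = ?d x1" "p (?d x2) = \<zero>\<^bsub>?E\<^esub>" "r (koszul K L x2) = \<zero>\<^bsub>W\<^esub>"
      "p (?d y1) = ?d y1" "p (?d y2) = \<zero>\<^bsub>?E\<^esub>" "r (koszul K L y2) = \<zero>\<^bsub>W\<^esub>" by blast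
    note x1 = degc(1)[OF h(1)] and y1 = degc(1)[OF h(2)]
    have "x \<oplus>\<^bsub>?T\<^esub> y = (x1 \<oplus>\<^bsub>?T\<^esub> y1) \<oplus>\<^bsub>?T\<^esub> (x2 \<oplus>\<^bsub>?T\<^esub> y2)"
      using h x1 y1 by (simp add: vs_assoc vs_lcomm)
    moreover have "p (?d (x1 \<oplus>\<^bsub>?T\<^esub> y1)) = ?d (x1 \<oplus>\<^bsub>?T\<^esub> y1)"
      using lin_add[OF pd x1 y1] lin_add[OF d(1) x1 y1] h by simp
    moreover have "p (?d (x2 \<oplus>\<^bsub>?T\<^esub> y2)) = \<zero>\<^bsub>?E\<^esub>" using lin_add[OF pd h(3,4)] h by simp
    moreover have "r (koszul K L (x2 \<oplus>\<^bsub>?T\<^esub> y2)) = \<zero>\<^bsub>W\<^esub>" using lin_add[OF rk h(3,4)] h W by simp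
    ultimately show ?case using degc(4)[OF h(1,2)] vs_add[OF vs_ext h(3,4)] by blast
  next
    case (smult c x)
    then obtain x1 x2 where h: "x1 \<in> ext_degree K L B D 3 \<beta>"
      "x2 \<in> carrier ?T" "x = x1 \<oplus>\<^bsub>?T\<^esub> x2"
      "p (?d x1) = ?d x1" "p (?d x2) = \<zero>\<^bsub>?E\<^esub>" "r (koszul K L x2) = \<zero>\<^bsub>W\<^esub>" by blast
    note x1 = degc(1)[OF h(1)]
    have "c \<odot>\<^bsub>?T\<^esub> x = c \<odot>\<^bsub>?T\<^esub> x1 \<oplus>\<^bsub>?T\<^esub> c \<odot>\<^bsub>?T\<^esub> x2"
      using h x1 smult(1) by (simp add: vs_smult_add)
    moreover have "p (?d (c \<odot>\<^bsub>?T\<^esub> x1)) = ?d (c \<odot>\<^bsub>?T\<^esub> x1)"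
      using lin_smult[OF pd smult(1) x1] lin_smult[OF d(1) smult(1) x1] h by simp
    moreover have "p (?d (c \<odot>\<^bsub>?T\<^esub> x2)) = \<zero>\<^bsub>?E\<^esub>" using lin_smult[OF pd smult(1) h(2)] h smult(1) by simp
    moreover have "r (koszul K L (c \<odot>\<^bsub>?T\<^esub> x2)) = \<zero>\<^bsub>W\<^esub>" using lin_smult[OF rk smult(1) h(2)] h W smult(1) by simp
    ultimately show ?case using degc(6)[OF smult(1) h(1)] vs_smult[OF vs_ext smult(1) h(2)] by blast
  qed
  then obtain z1 z2 where z12: "z1 \<in> ext_degree K L B D 3 \<beta>" "z2 \<in> carrier ?T" "z = z1 \<oplus>\<^bsub>?T\<^esub> z2"
    "p (?d z1) = ?d z1" "p (?d z2) = \<zero>\<^bsub>?E\<^esub>" "r (koszul K L z2) = \<zero>\<^bsub>W\<^esub>" by blast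
  \<comment> \<open>Applying \<open>p\<close> to d z = 0 removes d z2 and leaves d z1, so z1 is
    itself a cycle.\<close>
  note z1T = degc(1)[OF z12(1)]
  have "\<zero>\<^bsub>?E\<^esub> = p (?d z)" using dz lin_zero[OF p(1) vs_ext vs_ext] by simp
  also have "\<dots> = ?d z1" using z12 z1T lin_closed[OF d(1) z1T] by (simp add: lin_add[OF pd])
  finally have "z1 \<in> ce_cycles K L 3" using z1T by (simp add: cycles_iff)
  then have "koszul K L z1 = \<zero>\<^bsub>Kill K L\<^esub>"
    using hyp[of "homology_class K L 3 z1"] z12(1) reduced_koszul by (auto simp: homology_degree_def)
  then have "r (koszul K L z1) = \<zero>\<^bsub>W\<^esub>" using lin_zero[OF r vs_Kill W] by simp
  then show ?thesis using z12 z1T W by (simp add: lin_add[OF rk])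
qed

end

subsection \<open>The Lie algebra \<open>A \<otimes> L\<close>\<close>

locale current_over_field = graded_over_field K L B D \<beta> + algebra_over_field K A
  for K :: "('k, 'r) ring_scheme" (structure)
    and L :: "('k, 'l, 'n) lie_algebra_scheme"
    and B :: "('b, 's) monoid_scheme" and D :: "'b \<Rightarrow> 'l set" and \<beta> :: 'b
    and A :: "('k, 'a, 'm) module_scheme"
begin

abbreviation "AL \<equiv> tensor_lie K A L"
abbreviation "ten \<equiv> tens K A L"
abbreviation "LL \<equiv> ext_power K L 2"
abbreviation "G2 \<equiv> ext_power K AL 2"
abbreviation "AxLL \<equiv> tensor K A LL"

text \<open>\<open>tensor_lie\<close> is the tensor product with one more record field. The linear
  structure is unchanged but the record type is not, so linearity statements have to be carried
  across field by field.\<close>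

lemma AL_simps [simp]:
  "carrier AL = carrier (tensor K A L)" "\<zero>\<^bsub>AL\<^esub> = \<zero>\<^bsub>tensor K A L\<^esub>"
  "x \<oplus>\<^bsub>AL\<^esub> y = x \<oplus>\<^bsub>tensor K A L\<^esub> y" "c \<odot>\<^bsub>AL\<^esub> x = c \<odot>\<^bsub>tensor K A L\<^esub> x"
  "bracket AL = tensor_bracket K A L"
  by (simp_all add: tensor_lie_def module.defs)

lemma lin_AL [simp]: "lin AL W h \<longleftrightarrow> lin (tensor K A L) W h" "lin U AL f \<longleftrightarrow> lin U (tensor K A L) f"
  by (simp_all add: lin_def)

lemma bilin_AL: "bilin AL AL W h \<longleftrightarrow> bilin (tensor K A L) (tensor K A L) W h"
  by (simp add: bilin_def)

lemma vs_AL [simp]: "vs AL"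
proof (rule moduleI)
  show "cring K" by (rule is_cring)
  have T: "vs (tensor K A L)" by simp
  show "abelian_group AL"
  proof (rule abelian_groupI)
    fix x assume "x \<in> carrier AL"
    then show "\<exists>y\<in>carrier AL. y \<oplus>\<^bsub>AL\<^esub> x = \<zero>\<^bsub>AL\<^esub>"
      by (intro bexI[of _ "\<ominus>\<^bsub>tensor K A L\<^esub> x"]) simp_all
  qed (use T in \<open>simp_all add: vs_assoc vs_comm vs_lcomm\<close>)
qed (simp_all add: vs_add_smult vs_smult_add vs_smult_smult)

lemma spans_AL: "spans AL {ten a x | a x. a \<in> carrier A \<and> x \<in> carrier L}"
proof -
  have "submodule N K AL \<longleftrightarrow> submodule N K (tensor K A L)" for N
  proof
    assume "submodule N K AL"
    from sub_closed[OF this vs_AL] show "submodule N K (tensor K A L)" by (intro subI) auto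
  next
    assume "submodule N K (tensor K A L)"
    from sub_closed[OF this vs_tensor] show "submodule N K AL" by (intro subI) auto
  qed
  then show ?thesis using spans_tensor_all[of A L] by (simp add: spans_def mod_span_def)
qed

lemma tensor_bracket:
  shows "bilin AL AL AL (tensor_bracket K A L)"
    "\<And>a x b y. a \<in> carrier A \<Longrightarrow> x \<in> carrier L \<Longrightarrow> b \<in> carrier A \<Longrightarrow> y \<in> carrier L \<Longrightarrow>
      tensor_bracket K A L (ten a x) (ten b y) = ten (a \<otimes>\<^bsub>A\<^esub> b) (bracket L x y)"
proof -
  let ?T = "tensor K A L"
  let ?G = "{ten a x | a x. a \<in> carrier A \<and> x \<in> carrier L}"
  obtain \<phi> where \<phi>: "bilin ?T ?T ?T \<phi>"
    "\<And>a x b y. a \<in> carrier A \<Longrightarrow> x \<in> carrier L \<Longrightarrow> b \<in> carrier A \<Longrightarrow> y \<in> carrier L \<Longrightarrow>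
      \<phi> (ten a x) (ten b y) = ten (a \<otimes>\<^bsub>A\<^esub> b) (bracket L x y)"
  proof (rule tensor_tensor_lift[OF vs_A vs_L vs_tensor, of A L "\<lambda>a x b y. ten (a \<otimes>\<^bsub>A\<^esub> b) (bracket L x y)"])
    show "bilin A L ?T (\<lambda>a x. ten (a \<otimes>\<^bsub>A\<^esub> b) (bracket L x y))" if "b \<in> carrier A" "y \<in> carrier L" for b y
      using that by (intro bilinI lin_intros) simp_all
    show "bilin A L ?T (\<lambda>b y. ten (a \<otimes>\<^bsub>A\<^esub> b) (bracket L x y))" if "a \<in> carrier A" "x \<in> carrier L" for a x
      using that by (intro bilinI lin_intros) simp_all
  qed blast
  obtain h where h: "lin (tensor K ?T ?T) ?T h"
    "\<And>u v. u \<in> carrier ?T \<Longrightarrow> v \<in> carrier ?T \<Longrightarrow> h (tens K ?T ?T u v) = \<phi> u v"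
    by (rule tensor_lift[OF vs_tensor vs_tensor vs_tensor \<phi>(1)]) blast
  let ?P = "\<lambda>f. \<forall>a\<in>carrier A. \<forall>b\<in>carrier A. \<forall>x\<in>carrier L. \<forall>y\<in>carrier L.
          f (tens K ?T ?T (ten a x) (ten b y)) = ten (a \<otimes>\<^bsub>A\<^esub> b) (bracket L x y)"
  have P: "?P (restrict h (carrier (tensor K ?T ?T)))" using h(2) \<phi>(2) by simp
  have un: "\<forall>p q. lin (tensor K ?T ?T) ?T p \<longrightarrow> lin (tensor K ?T ?T) ?T q \<longrightarrow>
      ?P p \<longrightarrow> ?P q \<longrightarrow> (\<forall>s\<in>{tens K ?T ?T s t | s t. s \<in> ?G \<and> t \<in> ?G}. p s = q s)" by auto
  note t = the_hom_props[where P = ?P, OF spans_tensor[OF vs_tensor vs_tensor spans_tensor_all spans_tensor_all]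
      vs_tensor vs_tensor h(1) P un]
  have br: "tensor_bracket K A L u v = \<phi> u v" if "u \<in> carrier ?T" "v \<in> carrier ?T" for u v
    unfolding tensor_bracket_def using t(4)[of "tens K ?T ?T u v"] h(2) that by simp
  have "bilin ?T ?T ?T (tensor_bracket K A L)"
    by (rule bilin_cong[OF \<phi>(1)]) (simp_all add: br)
  then show "bilin AL AL AL (tensor_bracket K A L)" by (simp add: bilin_def)
  show "\<And>a x b y. a \<in> carrier A \<Longrightarrow> x \<in> carrier L \<Longrightarrow> b \<in> carrier A \<Longrightarrow> y \<in> carrier L \<Longrightarrow>
      tensor_bracket K A L (ten a x) (ten b y) = ten (a \<otimes>\<^bsub>A\<^esub> b) (bracket L x y)"
    by (simp add: br \<phi>(2))
qed

lemma bilin_AL_eq: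
  assumes "vs W" "bilin AL AL W \<phi>" "bilin AL AL W \<psi>"
    "\<And>a x b y. a \<in> carrier A \<Longrightarrow> x \<in> carrier L \<Longrightarrow> b \<in> carrier A \<Longrightarrow> y \<in> carrier L \<Longrightarrow>
      \<phi> (ten a x) (ten b y) = \<psi> (ten a x) (ten b y)"
    "u \<in> carrier AL" "v \<in> carrier AL"
  shows "\<phi> u v = \<psi> u v"
  by (rule bilin_eq[OF spans_AL spans_AL assms(2,3) vs_AL vs_AL assms(1) _ assms(5,6)])
    (use assms(4) in blast)

text \<open>An element of A \<otimes> L is in general a sum of pure tensors, on which alternation
  could not be tested directly; skewness can be tested on pure tensors.\<close>

lemma skew_alternating_AL:
  assumes W: "vs W" and \<phi>: "bilin AL AL W \<phi>"
    and skew: "\<And>a x b y. a \<in> carrier A \<Longrightarrow> x \<in> carrier L \<Longrightarrow> b \<in> carrier A \<Longrightarrow> y \<in> carrier L \<Longrightarrow>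
      \<phi> (ten a x) (ten b y) = \<ominus>\<^bsub>W\<^esub> \<phi> (ten b y) (ten a x)"
    and u: "u \<in> carrier AL"
  shows "\<phi> u u = \<zero>\<^bsub>W\<^esub>"
proof -
  have "bilin AL AL W (\<lambda>u v. \<ominus>\<^bsub>W\<^esub> \<phi> v u)"
    by (intro bilinI lin_uminus W bilin_left[OF \<phi>] bilin_right[OF \<phi>])
  from bilin_AL_eq[OF W \<phi> this skew u u] show ?thesis
    by (rule bilin_skew_alternating[OF \<phi> vs_AL W char u])
qed

lemma alt_AL: "alt_bracket AL"
  unfolding alt_bracket_def
proof (intro conjI ballI)
  fix u assume u: "u \<in> carrier AL"
  show "bracket AL u u = \<zero>\<^bsub>AL\<^esub>"
    unfolding AL_simps(5)
  proof (rule skew_alternating_AL[OF vs_AL tensor_bracket(1) _ u])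
    fix a x b y assume [simp]: "a \<in> carrier A" "x \<in> carrier L" "b \<in> carrier A" "y \<in> carrier L"
    have "ten (a \<otimes>\<^bsub>A\<^esub> b) (\<ominus>\<^bsub>L\<^esub> bracket L y x) = \<ominus>\<^bsub>AL\<^esub> ten (a \<otimes>\<^bsub>A\<^esub> b) (bracket L y x)"
      using lin_neg[of L AL "ten (a \<otimes>\<^bsub>A\<^esub> b)" "bracket L y x"] bilin_right[OF bilin_tens[OF vs_A vs_L], of "a \<otimes>\<^bsub>A\<^esub> b"]
      by simp
    then show "tensor_bracket K A L (ten a x) (ten b y) = \<ominus>\<^bsub>AL\<^esub> tensor_bracket K A L (ten b y) (ten a x)"
      using bracket_skew_L[of x y] mult_A_simps(3)[of a b] by (simp add: tensor_bracket(2))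
  qed
next
  show "bilin AL AL AL (bracket AL)" unfolding AL_simps(5) by (rule tensor_bracket(1))
qed (rule vs_AL)


lemma lin_ten [lin_intros]:
  "lin U A f \<Longrightarrow> x \<in> carrier L \<Longrightarrow> lin U AL (\<lambda>u. ten (f u) x)"
  "lin U L h \<Longrightarrow> a \<in> carrier A \<Longrightarrow> lin U AL (\<lambda>u. ten a (h u))"
  by (simp_all add: lin_tens)

text \<open>Maps out of the exterior square of A \<otimes> L come from functions of four arguments.
  Bilinearity in the second pair is inherited from the first through skewness.\<close>

lemma current_lift:
  assumes W: "vs W"
    and q1: "\<And>b y. b \<in> carrier A \<Longrightarrow> y \<in> carrier L \<Longrightarrow> bilin A L W (\<lambda>a x. q a x b y)"
    and skew: "\<And>a x b y. a \<in> carrier A \<Longrightarrow> x \<in> carrier L \<Longrightarrow> b \<in> carrier A \<Longrightarrow> y \<in> carrier L \<Longrightarrow>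
      q a x b y = \<ominus>\<^bsub>W\<^esub> q b y a x"
  obtains h where "lin G2 W h"
    "\<And>a x b y. a \<in> carrier A \<Longrightarrow> x \<in> carrier L \<Longrightarrow> b \<in> carrier A \<Longrightarrow> y \<in> carrier L \<Longrightarrow>
      h (wedge K AL [ten a x, ten b y]) = q a x b y"
proof -
  have q2: "bilin A L W (\<lambda>b y. q a x b y)" if "a \<in> carrier A" "x \<in> carrier L" for a x
  proof (rule bilin_cong[where \<phi> = "\<lambda>b y. \<ominus>\<^bsub>W\<^esub> q b y a x"])
    show "bilin A L W (\<lambda>b y. \<ominus>\<^bsub>W\<^esub> q b y a x)"
      by (intro bilinI lin_uminus W bilin_left[OF q1[OF that]] bilin_right[OF q1[OF that]])
  qed (simp_all add: skew[OF that, symmetric])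
  obtain \<phi> where \<phi>: "bilin (tensor K A L) (tensor K A L) W \<phi>"
    "\<And>a x b y. a \<in> carrier A \<Longrightarrow> x \<in> carrier L \<Longrightarrow> b \<in> carrier A \<Longrightarrow> y \<in> carrier L \<Longrightarrow>
      \<phi> (ten a x) (ten b y) = q a x b y"
    by (rule tensor_tensor_lift[OF vs_A vs_L W q1 q2]) blast+
  have b: "bilin AL AL W \<phi>" using \<phi>(1) by (simp add: bilin_AL)
  have sk: "\<phi> (ten a x) (ten b y) = \<ominus>\<^bsub>W\<^esub> \<phi> (ten b y) (ten a x)"
    if "a \<in> carrier A" "x \<in> carrier L" "b \<in> carrier A" "y \<in> carrier L" for a x b y
    using skew[OF that] that by (simp add: \<phi>(2))
  obtain h where h: "lin G2 W h"
    "\<And>u v. u \<in> carrier AL \<Longrightarrow> v \<in> carrier AL \<Longrightarrow> h (wedge K AL [u, v]) = \<phi> u v"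
    by (rule ext2_lift[OF vs_AL W b skew_alternating_AL[OF W b sk]]) blast+
  show thesis by (rule that[OF h(1)]) (simp add: h(2) \<phi>(2))
qed

lemma spans_G2: "spans G2 {wedge K AL [ten a x, ten b y] | a x b y.
    a \<in> carrier A \<and> x \<in> carrier L \<and> b \<in> carrier A \<and> y \<in> carrier L}"
  by (rule back_subst[of "spans G2", OF spans_ext2[OF vs_AL spans_AL]]) blast

lemma wedge_ten [simp]: "a \<in> carrier A \<Longrightarrow> x \<in> carrier L \<Longrightarrow> b \<in> carrier A \<Longrightarrow> y \<in> carrier L \<Longrightarrow>
    wedge K AL [ten a x, ten b y] \<in> carrier G2"
  by simp


lemma chain_map2:
  shows "lin G2 AxLL (chain_map2 K A L)"
    "\<And>a x b y. a \<in> carrier A \<Longrightarrow> x \<in> carrier L \<Longrightarrow> b \<in> carrier A \<Longrightarrow> y \<in> carrier L \<Longrightarrow>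
      chain_map2 K A L (wedge K AL [ten a x, ten b y]) = tens K A LL (a \<otimes>\<^bsub>A\<^esub> b) (wedge K L [x, y])"
proof -
  obtain h where h: "lin G2 AxLL h"
    "\<And>a x b y. a \<in> carrier A \<Longrightarrow> x \<in> carrier L \<Longrightarrow> b \<in> carrier A \<Longrightarrow> y \<in> carrier L \<Longrightarrow>
      h (wedge K AL [ten a x, ten b y]) = tens K A LL (a \<otimes>\<^bsub>A\<^esub> b) (wedge K L [x, y])"
  proof (rule current_lift[OF vs_tensor, of A LL "\<lambda>a x b y. tens K A LL (a \<otimes>\<^bsub>A\<^esub> b) (wedge K L [x, y])"])
    show "bilin A L AxLL (\<lambda>a x. tens K A LL (a \<otimes>\<^bsub>A\<^esub> b) (wedge K L [x, y]))"
      if "b \<in> carrier A" "y \<in> carrier L" for b y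
      using that by (intro bilinI lin_intros) simp_all
    fix a x b y assume [simp]: "a \<in> carrier A" "x \<in> carrier L" "b \<in> carrier A" "y \<in> carrier L"
    have "tens K A LL (a \<otimes>\<^bsub>A\<^esub> b) (\<ominus>\<^bsub>LL\<^esub> wedge K L [y, x]) = \<ominus>\<^bsub>AxLL\<^esub> tens K A LL (a \<otimes>\<^bsub>A\<^esub> b) (wedge K L [y, x])"
      by (rule lin_neg[OF bilin_right[OF bilin_tens]]) simp_all
    then show "tens K A LL (a \<otimes>\<^bsub>A\<^esub> b) (wedge K L [x, y]) = \<ominus>\<^bsub>AxLL\<^esub> tens K A LL (b \<otimes>\<^bsub>A\<^esub> a) (wedge K L [y, x])"
      using wedge2_swap[OF vs_L, of x y] mult_A_simps(3)[of a b] by simp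
  qed blast
  let ?P = "\<lambda>f. \<forall>a\<in>carrier A. \<forall>b\<in>carrier A. \<forall>x\<in>carrier L. \<forall>y\<in>carrier L.
          f (wedge K AL [ten a x, ten b y]) = tens K A LL (a \<otimes>\<^bsub>A\<^esub> b) (wedge K L [x, y])"
  have P: "?P (restrict h (carrier G2))" using h(2) by simp
  have un: "\<forall>p q. lin G2 AxLL p \<longrightarrow> lin G2 AxLL q \<longrightarrow> ?P p \<longrightarrow> ?P q \<longrightarrow>
    (\<forall>s\<in>{wedge K AL [ten a x, ten b y] | a x b y.
    a \<in> carrier A \<and> x \<in> carrier L \<and> b \<in> carrier A \<and> y \<in> carrier L}. p s = q s)" by auto
  note t = the_hom_props[where P = ?P, OF spans_G2 vs_ext vs_tensor h(1) P un, folded chain_map2_def]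
  show "lin G2 AxLL (chain_map2 K A L)" by (rule t(1))
  show "\<And>a x b y. a \<in> carrier A \<Longrightarrow> x \<in> carrier L \<Longrightarrow> b \<in> carrier A \<Longrightarrow> y \<in> carrier L \<Longrightarrow>
      chain_map2 K A L (wedge K AL [ten a x, ten b y]) = tens K A LL (a \<otimes>\<^bsub>A\<^esub> b) (wedge K L [x, y])"
    using t(2) by blast
qed

text \<open>By commutativity of A all three terms of the boundary receive the same coefficient
  abc.\<close>

lemma chain_map2_boundary:
  assumes "a \<in> carrier A" "x \<in> carrier L" "b \<in> carrier A" "y \<in> carrier L" "c \<in> carrier A" "z \<in> carrier L"
  shows "chain_map2 K A L (ce_diff K AL 3 (wedge K AL [ten a x, ten b y, ten c z])) =
    tens K A LL (a \<otimes>\<^bsub>A\<^esub> b \<otimes>\<^bsub>A\<^esub> c) (ce_diff K L 3 (wedge K L [x, y, z]))"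
proof -
  note [simp] = assms
  have t: "lin LL AxLL (tens K A LL (a \<otimes>\<^bsub>A\<^esub> b \<otimes>\<^bsub>A\<^esub> c))"
    by (rule bilin_right[OF bilin_tens]) simp_all
  have m: "a \<otimes>\<^bsub>A\<^esub> c \<otimes>\<^bsub>A\<^esub> b = a \<otimes>\<^bsub>A\<^esub> b \<otimes>\<^bsub>A\<^esub> c" "b \<otimes>\<^bsub>A\<^esub> c \<otimes>\<^bsub>A\<^esub> a = a \<otimes>\<^bsub>A\<^esub> b \<otimes>\<^bsub>A\<^esub> c"
    by (simp_all add: mult_A_simps)
  show ?thesis
    by (simp add: ce_diff_3(2)[OF alt_AL] ce_diff_3(2)[OF alt_L] tensor_bracket(2) lin_add[OF chain_map2(1)]
      lin_minus[OF chain_map2(1)] chain_map2(2) lin_add[OF t] lin_minus[OF t] m)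
qed

lemma spans_G3: "spans (ext_power K AL 3) {wedge K AL [ten a x, ten b y, ten c z] | a x b y c z.
    a \<in> carrier A \<and> x \<in> carrier L \<and> b \<in> carrier A \<and> y \<in> carrier L \<and> c \<in> carrier A \<and> z \<in> carrier L}"
  by (rule back_subst[of "spans (ext_power K AL 3)", OF spans_ext3[OF vs_AL spans_AL]]) blast

lemma vanish_on_boundaries:
  assumes W: "vs W" and h: "lin G2 W h"
    and z: "\<And>a x b y c z. a \<in> carrier A \<Longrightarrow> x \<in> carrier L \<Longrightarrow> b \<in> carrier A \<Longrightarrow> y \<in> carrier L \<Longrightarrow>
      c \<in> carrier A \<Longrightarrow> z \<in> carrier L \<Longrightarrow> h (ce_diff K AL 3 (wedge K AL [ten a x, ten b y, ten c z])) = \<zero>\<^bsub>W\<^esub>"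
    and u: "u \<in> ce_boundaries K AL 2"
  shows "h u = \<zero>\<^bsub>W\<^esub>"
proof -
  obtain w where w: "w \<in> carrier (ext_power K AL 3)" "u = ce_diff K AL 3 w"
    using u by (auto simp: ce_boundaries_def)
  have "h (ce_diff K AL 3 w) = \<zero>\<^bsub>W\<^esub>"
    by (rule lin_vanish[OF spans_G3 lin_comp[OF h ce_diff_3(1)[OF alt_AL]] vs_ext W _ w(1)]) (use z in blast)
  then show ?thesis using w by simp
qed

abbreviation "Q \<equiv> quot_mod G2 (ce_boundaries K AL 2)"
abbreviation "cls \<equiv> homology_class K AL 2"

lemma sub_B2: "sub (ce_boundaries K AL 2) G2"
  by (rule sub_boundaries(2)[OF alt_AL])

lemma vs_Q [simp]: "vs Q"
  by (rule vs_quot[OF vs_ext sub_B2])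

lemma lin_cls: "lin G2 Q cls"
  by (rule lin_homology_class[OF sub_B2])

lemmas lin_cls' [lin_intros] = lin_comp[OF lin_cls]

lemma cls_closed [simp]: "z \<in> carrier G2 \<Longrightarrow> cls z \<in> carrier Q"
  by (rule lin_closed[OF lin_cls])

lemma cls_eq_iff: "z \<in> carrier G2 \<Longrightarrow> w \<in> carrier G2 \<Longrightarrow> cls z = cls w \<longleftrightarrow> z \<ominus>\<^bsub>G2\<^esub> w \<in> ce_boundaries K AL 2"
  unfolding homology_class_def by (rule coset_eq_iff[OF vs_ext sub_B2])

lemma Q_lift:
  assumes "vs W" "lin G2 W h"
    "\<And>a x b y c z. a \<in> carrier A \<Longrightarrow> x \<in> carrier L \<Longrightarrow> b \<in> carrier A \<Longrightarrow> y \<in> carrier L \<Longrightarrow>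
      c \<in> carrier A \<Longrightarrow> z \<in> carrier L \<Longrightarrow> h (ce_diff K AL 3 (wedge K AL [ten a x, ten b y, ten c z])) = \<zero>\<^bsub>W\<^esub>"
  obtains k where "lin Q W k" "\<And>z. z \<in> carrier G2 \<Longrightarrow> k (cls z) = h z"
  unfolding homology_class_def
  by (rule quot_lift[OF vs_ext assms(1) sub_B2 assms(2) vanish_on_boundaries[OF assms]]) blast+

subsection \<open>The kernel of the natural map\<close>

text \<open>\<open>e\<close> is the differential in degree 2 once the first exterior power is
  identified with L. The bracket ab \<otimes> [x,y] of a \<otimes> x and b \<otimes> y depends only
  on ab \<otimes> (x \<and> y), so being a cycle for A \<otimes> L is a condition on the image under
  the chain map.\<close>

lemma bracket_map:
  obtains e where "lin LL L e" "\<And>x y. x \<in> carrier L \<Longrightarrow> y \<in> carrier L \<Longrightarrow> e (wedge K L [x, y]) = bracket L x y"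
    "\<And>w. w \<in> carrier LL \<Longrightarrow> w \<in> ce_cycles K L 2 \<longleftrightarrow> e w = \<zero>\<^bsub>L\<^esub>"
    "\<And>z. z \<in> carrier G2 \<Longrightarrow> z \<in> ce_cycles K AL 2 \<longleftrightarrow>
      tensor_map K A LL A L (\<lambda>a. a) e (chain_map2 K A L z) = \<zero>\<^bsub>tensor K A L\<^esub>"
proof -
  obtain e where e: "lin LL L e" "\<And>x y. x \<in> carrier L \<Longrightarrow> y \<in> carrier L \<Longrightarrow> e (wedge K L [x, y]) = bracket L x y"
    by (rule ext2_lift[OF vs_L vs_L alt_bracketD(2)[OF alt_L]]) auto
  obtain u where u: "lin (ext_power K L 1) L u" "\<And>x. x \<in> carrier L \<Longrightarrow> u (wedge K L [x]) = x"
    by (rule ext1_lift[OF vs_L vs_L lin_id]) blast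
  obtain v where v: "lin (ext_power K AL 1) AL v" "\<And>x. x \<in> carrier AL \<Longrightarrow> v (wedge K AL [x]) = x"
    by (rule ext1_lift[OF vs_AL vs_AL lin_id]) blast
  have one: "(2::nat) - 1 = 1" by (simp add: One_nat_def)
  have de: "ce_diff K L 2 w = wedge K L [e w]" if "w \<in> carrier LL" for w
    by (rule lin_eq[OF spans_ext2[OF vs_L spans_carrier] ce_diff_2(1)[OF alt_L] lin_wedge1[OF vs_L e(1)] vs_ext vs_ext _ that])
      (auto simp: ce_diff_2(2)[OF alt_L] e(2))
  have 1: "w \<in> ce_cycles K L 2 \<longleftrightarrow> e w = \<zero>\<^bsub>L\<^esub>" if w: "w \<in> carrier LL" for w
  proof -
    have "wedge K L [e w] = \<zero>\<^bsub>ext_power K L 1\<^esub> \<longleftrightarrow> e w = \<zero>\<^bsub>L\<^esub>"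
      using u(2)[OF lin_closed[OF e(1) w]] lin_zero[OF u(1) vs_ext vs_L]
        lin_zero[OF lin_wedge1[OF vs_L lin_id] vs_L vs_ext] by metis
    then show ?thesis using w de[OF w] by (simp only: cycles_iff one) blast
  qed
  let ?e = "tensor_map K A LL A L (\<lambda>a. a) e"
  note te = tensor_map[OF vs_A vs_ext vs_A vs_L lin_id e(1)]
  have dm: "ce_diff K AL 2 z = wedge K AL [?e (chain_map2 K A L z)]" if "z \<in> carrier G2" for z
  proof (rule lin_eq[OF spans_G2 ce_diff_2(1)[OF alt_AL] _ vs_ext vs_ext _ that])
    show "lin G2 (ext_power K AL 1) (\<lambda>z. wedge K AL [?e (chain_map2 K A L z)])"
      by (intro lin_wedge1 vs_AL) (simp add: lin_comp[OF te(1) chain_map2(1)])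
  qed (auto simp: ce_diff_2(2)[OF alt_AL] chain_map2(2) te(2) e(2) tensor_bracket(2))
  have 2: "z \<in> ce_cycles K AL 2 \<longleftrightarrow> ?e (chain_map2 K A L z) = \<zero>\<^bsub>tensor K A L\<^esub>" if z: "z \<in> carrier G2" for z
  proof -
    have c: "?e (chain_map2 K A L z) \<in> carrier AL"
      using lin_closed[OF lin_comp[OF te(1) chain_map2(1)] z] by simp
    have "wedge K AL [?e (chain_map2 K A L z)] = \<zero>\<^bsub>ext_power K AL 1\<^esub> \<longleftrightarrow> ?e (chain_map2 K A L z) = \<zero>\<^bsub>AL\<^esub>"
      using v(2)[OF c] lin_zero[OF v(1) vs_ext vs_AL]
        lin_zero[OF lin_wedge1[OF vs_AL lin_id] vs_AL vs_ext] by metis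
    then show ?thesis using z dm[OF z] by (simp only: cycles_iff one AL_simps(2)) blast
  qed
  show thesis by (rule that[OF e 1 2])
qed

abbreviation "half \<equiv> inv (\<one> \<oplus> \<one>)"

lemma half_closed [simp]: "half \<in> carrier K"
  using char field_Units by auto

lemma half_double [simp]:
  assumes "vs V" "x \<in> carrier V"
  shows "half \<odot>\<^bsub>V\<^esub> x \<oplus>\<^bsub>V\<^esub> half \<odot>\<^bsub>V\<^esub> x = x"
proof -
  have u: "\<one> \<oplus> \<one> \<in> Units K" using char field_Units by auto
  have "half \<odot>\<^bsub>V\<^esub> x \<oplus>\<^bsub>V\<^esub> half \<odot>\<^bsub>V\<^esub> x = (\<one> \<oplus> \<one>) \<odot>\<^bsub>V\<^esub> (half \<odot>\<^bsub>V\<^esub> x)"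
    using assms by (simp add: vs_add_smult)
  also have "\<dots> = ((\<one> \<oplus> \<one>) \<otimes> half) \<odot>\<^bsub>V\<^esub> x" using assms by (simp add: vs_smult_smult)
  also have "\<dots> = x" using u assms by simp
  finally show ?thesis .
qed

text \<open>\<open>N\<close> describes the natural map on the level of A \<otimes> \<Lambda>^2 L:
  project to cycles, then take classes. The third property is exactness of A \<otimes> B_2
  \<rightarrow> A \<otimes> Z_2 \<rightarrow> A \<otimes> H_2 in the middle, obtained by splitting
  \<Lambda>^2 L before tensoring with A.\<close>

lemma natural_map2:
  obtains N where "lin AxLL (tensor K A (homology K L 2)) N"
    "\<And>z. z \<in> ce_cycles K AL 2 \<Longrightarrow> natural_map2 K A L (cls z) = N (chain_map2 K A L z)"
    "\<And>z. z \<in> ce_cycles K AL 2 \<Longrightarrow> N (chain_map2 K A L z) = \<zero>\<^bsub>tensor K A (homology K L 2)\<^esub> \<Longrightarrow>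
      \<exists>t\<in>carrier (tensor K A (ext_power K L 3)).
        chain_map2 K A L z = tensor_map K A (ext_power K L 3) A LL (\<lambda>a. a) (ce_diff K L 3) t"
    "\<And>z. z \<in> carrier G2 \<Longrightarrow> chain_map2 K A L z = \<zero>\<^bsub>AxLL\<^esub> \<Longrightarrow> z \<in> ce_cycles K AL 2"
proof -
  let ?H = "homology K L 2" and ?hc = "homology_class K L 2" and ?Z = "ce_cycles K L 2"
  let ?Zr = "restrict_to LL ?Z" and ?m = "chain_map2 K A L" and ?T = "tensor K A L" and ?E3 = "ext_power K L 3"
  let ?tm = "\<lambda>V W f. tensor_map K A V A W (\<lambda>a. a) f"
  note B = sub_boundaries(2)[OF alt_L] and Z = sub_cycles(2)[OF alt_L]
  have vH [simp]: "vs ?H" by (rule vs_homology[OF B Z])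
  have vZ [simp]: "vs ?Zr" by (rule vs_restrict[OF vs_ext Z])
  have hc: "lin ?Zr ?H ?hc" by (rule lin_homology_class_cycles[OF B Z])
  obtain e where e: "lin LL L e" "\<And>x y. x \<in> carrier L \<Longrightarrow> y \<in> carrier L \<Longrightarrow> e (wedge K L [x, y]) = bracket L x y"
    "\<And>w. w \<in> carrier LL \<Longrightarrow> w \<in> ?Z \<longleftrightarrow> e w = \<zero>\<^bsub>L\<^esub>"
    "\<And>z. z \<in> carrier G2 \<Longrightarrow> z \<in> ce_cycles K AL 2 \<longleftrightarrow> ?tm LL L e (?m z) = \<zero>\<^bsub>?T\<^esub>"
    by (rule bracket_map) blast
  obtain d where d: "lin L LL d" "\<And>w. w \<in> carrier LL \<Longrightarrow> e (d (e w)) = e w"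
    by (rule pseudo_inverse_exists[OF vs_ext vs_L e(1)]) blast
  note de = lin_comp[OF d(1) e(1)]
  \<comment> \<open>As \<open>d\<close> is a generalised inverse of \<open>e\<close>, this is a
    projection of \<Lambda>^2 L onto the cycles.\<close>
  define P where "P w = w \<ominus>\<^bsub>LL\<^esub> d (e w)" for w
  have P: "lin LL LL P" unfolding P_def by (intro lin_diff vs_ext lin_id de)
  have PZ: "P w \<in> ?Z" if "w \<in> carrier LL" for w
    using e(3)[OF lin_closed[OF P that]] that lin_minus[OF e(1) vs_ext vs_L that lin_closed[OF de that]] d(2)[OF that]
      lin_closed[OF e(1) that] by (simp add: P_def)
  have Pid: "P w = w" if "w \<in> ?Z" for w
    using e(3) sub_closed(1)[OF Z vs_ext that] that lin_zero[OF d(1) vs_L vs_ext] by (simp add: P_def)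
  have Pr: "lin LL ?Zr P" by (rule lin_into_restrict[OF P PZ])
  have hP: "lin LL ?H (\<lambda>w. ?hc (P w))" by (rule lin_comp[OF hc Pr])
  define N where "N = ?tm LL ?H (\<lambda>w. ?hc (P w))"
  note N = tensor_map[OF vs_A vs_ext vs_A vH lin_id hP, folded N_def]
  note te = tensor_map[OF vs_A vs_ext vs_A vs_L lin_id e(1)]
  have i: "lin ?Zr LL (\<lambda>c. c)" by (rule lin_restrict_dom[OF lin_id vs_ext Z])
  note ti = tensor_map[OF vs_A vZ vs_A vs_ext lin_id i]
  note tP = tensor_map[OF vs_A vs_ext vs_A vZ lin_id Pr]
  note td = tensor_map[OF vs_A vs_L vs_A vs_ext lin_id d(1)]
  note tq = tensor_map[OF vs_A vZ vs_A vH lin_id hc]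
  have m0: "?hc (P w) = \<zero>\<^bsub>?H\<^esub>" if "w \<in> ce_boundaries K L 2" for w
    using homology_class_zero_iff[OF B sub_closed(1)[OF B vs_ext that]]
      Pid[OF subsetD[OF boundaries_2_subset_cycles that]] that by simp
  obtain k where k: "lin Q (tensor K A ?H) k" "\<And>z. z \<in> carrier G2 \<Longrightarrow> k (cls z) = N (?m z)"
  proof (rule Q_lift[OF vs_tensor lin_comp[OF N(1) chain_map2(1)]])
    fix a x b y c z assume a [simp]: "a \<in> carrier A" "x \<in> carrier L" "b \<in> carrier A" "y \<in> carrier L" "c \<in> carrier A" "z \<in> carrier L"
    have w: "ce_diff K L 3 (wedge K L [x, y, z]) \<in> ce_boundaries K L 2"
      by (auto simp: ce_boundaries_def)
    have "N (?m (ce_diff K AL 3 (wedge K AL [ten a x, ten b y, ten c z]))) = tens K A ?H (a \<otimes>\<^bsub>A\<^esub> b \<otimes>\<^bsub>A\<^esub> c) \<zero>\<^bsub>?H\<^esub>"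
      unfolding chain_map2_boundary[OF a] using N(2) m0[OF w] sub_closed(1)[OF B vs_ext w] by simp
    also have "\<dots> = \<zero>\<^bsub>tensor K A ?H\<^esub>"
      by (rule lin_zero[OF bilin_right[OF bilin_tens]]) simp_all
    finally show "N (?m (ce_diff K AL 3 (wedge K AL [ten a x, ten b y, ten c z]))) = \<zero>\<^bsub>tensor K A ?H\<^esub>" .
  qed blast
  let ?HG = "homology K AL 2"
  note ZG = sub_cycles(2)[OF alt_AL]
  have kH: "lin ?HG (tensor K A ?H) k"
    unfolding homology_eq[of AL] by (rule lin_restrict_dom[OF k(1) vs_Q sub_homology[OF sub_B2 ZG]])
  let ?Pr = "\<lambda>f. \<forall>z\<in>ce_cycles K AL 2. \<forall>w\<in>carrier (tensor K A ?Zr).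
          ?m z = ?tm ?Zr LL (\<lambda>c. c) w \<longrightarrow> f (cls z) = ?tm ?Zr ?H ?hc w"
  have Ni: "N (?tm ?Zr LL (\<lambda>c. c) w) = ?tm ?Zr ?H ?hc w" if "w \<in> carrier (tensor K A ?Zr)" for w
    by (rule lin_tensor_eq[OF vs_A vZ vs_tensor spans_carrier spans_carrier lin_comp[OF N(1) ti(1)] tq(1) _ that])
      (use sub_closed(1)[OF Z vs_ext] Pid in \<open>simp add: ti(2) N(2) tq(2)\<close>)
  have Pk: "?Pr (restrict k (carrier ?HG))"
    using k(2) sub_closed(1)[OF ZG vs_ext] Ni by (simp add: carrier_homology)
  have tPe: "?tm ?Zr LL (\<lambda>c. c) (?tm LL ?Zr P t) = t \<ominus>\<^bsub>AxLL\<^esub> ?tm L LL d (?tm LL L e t)"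
    if "t \<in> carrier AxLL" for t
  proof (rule lin_tensor_eq[OF vs_A vs_ext vs_tensor spans_carrier spans_carrier lin_comp[OF ti(1) tP(1)]
        lin_diff[OF vs_tensor lin_id lin_comp[OF td(1) te(1)]] _ that])
    fix a w assume aw: "a \<in> carrier A" "w \<in> carrier LL"
    have "tens K A LL a (P w) = tens K A LL a w \<ominus>\<^bsub>AxLL\<^esub> tens K A LL a (d (e w))"
      unfolding P_def using aw lin_closed[OF de] by (intro lin_minus[OF bilin_right[OF bilin_tens]]) simp_all
    then show "?tm ?Zr LL (\<lambda>c. c) (?tm LL ?Zr P (tens K A LL a w)) =
      tens K A LL a w \<ominus>\<^bsub>AxLL\<^esub> ?tm L LL d (?tm LL L e (tens K A LL a w))"
      using aw PZ lin_closed[OF e(1)] by (simp add: ti(2) tP(2) td(2) te(2))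
  qed
  have tZ: "?m z \<in> carrier AxLL" "?tm LL L e (?m z) = \<zero>\<^bsub>?T\<^esub>" if "z \<in> ce_cycles K AL 2" for z
  proof -
    have "z \<in> carrier G2" by (rule sub_closed(1)[OF ZG vs_ext that])
    then show "?m z \<in> carrier AxLL" "?tm LL L e (?m z) = \<zero>\<^bsub>?T\<^esub>"
      using lin_closed[OF chain_map2(1)] e(4) that by auto
  qed
  \<comment> \<open>The property \<open>?Pr\<close> constrains a map only at cycles whose image
    comes from A \<otimes> Z_2. Its uniqueness requires that every cycle is of this kind;
    \<open>?tm LL ?Zr P\<close> supplies the element of A \<otimes> Z_2.\<close>
  have ex: "\<exists>w\<in>carrier (tensor K A ?Zr). ?m z = ?tm ?Zr LL (\<lambda>c. c) w" if z: "z \<in> ce_cycles K AL 2" for z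
    using tPe[OF tZ(1)[OF z]] tZ[OF z] lin_zero[OF td(1) vs_tensor vs_tensor] lin_closed[OF tP(1) tZ(1)[OF z]]
    by (intro bexI[of _ "?tm LL ?Zr P (?m z)"]) simp_all
  have un: "\<forall>p q. lin ?HG (tensor K A ?H) p \<longrightarrow> lin ?HG (tensor K A ?H) q \<longrightarrow>
      ?Pr p \<longrightarrow> ?Pr q \<longrightarrow> (\<forall>s\<in>carrier ?HG. p s = q s)"
  proof (intro allI impI ballI)
    fix p q s assume h: "?Pr p" "?Pr q" "s \<in> carrier ?HG"
    then obtain z where z: "z \<in> ce_cycles K AL 2" "s = cls z" by (auto simp: carrier_homology)
    obtain w where w: "w \<in> carrier (tensor K A ?Zr)" "?m z = ?tm ?Zr LL (\<lambda>c. c) w" using ex[OF z(1)] by blast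
    show "p s = q s" using h(1)[rule_format, OF z(1) w] h(2)[rule_format, OF z(1) w] z(2) by simp
  qed
  have nm: "natural_map2 K A L (cls z) = N (?m z)" if z: "z \<in> ce_cycles K AL 2" for z
  proof -
    have "cls z \<in> carrier ?HG" using z by (simp add: carrier_homology)
    from the_hom_props(4)[where P = ?Pr, OF spans_carrier vs_homology[OF sub_B2 ZG] vs_tensor kH Pk un this]
    have "natural_map2 K A L (cls z) = k (cls z)" unfolding natural_map2_def Let_def .
    then show ?thesis using k(2) sub_closed(1)[OF ZG vs_ext z] by simp
  qed
  obtain s where s: "lin ?H ?Zr s" "\<And>h. h \<in> carrier ?H \<Longrightarrow> ?hc (s h) = h"
    by (rule section_exists[OF vZ vH hc]) (auto simp: carrier_homology)
  have sL: "lin ?H LL s" by (rule lin_restrict_cod[OF s(1) vs_ext Z])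
  \<comment> \<open>The identity of \<Lambda>^2 L splits as w = d (e w) + s (?hc (P w)) + F w, and F
    w is a boundary. In \<open>tF\<close> this is tensored with A; for the image of a cycle with
    \<open>N\<close> equal to zero the first two summands vanish, and the third is the required
    image of the differential.\<close>
  define F where "F w = P w \<ominus>\<^bsub>LL\<^esub> s (?hc (P w))" for w
  have F: "lin LL LL F" unfolding F_def by (intro lin_diff vs_ext P lin_comp[OF sL hP])
  have FB: "F w \<in> ce_boundaries K L 2" if w: "w \<in> carrier LL" for w
  proof -
    have sZ: "s (?hc (P w)) \<in> ?Z" using lin_closed[OF s(1) lin_closed[OF hP w]] by simp
    have "?hc (F w) = ?hc (P w) \<ominus>\<^bsub>?H\<^esub> ?hc (s (?hc (P w)))"
      unfolding F_def using lin_minus[OF hc vZ vH, of "P w" "s (?hc (P w))"] PZ[OF w] sZ Z by simp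
    then have "?hc (F w) = \<zero>\<^bsub>?H\<^esub>" using s(2) lin_closed[OF hP w] by simp
    then show ?thesis using homology_class_zero_iff[OF B lin_closed[OF F w]] by simp
  qed
  note d3 = ce_diff_3(1)[OF alt_L]
  obtain r where r: "lin LL ?E3 r" "\<And>x. x \<in> carrier ?E3 \<Longrightarrow> ce_diff K L 3 (r (ce_diff K L 3 x)) = ce_diff K L 3 x"
    by (rule pseudo_inverse_exists[OF vs_ext vs_ext d3]) blast
  have rF: "ce_diff K L 3 (r (F w)) = F w" if "w \<in> carrier LL" for w
    using FB[OF that] r(2) by (auto simp: ce_boundaries_def)
  note rFl = lin_comp[OF r(1) F]
  note trF = tensor_map[OF vs_A vs_ext vs_A vs_ext lin_id rFl]
  note td3 = tensor_map[OF vs_A vs_ext vs_A vs_ext lin_id d3]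
  note ts = tensor_map[OF vs_A vH vs_A vs_ext lin_id sL]
  have tF: "?tm ?E3 LL (ce_diff K L 3) (?tm LL ?E3 (\<lambda>w. r (F w)) t) =
      t \<ominus>\<^bsub>AxLL\<^esub> ?tm L LL d (?tm LL L e t) \<ominus>\<^bsub>AxLL\<^esub> ?tm ?H LL s (N t)" if "t \<in> carrier AxLL" for t
  proof (rule lin_tensor_eq[OF vs_A vs_ext vs_tensor spans_carrier spans_carrier lin_comp[OF td3(1) trF(1)]
        lin_diff[OF vs_tensor lin_diff[OF vs_tensor lin_id lin_comp[OF td(1) te(1)]] lin_comp[OF ts(1) N(1)]] _ that])
    fix a w assume aw: "a \<in> carrier A" "w \<in> carrier LL"
    have a: "lin LL AxLL (tens K A LL a)" using aw by (intro bilin_right[OF bilin_tens]) simp_all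
    have "tens K A LL a (F w) = tens K A LL a w \<ominus>\<^bsub>AxLL\<^esub> tens K A LL a (d (e w)) \<ominus>\<^bsub>AxLL\<^esub> tens K A LL a (s (?hc (P w)))"
      using aw lin_closed[OF de] lin_closed[OF sL lin_closed[OF hP]] lin_minus[OF a vs_ext vs_tensor] lin_closed[OF P]
      by (simp add: F_def P_def)
    then show "?tm ?E3 LL (ce_diff K L 3) (?tm LL ?E3 (\<lambda>w. r (F w)) (tens K A LL a w)) =
      tens K A LL a w \<ominus>\<^bsub>AxLL\<^esub> ?tm L LL d (?tm LL L e (tens K A LL a w)) \<ominus>\<^bsub>AxLL\<^esub> ?tm ?H LL s (N (tens K A LL a w))"
      using aw lin_closed[OF e(1)] lin_closed[OF hP] lin_closed[OF rFl] rF
      by (simp add: td3(2) trF(2) td(2) te(2) ts(2) N(2))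
  qed
  show thesis
  proof (rule that[OF N(1) nm])
    fix z assume z: "z \<in> ce_cycles K AL 2" and 0: "N (?m z) = \<zero>\<^bsub>tensor K A ?H\<^esub>"
    have "?m z = ?tm ?E3 LL (ce_diff K L 3) (?tm LL ?E3 (\<lambda>w. r (F w)) (?m z))"
      unfolding tF[OF tZ(1)[OF z]] tZ(2)[OF z] 0
      using lin_zero[OF td(1) vs_tensor vs_tensor] lin_zero[OF ts(1) vs_tensor vs_tensor] tZ(1)[OF z] by simp
    then show "\<exists>t\<in>carrier (tensor K A ?E3). ?m z = ?tm ?E3 LL (ce_diff K L 3) t"
      using lin_closed[OF trF(1) tZ(1)[OF z]] by blast
  next
    fix z assume "z \<in> carrier G2" "?m z = \<zero>\<^bsub>AxLL\<^esub>"
    then show "z \<in> ce_cycles K AL 2" using e(4) lin_zero[OF te(1) vs_tensor vs_tensor] by simp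
  qed
qed

definition hpair :: "'l \<Rightarrow> 'l \<Rightarrow> bool"
  where "hpair x y \<longleftrightarrow> (\<exists>\<gamma>\<in>carrier B. \<exists>\<delta>\<in>carrier B. x \<in> D \<gamma> \<and> y \<in> D \<delta> \<and> \<gamma> \<otimes>\<^bsub>B\<^esub> \<delta> = \<beta>)"

lemma hpair_closed: "hpair x y \<Longrightarrow> x \<in> carrier L" "hpair x y \<Longrightarrow> y \<in> carrier L"
  by (auto simp: hpair_def intro: D_closed)

abbreviation "G2deg \<equiv> ext_degree K AL B (tensor_component K A L D) 2 \<beta>"
abbreviation "G2hom \<equiv> {wedge K AL [ten a x, ten b y] | a x b y. a \<in> carrier A \<and> b \<in> carrier A \<and> hpair x y}"

lemma G2hom_subset: "G2hom \<subseteq> carrier G2"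
  using hpair_closed by (auto intro!: wedge_ten)

lemma tensor_component_subset: "\<gamma> \<in> carrier B \<Longrightarrow> tensor_component K A L D \<gamma> \<subseteq> carrier AL"
  unfolding tensor_component_def AL_simps
  by (rule sub_subset[OF sub_span[OF vs_tensor] vs_tensor]) (auto dest: D_closed)

text \<open>The components of A \<otimes> L are themselves spans. Bilinearity of the wedge replaces
  them by the explicit generators on which all later degree arguments take place.\<close>

lemma G2deg_eq: "G2deg = span G2 G2hom"
proof
  let ?T = "tensor K A L"
  let ?H = "hom_tuples B (tensor_component K A L D) 2 \<beta>"
  have "?H \<subseteq> tuples AL 2"
    by (rule subsetI, rule tuples_hom_tuples[where D = "tensor_component K A L D", OF tensor_component_subset])
  then have c: "wedge K AL ` ?H \<subseteq> carrier G2" by (auto intro!: wedge_closed)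
  have "wedge K AL [u, v] \<in> span G2 G2hom"
    if "\<gamma> \<in> carrier B" "\<delta> \<in> carrier B" "\<gamma> \<otimes>\<^bsub>B\<^esub> \<delta> = \<beta>" "u \<in> tensor_component K A L D \<gamma>" "v \<in> tensor_component K A L D \<delta>"
    for u v \<gamma> \<delta>
  proof (rule bilin_in_sub[OF bilin_wedge[OF vs_AL, unfolded bilin_AL] vs_tensor vs_tensor vs_ext _ _ sub_span[OF vs_ext G2hom_subset] _
        that(4,5)[unfolded tensor_component_def]])
    fix s t assume "s \<in> {ten a x |a x. a \<in> carrier A \<and> x \<in> D \<gamma>}" "t \<in> {ten a x |a x. a \<in> carrier A \<and> x \<in> D \<delta>}"
    then obtain a x b y where "s = ten a x" "t = ten b y" "a \<in> carrier A" "b \<in> carrier A" "x \<in> D \<gamma>" "y \<in> D \<delta>"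
      by blast
    moreover from this have "hpair x y" using that(1-3) by (auto simp: hpair_def)
    ultimately show "wedge K AL [s, t] \<in> span G2 G2hom" by (intro span_base) blast
  qed (use that D_closed in auto)
  then show "G2deg \<subseteq> span G2 G2hom"
    unfolding ext_degree_def
    by (intro span_least sub_span[OF vs_ext G2hom_subset]) (auto simp: hom_tuples_2[OF B_group])
  show "span G2 G2hom \<subseteq> G2deg"
    unfolding ext_degree_def
  proof (intro span_least sub_span[OF vs_ext c] subsetI)
    fix w assume "w \<in> G2hom"
    then obtain a x b y where w: "w = wedge K AL [ten a x, ten b y]" "a \<in> carrier A" "b \<in> carrier A" "hpair x y" by blast
    then obtain \<gamma> \<delta> where g: "\<gamma> \<in> carrier B" "\<delta> \<in> carrier B" "x \<in> D \<gamma>" "y \<in> D \<delta>" "\<gamma> \<otimes>\<^bsub>B\<^esub> \<delta> = \<beta>"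
      by (auto simp: hpair_def)
    have "ten a x \<in> tensor_component K A L D \<gamma>" "ten b y \<in> tensor_component K A L D \<delta>"
      unfolding tensor_component_def using w g by (auto intro!: span_base)
    then have "[ten a x, ten b y] \<in> ?H" using g hom_tuples_2[OF B_group] by blast
    then show "w \<in> span G2 (wedge K AL ` ?H)" unfolding w(1) by (intro span_base imageI)
  qed
qed

lemma sub_G2deg: "sub G2deg G2"
  unfolding G2deg_eq by (rule sub_span[OF vs_ext G2hom_subset])

lemma sub_Int: "vs V \<Longrightarrow> sub N V \<Longrightarrow> sub M V \<Longrightarrow> sub (N \<inter> M) V"
  using sub_closed[of N V] sub_closed[of M V] by (intro subI) auto

text \<open>With the coefficient \<open>a\<close> in the first factor and 1 in the two others, this
  boundary is a lift of a \<otimes> d(x \<and> y \<and> u) along the chain map, and it stays in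
  degree \<open>\<beta>\<close>.\<close>

lemma boundary_in_degree:
  assumes a: "a \<in> carrier A" and g: "\<gamma> \<in> carrier B" "\<delta> \<in> carrier B" "\<epsilon> \<in> carrier B" "x \<in> D \<gamma>" "y \<in> D \<delta>" "u \<in> D \<epsilon>"
    and \<beta>: "\<gamma> \<otimes>\<^bsub>B\<^esub> (\<delta> \<otimes>\<^bsub>B\<^esub> \<epsilon>) = \<beta>"
  shows "ce_diff K AL 3 (wedge K AL [ten a x, ten \<one>\<^bsub>A\<^esub> y, ten \<one>\<^bsub>A\<^esub> u]) \<in> G2deg"
proof -
  have [simp]: "x \<in> carrier L" "y \<in> carrier L" "u \<in> carrier L" using g D_closed by blast+
  note [simp] = a
  have h: "hpair (bracket L x y) u" "hpair (bracket L x u) y" "hpair (bracket L y u) x"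
    unfolding hpair_def using g \<beta> bracket_D[of \<gamma> \<delta> x y] bracket_D[of \<gamma> \<epsilon> x u] bracket_D[of \<delta> \<epsilon> y u]
    by (metis B_assoc B_comm B_mult)+
  have "wedge K AL [ten b v, ten c w] \<in> G2deg" if "b \<in> carrier A" "c \<in> carrier A" "hpair v w" for b c v w
    unfolding G2deg_eq using that by (intro span_base) blast
  then show ?thesis
    using h by (simp add: ce_diff_3(2)[OF alt_AL] tensor_bracket(2) sub_closed(4,5)[OF sub_G2deg vs_ext])
qed

abbreviation "skew_part a b x y \<equiv> wedge K AL [ten a x, ten b y] \<ominus>\<^bsub>G2\<^esub> wedge K AL [ten b x, ten a y]"
text \<open>The symmetric class belonging to a \<odot> b - ab \<odot> 1. Such elements span the
  kernel of multiplication, since i = i - \<mu>(i) \<odot> 1 whenever the product \<mu>(i) is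
  zero.\<close>

abbreviation "sym_part a b x y \<equiv>
  (wedge K AL [ten a x, ten b y] \<oplus>\<^bsub>G2\<^esub> wedge K AL [ten b x, ten a y]) \<ominus>\<^bsub>G2\<^esub>
  (wedge K AL [ten (a \<otimes>\<^bsub>A\<^esub> b) x, ten \<one>\<^bsub>A\<^esub> y] \<oplus>\<^bsub>G2\<^esub> wedge K AL [ten \<one>\<^bsub>A\<^esub> x, ten (a \<otimes>\<^bsub>A\<^esub> b) y])"

abbreviation "kernel_gens \<equiv>
  {cls (skew_part a b x y) | a b x y. a \<in> carrier A \<and> b \<in> carrier A \<and> hpair x y} \<union>
  {cls (sym_part a b x y) | a b x y. a \<in> carrier A \<and> b \<in> carrier A \<and> hpair x y}"

lemma kernel_gens_subset: "kernel_gens \<subseteq> carrier Q"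
  using hpair_closed by auto

text \<open>The chain map composed with \<open>l\<close> is multiplication by 2. Hence 2 z - l(m z)
  lies in the kernel of the chain map m for every z, which is how the kernel is computed and why a
  half appears.\<close>

lemma polarization:
  obtains l where "lin AxLL G2 l" "\<And>a x y. a \<in> carrier A \<Longrightarrow> x \<in> carrier L \<Longrightarrow> y \<in> carrier L \<Longrightarrow>
    l (tens K A LL a (wedge K L [x, y])) = wedge K AL [ten a x, ten \<one>\<^bsub>A\<^esub> y] \<oplus>\<^bsub>G2\<^esub> wedge K AL [ten \<one>\<^bsub>A\<^esub> x, ten a y]"
proof -
  let ?q = "\<lambda>a x y. wedge K AL [ten a x, ten \<one>\<^bsub>A\<^esub> y] \<oplus>\<^bsub>G2\<^esub> wedge K AL [ten \<one>\<^bsub>A\<^esub> x, ten a y]"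
  have q: "bilin L L G2 (?q a)" if "a \<in> carrier A" for a
    using that by (intro bilinI lin_intros) simp_all
  have alt: "?q a x x = \<zero>\<^bsub>G2\<^esub>" if "a \<in> carrier A" "x \<in> carrier L" for a x
    using that wedge2_swap[OF vs_AL, of "ten a x" "ten \<one>\<^bsub>A\<^esub> x"] by simp
  have "\<exists>h. lin LL G2 h \<and> (\<forall>x\<in>carrier L. \<forall>y\<in>carrier L. h (wedge K L [x, y]) = ?q a x y)" if "a \<in> carrier A" for a
  proof -
    note a = that
    obtain h where "lin LL G2 h" "\<And>x y. x \<in> carrier L \<Longrightarrow> y \<in> carrier L \<Longrightarrow> h (wedge K L [x, y]) = ?q a x y"
      by (rule ext2_lift[OF vs_L vs_ext q[OF a] alt[OF a]]) blast+
    then show ?thesis by blast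
  qed
  then obtain h where h: "\<And>a. a \<in> carrier A \<Longrightarrow> lin LL G2 (h a)"
    "\<And>a x y. a \<in> carrier A \<Longrightarrow> x \<in> carrier L \<Longrightarrow> y \<in> carrier L \<Longrightarrow> h a (wedge K L [x, y]) = ?q a x y" by metis
  have "bilin A LL G2 h"
  proof (rule bilinI)
    fix w assume w: "w \<in> carrier LL"
    note sp = spans_ext2[OF vs_L spans_carrier]
    have al: "lin A G2 (\<lambda>a. ?q a x y)" if "x \<in> carrier L" "y \<in> carrier L" for x y
      using that by (intro lin_intros) simp_all
    show "lin A G2 (\<lambda>a. h a w)"
    proof (rule linI)
      fix a assume a: "a \<in> carrier A"
      show "h a w \<in> carrier G2" by (rule lin_closed[OF h(1)[OF a] w])
      fix b assume b: "b \<in> carrier A"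
      show "h (a \<oplus>\<^bsub>A\<^esub> b) w = h a w \<oplus>\<^bsub>G2\<^esub> h b w"
        by (rule lin_eq[OF sp h(1) lin_plus[OF vs_ext h(1)[OF a] h(1)[OF b]] vs_ext vs_ext _ w])
          (use a b lin_add[OF al a b] in \<open>auto simp: h(2)\<close>)
    next
      fix c a assume c: "c \<in> carrier K" and a: "a \<in> carrier A"
      show "h (c \<odot>\<^bsub>A\<^esub> a) w = c \<odot>\<^bsub>G2\<^esub> h a w"
        by (rule lin_eq[OF sp h(1) lin_scale[OF vs_ext c h(1)[OF a]] vs_ext vs_ext _ w])
          (use a c lin_smult[OF al c a] in \<open>auto simp: h(2)\<close>)
    qed
  qed (rule h(1))
  from tensor_lift[OF vs_A vs_ext vs_ext this] obtain l where l:
    "lin AxLL G2 l" "\<And>a w. a \<in> carrier A \<Longrightarrow> w \<in> carrier LL \<Longrightarrow> l (tens K A LL a w) = h a w" by metis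
  show thesis by (rule that[OF l(1)]) (simp add: l(2) h(2))
qed

text \<open>The generators lie in the kernel because ab = ba and ab 1 = ab. Conversely, a cycle z of
  degree \<open>\<beta>\<close> in the kernel is changed by a boundary of degree
  \<open>\<beta>\<close> until its image under the chain map is zero; then 2 z = 2 z - l(m z), and
  the right side is visibly a combination of the generators.\<close>

lemma natural_kernel_eq: "natural_kernel K A L B D \<beta> = restrict_to Q (span Q kernel_gens)"
proof -
  let ?m = "chain_map2 K A L" and ?H = "tensor K A (homology K L 2)" and ?E3 = "ext_power K L 3"
  obtain N where N: "lin AxLL ?H N"
    "\<And>z. z \<in> ce_cycles K AL 2 \<Longrightarrow> natural_map2 K A L (cls z) = N (?m z)"
    "\<And>z. z \<in> ce_cycles K AL 2 \<Longrightarrow> N (?m z) = \<zero>\<^bsub>?H\<^esub> \<Longrightarrow>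
      \<exists>t\<in>carrier (tensor K A ?E3). ?m z = tensor_map K A ?E3 A LL (\<lambda>a. a) (ce_diff K L 3) t"
    "\<And>z. z \<in> carrier G2 \<Longrightarrow> ?m z = \<zero>\<^bsub>AxLL\<^esub> \<Longrightarrow> z \<in> ce_cycles K AL 2"
    by (rule natural_map2) blast
  note ZG = sub_cycles(2)[OF alt_AL]
  let ?K = "{h \<in> homology_degree K AL B (tensor_component K A L D) 2 \<beta>. natural_map2 K A L h = \<zero>\<^bsub>?H\<^esub>}"
  let ?M = "{z \<in> carrier G2. N (?m z) = \<zero>\<^bsub>?H\<^esub>}"
  have K_eq: "?K = cls ` ((ce_cycles K AL 2 \<inter> G2deg) \<inter> ?M)"
    unfolding homology_degree_def using N(2) sub_closed(1)[OF ZG vs_ext] by auto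
  have subK: "sub ?K Q"
    unfolding K_eq
    by (intro sub_image[OF vs_ext vs_Q lin_cls] sub_Int vs_ext ZG sub_G2deg sub_kernel[OF vs_ext vs_tensor lin_comp[OF N(1) chain_map2(1)]])
  have mem: "cls z \<in> ?K" if "z \<in> G2deg" "?m z = \<zero>\<^bsub>AxLL\<^esub>" for z
    unfolding K_eq using that N(4) sub_closed(1)[OF sub_G2deg vs_ext] lin_zero[OF N(1) vs_tensor vs_tensor] by auto
  have Gd: "wedge K AL [ten b v, ten c w] \<in> G2deg" if "b \<in> carrier A" "c \<in> carrier A" "hpair v w" for b c v w
    unfolding G2deg_eq using that by (intro span_base) blast
  have "kernel_gens \<subseteq> ?K"
  proof
    fix h assume "h \<in> kernel_gens"
    then consider a b x y where "h = cls (skew_part a b x y)" "a \<in> carrier A" "b \<in> carrier A" "hpair x y"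
      | a b x y where "h = cls (sym_part a b x y)" "a \<in> carrier A" "b \<in> carrier A" "hpair x y" by blast
    then show "h \<in> ?K"
    proof cases
      case 1
      note [simp] = 1(2,3) hpair_closed[OF 1(4)]
      show ?thesis unfolding 1(1)
        by (rule mem) (simp_all add: 1(4) Gd sub_closed(5)[OF sub_G2deg vs_ext] lin_minus[OF chain_map2(1)]
          chain_map2(2) mult_A_simps(3)[of b a])
    next
      case 2
      note [simp] = 2(2,3) hpair_closed[OF 2(4)]
      show ?thesis unfolding 2(1)
        by (rule mem) (simp_all add: 2(4) Gd sub_closed(4,5)[OF sub_G2deg vs_ext] lin_minus[OF chain_map2(1)]
          lin_add[OF chain_map2(1)] chain_map2(2) mult_A_simps(1,2) mult_A_simps(3)[of b a])
    qed
  qed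
  then have 1: "span Q kernel_gens \<subseteq> ?K" by (rule span_least[OF subK])
  have 2: "?K \<subseteq> span Q kernel_gens"
  proof
    fix h assume "h \<in> ?K"
    then obtain z where z: "z \<in> ce_cycles K AL 2" "z \<in> G2deg" "z \<in> carrier G2" "N (?m z) = \<zero>\<^bsub>?H\<^esub>" "h = cls z"
      unfolding K_eq by blast
    obtain t where t: "t \<in> carrier (tensor K A ?E3)"
      "?m z = tensor_map K A ?E3 A LL (\<lambda>a. a) (ce_diff K L 3) t" using N(3)[OF z(1,4)] by blast
    obtain p where p: "lin LL LL p"
      "\<And>\<gamma> \<delta> x y. \<gamma> \<in> carrier B \<Longrightarrow> \<delta> \<in> carrier B \<Longrightarrow> x \<in> D \<gamma> \<Longrightarrow> y \<in> D \<delta> \<Longrightarrow>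
      p (wedge K L [x, y]) = (if \<gamma> \<otimes>\<^bsub>B\<^esub> \<delta> = \<beta> then wedge K L [x, y] else \<zero>\<^bsub>LL\<^esub>)"
      "\<And>\<gamma> \<delta> \<epsilon> x y u. \<gamma> \<in> carrier B \<Longrightarrow> \<delta> \<in> carrier B \<Longrightarrow> \<epsilon> \<in> carrier B \<Longrightarrow> x \<in> D \<gamma> \<Longrightarrow> y \<in> D \<delta> \<Longrightarrow> u \<in> D \<epsilon> \<Longrightarrow>
      p (ce_diff K L 3 (wedge K L [x, y, u])) =
      (if \<gamma> \<otimes>\<^bsub>B\<^esub> (\<delta> \<otimes>\<^bsub>B\<^esub> \<epsilon>) = \<beta> then ce_diff K L 3 (wedge K L [x, y, u]) else \<zero>\<^bsub>LL\<^esub>)"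
      by (rule ext2_projection) blast
    note tp = tensor_map[OF vs_A vs_ext vs_A vs_ext lin_id p(1)]
    note td = tensor_map[OF vs_A vs_ext vs_A vs_ext lin_id ce_diff_3(1)[OF alt_L]]
    let ?tp = "tensor_map K A LL A LL (\<lambda>a. a) p" and ?td = "tensor_map K A ?E3 A LL (\<lambda>a. a) (ce_diff K L 3)"
    \<comment> \<open>The preimage \<open>t\<close> comes without a degree. Applying the projection
      to both sides of the equation for \<open>?m z\<close> leaves the left side alone and cuts the
      right side down to degree \<open>\<beta>\<close>.\<close>
    have "?tp (?m z) = ?m z"
    proof (rule lin_eq_on_span[OF lin_comp[OF tp(1) chain_map2(1)] chain_map2(1) vs_ext vs_tensor G2hom_subset _ z(2)[unfolded G2deg_eq]])
      fix s assume "s \<in> G2hom"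
      then obtain a x b y where s: "s = wedge K AL [ten a x, ten b y]" and a [simp]: "a \<in> carrier A" "b \<in> carrier A"
        and h: "hpair x y" by blast
      note [simp] = hpair_closed[OF h]
      have "p (wedge K L [x, y]) = wedge K L [x, y]" using h p(2) by (auto simp: hpair_def)
      then show "?tp (?m s) = ?m s" by (simp add: s chain_map2(2) tp(2))
    qed
    \<comment> \<open>The projection keeps or kills a \<otimes> d(x \<and> y \<and> u) according to
      its degree. If it is kept, \<open>boundary_in_degree\<close> provides a preimage that is a
      boundary of degree \<open>\<beta>\<close>.\<close>
    moreover have "?tp (?td t) \<in> ?m ` (ce_boundaries K AL 2 \<inter> G2deg)"
    proof (rule lin_span[OF lin_comp[OF tp(1) td(1)] vs_tensor vs_tensor _ _ _
          spansD[OF spans_tensor[OF vs_A vs_ext spans_carrier spans_ext3[OF vs_L spans_homogeneous]] t(1)]])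
      show "sub (?m ` (ce_boundaries K AL 2 \<inter> G2deg)) AxLL"
        by (intro sub_image[OF vs_ext vs_tensor chain_map2(1)] sub_Int vs_ext sub_B2 sub_G2deg)
      let ?U = "\<Union>\<gamma>\<in>carrier B. D \<gamma>"
      let ?G = "{tens K A ?E3 s t | s t. s \<in> carrier A \<and> t \<in> {wedge K L [s, t, u] | s t u. s \<in> ?U \<and> t \<in> ?U \<and> u \<in> ?U}}"
      show "?G \<subseteq> carrier (tensor K A ?E3)"
        by (rule spans_subset[OF spans_tensor[OF vs_A vs_ext spans_carrier spans_ext3[OF vs_L spans_homogeneous]]])
      fix s assume "s \<in> ?G"
      then obtain a x y u \<gamma> \<delta> \<epsilon> where s: "s = tens K A ?E3 a (wedge K L [x, y, u])" and a [simp]: "a \<in> carrier A"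
        and g [simp]: "\<gamma> \<in> carrier B" "\<delta> \<in> carrier B" "\<epsilon> \<in> carrier B" "x \<in> D \<gamma>" "y \<in> D \<delta>" "u \<in> D \<epsilon>" by blast
      have [simp]: "x \<in> carrier L" "y \<in> carrier L" "u \<in> carrier L" using g D_closed by blast+
      have dc: "ce_diff K L 3 (wedge K L [x, y, u]) \<in> carrier LL"
        by (rule lin_closed[OF ce_diff_3(1)[OF alt_L]]) simp
      have eq: "?tp (?td s) = tens K A LL a (p (ce_diff K L 3 (wedge K L [x, y, u])))"
        unfolding s using dc by (simp add: td(2) tp(2))
      show "?tp (?td s) \<in> ?m ` (ce_boundaries K AL 2 \<inter> G2deg)"
      proof (cases "\<gamma> \<otimes>\<^bsub>B\<^esub> (\<delta> \<otimes>\<^bsub>B\<^esub> \<epsilon>) = \<beta>")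
        case True
        let ?w = "ce_diff K AL 3 (wedge K AL [ten a x, ten \<one>\<^bsub>A\<^esub> y, ten \<one>\<^bsub>A\<^esub> u])"
        have "?tp (?td s) = ?m ?w"
          unfolding eq p(3)[OF g] using True by (simp add: chain_map2_boundary mult_A_simps(2))
        moreover have "?w \<in> ce_boundaries K AL 2" by (auto simp: ce_boundaries_def intro!: imageI)
        moreover have "?w \<in> G2deg" by (rule boundary_in_degree[OF a g True])
        ultimately show ?thesis by blast
      next
        case False
        have "?tp (?td s) = ?m \<zero>\<^bsub>G2\<^esub>"
          unfolding eq p(3)[OF g] using False lin_zero[OF bilin_right[OF bilin_tens[OF vs_A vs_ext] a] vs_ext vs_tensor]
            lin_zero[OF chain_map2(1) vs_ext vs_tensor] by simp
        then show ?thesis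
          using sub_closed(2)[OF sub_B2 vs_ext] sub_closed(2)[OF sub_G2deg vs_ext] by blast
      qed
    qed
    ultimately obtain v where v: "v \<in> ce_boundaries K AL 2" "v \<in> G2deg" "?m z = ?m v" using t(2) by auto
    have vG: "v \<in> carrier G2" by (rule sub_closed(1)[OF sub_B2 vs_ext v(1)])
    let ?z = "z \<ominus>\<^bsub>G2\<^esub> v"
    have z': "?z \<in> G2deg" "?m ?z = \<zero>\<^bsub>AxLL\<^esub>" "?z \<in> carrier G2"
      using sub_closed(5)[OF sub_G2deg vs_ext z(2) v(2)] lin_minus[OF chain_map2(1) vs_ext vs_tensor z(3) vG] v(3)
        lin_closed[OF chain_map2(1) vG] z(3) vG by simp_all
    have "?z \<ominus>\<^bsub>G2\<^esub> z = \<ominus>\<^bsub>G2\<^esub> v"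
      by (rule sg_eqI[of G2]) (use z(3) vG in \<open>simp_all add: sg_simps\<close>)
    then have hz: "h = cls ?z"
      using z(5) cls_eq_iff[OF z'(3) z(3)] sub_closed(3)[OF sub_B2 vs_ext v(1)] by simp
    obtain l where l: "lin AxLL G2 l" "\<And>a x y. a \<in> carrier A \<Longrightarrow> x \<in> carrier L \<Longrightarrow> y \<in> carrier L \<Longrightarrow>
      l (tens K A LL a (wedge K L [x, y])) = wedge K AL [ten a x, ten \<one>\<^bsub>A\<^esub> y] \<oplus>\<^bsub>G2\<^esub> wedge K AL [ten \<one>\<^bsub>A\<^esub> x, ten a y]"
      by (rule polarization) blast
    \<comment> \<open>This map doubles \<open>?z\<close>, whose chain image is zero, while it sends
      a generator of degree \<open>\<beta>\<close> to the sum of one skew part and one symmetric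
      part.\<close>
    have ppl: "lin G2 Q (\<lambda>w. cls ((w \<oplus>\<^bsub>G2\<^esub> w) \<ominus>\<^bsub>G2\<^esub> l (?m w)))"
      by (intro lin_cls' lin_diff lin_plus lin_id vs_ext lin_comp[OF l(1) chain_map2(1)])
    have "cls ((?z \<oplus>\<^bsub>G2\<^esub> ?z) \<ominus>\<^bsub>G2\<^esub> l (?m ?z)) \<in> span Q kernel_gens"
    proof (rule lin_span[OF ppl vs_ext vs_Q G2hom_subset sub_span[OF vs_Q kernel_gens_subset] _ z'(1)[unfolded G2deg_eq]])
      fix s assume "s \<in> G2hom"
      then obtain a x b y where s: "s = wedge K AL [ten a x, ten b y]" and a [simp]: "a \<in> carrier A" "b \<in> carrier A"
        and h: "hpair x y" by blast
      note [simp] = hpair_closed[OF h]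
      have "(s \<oplus>\<^bsub>G2\<^esub> s) \<ominus>\<^bsub>G2\<^esub> l (?m s) = skew_part a b x y \<oplus>\<^bsub>G2\<^esub> sym_part a b x y"
        by (rule sg_eqI[of G2]) (simp_all add: s chain_map2(2) l(2) sg_simps)
      then have "cls ((s \<oplus>\<^bsub>G2\<^esub> s) \<ominus>\<^bsub>G2\<^esub> l (?m s)) = cls (skew_part a b x y) \<oplus>\<^bsub>Q\<^esub> cls (sym_part a b x y)"
        by (simp add: lin_add[OF lin_cls])
      moreover have "cls (skew_part a b x y) \<in> span Q kernel_gens" "cls (sym_part a b x y) \<in> span Q kernel_gens"
        using a h by (blast intro: span_base)+
      ultimately show "cls ((s \<oplus>\<^bsub>G2\<^esub> s) \<ominus>\<^bsub>G2\<^esub> l (?m s)) \<in> span Q kernel_gens"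
        using sub_closed(4)[OF sub_span[OF vs_Q kernel_gens_subset] vs_Q] by simp
    qed
    then have "cls (?z \<oplus>\<^bsub>G2\<^esub> ?z) \<in> span Q kernel_gens"
      unfolding z'(2) using lin_zero[OF l(1) vs_tensor vs_ext] z'(3) by simp
    then have "half \<odot>\<^bsub>Q\<^esub> cls (?z \<oplus>\<^bsub>G2\<^esub> ?z) \<in> span Q kernel_gens"
      by (rule sub_closed(6)[OF sub_span[OF vs_Q kernel_gens_subset] vs_Q half_closed])
    then show "h \<in> span Q kernel_gens"
      using z'(3) hz by (simp add: lin_add[OF lin_cls] vs_smult_add)
  qed
  have "?K = span Q kernel_gens" using 1 2 by blast
  then show ?thesis by (simp add: natural_kernel_def homology_eq)
qed

subsection \<open>Relations in the second homology\<close>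

abbreviation "q a x b y \<equiv> cls (wedge K AL [ten a x, ten b y])"

lemma q_skew:
  assumes "a \<in> carrier A" "x \<in> carrier L" "b \<in> carrier A" "y \<in> carrier L"
  shows "q a x b y = \<ominus>\<^bsub>Q\<^esub> q b y a x"
  using wedge2_swap[OF vs_AL, of "ten a x" "ten b y"] lin_neg[OF lin_cls vs_ext vs_Q, of "wedge K AL [ten b y, ten a x]"] assms
  by simp

lemma lin_q:
  "a \<in> carrier A \<Longrightarrow> b \<in> carrier A \<Longrightarrow> y \<in> carrier L \<Longrightarrow> lin L Q (\<lambda>x. q a x b y)"
  "a \<in> carrier A \<Longrightarrow> b \<in> carrier A \<Longrightarrow> y \<in> carrier L \<Longrightarrow> lin L Q (\<lambda>x. q a y b x)"
  "x \<in> carrier L \<Longrightarrow> b \<in> carrier A \<Longrightarrow> y \<in> carrier L \<Longrightarrow> lin A Q (\<lambda>a. q a x b y)"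
  "x \<in> carrier L \<Longrightarrow> b \<in> carrier A \<Longrightarrow> y \<in> carrier L \<Longrightarrow> lin A Q (\<lambda>a. q b x a y)"
  by (intro lin_intros; simp)+


lemma cls_boundary: "u \<in> ce_boundaries K AL 2 \<Longrightarrow> cls u = \<zero>\<^bsub>Q\<^esub>"
  using coset_eq_zero_iff[OF vs_ext sub_B2] sub_closed(1)[OF sub_B2 vs_ext] unfolding homology_class_def by blast

text \<open>The boundary of (a \<otimes> x) \<and> (b \<otimes> y) \<and> (c \<otimes> z), brought
  to cyclic form. The relations that follow are combinations of instances of this one, most of them
  with some coefficient equal to 1.\<close>

lemma q_cocycle:
  assumes "a \<in> carrier A" "x \<in> carrier L" "b \<in> carrier A" "y \<in> carrier L" "c \<in> carrier A" "z \<in> carrier L"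
  shows "q (a \<otimes>\<^bsub>A\<^esub> b) (bracket L x y) c z \<oplus>\<^bsub>Q\<^esub> q (b \<otimes>\<^bsub>A\<^esub> c) (bracket L y z) a x \<oplus>\<^bsub>Q\<^esub>
    q (c \<otimes>\<^bsub>A\<^esub> a) (bracket L z x) b y = \<zero>\<^bsub>Q\<^esub>"
proof -
  note [simp] = assms
  have "cls (ce_diff K AL 3 (wedge K AL [ten a x, ten b y, ten c z])) = \<zero>\<^bsub>Q\<^esub>"
    by (rule cls_boundary) (auto simp: ce_boundaries_def intro!: imageI)
  then have "q (a \<otimes>\<^bsub>A\<^esub> b) (bracket L x y) c z \<ominus>\<^bsub>Q\<^esub> q (a \<otimes>\<^bsub>A\<^esub> c) (bracket L x z) b y \<oplus>\<^bsub>Q\<^esub>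
    q (b \<otimes>\<^bsub>A\<^esub> c) (bracket L y z) a x = \<zero>\<^bsub>Q\<^esub>"
    by (simp add: ce_diff_3(2)[OF alt_AL] tensor_bracket(2) lin_add[OF lin_cls] lin_minus[OF lin_cls])
  moreover have "q (a \<otimes>\<^bsub>A\<^esub> c) (bracket L x z) b y = \<ominus>\<^bsub>Q\<^esub> q (c \<otimes>\<^bsub>A\<^esub> a) (bracket L z x) b y"
    using bracket_skew_L[of x z] lin_neg[OF lin_q(1) vs_L vs_Q, of "c \<otimes>\<^bsub>A\<^esub> a" b y "bracket L z x"] mult_A_simps(3)[of a c]
    by simp
  ultimately show ?thesis by (simp add: a_minus_def vs_assoc vs_comm vs_lcomm)
qed

text \<open>Put the coefficient 1 on \<open>y\<close> and compare the cocycle relation with its copy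
  in which \<open>a\<close> and \<open>b\<close> are exchanged. The term with coefficient ab is
  common to both and cancels in the difference.\<close>

lemma q_killing:
  assumes "a \<in> carrier A" "b \<in> carrier A" "x \<in> carrier L" "y \<in> carrier L" "z \<in> carrier L"
  shows "q a (bracket L x y) b z \<ominus>\<^bsub>Q\<^esub> q b (bracket L x y) a z =
    q a x b (bracket L y z) \<ominus>\<^bsub>Q\<^esub> q b x a (bracket L y z)"
proof -
  note [simp] = assms
  have n: "q u (bracket L y x) v z = \<ominus>\<^bsub>Q\<^esub> q u (bracket L x y) v z" if "u \<in> carrier A" "v \<in> carrier A" for u v
    using bracket_skew_L[of y x] lin_neg[OF lin_q(1) vs_L vs_Q, of u v z "bracket L x y"] that by simp
  have m: "q u (bracket L z y) v x = q v x u (bracket L y z)" if "u \<in> carrier A" "v \<in> carrier A" for u v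
    using bracket_skew_L[of z y] lin_neg[OF lin_q(1) vs_L vs_Q, of u v x "bracket L y z"] that
      q_skew[of v x u "bracket L y z"] by simp
  have c: "b \<otimes>\<^bsub>A\<^esub> a = a \<otimes>\<^bsub>A\<^esub> b" by (rule mult_A_simps(3)) simp_all
  have F: "q a (bracket L y x) b z \<oplus>\<^bsub>Q\<^esub> q (a \<otimes>\<^bsub>A\<^esub> b) (bracket L x z) \<one>\<^bsub>A\<^esub> y \<oplus>\<^bsub>Q\<^esub> q b (bracket L z y) a x = \<zero>\<^bsub>Q\<^esub>"
    using q_cocycle[of "\<one>\<^bsub>A\<^esub>" y a x b z] by (simp add: mult_A_simps(1,2))
  have G: "q b (bracket L y x) a z \<oplus>\<^bsub>Q\<^esub> q (a \<otimes>\<^bsub>A\<^esub> b) (bracket L x z) \<one>\<^bsub>A\<^esub> y \<oplus>\<^bsub>Q\<^esub> q a (bracket L z y) b x = \<zero>\<^bsub>Q\<^esub>"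
    using q_cocycle[of "\<one>\<^bsub>A\<^esub>" y b x a z] by (simp add: mult_A_simps(1,2) c)
  have "(q a (bracket L x y) b z \<ominus>\<^bsub>Q\<^esub> q b (bracket L x y) a z) \<ominus>\<^bsub>Q\<^esub>
      (q a x b (bracket L y z) \<ominus>\<^bsub>Q\<^esub> q b x a (bracket L y z)) =
    (q b (bracket L y x) a z \<oplus>\<^bsub>Q\<^esub> q (a \<otimes>\<^bsub>A\<^esub> b) (bracket L x z) \<one>\<^bsub>A\<^esub> y \<oplus>\<^bsub>Q\<^esub> q a (bracket L z y) b x) \<ominus>\<^bsub>Q\<^esub>
    (q a (bracket L y x) b z \<oplus>\<^bsub>Q\<^esub> q (a \<otimes>\<^bsub>A\<^esub> b) (bracket L x z) \<one>\<^bsub>A\<^esub> y \<oplus>\<^bsub>Q\<^esub> q b (bracket L z y) a x)"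
    by (rule sg_eqI[of Q]) (simp_all add: n m q_skew[of b x a "bracket L y z"] q_skew[of a x b "bracket L y z"] sg_simps)
  also have "\<dots> = \<zero>\<^bsub>Q\<^esub>" unfolding F G by simp
  finally show ?thesis by (simp add: vs_minus_eq_zero_iff)
qed

text \<open>Combines the cocycle relations with coefficients (a,1,b) and (1,b,a) at x, y, z against
  those with (a,b,1) and (1,1,ab). Every term in which the bracket is not [x,y] occurs once on each
  side.\<close>

lemma q_symmetric:
  assumes "a \<in> carrier A" "b \<in> carrier A" "x \<in> carrier L" "y \<in> carrier L" "z \<in> carrier L"
  shows "q a (bracket L x y) b z \<oplus>\<^bsub>Q\<^esub> q b (bracket L x y) a z =
    q (a \<otimes>\<^bsub>A\<^esub> b) (bracket L x y) \<one>\<^bsub>A\<^esub> z \<oplus>\<^bsub>Q\<^esub> q \<one>\<^bsub>A\<^esub> (bracket L x y) (a \<otimes>\<^bsub>A\<^esub> b) z"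
proof -
  note [simp] = assms
  let ?n = "a \<otimes>\<^bsub>A\<^esub> b"
  have c: "b \<otimes>\<^bsub>A\<^esub> a = ?n" by (rule mult_A_simps(3)) simp_all
  note r = mult_A_simps(1,2) c
  let ?P = "bracket L x y" and ?R = "bracket L y z" and ?T = "bracket L z x"
  have F1: "q ?n ?P \<one>\<^bsub>A\<^esub> z \<oplus>\<^bsub>Q\<^esub> q b ?R a x \<oplus>\<^bsub>Q\<^esub> q a ?T b y = \<zero>\<^bsub>Q\<^esub>"
    using q_cocycle[of a x b y "\<one>\<^bsub>A\<^esub>" z] by (simp add: r)
  have F2: "q a ?P b z \<oplus>\<^bsub>Q\<^esub> q b ?R a x \<oplus>\<^bsub>Q\<^esub> q ?n ?T \<one>\<^bsub>A\<^esub> y = \<zero>\<^bsub>Q\<^esub>"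
    using q_cocycle[of a x "\<one>\<^bsub>A\<^esub>" y b z] by (simp add: r)
  have F6: "q b ?P a z \<oplus>\<^bsub>Q\<^esub> q ?n ?R \<one>\<^bsub>A\<^esub> x \<oplus>\<^bsub>Q\<^esub> q a ?T b y = \<zero>\<^bsub>Q\<^esub>"
    using q_cocycle[of "\<one>\<^bsub>A\<^esub>" x b y a z] by (simp add: r)
  have F9: "q \<one>\<^bsub>A\<^esub> ?P ?n z \<oplus>\<^bsub>Q\<^esub> q ?n ?R \<one>\<^bsub>A\<^esub> x \<oplus>\<^bsub>Q\<^esub> q ?n ?T \<one>\<^bsub>A\<^esub> y = \<zero>\<^bsub>Q\<^esub>"
    using q_cocycle[of "\<one>\<^bsub>A\<^esub>" x "\<one>\<^bsub>A\<^esub>" y ?n z] by (simp add: r)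
  have "(q a ?P b z \<oplus>\<^bsub>Q\<^esub> q b ?P a z) \<ominus>\<^bsub>Q\<^esub> (q ?n ?P \<one>\<^bsub>A\<^esub> z \<oplus>\<^bsub>Q\<^esub> q \<one>\<^bsub>A\<^esub> ?P ?n z) =
    ((q a ?P b z \<oplus>\<^bsub>Q\<^esub> q b ?R a x \<oplus>\<^bsub>Q\<^esub> q ?n ?T \<one>\<^bsub>A\<^esub> y) \<oplus>\<^bsub>Q\<^esub> (q b ?P a z \<oplus>\<^bsub>Q\<^esub> q ?n ?R \<one>\<^bsub>A\<^esub> x \<oplus>\<^bsub>Q\<^esub> q a ?T b y)) \<ominus>\<^bsub>Q\<^esub>
    ((q ?n ?P \<one>\<^bsub>A\<^esub> z \<oplus>\<^bsub>Q\<^esub> q b ?R a x \<oplus>\<^bsub>Q\<^esub> q a ?T b y) \<oplus>\<^bsub>Q\<^esub> (q \<one>\<^bsub>A\<^esub> ?P ?n z \<oplus>\<^bsub>Q\<^esub> q ?n ?R \<one>\<^bsub>A\<^esub> x \<oplus>\<^bsub>Q\<^esub> q ?n ?T \<one>\<^bsub>A\<^esub> y))"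
    by (rule sg_eqI[of Q]) (simp_all add: sg_simps)
  also have "\<dots> = \<zero>\<^bsub>Q\<^esub>" unfolding F1 F2 F6 F9 by simp
  finally show ?thesis by (simp add: vs_minus_eq_zero_iff)
qed

text \<open>Each of the first three \<open>k\<close> is evaluated at the rotation of x, y, z that
  occurs in the cocycle relation for a, b, c. Then the whole expression is twice that relation minus
  the relations with coefficients (abc,1,1) and (1,abc,1).\<close>

lemma q_T0:
  assumes "a \<in> carrier A" "b \<in> carrier A" "c \<in> carrier A" "x \<in> carrier L" "y \<in> carrier L" "z \<in> carrier L"
  defines "k u v \<equiv> q u (bracket L x y) v z \<ominus>\<^bsub>Q\<^esub> q v (bracket L x y) u z"
  shows "(k (a \<otimes>\<^bsub>A\<^esub> b) c \<oplus>\<^bsub>Q\<^esub> k (b \<otimes>\<^bsub>A\<^esub> c) a \<oplus>\<^bsub>Q\<^esub> k (c \<otimes>\<^bsub>A\<^esub> a) b) \<ominus>\<^bsub>Q\<^esub> k (a \<otimes>\<^bsub>A\<^esub> b \<otimes>\<^bsub>A\<^esub> c) \<one>\<^bsub>A\<^esub> = \<zero>\<^bsub>Q\<^esub>"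
proof -
  note [simp] = assms(1-6)
  let ?n = "a \<otimes>\<^bsub>A\<^esub> b \<otimes>\<^bsub>A\<^esub> c" and ?i = "\<one>\<^bsub>A\<^esub>"
  let ?P = "bracket L x y" and ?R = "bracket L y z" and ?T = "bracket L z x"
  have c: "(b \<otimes>\<^bsub>A\<^esub> c) \<otimes>\<^bsub>A\<^esub> a = ?n" "(c \<otimes>\<^bsub>A\<^esub> a) \<otimes>\<^bsub>A\<^esub> b = ?n"
    by (simp_all add: mult_A_simps)
  \<comment> \<open>Hence \<open>k\<close> can be computed from any cyclic rotation of \<open>x, y, z\<close>.\<close>
  have kR: "k u v = q u ?R v x \<ominus>\<^bsub>Q\<^esub> q v ?R u x" if [simp]: "u \<in> carrier A" "v \<in> carrier A" for u v
    unfolding k_def using q_killing[of u v x y z]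
    by (simp add: q_skew[of u x v ?R] q_skew[of v x u ?R] a_minus_def vs_comm)
  have kT: "k u v = q u ?T v y \<ominus>\<^bsub>Q\<^esub> q v ?T u y" if [simp]: "u \<in> carrier A" "v \<in> carrier A" for u v
    unfolding kR[OF that] using q_killing[of u v y z x]
    by (simp add: q_skew[of u y v ?T] q_skew[of v y u ?T] a_minus_def vs_comm)
  have solve: "s = w \<ominus>\<^bsub>Q\<^esub> r" if "r \<oplus>\<^bsub>Q\<^esub> s = w" "r \<in> carrier Q" "s \<in> carrier Q" for r s w
  proof -
    have "s = (r \<oplus>\<^bsub>Q\<^esub> s) \<ominus>\<^bsub>Q\<^esub> r"
      by (rule sg_eqI[of Q]) (use that(2,3) in \<open>simp_all add: sg_simps\<close>)
    then show ?thesis unfolding that(1) .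
  qed
  \<comment> \<open>The terms of \<open>k\<close> with reversed coefficients are eliminated by
    \<open>q_symmetric\<close>. This doubles the terms of the cocycle sum and leaves terms with
    coefficients abc and 1 only.\<close>
  have sP: "q c ?P (a \<otimes>\<^bsub>A\<^esub> b) z = (q ?n ?P ?i z \<oplus>\<^bsub>Q\<^esub> q ?i ?P ?n z) \<ominus>\<^bsub>Q\<^esub> q (a \<otimes>\<^bsub>A\<^esub> b) ?P c z"
    by (rule solve, rule q_symmetric) simp_all
  have sR: "q a ?R (b \<otimes>\<^bsub>A\<^esub> c) x = (q ?n ?R ?i x \<oplus>\<^bsub>Q\<^esub> q ?i ?R ?n x) \<ominus>\<^bsub>Q\<^esub> q (b \<otimes>\<^bsub>A\<^esub> c) ?R a x"
    by (rule solve, rule q_symmetric[of "b \<otimes>\<^bsub>A\<^esub> c" a y z x, unfolded c]) simp_all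
  have sT: "q b ?T (c \<otimes>\<^bsub>A\<^esub> a) y = (q ?n ?T ?i y \<oplus>\<^bsub>Q\<^esub> q ?i ?T ?n y) \<ominus>\<^bsub>Q\<^esub> q (c \<otimes>\<^bsub>A\<^esub> a) ?T b y"
    by (rule solve, rule q_symmetric[of "c \<otimes>\<^bsub>A\<^esub> a" b z x y, unfolded c]) simp_all
  have F: "q (a \<otimes>\<^bsub>A\<^esub> b) ?P c z \<oplus>\<^bsub>Q\<^esub> q (b \<otimes>\<^bsub>A\<^esub> c) ?R a x \<oplus>\<^bsub>Q\<^esub> q (c \<otimes>\<^bsub>A\<^esub> a) ?T b y = \<zero>\<^bsub>Q\<^esub>"
    by (rule q_cocycle) simp_all
  have F7: "q ?n ?P ?i z \<oplus>\<^bsub>Q\<^esub> q ?i ?R ?n x \<oplus>\<^bsub>Q\<^esub> q ?n ?T ?i y = \<zero>\<^bsub>Q\<^esub>"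
    using q_cocycle[of ?n x ?i y ?i z] by (simp add: mult_A_simps(1,2))
  have F8: "q ?n ?P ?i z \<oplus>\<^bsub>Q\<^esub> q ?n ?R ?i x \<oplus>\<^bsub>Q\<^esub> q ?i ?T ?n y = \<zero>\<^bsub>Q\<^esub>"
    using q_cocycle[of ?i x ?n y ?i z] by (simp add: mult_A_simps(1,2))
  have "(k (a \<otimes>\<^bsub>A\<^esub> b) c \<oplus>\<^bsub>Q\<^esub> k (b \<otimes>\<^bsub>A\<^esub> c) a \<oplus>\<^bsub>Q\<^esub> k (c \<otimes>\<^bsub>A\<^esub> a) b) \<ominus>\<^bsub>Q\<^esub> k ?n ?i =
    ((q (a \<otimes>\<^bsub>A\<^esub> b) ?P c z \<oplus>\<^bsub>Q\<^esub> q (b \<otimes>\<^bsub>A\<^esub> c) ?R a x \<oplus>\<^bsub>Q\<^esub> q (c \<otimes>\<^bsub>A\<^esub> a) ?T b y) \<oplus>\<^bsub>Q\<^esub>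
     (q (a \<otimes>\<^bsub>A\<^esub> b) ?P c z \<oplus>\<^bsub>Q\<^esub> q (b \<otimes>\<^bsub>A\<^esub> c) ?R a x \<oplus>\<^bsub>Q\<^esub> q (c \<otimes>\<^bsub>A\<^esub> a) ?T b y)) \<ominus>\<^bsub>Q\<^esub>
    ((q ?n ?P ?i z \<oplus>\<^bsub>Q\<^esub> q ?i ?R ?n x \<oplus>\<^bsub>Q\<^esub> q ?n ?T ?i y) \<oplus>\<^bsub>Q\<^esub>
     (q ?n ?P ?i z \<oplus>\<^bsub>Q\<^esub> q ?n ?R ?i x \<oplus>\<^bsub>Q\<^esub> q ?i ?T ?n y))"
    unfolding kR[of "b \<otimes>\<^bsub>A\<^esub> c" a, simplified] kT[of "c \<otimes>\<^bsub>A\<^esub> a" b, simplified]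
    unfolding k_def sP sR sT
    by (rule sg_eqI[of Q]) (simp_all add: sg_simps)
  also have "\<dots> = \<zero>\<^bsub>Q\<^esub>" unfolding F F7 F8 by simp
  finally show ?thesis .
qed

text \<open>A fixed choice, so that later statements can refer to one pairing. It is made with
  \<open>SOME\<close> because the generators determine the values only on the carriers. The defining
  value is written through \<open>skew_part\<close>, which makes the values on generators elements
  of \<open>kernel_gens\<close> for homogeneous pairs of degree \<open>\<beta>\<close>.\<close>

definition I2 where "I2 = (SOME \<phi>. bilin (ext_power K A 2) (sym_power K L 2) Q \<phi> \<and>
  (\<forall>a\<in>carrier A. \<forall>b\<in>carrier A. \<forall>x\<in>carrier L. \<forall>y\<in>carrier L.
    \<phi> (wedge K A [a, b]) (symprod K L [x, y]) = cls (skew_part a b x y)))"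

definition I1 where "I1 = (SOME \<phi>. bilin (sym_power K A 2) LL Q \<phi> \<and>
  (\<forall>a\<in>carrier A. \<forall>b\<in>carrier A. \<forall>x\<in>carrier L. \<forall>y\<in>carrier L.
    \<phi> (symprod K A [a, b]) (wedge K L [x, y]) =
      cls (wedge K AL [ten a x, ten b y] \<oplus>\<^bsub>G2\<^esub> wedge K AL [ten b x, ten a y])))"

lemma I2:
  shows "bilin (ext_power K A 2) (sym_power K L 2) Q I2"
    "\<And>a b x y. a \<in> carrier A \<Longrightarrow> b \<in> carrier A \<Longrightarrow> x \<in> carrier L \<Longrightarrow> y \<in> carrier L \<Longrightarrow>
      I2 (wedge K A [a, b]) (symprod K L [x, y]) = q a x b y \<ominus>\<^bsub>Q\<^esub> q b x a y"
proof -
  have "\<exists>\<phi>. bilin (ext_power K A 2) (sym_power K L 2) Q \<phi> \<and>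
    (\<forall>a\<in>carrier A. \<forall>b\<in>carrier A. \<forall>x\<in>carrier L. \<forall>y\<in>carrier L.
      \<phi> (wedge K A [a, b]) (symprod K L [x, y]) = cls (skew_part a b x y))"
  proof (rule ext_sym_lift[OF vs_A vs_L vs_Q, of "\<lambda>a b x y. cls (skew_part a b x y)"])
    show "bilin A A Q (\<lambda>a b. cls (skew_part a b x y))" if "x \<in> carrier L" "y \<in> carrier L" for x y
      using that by (intro bilinI lin_intros) simp_all
    show "bilin L L Q (\<lambda>x y. cls (skew_part a b x y))" if "a \<in> carrier A" "b \<in> carrier A" for a b
      using that by (intro bilinI lin_intros) simp_all
    show "cls (skew_part a a x y) = \<zero>\<^bsub>Q\<^esub>" if "a \<in> carrier A" "x \<in> carrier L" "y \<in> carrier L" for a x y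
      using that lin_zero[OF lin_cls vs_ext vs_Q] by simp
    fix a b x y assume [simp]: "a \<in> carrier A" "b \<in> carrier A" "x \<in> carrier L" "y \<in> carrier L"
    \<comment> \<open>Reversing both wedges costs a sign in each, and the two terms trade
      places.\<close>
    have "skew_part a b x y = skew_part a b y x"
      by (rule sg_eqI[of G2])
        (simp_all add: wedge2_swap[OF vs_AL, of "ten a y" "ten b x"] wedge2_swap[OF vs_AL, of "ten b y" "ten a x"] sg_simps)
    then show "cls (skew_part a b x y) = cls (skew_part a b y x)" by simp
  qed blast
  from someI_ex[OF this, folded I2_def]
  show "bilin (ext_power K A 2) (sym_power K L 2) Q I2"
    "\<And>a b x y. a \<in> carrier A \<Longrightarrow> b \<in> carrier A \<Longrightarrow> x \<in> carrier L \<Longrightarrow> y \<in> carrier L \<Longrightarrow>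
      I2 (wedge K A [a, b]) (symprod K L [x, y]) = q a x b y \<ominus>\<^bsub>Q\<^esub> q b x a y"
    by (simp_all add: lin_minus[OF lin_cls])
qed

lemma I1:
  shows "bilin (sym_power K A 2) LL Q I1"
    "\<And>a b x y. a \<in> carrier A \<Longrightarrow> b \<in> carrier A \<Longrightarrow> x \<in> carrier L \<Longrightarrow> y \<in> carrier L \<Longrightarrow>
      I1 (symprod K A [a, b]) (wedge K L [x, y]) = q a x b y \<oplus>\<^bsub>Q\<^esub> q b x a y"
proof -
  let ?s = "\<lambda>a b x y. wedge K AL [ten a x, ten b y] \<oplus>\<^bsub>G2\<^esub> wedge K AL [ten b x, ten a y]"
  have "\<exists>\<phi>. bilin (sym_power K A 2) LL Q \<phi> \<and>
    (\<forall>a\<in>carrier A. \<forall>b\<in>carrier A. \<forall>x\<in>carrier L. \<forall>y\<in>carrier L.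
      \<phi> (symprod K A [a, b]) (wedge K L [x, y]) = cls (?s a b x y))"
  proof (rule sym_ext_lift[OF vs_A vs_L vs_Q, of "\<lambda>a b x y. cls (?s a b x y)"])
    show "bilin A A Q (\<lambda>a b. cls (?s a b x y))" if "x \<in> carrier L" "y \<in> carrier L" for x y
      using that by (intro bilinI lin_intros) simp_all
    show "bilin L L Q (\<lambda>x y. cls (?s a b x y))" if "a \<in> carrier A" "b \<in> carrier A" for a b
      using that by (intro bilinI lin_intros) simp_all
    show "cls (?s a b x y) = cls (?s b a x y)" if "a \<in> carrier A" "b \<in> carrier A" "x \<in> carrier L" "y \<in> carrier L" for a b x y
      using that by (simp add: vs_comm)
    show "cls (?s a b x x) = \<zero>\<^bsub>Q\<^esub>" if "a \<in> carrier A" "b \<in> carrier A" "x \<in> carrier L" for a b x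
      using that wedge2_swap[OF vs_AL, of "ten a x" "ten b x"] lin_zero[OF lin_cls vs_ext vs_Q] by simp
  qed blast
  from someI_ex[OF this, folded I1_def]
  show "bilin (sym_power K A 2) LL Q I1"
    "\<And>a b x y. a \<in> carrier A \<Longrightarrow> b \<in> carrier A \<Longrightarrow> x \<in> carrier L \<Longrightarrow> y \<in> carrier L \<Longrightarrow>
      I1 (symprod K A [a, b]) (wedge K L [x, y]) = q a x b y \<oplus>\<^bsub>Q\<^esub> q b x a y"
    by (simp_all add: lin_add[OF lin_cls])
qed

lemma I2_eqI:
  assumes "vs W" "bilin (ext_power K A 2) (sym_power K L 2) W \<phi>" "bilin (ext_power K A 2) (sym_power K L 2) W \<psi>"
    "\<And>a b x y. a \<in> carrier A \<Longrightarrow> b \<in> carrier A \<Longrightarrow> x \<in> carrier L \<Longrightarrow> y \<in> carrier L \<Longrightarrow>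
      \<phi> (wedge K A [a, b]) (symprod K L [x, y]) = \<psi> (wedge K A [a, b]) (symprod K L [x, y])"
    "t \<in> carrier (ext_power K A 2)" "s \<in> carrier (sym_power K L 2)"
  shows "\<phi> t s = \<psi> t s"
  by (rule bilin_eq[OF spans_ext2[OF vs_A spans_carrier] spans_sym2[OF vs_L spans_carrier] assms(2,3) vs_ext vs_sym assms(1) _ assms(5,6)])
    (use assms(4) in blast)

lemma I1_eqI:
  assumes "vs W" "bilin (sym_power K A 2) LL W \<phi>" "bilin (sym_power K A 2) LL W \<psi>"
    "\<And>a b x y. a \<in> carrier A \<Longrightarrow> b \<in> carrier A \<Longrightarrow> x \<in> carrier L \<Longrightarrow> y \<in> carrier L \<Longrightarrow>
      \<phi> (symprod K A [a, b]) (wedge K L [x, y]) = \<psi> (symprod K A [a, b]) (wedge K L [x, y])"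
    "s \<in> carrier (sym_power K A 2)" "w \<in> carrier LL"
  shows "\<phi> s w = \<psi> s w"
  by (rule bilin_eq[OF spans_sym2[OF vs_A spans_carrier] spans_ext2[OF vs_L spans_carrier] assms(2,3) vs_sym vs_ext assms(1) _ assms(5,6)])
    (use assms(4) in blast)

abbreviation "derived \<equiv> span L {bracket L x y | x y. x \<in> carrier L \<and> y \<in> carrier L}"

lemma derived_gens: "{bracket L x y | x y. x \<in> carrier L \<and> y \<in> carrier L} \<subseteq> carrier L"
  by auto

lemma sub_derived: "sub derived L"
  by (rule sub_span[OF vs_L derived_gens])

lemma I2_kill_rels:
  assumes "t \<in> carrier (ext_power K A 2)" "n \<in> kill_rels"
  shows "I2 t n = \<zero>\<^bsub>Q\<^esub>"
proof -
  obtain s where s: "s \<in> carrier (tensor_power K L 3)" "n = killing_map K L s" using assms(2) by blast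
  have "I2 t (killing_map K L s) = \<zero>\<^bsub>Q\<^esub>"
  proof (rule lin_vanish[OF spans_tpow lin_comp[OF bilin_right[OF I2(1) assms(1)] killing_map(1)] vs_tpow vs_Q _ s(1)])
    fix p assume "p \<in> pure_tensor K L ` tuples L 3"
    then obtain x y z where p: "p = pure_tensor K L [x, y, z]"
      and [simp]: "x \<in> carrier L" "y \<in> carrier L" "z \<in> carrier L" using tuples_3 by blast
    show "I2 t (killing_map K L p) = \<zero>\<^bsub>Q\<^esub>"
    proof (rule lin_vanish[OF spans_ext2[OF vs_A spans_carrier] bilin_left[OF I2(1)] vs_ext vs_Q _ assms(1)])
      show "killing_map K L p \<in> carrier (sym_power K L 2)" unfolding p by (rule lin_closed[OF killing_map(1)]) simp
      fix u assume "u \<in> {wedge K A [s, t] |s t. s \<in> carrier A \<and> t \<in> carrier A}"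
      then obtain a b where u: "u = wedge K A [a, b]" and a [simp]: "a \<in> carrier A" "b \<in> carrier A" by blast
      show "I2 u (killing_map K L p) = \<zero>\<^bsub>Q\<^esub>"
        using q_killing[of a b x y z] bilin_closed[OF I2(1)]
        by (simp add: u p killing_map(2) lin_minus[OF bilin_right[OF I2(1)]] I2(2))
    qed
  qed
  then show ?thesis using s by simp
qed

text \<open>Linearity in both arguments reduces this to \<open>q_T0\<close>. It is enough that one
  factor of the symmetric product lies in [L, L], so what survives of S^2 L is the symmetric square
  of H_1.\<close>

lemma I2_T0_derived:
  assumes "t \<in> T0_range" "w \<in> derived" "z \<in> carrier L"
  shows "I2 t (symprod K L [w, z]) = \<zero>\<^bsub>Q\<^esub>"
proof -
  obtain s where s: "s \<in> carrier (tensor_power K A 3)" "t = T0 K A s" using assms(1) by blast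
  have t: "t \<in> carrier (ext_power K A 2)" using s lin_closed[OF T0(1)] by simp
  have lw: "lin L Q (\<lambda>w. I2 t (symprod K L [w, z]))"
    by (rule lin_comp[OF bilin_right[OF I2(1) t]]) (intro lin_symprod2 vs_L lin_id assms)
  show ?thesis
  proof (rule lin_eq_on_span[OF lw lin_const_zero[OF vs_Q] vs_L vs_Q derived_gens _ assms(2)])
    fix v assume "v \<in> {bracket L x y | x y. x \<in> carrier L \<and> y \<in> carrier L}"
    then obtain x y where v: "v = bracket L x y" and [simp]: "x \<in> carrier L" "y \<in> carrier L" by blast
    note [simp] = assms(3)
    have sv: "symprod K L [v, z] \<in> carrier (sym_power K L 2)" by (simp add: v)
    note l = bilin_left[OF I2(1) sv]
    have "I2 (T0 K A s) (symprod K L [v, z]) = \<zero>\<^bsub>Q\<^esub>"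
    proof (rule lin_vanish[OF spans_tpow lin_comp[OF l T0(1)] vs_tpow vs_Q _ s(1)])
      fix p assume "p \<in> pure_tensor K A ` tuples A 3"
      then obtain a b c where p: "p = pure_tensor K A [a, b, c]"
        and [simp]: "a \<in> carrier A" "b \<in> carrier A" "c \<in> carrier A" using tuples_3 by blast
      show "I2 (T0 K A p) (symprod K L [v, z]) = \<zero>\<^bsub>Q\<^esub>"
        using q_T0[of a b c x y z]
        by (simp add: p T0(2) lin_minus[OF l] lin_add[OF l]) (simp add: v I2(2))
    qed
    then show "I2 t (symprod K L [v, z]) = \<zero>\<^bsub>Q\<^esub>" using s(2) by simp
  qed
qed

lemma lin_mult_unit: "lin (sym_power K A 2) (sym_power K A 2) (\<lambda>s. symprod K A [sym_mult K A s, \<one>\<^bsub>A\<^esub>])"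
  by (intro lin_symprod2 vs_A sym_mult one_A)

text \<open>An element of the kernel of multiplication is not given by generators. Writing it as i -
  \<mu>(i) \<odot> 1 gives an expression linear in an arbitrary i of S^2 A, which can be tested on a
  \<odot> b; there it is \<open>q_symmetric\<close>.\<close>

lemma I1_derived:
  assumes "i \<in> mult_kernel" "w \<in> derived" "z \<in> carrier L"
  shows "I1 i (wedge K L [w, z]) = \<zero>\<^bsub>Q\<^esub>"
proof -
  have i: "i \<in> carrier (sym_power K A 2)" "sym_mult K A i = \<zero>\<^bsub>A\<^esub>" using assms(1) by auto
  have lw: "lin L Q (\<lambda>w. I1 i (wedge K L [w, z]))"
    by (rule lin_comp[OF bilin_right[OF I1(1) i(1)]]) (intro lin_wedge2 vs_L lin_id assms)
  show ?thesis
  proof (rule lin_eq_on_span[OF lw lin_const_zero[OF vs_Q] vs_L vs_Q derived_gens _ assms(2)])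
    fix v assume "v \<in> {bracket L x y | x y. x \<in> carrier L \<and> y \<in> carrier L}"
    then obtain x y where v: "v = bracket L x y" and [simp]: "x \<in> carrier L" "y \<in> carrier L" by blast
    note [simp] = assms(3)
    have sv: "wedge K L [v, z] \<in> carrier LL" by (simp add: v)
    note l = bilin_left[OF I1(1) sv]
    have "I1 (i \<ominus>\<^bsub>sym_power K A 2\<^esub> symprod K A [sym_mult K A i, \<one>\<^bsub>A\<^esub>]) (wedge K L [v, z]) = \<zero>\<^bsub>Q\<^esub>"
    proof (rule lin_vanish[OF spans_sym2[OF vs_A spans_carrier] lin_comp[OF l lin_diff[OF vs_sym lin_id lin_mult_unit]] vs_sym vs_Q _ i(1)])
      fix s assume "s \<in> {symprod K A [s, t] |s t. s \<in> carrier A \<and> t \<in> carrier A}"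
      then obtain a b where s: "s = symprod K A [a, b]" and [simp]: "a \<in> carrier A" "b \<in> carrier A" by blast
      show "I1 (s \<ominus>\<^bsub>sym_power K A 2\<^esub> symprod K A [sym_mult K A s, \<one>\<^bsub>A\<^esub>]) (wedge K L [v, z]) = \<zero>\<^bsub>Q\<^esub>"
        using q_symmetric[of a b x y z]
        by (simp add: s sym_mult(2) lin_minus[OF l]) (simp add: v I1(2))
    qed
    moreover have "symprod K A [\<zero>\<^bsub>A\<^esub>, \<one>\<^bsub>A\<^esub>] = \<zero>\<^bsub>sym_power K A 2\<^esub>"
      by (rule lin_zero[OF lin_symprod2(1)[OF vs_A lin_id one_A] vs_A vs_sym])
    ultimately show "I1 i (wedge K L [v, z]) = \<zero>\<^bsub>Q\<^esub>" using i by simp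
  qed
qed

end

subsection \<open>The exact sequence\<close>

context base_field
begin

text \<open>A criterion for split exactness. The maps out are defined on all of \<open>Q\<close>,
  and the decomposition of the identity in the last premise is asked only on
  \<open>\<Gamma>\<close>; linearity extends it to the span. On the kernel of \<open>g\<close> it
  reduces to h = f(r h), and preimages under \<open>g\<close> are sums of values of \<open>e\<close>
  and \<open>e'\<close>.\<close>

lemma short_exact_split:
  assumes vs: "vs Q" "vs U" "vs W" "vs W'" and \<Gamma>: "\<Gamma> \<subseteq> carrier Q"
    and f: "lin U Q f" "\<And>u. u \<in> carrier U \<Longrightarrow> f u \<in> span Q \<Gamma>"
    and e: "lin W Q e" "\<And>w. w \<in> carrier W \<Longrightarrow> e w \<in> span Q \<Gamma>"
    and e': "lin W' Q e'" "\<And>w. w \<in> carrier W' \<Longrightarrow> e' w \<in> span Q \<Gamma>"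
    and r: "lin Q U r" and p: "lin Q W p" and p': "lin Q W' p'"
    and rf: "\<And>u. u \<in> carrier U \<Longrightarrow> r (f u) = u"
    and pf: "\<And>u. u \<in> carrier U \<Longrightarrow> p (f u) = \<zero>\<^bsub>W\<^esub>" "\<And>u. u \<in> carrier U \<Longrightarrow> p' (f u) = \<zero>\<^bsub>W'\<^esub>"
    and pe: "\<And>w. w \<in> carrier W \<Longrightarrow> p (e w) = w" "\<And>w. w \<in> carrier W \<Longrightarrow> p' (e w) = \<zero>\<^bsub>W'\<^esub>"
    and pe': "\<And>w. w \<in> carrier W' \<Longrightarrow> p (e' w) = \<zero>\<^bsub>W\<^esub>" "\<And>w. w \<in> carrier W' \<Longrightarrow> p' (e' w) = w"
    and sum: "\<And>h. h \<in> \<Gamma> \<Longrightarrow> f (r h) \<oplus>\<^bsub>Q\<^esub> e (p h) \<oplus>\<^bsub>Q\<^esub> e' (p' h) = h"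
  shows "\<exists>f g. short_exact K U (restrict_to Q (span Q \<Gamma>)) (direct_sum W W') f g"
proof -
  let ?N = "span Q \<Gamma>"
  note n = sub_closed[OF sub_span[OF vs(1) \<Gamma>] vs(1)]
  let ?f = "restrict f (carrier U)" and ?g = "\<lambda>h\<in>?N. (p h, p' h)"
  have sum': "f (r h) \<oplus>\<^bsub>Q\<^esub> e (p h) \<oplus>\<^bsub>Q\<^esub> e' (p' h) = h" if "h \<in> ?N" for h
    by (rule lin_eq_on_span[OF _ lin_id vs(1,1) \<Gamma> sum that])
      (intro lin_plus vs lin_comp[OF f(1) r] lin_comp[OF e(1) p] lin_comp[OF e'(1) p'])
  have "?f \<in> mod_hom K U (restrict_to Q ?N)"
    using f vs by (simp add: mod_hom_iff lin_restrict_ext lin_into_restrict)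
  moreover have "?g \<in> mod_hom K (restrict_to Q ?N) (direct_sum W W')"
    using n lin_closed[OF p] lin_closed[OF p'] by (auto simp: mod_hom_def direct_sum_def
      lin_add[OF p] lin_add[OF p'] lin_smult[OF p] lin_smult[OF p'])
  moreover have "inj_on ?f (carrier U)"
    by (rule inj_onI) (metis restrict_apply' rf)
  moreover have "?f ` carrier U = a_kernel (restrict_to Q ?N) (direct_sum W W') ?g"
  proof
    show "?f ` carrier U \<subseteq> a_kernel (restrict_to Q ?N) (direct_sum W W') ?g"
      using f(2) pf by (auto simp: a_kernel_def' direct_sum_def)
    show "a_kernel (restrict_to Q ?N) (direct_sum W W') ?g \<subseteq> ?f ` carrier U"
    proof
      fix h assume "h \<in> a_kernel (restrict_to Q ?N) (direct_sum W W') ?g"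
      then have h: "h \<in> ?N" "p h = \<zero>\<^bsub>W\<^esub>" "p' h = \<zero>\<^bsub>W'\<^esub>" by (auto simp: a_kernel_def' direct_sum_def)
      have rh: "r h \<in> carrier U" using lin_closed[OF r n(1)[OF h(1)]] .
      have "h = f (r h)"
        using sum'[OF h(1)] h(2,3) lin_zero[OF e(1) vs(3,1)] lin_zero[OF e'(1) vs(4,1)] lin_closed[OF f(1) rh] vs
        by simp
      then show "h \<in> ?f ` carrier U" using rh by force
    qed
  qed
  moreover have "?g ` carrier (restrict_to Q ?N) = carrier (direct_sum W W')"
  proof
    show "?g ` carrier (restrict_to Q ?N) \<subseteq> carrier (direct_sum W W')"
      using lin_closed[OF p n(1)] lin_closed[OF p' n(1)] by (auto simp: direct_sum_def)
    show "carrier (direct_sum W W') \<subseteq> ?g ` carrier (restrict_to Q ?N)"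
    proof
      fix y assume "y \<in> carrier (direct_sum W W')"
      then obtain w w' where y: "y = (w, w')" "w \<in> carrier W" "w' \<in> carrier W'" by (auto simp: direct_sum_def)
      let ?h = "e w \<oplus>\<^bsub>Q\<^esub> e' w'"
      have "?h \<in> ?N" using n(4)[OF e(2)[OF y(2)] e'(2)[OF y(3)]] .
      moreover have "p ?h = w" "p' ?h = w'"
        using y lin_closed[OF e(1)] lin_closed[OF e'(1)] pe pe' vs
        by (simp_all add: lin_add[OF p] lin_add[OF p'])
      ultimately show "y \<in> ?g ` carrier (restrict_to Q ?N)" using y(1) by force
    qed
  qed
  ultimately show ?thesis unfolding short_exact_def by blast
qed

lemma span_sub: "sub N V \<Longrightarrow> span V N = N"
  by (intro subset_antisym span_least span_superset) auto

end

context current_over_field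
begin

section \<open>The first homology as L/[L, L], and the parts of degree
  \<open>\<beta>\<close>\<close>

abbreviation "H1 \<equiv> homology K L 1"
abbreviation "c1 x \<equiv> homology_class K L 1 (wedge K L [x])"

lemma vs_H1 [simp]: "vs H1"
  by (rule vs_homology[OF sub_boundaries(1)[OF alt_L] sub_cycles(1)[OF vs_L]])

lemma lin_class1: "lin (ext_power K L 1) H1 (homology_class K L 1)"
  using lin_homology_class_cycles[OF sub_boundaries(1)[OF alt_L] sub_cycles(1)[OF vs_L]]
  by (simp add: cycles_1 lin_def)

lemma lin_c1 [lin_intros]: "lin U L f \<Longrightarrow> lin U H1 (\<lambda>x. c1 (f x))"
  by (rule lin_comp[OF lin_class1]) (rule lin_wedge1[OF vs_L])

lemma c1_closed [simp]: "x \<in> carrier L \<Longrightarrow> c1 x \<in> carrier H1"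
  by (rule lin_closed[OF lin_c1[OF lin_id]])

lemma ext1_carrier: "carrier (ext_power K L 1) = (\<lambda>x. wedge K L [x]) ` carrier L"
proof -
  obtain u where u: "lin (ext_power K L 1) L u" "\<And>x. x \<in> carrier L \<Longrightarrow> u (wedge K L [x]) = x"
    by (rule ext1_lift[OF vs_L vs_L lin_id]) blast
  have "wedge K L [u w] = w" if "w \<in> carrier (ext_power K L 1)" for w
    by (rule lin_eq[OF spans_ext lin_wedge1[OF vs_L u(1)] lin_id vs_ext vs_ext _ that])
      (use u(2) in \<open>auto dest!: tuples_1\<close>)
  then have "w \<in> (\<lambda>x. wedge K L [x]) ` carrier L" if "w \<in> carrier (ext_power K L 1)" for w
    using that lin_closed[OF u(1) that] by (metis imageI)
  then show ?thesis by auto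
qed

lemma c1_surj: "carrier H1 \<subseteq> (\<lambda>x. c1 x) ` carrier L"
  by (auto simp: carrier_homology cycles_1 ext1_carrier)

lemma c1_bracket: "x \<in> carrier L \<Longrightarrow> y \<in> carrier L \<Longrightarrow> c1 (bracket L x y) = \<zero>\<^bsub>H1\<^esub>"
proof -
  assume [simp]: "x \<in> carrier L" "y \<in> carrier L"
  have "wedge K L [bracket L x y] \<in> ce_boundaries K L 1"
    unfolding ce_boundaries_def using ce_diff_2(2)[OF alt_L, of x y]
    by (intro image_eqI[of _ _ "wedge K L [x, y]"]) simp_all
  then show ?thesis using homology_class_zero_iff[OF sub_boundaries(1)[OF alt_L]] by simp
qed

text \<open>The 1-boundaries are the images of brackets and their combinations; the inverse
  \<open>u\<close> of the identification of L with its first exterior power carries this back to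
  L.\<close>

lemma c1_zero_derived:
  assumes "x \<in> carrier L" "c1 x = \<zero>\<^bsub>H1\<^esub>"
  shows "x \<in> derived"
proof -
  let ?w = "\<lambda>x. wedge K L [x]"
  note w = lin_wedge1[OF vs_L lin_id]
  obtain u where u: "lin (ext_power K L 1) L u" "\<And>x. x \<in> carrier L \<Longrightarrow> u (wedge K L [x]) = x"
    by (rule ext1_lift[OF vs_L vs_L lin_id]) blast
  have "?w x \<in> ce_boundaries K L 1"
    using homology_class_zero_iff[OF sub_boundaries(1)[OF alt_L], of "?w x"] assms by simp
  then obtain v where v: "v \<in> carrier LL" "?w x = ce_diff K L 2 v" by (auto simp: ce_boundaries_def)
  have "ce_diff K L 2 v \<in> ?w ` derived"
    by (rule lin_span[OF ce_diff_2(1)[OF alt_L] vs_ext vs_ext spans_subset[OF spans_ext2[OF vs_L spans_carrier]]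
          sub_image[OF vs_L vs_ext w sub_derived] _ spansD[OF spans_ext2[OF vs_L spans_carrier] v(1)]])
      (auto simp: ce_diff_2(2)[OF alt_L] intro!: imageI span_base, blast)
  then obtain y where y: "y \<in> derived" "?w x = ?w y" unfolding v(2)[symmetric] by blast
  have "x = u (?w y)" using u(2)[OF assms(1)] y(2) by simp
  then have "x = y" using u(2)[OF sub_closed(1)[OF sub_derived vs_L y(1)]] by simp
  then show ?thesis using y by simp
qed

lemma homology_degree_1:
  assumes "\<gamma> \<in> carrier B"
  shows "homology_degree K L B D 1 \<gamma> = (\<lambda>x. c1 x) ` D \<gamma>"
proof -
  have "wedge K L ` hom_tuples B D 1 \<gamma> = (\<lambda>x. wedge K L [x]) ` D \<gamma>"
    using hom_tuples_1[OF B_group, of _ D \<gamma>] assms by (auto simp: image_iff)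
  then have "ext_degree K L B D 1 \<gamma> = (\<lambda>x. wedge K L [x]) ` D \<gamma>"
    using image_span[OF lin_wedge1[OF vs_L lin_id] vs_L vs_ext sub_subset[OF sub_D[OF assms] vs_L]]
      span_sub[OF sub_D[OF assms]] by (simp add: ext_degree_def)
  moreover have "(\<lambda>x. wedge K L [x]) ` D \<gamma> \<subseteq> ce_cycles K L 1"
    using D_closed[OF assms] by (auto simp: cycles_1)
  ultimately show ?thesis by (auto simp: homology_degree_def image_image Int_absorb1)
qed

lemma hom_tuples_H1:
  "xs \<in> hom_tuples B (homology_degree K L B D 1) 2 \<beta> \<longleftrightarrow> (\<exists>x y. hpair x y \<and> xs = [c1 x, c1 y])"
  unfolding hom_tuples_2[OF B_group] hpair_def
  by (auto simp: homology_degree_1)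

abbreviation "H1S \<equiv> restrict_to (sym_power K H1 2) (sym_degree K H1 B (homology_degree K L B D 1) 2 \<beta>)"
abbreviation "H1E \<equiv> restrict_to (ext_power K H1 2) (ext_degree K H1 B (homology_degree K L B D 1) 2 \<beta>)"
abbreviation "KillD \<equiv> restrict_to (Kill K L) (Kill_degree K L B D \<beta>)"

lemma H1S_gens: "{symprod K H1 [c1 x, c1 y] | x y. hpair x y} \<subseteq> carrier (sym_power K H1 2)"
  using hpair_closed by auto

lemma H1E_gens: "{wedge K H1 [c1 x, c1 y] | x y. hpair x y} \<subseteq> carrier (ext_power K H1 2)"
  using hpair_closed by auto

lemma H1S_eq: "sym_degree K H1 B (homology_degree K L B D 1) 2 \<beta> =
    span (sym_power K H1 2) {symprod K H1 [c1 x, c1 y] | x y. hpair x y}"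
proof -
  have "hom_tuples B (homology_degree K L B D 1) 2 \<beta> = {[c1 x, c1 y] | x y. hpair x y}"
    using hom_tuples_H1 by blast
  then have "symprod K H1 ` hom_tuples B (homology_degree K L B D 1) 2 \<beta> = {symprod K H1 [c1 x, c1 y] | x y. hpair x y}"
    by auto
  then show ?thesis by (simp add: sym_degree_def)
qed

lemma H1E_eq: "ext_degree K H1 B (homology_degree K L B D 1) 2 \<beta> =
    span (ext_power K H1 2) {wedge K H1 [c1 x, c1 y] | x y. hpair x y}"
proof -
  have "hom_tuples B (homology_degree K L B D 1) 2 \<beta> = {[c1 x, c1 y] | x y. hpair x y}"
    using hom_tuples_H1 by blast
  then have "wedge K H1 ` hom_tuples B (homology_degree K L B D 1) 2 \<beta> = {wedge K H1 [c1 x, c1 y] | x y. hpair x y}"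
    by auto
  then show ?thesis by (simp add: ext_degree_def)
qed

lemma KillD_eq: "Kill_degree K L B D \<beta> = span (Kill K L) {kill_class K L (symprod K L [x, y]) | x y. hpair x y}"
proof -
  have "symprod K L ` hom_tuples B D 2 \<beta> = {symprod K L [x, y] | x y. hpair x y}"
    using hom_tuples_2[OF B_group, of _ D \<beta>] by (auto simp: hpair_def image_iff) blast+
  moreover have "{symprod K L [x, y] | x y. hpair x y} \<subseteq> carrier (sym_power K L 2)"
    using hpair_closed by auto
  moreover have "kill_class K L ` {symprod K L [x, y] | x y. hpair x y} = {kill_class K L (symprod K L [x, y]) | x y. hpair x y}"
    by blast
  ultimately show ?thesis
    using image_span[OF lin_kill_class vs_sym vs_Kill] by (simp add: Kill_degree_def sym_degree_def)
qed

lemma vs_targets [simp]: "vs H1S" "vs H1E" "vs KillD"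
  using H1S_gens H1E_gens sub_Kill_degree by (simp_all add: H1S_eq H1E_eq)

lemma spans_targets:
  "spans H1S {symprod K H1 [c1 x, c1 y] | x y. hpair x y}"
  "spans H1E {wedge K H1 [c1 x, c1 y] | x y. hpair x y}"
  "spans KillD {kill_class K L (symprod K L [x, y]) | x y. hpair x y}"
proof -
  have "{kill_class K L (symprod K L [x, y]) | x y. hpair x y} \<subseteq> carrier (Kill K L)" using hpair_closed by auto
  then show "spans H1S {symprod K H1 [c1 x, c1 y] | x y. hpair x y}"
    "spans H1E {wedge K H1 [c1 x, c1 y] | x y. hpair x y}"
    "spans KillD {kill_class K L (symprod K L [x, y]) | x y. hpair x y}"
    unfolding H1S_eq H1E_eq KillD_eq using H1S_gens H1E_gens by (simp_all add: spans_restrict_span)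
qed

lemma H1_section:
  obtains s where "lin H1 L s" "\<And>h. h \<in> carrier H1 \<Longrightarrow> c1 (s h) = h"
    "\<And>x. x \<in> carrier L \<Longrightarrow> s (c1 x) \<ominus>\<^bsub>L\<^esub> x \<in> derived"
proof -
  note c = lin_c1[OF lin_id]
  obtain s where s: "lin H1 L s" "\<And>h. h \<in> carrier H1 \<Longrightarrow> c1 (s h) = h"
    by (rule section_exists[OF vs_L vs_H1 c c1_surj]) blast
  have d: "s (c1 x) \<ominus>\<^bsub>L\<^esub> x \<in> derived" if x: "x \<in> carrier L" for x
  proof (rule c1_zero_derived)
    have sx: "s (c1 x) \<in> carrier L" using lin_closed[OF s(1)] x by simp
    then show "s (c1 x) \<ominus>\<^bsub>L\<^esub> x \<in> carrier L" using x by simp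
    show "c1 (s (c1 x) \<ominus>\<^bsub>L\<^esub> x) = \<zero>\<^bsub>H1\<^esub>"
      using lin_minus[OF c vs_L vs_H1 sx x] s(2)[of "c1 x"] x by simp
  qed
  show thesis by (rule that[OF s d])
qed

lemma bilin_section_eq:
  assumes W: "vs W" and \<phi>: "bilin L L W \<phi>"
    and u: "u \<in> carrier L" "x \<in> carrier L" "v \<in> carrier L" "y \<in> carrier L"
    and 0: "\<phi> (u \<ominus>\<^bsub>L\<^esub> x) v = \<zero>\<^bsub>W\<^esub>" "\<phi> x (v \<ominus>\<^bsub>L\<^esub> y) = \<zero>\<^bsub>W\<^esub>"
  shows "\<phi> u v = \<phi> x y"
proof -
  note c = bilin_closed[OF \<phi>]
  have "\<phi> u v = \<phi> x v"
    using 0(1) lin_minus[OF bilin_left[OF \<phi>] vs_L W] u c W by (simp add: vs_minus_eq_zero_iff)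
  also have "\<dots> = \<phi> x y"
    using 0(2) lin_minus[OF bilin_right[OF \<phi>] vs_L W] u c W by (simp add: vs_minus_eq_zero_iff)
  finally show ?thesis .
qed

text \<open>For \<open>t\<close> in the image of T_0 the map \<open>I2 t\<close> is a symmetric form
  on L/[L, L]. Changing representatives modulo [L, L] in one argument at a time shows that the
  choice of a section of L \<rightarrow> H_1 does not affect it.\<close>

lemma I2_section:
  assumes t: "t \<in> T0_range" and u: "u \<in> carrier L" "x \<in> carrier L" "v \<in> carrier L" "y \<in> carrier L"
    and d: "u \<ominus>\<^bsub>L\<^esub> x \<in> derived" "v \<ominus>\<^bsub>L\<^esub> y \<in> derived"
  shows "I2 t (symprod K L [u, v]) = I2 t (symprod K L [x, y])"
proof (rule bilin_section_eq[OF vs_Q _ u])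
  have t': "t \<in> carrier (ext_power K A 2)" by (rule sub_closed(1)[OF sub_T0_range vs_ext t])
  show "bilin L L Q (\<lambda>u v. I2 t (symprod K L [u, v]))"
    by (intro bilinI lin_comp[OF bilin_right[OF I2(1) t']] lin_symprod2 vs_L lin_id)
  show "I2 t (symprod K L [u \<ominus>\<^bsub>L\<^esub> x, v]) = \<zero>\<^bsub>Q\<^esub>" by (rule I2_T0_derived[OF t d(1) u(3)])
  show "I2 t (symprod K L [x, v \<ominus>\<^bsub>L\<^esub> y]) = \<zero>\<^bsub>Q\<^esub>"
    using I2_T0_derived[OF t d(2) u(2)] symprod2_comm[of x L "v \<ominus>\<^bsub>L\<^esub> y"] u by simp
qed

lemma I1_section:
  assumes i: "i \<in> mult_kernel" and u: "u \<in> carrier L" "x \<in> carrier L" "v \<in> carrier L" "y \<in> carrier L"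
    and d: "u \<ominus>\<^bsub>L\<^esub> x \<in> derived" "v \<ominus>\<^bsub>L\<^esub> y \<in> derived"
  shows "I1 i (wedge K L [u, v]) = I1 i (wedge K L [x, y])"
proof (rule bilin_section_eq[OF vs_Q _ u])
  have i': "i \<in> carrier (sym_power K A 2)" using i by simp
  note l = bilin_right[OF I1(1) i']
  show "bilin L L Q (\<lambda>u v. I1 i (wedge K L [u, v]))"
    by (intro bilinI lin_comp[OF l] lin_wedge2 vs_L lin_id)
  show "I1 i (wedge K L [u \<ominus>\<^bsub>L\<^esub> x, v]) = \<zero>\<^bsub>Q\<^esub>" by (rule I1_derived[OF i d(1) u(3)])
  show "I1 i (wedge K L [x, v \<ominus>\<^bsub>L\<^esub> y]) = \<zero>\<^bsub>Q\<^esub>"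
    using I1_derived[OF i d(2) u(2)] wedge2_swap[OF vs_L, of x "v \<ominus>\<^bsub>L\<^esub> y"] u
      lin_neg[OF l vs_ext vs_Q, of "wedge K L [v \<ominus>\<^bsub>L\<^esub> y, x]"] by simp
qed

section \<open>Linear maps from \<open>Q\<close> to the three outer terms\<close>

lemma lin_half: "vs W \<Longrightarrow> lin V W f \<Longrightarrow> lin V W (\<lambda>x. half \<odot>\<^bsub>W\<^esub> f x)"
  by (rule lin_scale) simp_all

lemma tens_neg:
  assumes "vs V" "vs W" "v \<in> carrier V" "w \<in> carrier W"
  shows "tens K V W (\<ominus>\<^bsub>V\<^esub> v) w = \<ominus>\<^bsub>tensor K V W\<^esub> tens K V W v w"
    "tens K V W v (\<ominus>\<^bsub>W\<^esub> w) = \<ominus>\<^bsub>tensor K V W\<^esub> tens K V W v w"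
  using lin_neg[OF bilin_left[OF bilin_tens[OF assms(1,2)] assms(4)] assms(1) vs_tensor assms(3)]
    lin_neg[OF bilin_right[OF bilin_tens[OF assms(1,2)] assms(3)] assms(2) vs_tensor assms(4)] by auto

lemma tens_zero:
  assumes "vs V" "vs W"
  shows "w \<in> carrier W \<Longrightarrow> tens K V W \<zero>\<^bsub>V\<^esub> w = \<zero>\<^bsub>tensor K V W\<^esub>"
    "v \<in> carrier V \<Longrightarrow> tens K V W v \<zero>\<^bsub>W\<^esub> = \<zero>\<^bsub>tensor K V W\<^esub>"
  using lin_zero[OF bilin_left[OF bilin_tens[OF assms]] assms(1) vs_tensor]
    lin_zero[OF bilin_right[OF bilin_tens[OF assms]] assms(2) vs_tensor] by auto

text \<open>One construction serves two targets: HH_1(A) \<otimes> Kill(L) in degree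
  \<open>\<beta>\<close> with the correction \<open>\<theta>\<close>, and the image of T_0 tensored
  with S^2(H_1) with \<open>\<theta>\<close> zero. The premise \<open>cyc\<close> is precisely the
  condition that the map kills the boundary of three pure tensors.\<close>

lemma skew_lift:
  assumes Y: "vs Y" and X: "vs X" and r: "lin (ext_power K A 2) Y r" and h: "lin (sym_power K L 2) X h"
    and \<theta>: "lin LL X \<theta>"
    and cyc: "\<And>a b c x y z. a \<in> carrier A \<Longrightarrow> b \<in> carrier A \<Longrightarrow> c \<in> carrier A \<Longrightarrow>
      x \<in> carrier L \<Longrightarrow> y \<in> carrier L \<Longrightarrow> z \<in> carrier L \<Longrightarrow>
      (tens K Y X (r (wedge K A [a \<otimes>\<^bsub>A\<^esub> b, c])) (h (symprod K L [bracket L x y, z])) \<oplus>\<^bsub>tensor K Y X\<^esub>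
      tens K Y X (r (wedge K A [b \<otimes>\<^bsub>A\<^esub> c, a])) (h (symprod K L [bracket L y z, x])) \<oplus>\<^bsub>tensor K Y X\<^esub>
      tens K Y X (r (wedge K A [c \<otimes>\<^bsub>A\<^esub> a, b])) (h (symprod K L [bracket L z x, y]))) =
      tens K Y X (r (wedge K A [a \<otimes>\<^bsub>A\<^esub> b \<otimes>\<^bsub>A\<^esub> c, \<one>\<^bsub>A\<^esub>])) (\<theta> (ce_diff K L 3 (wedge K L [x, y, z])))"
  obtains g where "lin Q (tensor K Y X) g"
    "\<And>t s. t \<in> carrier (ext_power K A 2) \<Longrightarrow> s \<in> carrier (sym_power K L 2) \<Longrightarrow> g (I2 t s) = tens K Y X (r t) (h s)"
    "\<And>s w. s \<in> carrier (sym_power K A 2) \<Longrightarrow> w \<in> carrier LL \<Longrightarrow>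
      g (I1 s w) = \<ominus>\<^bsub>tensor K Y X\<^esub> tens K Y X (r (wedge K A [sym_mult K A s, \<one>\<^bsub>A\<^esub>])) (\<theta> w)"
proof -
  let ?T = "tensor K Y X"
  \<comment> \<open>Since 2 q = I2 + I1 on generators, the desired values on \<open>I2\<close> and
    \<open>I1\<close> add up to twice the value on q; hence this formula and the factor
    \<open>half\<close> in front of it.\<close>
  let ?q = "\<lambda>a x b y. tens K Y X (r (wedge K A [a, b])) (h (symprod K L [x, y])) \<ominus>\<^bsub>?T\<^esub>
    tens K Y X (r (wedge K A [a \<otimes>\<^bsub>A\<^esub> b, \<one>\<^bsub>A\<^esub>])) (\<theta> (wedge K L [x, y]))"
  note li = lin_comp[OF r] lin_comp[OF h] lin_comp[OF \<theta>] lin_intros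
  have rc [simp]: "r t \<in> carrier Y" if "t \<in> carrier (ext_power K A 2)" for t by (rule lin_closed[OF r that])
  have hc [simp]: "h t \<in> carrier X" if "t \<in> carrier (sym_power K L 2)" for t by (rule lin_closed[OF h that])
  have tc [simp]: "\<theta> t \<in> carrier X" if "t \<in> carrier LL" for t by (rule lin_closed[OF \<theta> that])
  note [simp] = Y X
  have rs: "r (wedge K A [b, a]) = \<ominus>\<^bsub>Y\<^esub> r (wedge K A [a, b])" if "a \<in> carrier A" "b \<in> carrier A" for a b
    using wedge2_swap[OF vs_A that(2,1)] lin_neg[OF r vs_ext Y, of "wedge K A [a, b]"] that by simp
  have ts: "\<theta> (wedge K L [y, x]) = \<ominus>\<^bsub>X\<^esub> \<theta> (wedge K L [x, y])" if "x \<in> carrier L" "y \<in> carrier L" for x y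
    using wedge2_swap[OF vs_L that(2,1)] lin_neg[OF \<theta> vs_ext X, of "wedge K L [x, y]"] that by simp
  have tr: "\<ominus>\<^bsub>?T\<^esub> tens K Y X y x = tens K Y X (\<ominus>\<^bsub>Y\<^esub> y) x" if "y \<in> carrier Y" "x \<in> carrier X" for x y
    using tens_neg(1)[OF Y X that] by simp
  obtain k where k: "lin G2 ?T k"
    "\<And>a x b y. a \<in> carrier A \<Longrightarrow> x \<in> carrier L \<Longrightarrow> b \<in> carrier A \<Longrightarrow> y \<in> carrier L \<Longrightarrow>
      k (wedge K AL [ten a x, ten b y]) = half \<odot>\<^bsub>?T\<^esub> ?q a x b y"
  proof (rule current_lift[OF vs_tensor, of Y X "\<lambda>a x b y. half \<odot>\<^bsub>?T\<^esub> ?q a x b y"])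
    show "bilin A L ?T (\<lambda>a x. half \<odot>\<^bsub>?T\<^esub> ?q a x b y)" if "b \<in> carrier A" "y \<in> carrier L" for b y
      using that by (intro bilinI lin_half li vs_tensor) simp_all
    fix a x b y assume [simp]: "a \<in> carrier A" "x \<in> carrier L" "b \<in> carrier A" "y \<in> carrier L"
    have "?q a x b y = \<ominus>\<^bsub>?T\<^esub> ?q b y a x"
      using mult_A_simps(3)[of b a] symprod2_comm[of y L x]
      by (intro sg_eqI[where V = ?T and x = "?q a x b y"])
        (simp_all add: rs[of a b] ts[of x y] tens_neg sg_simps)
    then show "half \<odot>\<^bsub>?T\<^esub> ?q a x b y = \<ominus>\<^bsub>?T\<^esub> (half \<odot>\<^bsub>?T\<^esub> ?q b y a x)"
      by (simp add: vs_smult_neg)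
  qed blast
  obtain g where g: "lin Q ?T g" "\<And>z. z \<in> carrier G2 \<Longrightarrow> g (cls z) = k z"
  proof (rule Q_lift[OF vs_tensor k(1)])
    fix a x b y c z assume a [simp]: "a \<in> carrier A" "x \<in> carrier L" "b \<in> carrier A" "y \<in> carrier L" "c \<in> carrier A" "z \<in> carrier L"
    let ?n = "a \<otimes>\<^bsub>A\<^esub> b \<otimes>\<^bsub>A\<^esub> c" and ?d = "\<lambda>w. tens K Y X (r (wedge K A [a \<otimes>\<^bsub>A\<^esub> b \<otimes>\<^bsub>A\<^esub> c, \<one>\<^bsub>A\<^esub>])) (\<theta> w)"
    have m: "a \<otimes>\<^bsub>A\<^esub> c \<otimes>\<^bsub>A\<^esub> b = ?n" "b \<otimes>\<^bsub>A\<^esub> c \<otimes>\<^bsub>A\<^esub> a = ?n" "c \<otimes>\<^bsub>A\<^esub> a = a \<otimes>\<^bsub>A\<^esub> c"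
      by (simp_all add: mult_A_simps)
    have d: "lin LL ?T ?d" by (intro lin_tens(2) Y X \<theta> rc) simp
    have hz: "h (symprod K L [bracket L z x, y]) = \<ominus>\<^bsub>X\<^esub> h (symprod K L [bracket L x z, y])"
      using bracket_skew_L[of z x] lin_neg[OF lin_comp[OF h lin_symprod2(1)[OF vs_L lin_id]], of y "bracket L x z"] by simp
    have "k (ce_diff K AL 3 (wedge K AL [ten a x, ten b y, ten c z])) =
      half \<odot>\<^bsub>?T\<^esub> ?q (a \<otimes>\<^bsub>A\<^esub> b) (bracket L x y) c z \<ominus>\<^bsub>?T\<^esub> half \<odot>\<^bsub>?T\<^esub> ?q (a \<otimes>\<^bsub>A\<^esub> c) (bracket L x z) b y \<oplus>\<^bsub>?T\<^esub>
      half \<odot>\<^bsub>?T\<^esub> ?q (b \<otimes>\<^bsub>A\<^esub> c) (bracket L y z) a x"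
      by (simp add: ce_diff_3(2)[OF alt_AL] tensor_bracket(2) lin_add[OF k(1)] lin_minus[OF k(1)] k(2))
    also have "\<dots> = half \<odot>\<^bsub>?T\<^esub> ((tens K Y X (r (wedge K A [a \<otimes>\<^bsub>A\<^esub> b, c])) (h (symprod K L [bracket L x y, z])) \<oplus>\<^bsub>?T\<^esub>
      tens K Y X (r (wedge K A [b \<otimes>\<^bsub>A\<^esub> c, a])) (h (symprod K L [bracket L y z, x])) \<oplus>\<^bsub>?T\<^esub>
      tens K Y X (r (wedge K A [c \<otimes>\<^bsub>A\<^esub> a, b])) (h (symprod K L [bracket L z x, y]))) \<ominus>\<^bsub>?T\<^esub>
      (?d (wedge K L [bracket L x y, z]) \<ominus>\<^bsub>?T\<^esub> ?d (wedge K L [bracket L x z, y]) \<oplus>\<^bsub>?T\<^esub> ?d (wedge K L [bracket L y z, x])))"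
      by (rule sg_eqI[of ?T]) (simp_all add: m hz tens_neg(2) sg_simps)
    also have "\<dots> = half \<odot>\<^bsub>?T\<^esub> (?d (ce_diff K L 3 (wedge K L [x, y, z])) \<ominus>\<^bsub>?T\<^esub> ?d (ce_diff K L 3 (wedge K L [x, y, z])))"
      unfolding cyc[OF a(1,3,5,2,4,6)] by (simp add: ce_diff_3(2)[OF alt_L] lin_add[OF d] lin_minus[OF d])
    also have "\<dots> = \<zero>\<^bsub>?T\<^esub>"
      using lin_closed[OF d lin_closed[OF ce_diff_3(1)[OF alt_L]], of "wedge K L [x, y, z]"] by simp
    finally show "k (ce_diff K AL 3 (wedge K AL [ten a x, ten b y, ten c z])) = \<zero>\<^bsub>?T\<^esub>" .
  qed blast
  show thesis
  proof (rule that[OF g(1)])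
    fix t s assume ts: "t \<in> carrier (ext_power K A 2)" "s \<in> carrier (sym_power K L 2)"
    show "g (I2 t s) = tens K Y X (r t) (h s)"
    proof (rule I2_eqI[OF vs_tensor _ _ _ ts])
      show "bilin (ext_power K A 2) (sym_power K L 2) ?T (\<lambda>t s. g (I2 t s))"
        by (intro bilinI lin_comp[OF g(1)] bilin_left[OF I2(1)] bilin_right[OF I2(1)])
      show "bilin (ext_power K A 2) (sym_power K L 2) ?T (\<lambda>t s. tens K Y X (r t) (h s))"
        by (intro bilinI lin_tens Y X r h rc hc)
      fix a b x y assume [simp]: "a \<in> carrier A" "b \<in> carrier A" "x \<in> carrier L" "y \<in> carrier L"
      have "g (I2 (wedge K A [a, b]) (symprod K L [x, y])) = half \<odot>\<^bsub>?T\<^esub> ?q a x b y \<ominus>\<^bsub>?T\<^esub> half \<odot>\<^bsub>?T\<^esub> ?q b x a y"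
        by (simp add: I2(2) lin_minus[OF g(1)] g(2) k(2))
      also have "\<dots> = half \<odot>\<^bsub>?T\<^esub> tens K Y X (r (wedge K A [a, b])) (h (symprod K L [x, y])) \<oplus>\<^bsub>?T\<^esub>
        half \<odot>\<^bsub>?T\<^esub> tens K Y X (r (wedge K A [a, b])) (h (symprod K L [x, y]))"
        using mult_A_simps(3)[of b a] by (intro sg_eqI[where V = ?T and x = "half \<odot>\<^bsub>?T\<^esub> ?q a x b y \<ominus>\<^bsub>?T\<^esub> half \<odot>\<^bsub>?T\<^esub> ?q b x a y"])
          (simp_all add: rs[of a b] tens_neg sg_simps del: half_double)
      finally show "g (I2 (wedge K A [a, b]) (symprod K L [x, y])) = tens K Y X (r (wedge K A [a, b])) (h (symprod K L [x, y]))"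
        by simp
    qed
  next
    fix s w assume sw: "s \<in> carrier (sym_power K A 2)" "w \<in> carrier LL"
    show "g (I1 s w) = \<ominus>\<^bsub>?T\<^esub> tens K Y X (r (wedge K A [sym_mult K A s, \<one>\<^bsub>A\<^esub>])) (\<theta> w)"
    proof (rule I1_eqI[OF vs_tensor _ _ _ sw])
      show "bilin (sym_power K A 2) LL ?T (\<lambda>s w. g (I1 s w))"
        by (intro bilinI lin_comp[OF g(1)] bilin_left[OF I1(1)] bilin_right[OF I1(1)])
      have mc: "sym_mult K A s \<in> carrier A" if "s \<in> carrier (sym_power K A 2)" for s
        by (rule lin_closed[OF sym_mult(1) that])
      have mw: "wedge K A [sym_mult K A s, \<one>\<^bsub>A\<^esub>] \<in> carrier (ext_power K A 2)" if "s \<in> carrier (sym_power K A 2)" for s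
        using mc[OF that] by simp
      show "bilin (sym_power K A 2) LL ?T (\<lambda>s w. \<ominus>\<^bsub>?T\<^esub> tens K Y X (r (wedge K A [sym_mult K A s, \<one>\<^bsub>A\<^esub>])) (\<theta> w))"
        by (intro bilinI lin_uminus vs_tensor lin_tens Y X \<theta> rc tc lin_comp[OF r] lin_wedge2 vs_A sym_mult(1) one_A mw)
      fix a b x y assume [simp]: "a \<in> carrier A" "b \<in> carrier A" "x \<in> carrier L" "y \<in> carrier L"
      let ?e = "tens K Y X (r (wedge K A [a \<otimes>\<^bsub>A\<^esub> b, \<one>\<^bsub>A\<^esub>])) (\<theta> (wedge K L [x, y]))"
      have "g (I1 (symprod K A [a, b]) (wedge K L [x, y])) = half \<odot>\<^bsub>?T\<^esub> ?q a x b y \<oplus>\<^bsub>?T\<^esub> half \<odot>\<^bsub>?T\<^esub> ?q b x a y"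
        by (simp add: I1(2) lin_add[OF g(1)] g(2) k(2))
      also have "\<dots> = \<ominus>\<^bsub>?T\<^esub> (half \<odot>\<^bsub>?T\<^esub> ?e \<oplus>\<^bsub>?T\<^esub> half \<odot>\<^bsub>?T\<^esub> ?e)"
        using mult_A_simps(3)[of b a] by (intro sg_eqI[where V = ?T and x = "half \<odot>\<^bsub>?T\<^esub> ?q a x b y \<oplus>\<^bsub>?T\<^esub> half \<odot>\<^bsub>?T\<^esub> ?q b x a y"])
          (simp_all add: rs[of a b] tens_neg sg_simps del: half_double)
      finally show "g (I1 (symprod K A [a, b]) (wedge K L [x, y])) =
        \<ominus>\<^bsub>?T\<^esub> tens K Y X (r (wedge K A [sym_mult K A (symprod K A [a, b]), \<one>\<^bsub>A\<^esub>])) (\<theta> (wedge K L [x, y]))"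
        by (simp add: sym_mult(2))
    qed
  qed
qed

text \<open>Here boundaries cause no difficulty: each of the three terms of a boundary has a bracket
  in its second factor and is killed by \<open>h\<close>. As the formula is symmetric in the
  coefficients, skew classes go to zero.\<close>

lemma symmetric_lift:
  assumes X: "vs X" and h: "lin LL X h"
    and h0: "\<And>x y z. x \<in> carrier L \<Longrightarrow> y \<in> carrier L \<Longrightarrow> z \<in> carrier L \<Longrightarrow> h (wedge K L [bracket L x y, z]) = \<zero>\<^bsub>X\<^esub>"
  obtains g where "lin Q (tensor K (I_alg K A) X) g"
    "\<And>t s. t \<in> carrier (ext_power K A 2) \<Longrightarrow> s \<in> carrier (sym_power K L 2) \<Longrightarrow> g (I2 t s) = \<zero>\<^bsub>tensor K (I_alg K A) X\<^esub>"
    "\<And>i w. i \<in> mult_kernel \<Longrightarrow> w \<in> carrier LL \<Longrightarrow> g (I1 i w) = tens K (I_alg K A) X i (h w)"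
proof -
  let ?I = "I_alg K A"
  let ?T = "tensor K ?I X" and ?S = "sym_power K A 2"
  \<comment> \<open>The projection of S^2 A onto the kernel of multiplication along the elements a
    \<odot> 1.\<close>
  define r where "r s = s \<ominus>\<^bsub>?S\<^esub> symprod K A [sym_mult K A s, \<one>\<^bsub>A\<^esub>]" for s
  have rS: "lin ?S ?S r" unfolding r_def by (intro lin_diff vs_sym lin_id lin_mult_unit)
  have rm: "r s \<in> mult_kernel" if "s \<in> carrier ?S" for s
    using that lin_closed[OF rS that] lin_closed[OF sym_mult(1) that] lin_closed[OF lin_mult_unit that]
    by (simp add: r_def lin_minus[OF sym_mult(1)] sym_mult(2) mult_A_simps(2))
  have r: "lin ?S ?I r" unfolding I_alg_eq by (rule lin_into_restrict[OF rS rm])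
  have rc [simp]: "r s \<in> carrier ?I" if "s \<in> carrier ?S" for s by (rule lin_closed[OF r that])
  have hc [simp]: "h t \<in> carrier X" if "t \<in> carrier LL" for t by (rule lin_closed[OF h that])
  note [simp] = X
  have r1: "r i = i" if "i \<in> mult_kernel" for i
    using that lin_zero[OF lin_symprod2(1)[OF vs_A lin_id one_A] vs_A vs_sym] by (simp add: r_def)
  let ?q = "\<lambda>a x b y. tens K ?I X (r (symprod K A [a, b])) (h (wedge K L [x, y]))"
  have hs: "h (wedge K L [y, x]) = \<ominus>\<^bsub>X\<^esub> h (wedge K L [x, y])" if "x \<in> carrier L" "y \<in> carrier L" for x y
    using wedge2_swap[OF vs_L that(2,1)] lin_neg[OF h vs_ext X, of "wedge K L [x, y]"] that by simp
  obtain k where k: "lin G2 ?T k"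
    "\<And>a x b y. a \<in> carrier A \<Longrightarrow> x \<in> carrier L \<Longrightarrow> b \<in> carrier A \<Longrightarrow> y \<in> carrier L \<Longrightarrow>
      k (wedge K AL [ten a x, ten b y]) = half \<odot>\<^bsub>?T\<^esub> ?q a x b y"
  proof (rule current_lift[OF vs_tensor, of ?I X "\<lambda>a x b y. half \<odot>\<^bsub>?T\<^esub> ?q a x b y"])
    show "bilin A L ?T (\<lambda>a x. half \<odot>\<^bsub>?T\<^esub> ?q a x b y)" if "b \<in> carrier A" "y \<in> carrier L" for b y
      using that by (intro bilinI lin_half lin_tens lin_comp[OF r] lin_comp[OF h] lin_symprod2 lin_wedge2 lin_id vs_A vs_L vs_tensor vs_I_alg X) simp_all
    fix a x b y assume [simp]: "a \<in> carrier A" "x \<in> carrier L" "b \<in> carrier A" "y \<in> carrier L"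
    show "half \<odot>\<^bsub>?T\<^esub> ?q a x b y = \<ominus>\<^bsub>?T\<^esub> (half \<odot>\<^bsub>?T\<^esub> ?q b y a x)"
      using symprod2_comm[of b A a] by (simp add: hs[of x y] tens_neg vs_smult_neg)
  qed blast
  obtain g where g: "lin Q ?T g" "\<And>z. z \<in> carrier G2 \<Longrightarrow> g (cls z) = k z"
  proof (rule Q_lift[OF vs_tensor k(1)])
    fix a x b y c z assume [simp]: "a \<in> carrier A" "x \<in> carrier L" "b \<in> carrier A" "y \<in> carrier L" "c \<in> carrier A" "z \<in> carrier L"
    show "k (ce_diff K AL 3 (wedge K AL [ten a x, ten b y, ten c z])) = \<zero>\<^bsub>?T\<^esub>"
      by (simp add: ce_diff_3(2)[OF alt_AL] tensor_bracket(2) lin_add[OF k(1)] lin_minus[OF k(1)] k(2) h0 tens_zero)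
  qed blast
  show thesis
  proof (rule that[OF g(1)])
    fix t s assume ts: "t \<in> carrier (ext_power K A 2)" "s \<in> carrier (sym_power K L 2)"
    show "g (I2 t s) = \<zero>\<^bsub>?T\<^esub>"
    proof (rule I2_eqI[OF vs_tensor _ _ _ ts])
      show "bilin (ext_power K A 2) (sym_power K L 2) ?T (\<lambda>t s. g (I2 t s))"
        by (intro bilinI lin_comp[OF g(1)] bilin_left[OF I2(1)] bilin_right[OF I2(1)])
      show "bilin (ext_power K A 2) (sym_power K L 2) ?T (\<lambda>t s. \<zero>\<^bsub>?T\<^esub>)"
        by (intro bilinI lin_const_zero vs_tensor)
      fix a b x y assume [simp]: "a \<in> carrier A" "b \<in> carrier A" "x \<in> carrier L" "y \<in> carrier L"
      show "g (I2 (wedge K A [a, b]) (symprod K L [x, y])) = \<zero>\<^bsub>?T\<^esub>"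
        using symprod2_comm[of b A a] by (simp add: I2(2) lin_minus[OF g(1)] g(2) k(2))
    qed
  next
    fix i w assume iw: "i \<in> mult_kernel" "w \<in> carrier LL"
    have i: "i \<in> carrier ?S" using iw(1) by simp
    have "g (I1 i w) = tens K ?I X (r i) (h w)"
    proof (rule I1_eqI[OF vs_tensor _ _ _ i iw(2)])
      show "bilin (sym_power K A 2) LL ?T (\<lambda>s w. g (I1 s w))"
        by (intro bilinI lin_comp[OF g(1)] bilin_left[OF I1(1)] bilin_right[OF I1(1)])
      show "bilin (sym_power K A 2) LL ?T (\<lambda>s w. tens K ?I X (r s) (h w))"
        by (intro bilinI lin_tens vs_I_alg X r h rc hc)
      fix a b x y assume [simp]: "a \<in> carrier A" "b \<in> carrier A" "x \<in> carrier L" "y \<in> carrier L"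
      show "g (I1 (symprod K A [a, b]) (wedge K L [x, y])) = tens K ?I X (r (symprod K A [a, b])) (h (wedge K L [x, y]))"
        using symprod2_comm[of b A a] by (simp add: I1(2) lin_add[OF g(1)] g(2) k(2))
    qed
    then show "g (I1 i w) = tens K ?I X i (h w)" using r1[OF iw(1)] by simp
  qed
qed

lemma exact_sequence:
  assumes hyp: "\<And>h. h \<in> homology_degree K L B D 3 \<beta> \<Longrightarrow> reduced_koszul K L h = \<zero>\<^bsub>Kill K L\<^esub>"
  shows "\<exists>f g. short_exact K (tensor K (T0_image K A) H1S) (natural_kernel K A L B D \<beta>)
    (direct_sum (tensor K (HH1 K A) KillD) (tensor K (I_alg K A) H1E)) f g"
proof -
  let ?EA = "ext_power K A 2" and ?SL = "sym_power K L 2"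
  let ?U = "tensor K (T0_image K A) H1S" and ?W = "tensor K (HH1 K A) KillD" and ?W' = "tensor K (I_alg K A) H1E"
  let ?N = "span Q kernel_gens"
  define hh where "hh v = T0_range +>\<^bsub>?EA\<^esub> v" for v
  have hh: "lin ?EA (HH1 K A) hh"
    unfolding HH1_def hh_def by (rule lin_coset[OF vs_ext sub_T0_range])
  have hh0: "hh v = \<zero>\<^bsub>HH1 K A\<^esub> \<longleftrightarrow> v \<in> T0_range" if "v \<in> carrier ?EA" for v
    unfolding HH1_def hh_def by (rule coset_eq_zero_iff[OF vs_ext sub_T0_range that])
  have hh_surj: "carrier (HH1 K A) \<subseteq> hh ` carrier ?EA"
    unfolding HH1_def hh_def by (simp add: quot_carrier)
  obtain s1 where s1: "lin (HH1 K A) ?EA s1" "\<And>u. u \<in> carrier (HH1 K A) \<Longrightarrow> hh (s1 u) = u"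
    by (rule section_exists[OF vs_ext vs_HH1 hh hh_surj]) blast
  obtain s2 where s2: "lin (Kill K L) ?SL s2" "\<And>u. u \<in> carrier (Kill K L) \<Longrightarrow> kill_class K L (s2 u) = u"
    by (rule section_exists[OF vs_sym vs_Kill lin_kill_class kill_class_surj]) blast
  obtain s where s: "lin H1 L s" "\<And>h. h \<in> carrier H1 \<Longrightarrow> c1 (s h) = h"
    "\<And>x. x \<in> carrier L \<Longrightarrow> s (c1 x) \<ominus>\<^bsub>L\<^esub> x \<in> derived"
    by (rule H1_section) blast
  have sc [simp]: "s h \<in> carrier L" if "h \<in> carrier H1" for h by (rule lin_closed[OF s(1) that])

  \<comment> \<open>\<open>Sc\<close> and \<open>Ec\<close> are induced by the projection L
    \<rightarrow> H_1 on symmetric and exterior squares, \<open>Ss\<close> and \<open>Es\<close> by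
    the section \<open>s\<close> of it; so the latter are sections of the former.\<close>
  have "bilin L L (sym_power K H1 2) (\<lambda>x y. symprod K H1 [c1 x, c1 y])"
    by (intro bilinI lin_intros) simp_all
  from sym2_lift[OF vs_L vs_sym this] obtain Sc where Sc: "lin ?SL (sym_power K H1 2) Sc"
    "\<And>x y. x \<in> carrier L \<Longrightarrow> y \<in> carrier L \<Longrightarrow> Sc (symprod K L [x, y]) = symprod K H1 [c1 x, c1 y]"
    using symprod2_comm c1_closed by metis
  have "bilin L L (ext_power K H1 2) (\<lambda>x y. wedge K H1 [c1 x, c1 y])"
    by (intro bilinI lin_intros) simp_all
  from ext2_lift[OF vs_L vs_ext this] obtain Ec where Ec: "lin LL (ext_power K H1 2) Ec"
    "\<And>x y. x \<in> carrier L \<Longrightarrow> y \<in> carrier L \<Longrightarrow> Ec (wedge K L [x, y]) = wedge K H1 [c1 x, c1 y]"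
    using wedge2_self c1_closed by metis
  have "bilin H1 H1 ?SL (\<lambda>x y. symprod K L [s x, s y])"
    by (intro bilinI lin_symprod2 vs_L s(1)) simp_all
  from sym2_lift[OF vs_H1 vs_sym this] obtain Ss where Ss: "lin (sym_power K H1 2) ?SL Ss"
    "\<And>x y. x \<in> carrier H1 \<Longrightarrow> y \<in> carrier H1 \<Longrightarrow> Ss (symprod K H1 [x, y]) = symprod K L [s x, s y]"
    using symprod2_comm sc by metis
  have "bilin H1 H1 LL (\<lambda>x y. wedge K L [s x, s y])"
    by (intro bilinI lin_wedge2 vs_L s(1)) simp_all
  from ext2_lift[OF vs_H1 vs_ext this] obtain Es where Es: "lin (ext_power K H1 2) LL Es"
    "\<And>x y. x \<in> carrier H1 \<Longrightarrow> y \<in> carrier H1 \<Longrightarrow> Es (wedge K H1 [x, y]) = wedge K L [s x, s y]"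
    using wedge2_self sc by metis
  have ScSs: "Sc (Ss w) = w" if "w \<in> carrier (sym_power K H1 2)" for w
    by (rule lin_eq[OF spans_sym2[OF vs_H1 spans_carrier] lin_comp[OF Sc(1) Ss(1)] lin_id vs_sym vs_sym _ that])
      (auto simp: Sc(2) Ss(2) s(2))
  have EcEs: "Ec (Es w) = w" if "w \<in> carrier (ext_power K H1 2)" for w
    by (rule lin_eq[OF spans_ext2[OF vs_H1 spans_carrier] lin_comp[OF Ec(1) Es(1)] lin_id vs_ext vs_ext _ that])
      (auto simp: Ec(2) Es(2) s(2))

  have subS: "sub (carrier H1S) (sym_power K H1 2)" "sub (carrier H1E) (ext_power K H1 2)"
    using H1S_gens H1E_gens by (simp_all add: H1S_eq H1E_eq)
  \<comment> \<open>For the two squares of H_1 any linear retraction onto the part of degree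
    \<open>\<beta>\<close> serves. For Kill(L) the homogeneous projection is taken, because
    \<open>koszul_projection_cycle\<close> asks that the other degrees be killed.\<close>
  obtain \<rho>3 where \<rho>3: "lin (sym_power K H1 2) H1S \<rho>3" "\<And>x. x \<in> carrier H1S \<Longrightarrow> \<rho>3 x = x"
    using retraction_exists[OF vs_sym subS(1)] by auto
  obtain \<rho>2 where \<rho>2: "lin (ext_power K H1 2) H1E \<rho>2" "\<And>x. x \<in> carrier H1E \<Longrightarrow> \<rho>2 x = x"
    using retraction_exists[OF vs_ext subS(2)] by auto
  obtain \<rho> where \<rho>: "lin (Kill K L) KillD \<rho>"
    "\<And>\<gamma> \<delta> x y. \<gamma> \<in> carrier B \<Longrightarrow> \<delta> \<in> carrier B \<Longrightarrow> x \<in> D \<gamma> \<Longrightarrow> y \<in> D \<delta> \<Longrightarrow>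
      \<rho> (kill_class K L (symprod K L [x, y])) =
        (if \<gamma> \<otimes>\<^bsub>B\<^esub> \<delta> = \<beta> then kill_class K L (symprod K L [x, y]) else \<zero>\<^bsub>Kill K L\<^esub>)"
    by (rule Kill_projection) blast
  have \<rho>h: "\<rho> (kill_class K L (symprod K L [x, y])) = kill_class K L (symprod K L [x, y])" if "hpair x y" for x y
    using that \<rho>(2) by (auto simp: hpair_def)
  have KD: "lin KillD (Kill K L) (\<lambda>x. x)"
    by (rule lin_restrict_dom[OF lin_id vs_Kill sub_Kill_degree])
  have \<rho>id: "\<rho> k = k" if "k \<in> carrier KillD" for k
    by (rule lin_eq[OF spans_targets(3) lin_comp[OF \<rho>(1) KD] lin_id vs_targets(3) vs_targets(3) _ that])
      (use \<rho>h in auto)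
  \<comment> \<open>The composite with \<open>\<rho>\<close> vanishes on cycles of every degree, so
    that it factors through the differential on the whole of the third exterior power.\<close>
  obtain \<theta> where \<theta>: "lin LL KillD \<theta>"
    "\<And>z. z \<in> carrier (ext_power K L 3) \<Longrightarrow> \<theta> (ce_diff K L 3 z) = \<rho> (koszul K L z)"
  proof (rule factor_exists[OF vs_ext vs_ext vs_targets(3) ce_diff_3(1)[OF alt_L] lin_comp[OF \<rho>(1) koszul(1)]])
    fix z assume "z \<in> carrier (ext_power K L 3)" "ce_diff K L 3 z = \<zero>\<^bsub>LL\<^esub>"
    then have "z \<in> ce_cycles K L 3" by (simp add: cycles_iff)
    then show "\<rho> (koszul K L z) = \<zero>\<^bsub>KillD\<^esub>"
      by (rule koszul_projection_cycle[OF hyp \<rho>(1) vs_targets(3), rotated 2]) (use \<rho>(2) in auto)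
  qed blast
  let ?h = "\<lambda>x. \<rho> (kill_class K L x)"
  have h: "lin ?SL KillD ?h" by (rule lin_comp[OF \<rho>(1) lin_kill_class])
  obtain G1 where G1: "lin Q ?W G1"
    "\<And>t x. t \<in> carrier ?EA \<Longrightarrow> x \<in> carrier ?SL \<Longrightarrow> G1 (I2 t x) = tens K (HH1 K A) KillD (hh t) (?h x)"
    "\<And>i w. i \<in> carrier (sym_power K A 2) \<Longrightarrow> w \<in> carrier LL \<Longrightarrow>
      G1 (I1 i w) = \<ominus>\<^bsub>?W\<^esub> tens K (HH1 K A) KillD (hh (wedge K A [sym_mult K A i, \<one>\<^bsub>A\<^esub>])) (\<theta> w)"
  proof (rule skew_lift[OF vs_HH1 vs_targets(3) hh h \<theta>(1)])
    fix a b c x y z assume [simp]: "a \<in> carrier A" "b \<in> carrier A" "c \<in> carrier A" "x \<in> carrier L" "y \<in> carrier L" "z \<in> carrier L"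
    let ?o = "?h (symprod K L [x, bracket L y z])"
    have oc: "?o \<in> carrier KillD" by (rule lin_closed[OF h]) simp
    \<comment> \<open>By invariance and symmetry the three second factors agree, and they agree with
      the Koszul value. The condition of \<open>skew_lift\<close> becomes an identity between first
      factors, namely the vanishing of T_0(a \<otimes> b \<otimes> c) in HH_1(A).\<close>
    have o: "?h (symprod K L [bracket L x y, z]) = ?o" "?h (symprod K L [bracket L y z, x]) = ?o"
      "?h (symprod K L [bracket L z x, y]) = ?o"
      using kill_class_invariant[of x y z] symprod2_comm[of x L "bracket L y z"] kill_class_invariant[of y z x]
        symprod2_comm[of y L "bracket L z x"] by simp_all
    have w: "\<theta> (ce_diff K L 3 (wedge K L [x, y, z])) = ?o" by (simp add: \<theta>(2) koszul(2))
    have hc: "hh (wedge K A [u, v]) \<in> carrier (HH1 K A)" if "u \<in> carrier A" "v \<in> carrier A" for u v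
      using that by (intro lin_closed[OF hh]) simp
    note l = bilin_left[OF bilin_tens[OF vs_HH1 vs_targets(3)] oc]
    have "hh (T0 K A (pure_tensor K A [a, b, c])) = \<zero>\<^bsub>HH1 K A\<^esub>"
      using lin_closed[OF T0(1)] by (subst hh0) auto
    then have "hh (wedge K A [a \<otimes>\<^bsub>A\<^esub> b, c]) \<oplus>\<^bsub>HH1 K A\<^esub> hh (wedge K A [b \<otimes>\<^bsub>A\<^esub> c, a]) \<oplus>\<^bsub>HH1 K A\<^esub>
      hh (wedge K A [c \<otimes>\<^bsub>A\<^esub> a, b]) = hh (wedge K A [a \<otimes>\<^bsub>A\<^esub> b \<otimes>\<^bsub>A\<^esub> c, \<one>\<^bsub>A\<^esub>])"
      by (simp add: T0(2) lin_minus[OF hh] lin_add[OF hh] hc vs_minus_eq_zero_iff)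
    then show "tens K (HH1 K A) KillD (hh (wedge K A [a \<otimes>\<^bsub>A\<^esub> b, c])) (?h (symprod K L [bracket L x y, z])) \<oplus>\<^bsub>?W\<^esub>
      tens K (HH1 K A) KillD (hh (wedge K A [b \<otimes>\<^bsub>A\<^esub> c, a])) (?h (symprod K L [bracket L y z, x])) \<oplus>\<^bsub>?W\<^esub>
      tens K (HH1 K A) KillD (hh (wedge K A [c \<otimes>\<^bsub>A\<^esub> a, b])) (?h (symprod K L [bracket L z x, y])) =
      tens K (HH1 K A) KillD (hh (wedge K A [a \<otimes>\<^bsub>A\<^esub> b \<otimes>\<^bsub>A\<^esub> c, \<one>\<^bsub>A\<^esub>])) (\<theta> (ce_diff K L 3 (wedge K L [x, y, z])))"
      unfolding o w by (simp add: hc flip: lin_add[OF l])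
  qed blast
  \<comment> \<open>The projection of \<Lambda>^2 A onto the image of T_0, complementary to the
    section \<open>s1\<close>.\<close>
  let ?r = "\<lambda>v. v \<ominus>\<^bsub>?EA\<^esub> s1 (hh v)"
  have s1h: "lin ?EA ?EA (\<lambda>v. s1 (hh v))" by (rule lin_comp[OF s1(1) hh])
  have rE: "lin ?EA ?EA ?r" by (intro lin_diff vs_ext lin_id s1h)
  have rT: "?r v \<in> T0_range" if v: "v \<in> carrier ?EA" for v
  proof -
    have "hh (?r v) = \<zero>\<^bsub>HH1 K A\<^esub>"
      using lin_minus[OF hh vs_ext vs_HH1 v lin_closed[OF s1h v]] s1(2) lin_closed[OF hh v] by simp
    then show ?thesis using hh0 lin_closed[OF rE v] by simp
  qed
  have r: "lin ?EA (T0_image K A) ?r" unfolding T0_image_def by (rule lin_into_restrict[OF rE rT])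
  have hhT: "hh v = \<zero>\<^bsub>HH1 K A\<^esub>" if "v \<in> T0_range" for v
    using hh0[OF sub_closed(1)[OF sub_T0_range vs_ext that]] that by blast
  have rid: "?r v = v" if "v \<in> T0_range" for v
  proof -
    have v: "v \<in> carrier ?EA" by (rule sub_closed(1)[OF sub_T0_range vs_ext that])
    then show ?thesis using hhT[OF that] lin_zero[OF s1(1) vs_HH1 vs_ext] by simp
  qed
  have T0c: "carrier (T0_image K A) = T0_range" by (simp add: T0_image_def)
  let ?h3 = "\<lambda>x. \<rho>3 (Sc x)"
  have h3: "lin ?SL H1S ?h3" by (rule lin_comp[OF \<rho>3(1) Sc(1)])
  have S0: "?h3 (symprod K L [bracket L x y, z]) = \<zero>\<^bsub>H1S\<^esub>" if "x \<in> carrier L" "y \<in> carrier L" "z \<in> carrier L" for x y z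
    using that lin_zero[OF lin_symprod2(1)[OF vs_H1 lin_id], of "c1 z"] lin_zero[OF \<rho>3(1)] by (simp add: Sc(2) c1_bracket)
  have t0S: "tens K (T0_image K A) H1S v \<zero>\<^bsub>sym_power K H1 2\<^esub> = \<zero>\<^bsub>?U\<^esub>" if "v \<in> carrier (T0_image K A)" for v
    using tens_zero(2)[OF vs_T0_image vs_targets(1) that] by simp
  \<comment> \<open>Brackets vanish in H_1, so both sides of the condition are zero when
    \<open>\<theta>\<close> is taken to be the zero map.\<close>
  obtain R where R: "lin Q ?U R"
    "\<And>t x. t \<in> carrier ?EA \<Longrightarrow> x \<in> carrier ?SL \<Longrightarrow> R (I2 t x) = tens K (T0_image K A) H1S (?r t) (?h3 x)"
    "\<And>i w. i \<in> carrier (sym_power K A 2) \<Longrightarrow> w \<in> carrier LL \<Longrightarrow>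
      R (I1 i w) = \<ominus>\<^bsub>?U\<^esub> tens K (T0_image K A) H1S (?r (wedge K A [sym_mult K A i, \<one>\<^bsub>A\<^esub>])) \<zero>\<^bsub>H1S\<^esub>"
    by (rule skew_lift[OF vs_T0_image vs_targets(1) r h3 lin_const_zero[OF vs_targets(1), of LL]])
      (simp_all add: S0 t0S lin_closed[OF r])
  let ?h2 = "\<lambda>x. \<rho>2 (Ec x)"
  have h2: "lin LL H1E ?h2" by (rule lin_comp[OF \<rho>2(1) Ec(1)])
  have E0: "?h2 (wedge K L [bracket L x y, z]) = \<zero>\<^bsub>H1E\<^esub>" if "x \<in> carrier L" "y \<in> carrier L" "z \<in> carrier L" for x y z
    using that lin_zero[OF lin_wedge2(1)[OF vs_H1 lin_id], of "c1 z"] lin_zero[OF \<rho>2(1)] by (simp add: Ec(2) c1_bracket)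
  obtain G2' where G2': "lin Q ?W' G2'"
    "\<And>t x. t \<in> carrier ?EA \<Longrightarrow> x \<in> carrier ?SL \<Longrightarrow> G2' (I2 t x) = \<zero>\<^bsub>?W'\<^esub>"
    "\<And>i w. i \<in> mult_kernel \<Longrightarrow> w \<in> carrier LL \<Longrightarrow> G2' (I1 i w) = tens K (I_alg K A) H1E i (?h2 w)"
    by (rule symmetric_lift[OF vs_targets(2) h2 E0]) blast+
  \<comment> \<open>The correction term of \<open>I1 i w\<close> has the factor \<mu>(i) \<and> 1,
    which is zero for \<open>i\<close> in the kernel of multiplication.\<close>
  have I1z: "G1 (I1 i w) = \<zero>\<^bsub>?W\<^esub>" "R (I1 i w) = \<zero>\<^bsub>?U\<^esub>" if "i \<in> mult_kernel" "w \<in> carrier LL" for i w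
  proof -
    have i: "i \<in> carrier (sym_power K A 2)" "sym_mult K A i = \<zero>\<^bsub>A\<^esub>" using that(1) by auto
    have w0: "wedge K A [\<zero>\<^bsub>A\<^esub>, \<one>\<^bsub>A\<^esub>] = \<zero>\<^bsub>?EA\<^esub>"
      by (rule lin_zero[OF lin_wedge2(1)[OF vs_A lin_id one_A] vs_A vs_ext])
    show "G1 (I1 i w) = \<zero>\<^bsub>?W\<^esub>"
      using G1(3)[OF i(1) that(2)] i(2) lin_zero[OF hh vs_ext vs_HH1] lin_closed[OF \<theta>(1) that(2)]
      by (simp add: w0 tens_zero)
    show "R (I1 i w) = \<zero>\<^bsub>?U\<^esub>"
      using R(3)[OF i(1) that(2)] i(2) lin_closed[OF r, of "\<zero>\<^bsub>?EA\<^esub>"] by (simp add: w0 t0S)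
  qed

  have SsL: "lin H1S ?SL Ss" by (rule lin_restrict_dom[OF Ss(1) vs_sym subS(1)[simplified]])
  have EsL: "lin H1E LL Es" by (rule lin_restrict_dom[OF Es(1) vs_ext subS(2)[simplified]])
  have s2L: "lin KillD ?SL s2" by (rule lin_restrict_dom[OF s2(1) vs_Kill sub_Kill_degree])
  have TE: "lin (T0_image K A) ?EA (\<lambda>x. x)"
    unfolding T0_image_def by (rule lin_restrict_dom[OF lin_id vs_ext sub_T0_range])
  have IS: "lin (I_alg K A) (sym_power K A 2) (\<lambda>x. x)"
    unfolding I_alg_eq by (rule lin_restrict_dom[OF lin_id vs_sym sub_mult_kernel])
  have Ic: "carrier (I_alg K A) = mult_kernel" by (simp add: I_alg_eq)
  have fb: "bilin (T0_image K A) H1S Q (\<lambda>t x. I2 t (Ss x))"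
    by (intro bilinI lin_comp[OF bilin_left[OF I2(1)] TE] lin_comp[OF bilin_right[OF I2(1)] SsL])
      (auto intro: lin_closed[OF SsL] lin_closed[OF TE])
  have eb: "bilin (HH1 K A) KillD Q (\<lambda>u k. I2 (s1 u) (s2 k))"
    by (intro bilinI lin_comp[OF bilin_left[OF I2(1)] s1(1)] lin_comp[OF bilin_right[OF I2(1)] s2L])
      (auto intro: lin_closed[OF s2L] lin_closed[OF s1(1)])
  have eb': "bilin (I_alg K A) H1E Q (\<lambda>i w. I1 i (Es w))"
    by (intro bilinI lin_comp[OF bilin_left[OF I1(1)] IS] lin_comp[OF bilin_right[OF I1(1)] EsL])
      (auto intro: lin_closed[OF EsL] lin_closed[OF IS])
  obtain f where f: "lin ?U Q f"
    "\<And>t x. t \<in> carrier (T0_image K A) \<Longrightarrow> x \<in> carrier H1S \<Longrightarrow> f (tens K (T0_image K A) H1S t x) = I2 t (Ss x)"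
    using tensor_lift[OF vs_T0_image vs_targets(1) vs_Q fb] by metis
  obtain e where e: "lin ?W Q e"
    "\<And>u k. u \<in> carrier (HH1 K A) \<Longrightarrow> k \<in> carrier KillD \<Longrightarrow> e (tens K (HH1 K A) KillD u k) = I2 (s1 u) (s2 k)"
    using tensor_lift[OF vs_HH1 vs_targets(3) vs_Q eb] by metis
  obtain e' where e': "lin ?W' Q e'"
    "\<And>i w. i \<in> carrier (I_alg K A) \<Longrightarrow> w \<in> carrier H1E \<Longrightarrow> e' (tens K (I_alg K A) H1E i w) = I1 i (Es w)"
    using tensor_lift[OF vs_I_alg vs_targets(2) vs_Q eb'] by metis

  have subN: "sub ?N Q" by (rule sub_span[OF vs_Q kernel_gens_subset])
  have I2N: "I2 t (symprod K L [x, y]) \<in> ?N" if t: "t \<in> carrier ?EA" and xy: "hpair x y" for t x y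
  proof -
    note [simp] = hpair_closed[OF xy]
    show ?thesis
    proof (rule lin_span[OF bilin_left[OF I2(1)] vs_ext vs_Q spans_subset[OF spans_ext2[OF vs_A spans_carrier]] subN _
          spansD[OF spans_ext2[OF vs_A spans_carrier] t]])
      fix v assume "v \<in> {wedge K A [s, t] |s t. s \<in> carrier A \<and> t \<in> carrier A}"
      then obtain a b where v: "v = wedge K A [a, b]" and [simp]: "a \<in> carrier A" "b \<in> carrier A" by blast
      have "cls (skew_part a b x y) \<in> kernel_gens" by (intro UnI1 CollectI exI[of _ a] exI[of _ b] exI[of _ x] exI[of _ y]) (simp add: xy)
      then have g: "cls (skew_part a b x y) \<in> ?N" by (rule span_base)
      have "I2 v (symprod K L [x, y]) = cls (skew_part a b x y)"
        by (simp add: v I2(2) lin_minus[OF lin_cls])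
      also note g
      finally show "I2 v (symprod K L [x, y]) \<in> ?N" .
    qed simp
  qed
  have symI: "I1 (symprod K A [a, b] \<ominus>\<^bsub>sym_power K A 2\<^esub> symprod K A [a \<otimes>\<^bsub>A\<^esub> b, \<one>\<^bsub>A\<^esub>]) (wedge K L [x, y]) = cls (sym_part a b x y)"
    if [simp]: "a \<in> carrier A" "b \<in> carrier A" "x \<in> carrier L" "y \<in> carrier L" for a b x y
    by (simp add: lin_minus[OF bilin_left[OF I1(1)]] I1(2) lin_minus[OF lin_cls] lin_add[OF lin_cls])
  have I1N: "I1 i (wedge K L [x, y]) \<in> ?N" if i: "i \<in> mult_kernel" and xy: "hpair x y" for i x y
  proof -
    note [simp] = hpair_closed[OF xy]
    have i': "i \<in> carrier (sym_power K A 2)" using i by simp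
    have wl: "wedge K L [x, y] \<in> carrier LL" by simp
    \<comment> \<open>The subtracted term is zero for the given \<open>i\<close>; with it the claim
      is linear on all of S^2 A and can be tested on a \<odot> b, where it gives a symmetric
      generator.\<close>
    have "I1 (i \<ominus>\<^bsub>sym_power K A 2\<^esub> symprod K A [sym_mult K A i, \<one>\<^bsub>A\<^esub>]) (wedge K L [x, y]) \<in> ?N"
    proof (rule lin_span[OF lin_comp[OF bilin_left[OF I1(1) wl] lin_diff[OF vs_sym lin_id lin_mult_unit]] vs_sym vs_Q
          spans_subset[OF spans_sym2[OF vs_A spans_carrier]] subN _ spansD[OF spans_sym2[OF vs_A spans_carrier] i']])
      fix v assume "v \<in> {symprod K A [s, t] |s t. s \<in> carrier A \<and> t \<in> carrier A}"
      then obtain a b where v: "v = symprod K A [a, b]" and [simp]: "a \<in> carrier A" "b \<in> carrier A" by blast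
      have "cls (sym_part a b x y) \<in> kernel_gens" by (intro UnI2 CollectI exI[of _ a] exI[of _ b] exI[of _ x] exI[of _ y]) (simp add: xy)
      then have "cls (sym_part a b x y) \<in> ?N" by (rule span_base)
      then show "I1 (v \<ominus>\<^bsub>sym_power K A 2\<^esub> symprod K A [sym_mult K A v, \<one>\<^bsub>A\<^esub>]) (wedge K L [x, y]) \<in> ?N"
        by (simp add: v sym_mult(2) symI)
    qed
    moreover have "symprod K A [sym_mult K A i, \<one>\<^bsub>A\<^esub>] = \<zero>\<^bsub>sym_power K A 2\<^esub>"
      using i lin_zero[OF lin_symprod2(1)[OF vs_A lin_id one_A] vs_A vs_sym] by simp
    ultimately show ?thesis using i' by simp
  qed
  \<comment> \<open>\<open>s\<close> recovers x and y only modulo [L, L]; for \<open>t\<close> in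
    the image of T_0 this does not change the class.\<close>
  have fgen: "I2 t (Ss (symprod K H1 [c1 x, c1 y])) = I2 t (symprod K L [x, y])" if t: "t \<in> T0_range" and xy: "hpair x y" for t x y
    using hpair_closed[OF xy] by (simp add: Ss(2) I2_section[OF t _ _ _ _ s(3) s(3)])
  \<comment> \<open>\<open>s2\<close> recovers an element only up to Killing relations, on which
    \<open>I2\<close> vanishes.\<close>
  have egen: "I2 u (s2 (kill_class K L x)) = I2 u x" if u: "u \<in> carrier ?EA" and x: "x \<in> carrier ?SL" for u x
  proof -
    have sx: "s2 (kill_class K L x) \<in> carrier ?SL" by (rule lin_closed[OF s2(1)]) (simp add: x)
    have "kill_class K L (s2 (kill_class K L x) \<ominus>\<^bsub>?SL\<^esub> x) = \<zero>\<^bsub>Kill K L\<^esub>"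
      using lin_minus[OF lin_kill_class vs_sym vs_Kill sx x] s2(2) x by simp
    then have "s2 (kill_class K L x) \<ominus>\<^bsub>?SL\<^esub> x \<in> kill_rels" using kill_class_eq_zero_iff sx x by simp
    from I2_kill_rels[OF u this] show ?thesis
      using lin_minus[OF bilin_right[OF I2(1) u] vs_sym vs_Q sx x] bilin_closed[OF I2(1) u] sx x
      by (simp add: vs_minus_eq_zero_iff)
  qed
  have egen': "I1 i (Es (wedge K H1 [c1 x, c1 y])) = I1 i (wedge K L [x, y])" if i: "i \<in> mult_kernel" and xy: "hpair x y" for i x y
    using hpair_closed[OF xy] by (simp add: Es(2) I1_section[OF i _ _ _ _ s(3) s(3)])

  have H1Sc: "x \<in> carrier (sym_power K H1 2)" if "x \<in> carrier H1S" for x by (rule sub_closed(1)[OF subS(1) vs_sym that])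
  have H1Ec: "x \<in> carrier (ext_power K H1 2)" if "x \<in> carrier H1E" for x by (rule sub_closed(1)[OF subS(2) vs_ext that])
  have Kc: "k \<in> carrier (Kill K L)" if "k \<in> carrier KillD" for k using lin_closed[OF KD that] .
  have TEc: "t \<in> carrier ?EA" if "t \<in> carrier (T0_image K A)" for t using lin_closed[OF TE that] .

  have fN: "f (tens K (T0_image K A) H1S u w) \<in> ?N" if u: "u \<in> carrier (T0_image K A)" and w: "w \<in> {symprod K H1 [c1 x, c1 y] |x y. hpair x y}" for u w
  proof -
    obtain x y where xy: "hpair x y" and w': "w = symprod K H1 [c1 x, c1 y]" using w by blast
    have "w \<in> carrier H1S" using spans_subset[OF spans_targets(1)] w by blast
    then have "f (tens K (T0_image K A) H1S u w) = I2 u (symprod K L [x, y])" using f(2)[OF u] fgen[OF _ xy] u by (simp add: w' T0c)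
    also have "\<dots> \<in> ?N" by (rule I2N[OF TEc[OF u] xy])
    finally show ?thesis .
  qed
  have eN: "e (tens K (HH1 K A) KillD u w) \<in> ?N" if u: "u \<in> carrier (HH1 K A)" and w: "w \<in> {kill_class K L (symprod K L [x, y]) |x y. hpair x y}" for u w
  proof -
    obtain x y where xy: "hpair x y" and w': "w = kill_class K L (symprod K L [x, y])" using w by blast
    have "w \<in> carrier KillD" using spans_subset[OF spans_targets(3)] w by blast
    then have "e (tens K (HH1 K A) KillD u w) = I2 (s1 u) (symprod K L [x, y])"
      using e(2)[OF u] egen[OF lin_closed[OF s1(1) u]] hpair_closed[OF xy] by (simp add: w')
    also have "\<dots> \<in> ?N" by (rule I2N[OF lin_closed[OF s1(1) u] xy])
    finally show ?thesis .
  qed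
  have eN': "e' (tens K (I_alg K A) H1E u w) \<in> ?N" if u: "u \<in> carrier (I_alg K A)" and w: "w \<in> {wedge K H1 [c1 x, c1 y] |x y. hpair x y}" for u w
  proof -
    obtain x y where xy: "hpair x y" and w': "w = wedge K H1 [c1 x, c1 y]" using w by blast
    have "w \<in> carrier H1E" using spans_subset[OF spans_targets(2)] w by blast
    then have "e' (tens K (I_alg K A) H1E u w) = I1 u (wedge K L [x, y])" using e'(2)[OF u] egen'[OF _ xy] u by (simp add: w' Ic)
    also have "\<dots> \<in> ?N" by (rule I1N[OF u[unfolded Ic] xy])
    finally show ?thesis .
  qed
  have "\<exists>f g. short_exact K ?U (restrict_to Q ?N) (direct_sum ?W ?W') f g"
  proof (rule short_exact_split[OF vs_Q vs_tensor vs_tensor vs_tensor kernel_gens_subset f(1) _ e(1) _ e'(1) _ R(1) G1(1) G2'(1)])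
    fix u assume u: "u \<in> carrier ?U"
    show "f u \<in> ?N"
      by (rule lin_span[OF f(1) vs_tensor vs_Q spans_subset[OF spans_tensor[OF vs_T0_image vs_targets(1) spans_carrier spans_targets(1)]]
            subN _ spansD[OF spans_tensor[OF vs_T0_image vs_targets(1) spans_carrier spans_targets(1)] u]])
        (use fN in blast)
    show "R (f u) = u"
      by (rule lin_tensor_eq[OF vs_T0_image vs_targets(1) vs_tensor spans_carrier spans_carrier lin_comp[OF R(1) f(1)] lin_id _ u])
        (simp add: f(2) R(2) TEc lin_closed[OF SsL] ScSs H1Sc \<rho>3(2) rid T0c)
    show "G1 (f u) = \<zero>\<^bsub>?W\<^esub>"
      by (rule lin_tensor_eq[OF vs_T0_image vs_targets(1) vs_tensor spans_carrier spans_carrier lin_comp[OF G1(1) f(1)] lin_const_zero[OF vs_tensor] _ u])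
        (use hh0 tens_zero(1)[OF vs_HH1 vs_targets(3) lin_closed[OF h]] in \<open>simp add: f(2) G1(2) TEc lin_closed[OF SsL] T0c hhT\<close>)
    show "G2' (f u) = \<zero>\<^bsub>?W'\<^esub>"
      by (rule lin_tensor_eq[OF vs_T0_image vs_targets(1) vs_tensor spans_carrier spans_carrier lin_comp[OF G2'(1) f(1)] lin_const_zero[OF vs_tensor] _ u])
        (simp add: f(2) G2'(2) TEc lin_closed[OF SsL])
  next
    fix w assume w: "w \<in> carrier ?W"
    show "e w \<in> ?N"
      by (rule lin_span[OF e(1) vs_tensor vs_Q spans_subset[OF spans_tensor[OF vs_HH1 vs_targets(3) spans_carrier spans_targets(3)]]
            subN _ spansD[OF spans_tensor[OF vs_HH1 vs_targets(3) spans_carrier spans_targets(3)] w]])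
        (use eN in blast)
    show "G1 (e w) = w"
      by (rule lin_tensor_eq[OF vs_HH1 vs_targets(3) vs_tensor spans_carrier spans_carrier lin_comp[OF G1(1) e(1)] lin_id _ w])
        (simp add: e(2) G1(2) lin_closed[OF s1(1)] lin_closed[OF s2L] s1(2) s2(2) Kc \<rho>id)
    show "G2' (e w) = \<zero>\<^bsub>?W'\<^esub>"
      by (rule lin_tensor_eq[OF vs_HH1 vs_targets(3) vs_tensor spans_carrier spans_carrier lin_comp[OF G2'(1) e(1)] lin_const_zero[OF vs_tensor] _ w])
        (simp add: e(2) G2'(2) lin_closed[OF s1(1)] lin_closed[OF s2L])
  next
    fix w assume w: "w \<in> carrier ?W'"
    show "e' w \<in> ?N"
      by (rule lin_span[OF e'(1) vs_tensor vs_Q spans_subset[OF spans_tensor[OF vs_I_alg vs_targets(2) spans_carrier spans_targets(2)]]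
            subN _ spansD[OF spans_tensor[OF vs_I_alg vs_targets(2) spans_carrier spans_targets(2)] w]])
        (use eN' in blast)
    show "G1 (e' w) = \<zero>\<^bsub>?W\<^esub>"
      by (rule lin_tensor_eq[OF vs_I_alg vs_targets(2) vs_tensor spans_carrier spans_carrier lin_comp[OF G1(1) e'(1)] lin_const_zero[OF vs_tensor] _ w])
        (simp add: e'(2) I1z lin_closed[OF EsL] Ic)
    show "G2' (e' w) = w"
      by (rule lin_tensor_eq[OF vs_I_alg vs_targets(2) vs_tensor spans_carrier spans_carrier lin_comp[OF G2'(1) e'(1)] lin_id _ w])
        (simp add: e'(2) G2'(3) lin_closed[OF EsL] Ic EcEs H1Ec \<rho>2(2))
  next
    fix h' assume "h' \<in> kernel_gens"
    then consider a b x y where "h' = cls (skew_part a b x y)" "a \<in> carrier A" "b \<in> carrier A" "hpair x y"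
      | a b x y where "h' = cls (sym_part a b x y)" "a \<in> carrier A" "b \<in> carrier A" "hpair x y" by blast
    then show "f (R h') \<oplus>\<^bsub>Q\<^esub> e (G1 h') \<oplus>\<^bsub>Q\<^esub> e' (G2' h') = h'"
    proof cases
      case 1
      note [simp] = 1(2,3) hpair_closed[OF 1(4)]
      let ?v = "wedge K A [a, b]" and ?x = "symprod K L [x, y]"
      have v: "?v \<in> carrier ?EA" and x: "?x \<in> carrier ?SL" by simp_all
      have h': "h' = I2 ?v ?x" by (simp add: 1(1) I2(2) lin_minus[OF lin_cls])
      have xS: "symprod K H1 [c1 x, c1 y] \<in> carrier H1S" using spans_subset[OF spans_targets(1)] 1(4) by blast
      have xK: "kill_class K L ?x \<in> carrier KillD" using spans_subset[OF spans_targets(3)] 1(4) by blast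
      \<comment> \<open>The skew generator splits along ?v = ?r ?v + s1 (hh ?v): the first summand
        comes back through \<open>f\<close> and \<open>R\<close>, the second through
        \<open>e\<close> and \<open>G1\<close>.\<close>
      have "f (R h') = I2 (?r ?v) ?x"
        unfolding h' R(2)[OF v x] using f(2)[OF lin_closed[OF r v] xS] fgen[OF rT[OF v] 1(4)]
        by (simp add: Sc(2) \<rho>3(2)[OF xS])
      moreover have "e (G1 h') = I2 (s1 (hh ?v)) ?x"
        unfolding h' G1(2)[OF v x] \<rho>h[OF 1(4)] using e(2)[OF lin_closed[OF hh v] xK] egen[OF lin_closed[OF s1h v] x] by simp
      moreover have "e' (G2' h') = \<zero>\<^bsub>Q\<^esub>"
        unfolding h' G2'(2)[OF v x] by (rule lin_zero[OF e'(1) vs_tensor vs_Q])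
      moreover have "I2 (?r ?v) ?x \<oplus>\<^bsub>Q\<^esub> I2 (s1 (hh ?v)) ?x = I2 ?v ?x"
        unfolding lin_minus[OF bilin_left[OF I2(1) x] vs_ext vs_Q v lin_closed[OF s1h v]]
        using bilin_closed[OF I2(1) v x] bilin_closed[OF I2(1) lin_closed[OF s1h v] x] by (simp add: a_minus_def vs_assoc)
      ultimately show ?thesis using bilin_closed[OF I2(1) v x] by (simp add: h')
    next
      case 2
      note [simp] = 2(2,3) hpair_closed[OF 2(4)]
      let ?i = "symprod K A [a, b] \<ominus>\<^bsub>sym_power K A 2\<^esub> symprod K A [a \<otimes>\<^bsub>A\<^esub> b, \<one>\<^bsub>A\<^esub>]" and ?w = "wedge K L [x, y]"
      have w: "?w \<in> carrier LL" by simp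
      have i: "?i \<in> mult_kernel" by (simp add: lin_minus[OF sym_mult(1)] sym_mult(2) mult_A_simps(2))
      have h': "h' = I1 ?i ?w" unfolding 2(1) by (rule symI[symmetric]) simp_all
      have wE: "wedge K H1 [c1 x, c1 y] \<in> carrier H1E" using spans_subset[OF spans_targets(2)] 2(4) by blast
      \<comment> \<open>A symmetric generator is recovered whole by \<open>e'\<close> and
        \<open>G2'\<close>; the other two composites vanish on it by \<open>I1z\<close>.\<close>
      have "e' (G2' h') = I1 ?i ?w"
        unfolding h' G2'(3)[OF i w] using e'(2)[OF i[folded Ic] wE] egen'[OF i 2(4)] by (simp add: Ec(2) \<rho>2(2)[OF wE])
      moreover have "f (R h') = \<zero>\<^bsub>Q\<^esub>" "e (G1 h') = \<zero>\<^bsub>Q\<^esub>"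
        unfolding h' I1z[OF i w] by (rule lin_zero[OF f(1) vs_tensor vs_Q] lin_zero[OF e(1) vs_tensor vs_Q])+
      moreover have "h' \<in> carrier Q" by (rule subsetD[OF kernel_gens_subset \<open>h' \<in> kernel_gens\<close>])
      ultimately show ?thesis unfolding h'[symmetric] by (simp only: vs_l_zero vs_Q vs_zero)
    qed
  qed
  then show ?thesis by (simp add: natural_kernel_eq)
qed

end

theorem corollaryB12:
  fixes K :: "('k, 'r) ring_scheme"
    and A :: "('k, 'a, 'm) module_scheme"
    and L :: "('k, 'l, 'n) lie_algebra_scheme"
    and B :: "('b, 's) monoid_scheme"
    and D :: "'b \<Rightarrow> 'l set"
    and \<beta> :: 'b
  assumes "field K"
    and char_neq_2: "\<one>\<^bsub>K\<^esub> \<oplus>\<^bsub>K\<^esub> \<one>\<^bsub>K\<^esub> \<noteq> \<zero>\<^bsub>K\<^esub>"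
    and "algebra K A"
    and "graded_lie_algebra K L B D"
    and "\<beta> \<in> carrier B"
    and "\<And>h. h \<in> homology_degree K L B D 3 \<beta> \<Longrightarrow> reduced_koszul K L h = \<zero>\<^bsub>Kill K L\<^esub>"
  shows "\<exists>f g. short_exact K
      (tensor K (T0_image K A)
        (restrict_to (sym_power K (homology K L 1) 2)
          (sym_degree K (homology K L 1) B (homology_degree K L B D 1) 2 \<beta>)))
      (natural_kernel K A L B D \<beta>)
      (direct_sum
        (tensor K (HH1 K A) (restrict_to (Kill K L) (Kill_degree K L B D \<beta>)))
        (tensor K (I_alg K A)
          (restrict_to (ext_power K (homology K L 1) 2)
            (ext_degree K (homology K L 1) B (homology_degree K L B D 1) 2 \<beta>))))
      f g"
proof -
  have "current_over_field K L B D A"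
    using assms(1-4) graded_lie_algebra.axioms(1)[OF assms(4)]
    by (simp add: current_over_field_def graded_over_field_def graded_over_field_axioms_def lie_over_field_def
      lie_over_field_axioms_def algebra_over_field_def algebra_over_field_axioms_def base_field_def)
  from current_over_field.exact_sequence[OF this assms(6)] show ?thesis .
qed

end
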